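(* Let $0<r<1$, let $T_1,T_2$ be $\mathbb{A}_r$-contractions on a complex Hilbert space $\mathcal{H}$, and let $X\in\mathcal{B}(\mathcal{H})$ commute with $T_1$ and with $T_2$. Let $\widehat{T}_X$ be the operator on $\mathcal{H}\oplus\mathcal{H}$ given by $$\widehat{T}_X=\begin{bmatrix} T_1 & X(T_1-T_2)\\ 0 & T_2\end{bmatrix}.$$ Then the following are equivalent. (1) $\widehat{T}_X$ is an $\mathbb{A}_r$-contraction. (2) For every $\epsilon\in(0,1)$ and every $\alpha\in\mathbb{T}$ there exists a contraction $K(\epsilon;\alpha)$ on $\mathcal{H}$ such that $$\frac{X\big(\Gamma_\epsilon(\alpha T_1)-\Gamma_\epsilon(\alpha T_2)\big)}{2}=\big(\mathrm{Re}\,\Gamma_\epsilon(\alpha T_1)\big)^{1/2}\,K(\epsilon;\alpha)\,\big(\mathrm{Re}\,\Gamma_\epsilon(\alpha T_2)\big)^{1/2}.$$ (3) For every $\epsilon\in(0,1)$ and every $\alpha\in\mathbb{T}$ there exists a unitary $U(\epsilon;\alpha)$ on $\mathcal{H}\oplus\mathcal{H}$ such that $$\frac{X\big(\Gamma_\epsilon(\alpha T_1)-\Gamma_\epsilon(\alpha T_2)\big)}{2}=\begin{bmatrix}\big(\mathrm{Re}\,\Gamma_\epsilon(\alpha T_1)\big)^{1/2} & 0\end{bmatrix}\,U(\epsilon;\alpha)\,\begin{bmatrix}\big(\mathrm{Re}\,\Gamma_\epsilon(\alpha T_2)\big)^{1/2}\\ 0\end{bmatrix}.$$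
   Context: All operators are bounded linear operators on complex Hilbert spaces; $\mathcal{B}(\mathcal{H})$ is the space of all operators on $\mathcal{H}$; a contraction is an operator of norm at most $1$; $\mathbb{T}$ is the unit circle in $\mathbb{C}$. Fix $0<r<1$ and put $\mathbb{A}_r=\{z\in\mathbb{C}: r<|z|<1\}$, with closure $\overline{\mathbb{A}}_r$. A compact set $K\subseteq\mathbb{C}$ is a spectral set for an operator $T$ if $\sigma(T)\subseteq K$ and $\|f(T)\|\le\sup_{x\in K}|f(x)|$ for every rational function $f$ with poles off $K$. An operator having $\overline{\mathbb{A}}_r$ as a spectral set is called an $\mathbb{A}_r$-contraction. For $\epsilon\in(0,1)$ let $$\Gamma_\epsilon(z)=2\sum_{k=-\infty}^{\infty}\frac{(1-\epsilon)^k}{1+(1-\epsilon)^{2k}r^k}\,z^k ,$$ which converges to a holomorphic function on a neighbourhood of $\overline{\mathbb{A}}_r$. If $\sigma(T)\subseteq\overline{\mathbb{A}}_r$ and $\alpha\in\mathbb{T}$, then $\Gamma_\epsilon(\alpha T)$ is the operator obtained by applying $\Gamma_\epsilon$ to $\alpha T$ by the holomorphic functional calculus. For an operator $S$, $\mathrm{Re}\,S=(S+S^* )/2$. For an $\mathbb{A}_r$-contraction $T$ one has $\mathrm{Re}\,\Gamma_\epsilon(\alpha T)\ge 0$ for all $\epsilon\in(0,1)$, $\alpha\in\mathbb{T}$ (a known result of Agler), and $(\mathrm{Re}\,\Gamma_\epsilon(\alpha T))^{1/2}$ denotes its positive square root. For $A\in\mathcal{B}(\mathcal{H})$, $\begin{bmatrix}A&0\end{bmatrix}:\mathcal{H}\oplus\mathcal{H}\to\mathcal{H}$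 is the row operator and $\begin{bmatrix}A\\0\end{bmatrix}:\mathcal{H}\to\mathcal{H}\oplus\mathcal{H}$ is the column operator. *)

theory Defs
  imports
    "HOL-Analysis.Analysis"
    "HOL-Complex_Analysis.Complex_Analysis"
    "HOL-Computational_Algebra.Polynomial"
begin

section \<open>Complex Hilbert spaces\<close>

class scaleC =
  fixes scaleC :: "complex \<Rightarrow> 'a \<Rightarrow> 'a"  (infixr "*\<^sub>C" 75)

text \<open>
  A complex Hilbert space is a real Hilbert space with a compatible complex structure.
  The complex inner product is linear in its first argument; the norm is the one of
  \<^class>\<open>real_inner\<close>, so that the last axiom makes it the square root of \<open>cinner x x\<close>.
\<close>

class chilbert_space = scaleC + real_inner + banach +
  fixes cinner :: "'a \<Rightarrow> 'a \<Rightarrow> complex"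
  assumes scaleC_add_right: "c *\<^sub>C (x + y) = c *\<^sub>C x + c *\<^sub>C y"
    and scaleC_add_left: "(c + d) *\<^sub>C x = c *\<^sub>C x + d *\<^sub>C x"
    and scaleC_scaleC: "c *\<^sub>C d *\<^sub>C x = (c * d) *\<^sub>C x"
    and scaleC_of_real: "complex_of_real s *\<^sub>C x = s *\<^sub>R x"
    and cinner_add_left: "cinner (x + y) z = cinner x z + cinner y z"
    and cinner_scaleC_left: "cinner (c *\<^sub>C x) y = c * cinner x y"
    and cinner_commute: "cinner x y = cnj (cinner y x)"
    and Re_cinner: "Re (cinner x y) = inner x y"

lemma cinner_self: "cinner x x = complex_of_real ((norm x)\<^sup>2)" for x :: "'a::chilbert_space"
proof (rule complex_eqI)
  show "Re (cinner x x) = Re (complex_of_real ((norm x)\<^sup>2))"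
    by (simp add: Re_cinner power2_norm_eq_inner)
  have "Im (cinner x x) = - Im (cinner x x)"
    by (subst cinner_commute) simp
  then show "Im (cinner x x) = Im (complex_of_real ((norm x)\<^sup>2))"
    by simp
qed

lemma norm_scaleC: "norm (c *\<^sub>C x) = norm c * norm x" for x :: "'a::chilbert_space"
proof -
  have "cinner (c *\<^sub>C x) (c *\<^sub>C x) = c * cnj (c * cinner x x)"
    by (subst cinner_scaleC_left, subst cinner_commute, subst cinner_scaleC_left) simp
  also have "\<dots> = complex_of_real ((norm c * norm x)\<^sup>2)"
    using complex_norm_square[of c] by (simp add: cinner_self power_mult_distrib)
  finally have "(norm (c *\<^sub>C x))\<^sup>2 = (norm c * norm x)\<^sup>2"
    by (simp only: cinner_self of_real_eq_iff)
  then show ?thesis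
    by (simp add: power2_eq_iff_nonneg)
qed

lemma bounded_linear_scaleC: "bounded_linear (\<lambda>x :: 'a::chilbert_space. c *\<^sub>C x)"
proof (rule bounded_linear_intro)
  fix x y :: 'a and s :: real
  show "c *\<^sub>C (x + y) = c *\<^sub>C x + c *\<^sub>C y"
    by (rule scaleC_add_right)
  show "c *\<^sub>C (s *\<^sub>R x) = s *\<^sub>R (c *\<^sub>C x)"
    by (simp add: scaleC_of_real[symmetric] scaleC_scaleC mult.commute)
  show "norm (c *\<^sub>C x) \<le> norm x * norm c"
    by (simp add: norm_scaleC)
qed

instantiation complex :: chilbert_space
begin

definition "scaleC c (z :: complex) = c * z"
definition "cinner (z :: complex) w = z * cnj w"

instance
  by standard
    (auto simp: scaleC_complex_def cinner_complex_def algebra_simps scaleR_conv_of_real inner_complex_def)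

end

text \<open>The type \<^typ>\<open>'a \<times> 'b\<close> is the orthogonal direct sum.\<close>

instantiation prod :: (chilbert_space, chilbert_space) chilbert_space
begin

definition "scaleC c (x :: 'a \<times> 'b) = (c *\<^sub>C fst x, c *\<^sub>C snd x)"
definition "cinner (x :: 'a \<times> 'b) y = cinner (fst x) (fst y) + cinner (snd x) (snd y)"

instance
proof
  fix x y :: "'a \<times> 'b"
  show "cinner x y = cnj (cinner y x)"
    unfolding cinner_prod_def
    by (metis complex_cnj_add cinner_commute)
qed (auto simp: scaleC_prod_def cinner_prod_def scaleC_add_right scaleC_add_left scaleC_scaleC
    scaleC_of_real cinner_add_left cinner_scaleC_left Re_cinner inner_prod_def algebra_simps
    scaleR_prod_def)

end


section \<open>Bounded operators\<close>

text \<open>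
  Operators are elements of the library type \<^typ>\<open>'a \<Rightarrow>\<^sub>L 'b\<close>, which only guarantees real
  linearity; complex linearity is the predicate \<open>clinear_op\<close>. The norm of \<^typ>\<open>'a \<Rightarrow>\<^sub>L 'b\<close>
  is the operator norm.
\<close>

definition clinear_op :: "('a::chilbert_space \<Rightarrow>\<^sub>L 'b::chilbert_space) \<Rightarrow> bool" where
  "clinear_op T \<longleftrightarrow> (\<forall>c x. blinfun_apply T (c *\<^sub>C x) = c *\<^sub>C blinfun_apply T x)"

instantiation blinfun :: (real_normed_vector, chilbert_space) scaleC
begin

lift_definition scaleC_blinfun :: "complex \<Rightarrow> 'a \<Rightarrow>\<^sub>L 'b \<Rightarrow> 'a \<Rightarrow>\<^sub>L 'b" is "\<lambda>c T x. c *\<^sub>C T x"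
  by (rule bounded_linear_compose[OF bounded_linear_scaleC])

instance ..

end

definition op_contraction :: "('a::chilbert_space \<Rightarrow>\<^sub>L 'b::chilbert_space) \<Rightarrow> bool" where
  "op_contraction K \<longleftrightarrow> clinear_op K \<and> norm K \<le> 1"

text \<open>
  The definite descriptions below denote the intended operators in the cases that matter:
  \<open>op_adj T\<close> for every complex-linear \<open>T\<close>, \<open>op_sqrt A\<close> for every positive \<open>A\<close>,
  \<open>op_inv A\<close> for every invertible \<open>A\<close>.
\<close>

definition op_adj :: "('a::chilbert_space \<Rightarrow>\<^sub>L 'b::chilbert_space) \<Rightarrow> ('b \<Rightarrow>\<^sub>L 'a)" where
  "op_adj T = (THE S. \<forall>x y. cinner (blinfun_apply T x) y = cinner x (blinfun_apply S y))"

definition op_unitary :: "('a::chilbert_space \<Rightarrow>\<^sub>L 'a) \<Rightarrow> bool" where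
  "op_unitary U \<longleftrightarrow> clinear_op U \<and> op_adj U o\<^sub>L U = id_blinfun \<and> U o\<^sub>L op_adj U = id_blinfun"

definition op_Re :: "('a::chilbert_space \<Rightarrow>\<^sub>L 'a) \<Rightarrow> ('a \<Rightarrow>\<^sub>L 'a)" where
  "op_Re S = (1/2) *\<^sub>R (S + op_adj S)"

definition op_pos :: "('a::chilbert_space \<Rightarrow>\<^sub>L 'a) \<Rightarrow> bool" where
  "op_pos A \<longleftrightarrow> clinear_op A \<and>
     (\<forall>x. cinner (blinfun_apply A x) x \<in> \<real> \<and> 0 \<le> Re (cinner (blinfun_apply A x) x))"

definition op_sqrt :: "('a::chilbert_space \<Rightarrow>\<^sub>L 'a) \<Rightarrow> ('a \<Rightarrow>\<^sub>L 'a)" where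
  "op_sqrt A = (THE R. op_pos R \<and> R o\<^sub>L R = A)"

definition is_inverse_op :: "('a::chilbert_space \<Rightarrow>\<^sub>L 'a) \<Rightarrow> ('a \<Rightarrow>\<^sub>L 'a) \<Rightarrow> bool" where
  "is_inverse_op A B \<longleftrightarrow> clinear_op B \<and> A o\<^sub>L B = id_blinfun \<and> B o\<^sub>L A = id_blinfun"

definition op_inv :: "('a::chilbert_space \<Rightarrow>\<^sub>L 'a) \<Rightarrow> ('a \<Rightarrow>\<^sub>L 'a)" where
  "op_inv A = (THE B. is_inverse_op A B)"

definition op_spectrum :: "('a::chilbert_space \<Rightarrow>\<^sub>L 'a) \<Rightarrow> complex set" where
  "op_spectrum T = {z. \<not> (\<exists>B. is_inverse_op (z *\<^sub>C id_blinfun - T) B)}"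

definition row_op ::
    "('a::chilbert_space \<Rightarrow>\<^sub>L 'c::chilbert_space) \<Rightarrow> ('b::chilbert_space \<Rightarrow>\<^sub>L 'c) \<Rightarrow> (('a \<times> 'b) \<Rightarrow>\<^sub>L 'c)" where
  "row_op A B = (A o\<^sub>L fst_blinfun) + (B o\<^sub>L snd_blinfun)"

lift_definition col_op ::
    "('a::chilbert_space \<Rightarrow>\<^sub>L 'b::chilbert_space) \<Rightarrow> ('a \<Rightarrow>\<^sub>L 'c::chilbert_space) \<Rightarrow> ('a \<Rightarrow>\<^sub>L ('b \<times> 'c))"
  is "\<lambda>A B x. (A x, B x)"
  by (rule bounded_linear_Pair)

text \<open>\<open>block_op A B C D\<close> has first row \<open>A, B\<close> and second row \<open>C, D\<close>.\<close>

definition block_op ::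
    "('a::chilbert_space \<Rightarrow>\<^sub>L 'c::chilbert_space) \<Rightarrow> ('b::chilbert_space \<Rightarrow>\<^sub>L 'c) \<Rightarrow>
     ('a \<Rightarrow>\<^sub>L 'd::chilbert_space) \<Rightarrow> ('b \<Rightarrow>\<^sub>L 'd) \<Rightarrow> (('a \<times> 'b) \<Rightarrow>\<^sub>L ('c \<times> 'd))" where
  "block_op A B C D = col_op (row_op A B) (row_op C D)"

lemma block_op_apply:
  "blinfun_apply (block_op A B C D) (x, y) =
     (blinfun_apply A x + blinfun_apply B y, blinfun_apply C x + blinfun_apply D y)"
  by (simp add: block_op_def row_op_def col_op.rep_eq blinfun.add_left)


section \<open>Spectral sets\<close>

primrec op_power :: "('a::chilbert_space \<Rightarrow>\<^sub>L 'a) \<Rightarrow> nat \<Rightarrow> ('a \<Rightarrow>\<^sub>L 'a)" where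
  "op_power T 0 = id_blinfun"
| "op_power T (Suc n) = T o\<^sub>L op_power T n"

definition poly_op :: "complex poly \<Rightarrow> ('a::chilbert_space \<Rightarrow>\<^sub>L 'a) \<Rightarrow> ('a \<Rightarrow>\<^sub>L 'a)" where
  "poly_op p T = (\<Sum>i\<le>degree p. coeff p i *\<^sub>C op_power T i)"

text \<open>
  A rational function with poles off \<open>K\<close> is a quotient \<open>p / q\<close> of polynomials such that \<open>q\<close>
  has no zero in \<open>K\<close>; its value at \<open>T\<close> is \<open>p(T) q(T)\<^sup>-\<^sup>1\<close>.
\<close>

definition spectral_set :: "complex set \<Rightarrow> ('a::chilbert_space \<Rightarrow>\<^sub>L 'a) \<Rightarrow> bool" where
  "spectral_set K T \<longleftrightarrow> compact K \<and> op_spectrum T \<subseteq> K \<and>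
     (\<forall>p q. (\<forall>z\<in>K. poly q z \<noteq> 0) \<longrightarrow>
        norm (poly_op p T o\<^sub>L op_inv (poly_op q T)) \<le> (SUP z\<in>K. cmod (poly p z / poly q z)))"

definition annulus :: "real \<Rightarrow> complex set" where
  "annulus r = {z. r < cmod z \<and> cmod z < 1}"

definition annulus_contraction :: "real \<Rightarrow> ('a::chilbert_space \<Rightarrow>\<^sub>L 'a) \<Rightarrow> bool" where
  "annulus_contraction r T \<longleftrightarrow> clinear_op T \<and> spectral_set (closure (annulus r)) T"


section \<open>Holomorphic functional calculus\<close>

definition op_contour_integral ::
    "(real \<Rightarrow> complex) \<Rightarrow> (complex \<Rightarrow> 'a::chilbert_space \<Rightarrow>\<^sub>L 'a) \<Rightarrow> ('a \<Rightarrow>\<^sub>L 'a)" where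
  "op_contour_integral \<gamma> F =
     integral {0..1} (\<lambda>t. vector_derivative \<gamma> (at t within {0..1}) *\<^sub>C F (\<gamma> t))"

text \<open>
  \<open>surrounds \<gamma>s S U\<close>: the cycle formed by the closed paths in the list \<open>\<gamma>s\<close> lies in
  \<open>U - S\<close> and winds once around each point of \<open>S\<close> and zero times around each point outside \<open>U\<close>.
\<close>

definition surrounds :: "(real \<Rightarrow> complex) list \<Rightarrow> complex set \<Rightarrow> complex set \<Rightarrow> bool" where
  "surrounds \<gamma>s S U \<longleftrightarrow>
     (\<forall>\<gamma>\<in>set \<gamma>s. valid_path \<gamma> \<and> pathfinish \<gamma> = pathstart \<gamma> \<and> path_image \<gamma> \<subseteq> U - S) \<and>
     (\<forall>z\<in>S. (\<Sum>\<gamma>\<leftarrow>\<gamma>s. winding_number \<gamma> z) = 1) \<and>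
     (\<forall>z. z \<notin> U \<longrightarrow> (\<Sum>\<gamma>\<leftarrow>\<gamma>s. winding_number \<gamma> z) = 0)"

text \<open>
  The Riesz--Dunford integral of \<open>f\<close>, holomorphic near the spectrum of \<open>T\<close>. The value is
  independent of the neighbourhood \<open>U\<close> and of the cycle \<open>\<gamma>s\<close> by Cauchy's theorem.
\<close>

definition hol_calc :: "(complex \<Rightarrow> complex) \<Rightarrow> ('a::chilbert_space \<Rightarrow>\<^sub>L 'a) \<Rightarrow> ('a \<Rightarrow>\<^sub>L 'a)" where
  "hol_calc f T = (THE S. \<exists>U \<gamma>s. open U \<and> op_spectrum T \<subseteq> U \<and> f holomorphic_on U \<and>
     surrounds \<gamma>s (op_spectrum T) U \<and>
     S = (1 / (2 * complex_of_real pi * \<i>)) *\<^sub>C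
       (\<Sum>\<gamma>\<leftarrow>\<gamma>s. op_contour_integral \<gamma> (\<lambda>z. f z *\<^sub>C op_inv (z *\<^sub>C id_blinfun - T))))"

text \<open>
  The series converges absolutely for \<open>(1 - e) r < |z| < 1 / (1 - e)\<close>, a neighbourhood of the
  closed annulus.
\<close>

definition Gamma_fun :: "real \<Rightarrow> real \<Rightarrow> complex \<Rightarrow> complex" where
  "Gamma_fun r e z = 2 * (\<Sum>\<^sub>\<infinity>k\<in>(UNIV :: int set).
     complex_of_real ((1 - e) powi k / (1 + (1 - e) powi (2 * k) * r powi k)) * z powi k)"

definition Gamma_op :: "real \<Rightarrow> real \<Rightarrow> complex \<Rightarrow> ('a::chilbert_space \<Rightarrow>\<^sub>L 'a) \<Rightarrow> ('a \<Rightarrow>\<^sub>L 'a)" where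
  "Gamma_op r e \<alpha> T = hol_calc (Gamma_fun r e) (\<alpha> *\<^sub>C T)"

end

theory Submission
  imports Defs "HOL-Computational_Algebra.Fundamental_Theorem_Algebra"
begin

text \<open>
  Why the theorem holds. Write \<open>G\<^sub>j\<close> for the operator \<open>\<Gamma>\<^sub>\<epsilon>(\<alpha> T\<^sub>j)\<close>. Since \<open>X\<close> commutes with \<open>T\<^sub>1\<close>, the block
  operator is \<open>S\<^sup>-\<^sup>1 (T\<^sub>1 \<oplus> T\<^sub>2) S\<close> for the unipotent \<open>S\<close> with corner \<open>X\<close>. Hence its spectrum lies in the closed
  annulus, and \<open>\<Gamma>\<^sub>\<epsilon>\<close> of its multiple by \<open>\<alpha>\<close> is again a block operator, with diagonal \<open>G\<^sub>1, G\<^sub>2\<close> and corner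
  \<open>X (G\<^sub>1 - G\<^sub>2)\<close> (lemma \<open>kernel_op_upper\<close>). By Agler's criterion
  (\<open>annulus_contraction_iff_kernels_positive\<close>) it is an annulus contraction iff all these blocks have a
  positive real part, and \<open>Re G\<^sub>j \<ge> 0\<close> because the \<open>T\<^sub>j\<close> are annulus contractions. A block with positive
  diagonal has a positive real part iff half of its corner is \<open>(Re G\<^sub>1)\<^bsup>1/2\<^esup> K (Re G\<^sub>2)\<^bsup>1/2\<^esup>\<close> for a contraction
  \<open>K\<close> (\<open>positive_block_iff_factorization\<close>); this is the
  second condition. Contractions are the corners of unitaries on the
  doubled space (\<open>contraction_iff_unitary_corner\<close>); this is the third.

  Most of the text proves Agler's criterion. With \<open>s = 1 - \<epsilon>\<close> and \<open>q = s\<^sup>2 r\<close>, the function \<open>\<Gamma>\<^sub>\<epsilon>(z)\<close> is the member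
  \<open>a = b = 1\<close>, taken at \<open>s z\<close>, of a family of kernels \<open>k\<^sub>a\<^sub>,\<^sub>b\<close> on \<open>q < |z| < 1\<close>. The real part of \<open>k\<^sub>a\<^sub>,\<^sub>b\<close> has as
  boundary values the unit point masses at \<open>a\<close> on the outer and at \<open>q b\<close> on the inner circle. When \<open>a b = 1\<close>,
  the kernel is invariant under \<open>z \<mapsto> q/z\<close> and has a positive real part by the minimum principle.
  One direction of the criterion is therefore the fact that a spectral set carries positivity of the real
  part over to the operator (\<open>annulus_contraction_laurent_positive\<close>).

  The other direction starts from the kernels with \<open>a = b\<close>, which are the rotations of \<open>\<Gamma>\<^sub>\<epsilon>\<close>, and has three
  steps. First, if \<open>a b = 1\<close> and \<open>a \<noteq> 1\<close>, then \<open>(k\<^sub>1\<^sub>,\<^sub>1 - \<i> y) (k\<^sub>a\<^sub>,\<^sub>b - \<i> D)\<close> is a positive constant for suitable real \<open>y, D\<close>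
  (\<open>kern_moebius\<close>), because both factors are imaginary on the boundary and each has its zero at the pole
  of the other. The identity holds for operators, and so positivity passes from \<open>k\<^sub>1\<^sub>,\<^sub>1\<close> to all kernels with
  \<open>a b = 1\<close> and, after rotation, to all kernels (\<open>kernel_op_positive_all_poles\<close>). Second, a Laurent
  polynomial with a positive real part on the boundary is, up to an imaginary constant, an average of
  kernels, by the Poisson formula; so its operator has a positive real part (\<open>laurent_positive\<close>). Third,
  for a rational \<open>f\<close> with \<open>|f| < m\<close> the function \<open>(m + f) / (m - f)\<close> has a positive real part and is a
  uniform limit of Laurent polynomials; positivity of the operator is the inequality \<open>|f(T)| \<le> m\<close> (\<open>annulus_contraction_if_positive\<close>).

  The operators \<open>\<Gamma>\<^sub>\<epsilon>(\<alpha> T)\<close> are Riesz--Dunford integrals over an arbitrary cycle around the spectrum. That the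
  cycle does not matter is Cauchy's theorem for cycles; on two concentric circles the integral of a
  Laurent polynomial is found from a recursion, and uniform limits give the Laurent series
  (\<open>hol_calc_eq_laurent_limit\<close>). Everything else is done with Laurent series in \<open>T\<close> and \<open>T\<^sup>-\<^sup>1\<close>.
\<close>

section \<open>Complex inner products\<close>

lemma scaleC_zero_left [simp]: "0 *\<^sub>C x = 0" for x :: "'a::chilbert_space"
  using scaleC_of_real[of 0 x] by simp

lemma scaleC_one [simp]: "1 *\<^sub>C x = x" for x :: "'a::chilbert_space"
  using scaleC_of_real[of 1 x] by simp

lemma scaleC_zero_right [simp]: "c *\<^sub>C (0 :: 'a::chilbert_space) = 0"
  using scaleC_add_right[of c "0::'a" 0] by simp

lemma scaleC_minus_left: "(- c) *\<^sub>C x = - (c *\<^sub>C x)" for x :: "'a::chilbert_space"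
  using scaleC_add_left[of c "-c" x] by (simp add: eq_neg_iff_add_eq_0 add.commute)

lemma scaleC_minus_right: "c *\<^sub>C (- x) = - (c *\<^sub>C x)" for x :: "'a::chilbert_space"
  using scaleC_add_right[of c x "-x"] by (simp add: eq_neg_iff_add_eq_0 add.commute)

lemma scaleC_diff_left: "(c - d) *\<^sub>C x = c *\<^sub>C x - d *\<^sub>C x" for x :: "'a::chilbert_space"
  using scaleC_add_left[of c "-d" x] by (simp add: scaleC_minus_left)

lemma scaleC_diff_right: "c *\<^sub>C (x - y) = c *\<^sub>C x - c *\<^sub>C y" for x y :: "'a::chilbert_space"
  using scaleC_add_right[of c x "-y"] by (simp add: scaleC_minus_right)

lemma scaleC_scaleR: "c *\<^sub>C (s *\<^sub>R x) = s *\<^sub>R (c *\<^sub>C x)" for x :: "'a::chilbert_space"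
  by (simp add: scaleC_of_real[symmetric] scaleC_scaleC mult.commute)

lemma cnj_cinner [simp]: "cnj (cinner x y) = cinner y x" for x :: "'a::chilbert_space"
  by (rule cinner_commute[symmetric])

lemma cinner_add_right: "cinner x (y + z) = cinner x y + cinner x z"
  for x :: "'a::chilbert_space"
  by (metis cinner_add_left cinner_commute complex_cnj_add)

lemma cinner_scaleC_right: "cinner x (c *\<^sub>C y) = cnj c * cinner x y"
  for x :: "'a::chilbert_space"
  by (metis cinner_commute cinner_scaleC_left complex_cnj_mult)

lemma cinner_scaleR_left: "cinner (s *\<^sub>R x) y = of_real s * cinner x y"
  for x :: "'a::chilbert_space"
  by (metis cinner_scaleC_left scaleC_of_real)

lemma cinner_scaleR_right: "cinner x (s *\<^sub>R y) = of_real s * cinner x y"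
  for x :: "'a::chilbert_space"
  by (metis cinner_scaleC_right scaleC_of_real complex_cnj_complex_of_real)

lemma ex_unimodular_rotation: "\<exists>c. cmod c = 1 \<and> c * z = of_real (cmod z)"
proof (cases "z = 0")
  case False
  have "cnj z * z = complex_of_real (cmod z) * complex_of_real (cmod z)"
    using complex_norm_square[of z] by (simp only: power2_eq_square mult.commute of_real_mult)
  then have "cnj z / complex_of_real (cmod z) * z = of_real (cmod z)"
    using False by simp
  moreover have "cmod (cnj z / complex_of_real (cmod z)) = 1"
    using False by (simp add: norm_divide)
  ultimately show ?thesis by blast
qed (auto intro: exI[of _ 1])

lemma norm_cinner_le: "cmod (cinner x y) \<le> norm x * norm y"
  for x y :: "'a::chilbert_space"
proof -
  obtain c where c: "cmod c = 1" and "c * cinner x y = cmod (cinner x y)"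
    using ex_unimodular_rotation by metis
  then have "cmod (cinner x y) = Re (cinner (c *\<^sub>C x) y)"
    by (simp add: cinner_scaleC_left)
  also have "\<dots> \<le> norm (c *\<^sub>C x) * norm y"
    by (simp add: Re_cinner norm_cauchy_schwarz)
  finally show ?thesis
    using c by (simp add: norm_scaleC)
qed

lemma bounded_bilinear_cinner: "bounded_bilinear (cinner :: 'a::chilbert_space \<Rightarrow> _)"
proof
  show "\<exists>K. \<forall>a b :: 'a. cmod (cinner a b) \<le> norm a * norm b * K"
    by (intro exI[of _ 1]) (simp add: norm_cinner_le)
qed (simp_all add: cinner_add_left cinner_add_right cinner_scaleR_left cinner_scaleR_right scaleR_conv_of_real)

interpretation cinner: bounded_bilinear "cinner :: 'a::chilbert_space \<Rightarrow> 'a \<Rightarrow> complex"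
  by (rule bounded_bilinear_cinner)

lemma cinner_eqI: "(\<And>z. cinner x z = cinner y z) \<Longrightarrow> x = y" for x y :: "'a::chilbert_space"
proof -
  assume "\<And>z. cinner x z = cinner y z"
  then have "cinner (x - y) (x - y) = 0"
    by (simp add: cinner.diff_left)
  then show ?thesis by (simp add: cinner_self)
qed

lemma cinner_eqI_right: "(\<And>z. cinner z x = cinner z y) \<Longrightarrow> x = y" for x y :: "'a::chilbert_space"
  by (rule cinner_eqI) (metis cinner_commute)

lemma Re_cinner_self: "Re (cinner x x) = (norm x)\<^sup>2" for x :: "'a::chilbert_space"
  by (simp add: cinner_self)

lemma blinfun_apply_scaleC [simp]: "blinfun_apply (c *\<^sub>C T) x = c *\<^sub>C blinfun_apply T x"
  by (simp add: scaleC_blinfun.rep_eq)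

lemma norm_scaleC_blinfun: "norm (c *\<^sub>C T) = cmod c * norm T"
  for T :: "'a::real_normed_vector \<Rightarrow>\<^sub>L 'b::chilbert_space"
proof -
  have *: "norm (c *\<^sub>C T) \<le> cmod c * norm T" for c and T :: "'a \<Rightarrow>\<^sub>L 'b"
    by (rule norm_blinfun_bound)
      (auto simp: norm_scaleC mult.assoc intro!: mult_left_mono norm_blinfun)
  show ?thesis
  proof (cases "c = 0")
    case True
    have "norm (c *\<^sub>C T) \<le> cmod c * norm T" by (rule *)
    with True show ?thesis by simp
  next
    case False
    have "inverse c *\<^sub>C c *\<^sub>C T = T"
      using False by (intro blinfun_eqI) (simp add: scaleC_scaleC)
    then have "cmod c * norm T \<le> cmod c * (cmod (inverse c) * norm (c *\<^sub>C T))"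
      using *[of "inverse c" "c *\<^sub>C T"] by (simp add: mult_left_mono)
    also have "\<dots> = norm (c *\<^sub>C T)"
      using False by (simp add: norm_inverse)
    finally show ?thesis using *[of c T] by simp
  qed
qed

section \<open>Complex-linear operators\<close>

lemma clinear_opD: "clinear_op T \<Longrightarrow> blinfun_apply T (c *\<^sub>C x) = c *\<^sub>C blinfun_apply T x"
  by (simp add: clinear_op_def)

named_theorems clin

lemma clinear_op_0 [simp, clin]: "clinear_op 0"
  by (simp add: clinear_op_def)

lemma clinear_op_id [simp, clin]: "clinear_op id_blinfun"
  by (simp add: clinear_op_def)

lemma clinear_op_add [clin]: "clinear_op S \<Longrightarrow> clinear_op T \<Longrightarrow> clinear_op (S + T)"
  by (simp add: clinear_op_def blinfun.add_left scaleC_add_right)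

lemma clinear_op_diff [clin]: "clinear_op S \<Longrightarrow> clinear_op T \<Longrightarrow> clinear_op (S - T)"
  by (simp add: clinear_op_def blinfun.diff_left scaleC_diff_right)

lemma clinear_op_minus [clin]: "clinear_op S \<Longrightarrow> clinear_op (- S)"
  by (simp add: clinear_op_def blinfun.minus_left scaleC_minus_right)

lemma clinear_op_scaleR [clin]: "clinear_op S \<Longrightarrow> clinear_op (s *\<^sub>R S)"
  by (simp add: clinear_op_def blinfun.scaleR_left scaleC_scaleR)

lemma clinear_op_scaleC [clin]: "clinear_op S \<Longrightarrow> clinear_op (c *\<^sub>C S)"
  by (simp add: clinear_op_def scaleC_scaleC mult.commute)

lemma clinear_op_compose [clin]: "clinear_op S \<Longrightarrow> clinear_op T \<Longrightarrow> clinear_op (S o\<^sub>L T)"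
  by (simp add: clinear_op_def)

lemma clinear_op_sum [clin]: "(\<And>i. i \<in> I \<Longrightarrow> clinear_op (f i)) \<Longrightarrow> clinear_op (\<Sum>i\<in>I. f i)"
  by (induction I rule: infinite_finite_induct) (auto intro: clin)

lemma tendsto_blinfun_apply: "(f \<longlongrightarrow> T) F \<Longrightarrow> ((\<lambda>n. blinfun_apply (f n) x) \<longlongrightarrow> blinfun_apply T x) F"
  by (intro tendsto_intros)

lemma clinear_op_lim:
  assumes "f \<longlonglongrightarrow> T" "\<And>n. clinear_op (f n)"
  shows "clinear_op T"
  unfolding clinear_op_def
proof (intro allI)
  fix c x
  have "(\<lambda>n. c *\<^sub>C blinfun_apply (f n) x) \<longlonglongrightarrow> c *\<^sub>C blinfun_apply T x"
    by (intro bounded_linear.tendsto[OF bounded_linear_scaleC] tendsto_blinfun_apply assms)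
  moreover have "(\<lambda>n. blinfun_apply (f n) (c *\<^sub>C x)) \<longlonglongrightarrow> blinfun_apply T (c *\<^sub>C x)"
    by (intro tendsto_blinfun_apply assms)
  ultimately show "blinfun_apply T (c *\<^sub>C x) = c *\<^sub>C blinfun_apply T x"
    using assms(2) by (simp add: clinear_opD LIMSEQ_unique)
qed

interpretation blinfun_compose: bounded_bilinear
  "(o\<^sub>L) :: ('b::real_normed_vector \<Rightarrow>\<^sub>L 'c::real_normed_vector) \<Rightarrow> ('a::real_normed_vector \<Rightarrow>\<^sub>L 'b) \<Rightarrow> _"
  by (rule bounded_bilinear_blinfun_compose)

lemma compose_eqs:
  "(A o\<^sub>L B) o\<^sub>L C = A o\<^sub>L (B o\<^sub>L C)"
  "id_blinfun o\<^sub>L A = A" "A o\<^sub>L id_blinfun = A"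
  by (auto intro!: blinfun_eqI)

section \<open>Representation of functionals\<close>

text \<open>On a subspace that need not be closed, the quadratic functional \<open>|m|\<^sup>2 - 2 \<phi>(m)\<close> has minimising
  sequences; the parallelogram identity makes them Cauchy, and the limit represents \<open>\<phi>\<close>. Working
  with a non-closed subspace makes it unnecessary to extend \<open>\<phi>\<close> by continuity.\<close>

lemma riesz_subspace:
  fixes M :: "'a::{real_inner, banach} set" and \<phi> :: "'a \<Rightarrow> real"
  assumes M: "subspace M"
    and add: "\<And>x y. x \<in> M \<Longrightarrow> y \<in> M \<Longrightarrow> \<phi> (x + y) = \<phi> x + \<phi> y"
    and scale: "\<And>c x. x \<in> M \<Longrightarrow> \<phi> (c *\<^sub>R x) = c * \<phi> x"
    and bd: "\<And>x. x \<in> M \<Longrightarrow> \<phi> x \<le> C * norm x"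
  shows "\<exists>y\<in>closure M. \<forall>x\<in>M. \<phi> x = inner x y"
proof -
  define J where "J m = (norm m)\<^sup>2 - 2 * \<phi> m" for m
  define I where "I = Inf (J ` M)"
  have "J m \<ge> - C\<^sup>2" if "m \<in> M" for m
  proof -
    have "0 \<le> (norm m - C)\<^sup>2" by simp
    then show ?thesis using bd[OF that] by (simp add: J_def power2_diff algebra_simps)
  qed
  then have bdd: "bdd_below (J ` M)" by (auto intro!: bdd_belowI2)
  have I_le: "I \<le> J m" if "m \<in> M" for m
    unfolding I_def using that bdd by (auto intro: cInf_lower)
  have "\<exists>m\<in>M. J m < I + 1 / real (Suc n)" for n
  proof (rule ccontr)
    assume "\<not> ?thesis"
    then have "I + 1 / real (Suc n) \<le> Inf (J ` M)"
      using subspace_0[OF M] by (intro cInf_greatest) (auto simp: not_less)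
    then show False by (simp add: I_def field_simps)
  qed
  then obtain m where m: "\<And>n. m n \<in> M" "\<And>n. J (m n) < I + 1 / real (Suc n)" by metis
  have par: "(norm (x - y))\<^sup>2 \<le> 2 * (J x - I) + 2 * (J y - I)" if "x \<in> M" "y \<in> M" for x y
  proof -
    have mid: "(1/2) *\<^sub>R (x + y) \<in> M" using that M by (auto intro: subspace_add subspace_scale)
    have "(norm (x - y))\<^sup>2 = 2 * (norm x)\<^sup>2 + 2 * (norm y)\<^sup>2 - (norm (x + y))\<^sup>2"
      by (simp add: power2_norm_eq_inner inner_diff inner_add inner_commute algebra_simps)
    also have "(norm (x + y))\<^sup>2 = 4 * (norm ((1/2) *\<^sub>R (x + y)))\<^sup>2"
      by (simp add: power_divide)
    also have "2 * (norm x)\<^sup>2 + 2 * (norm y)\<^sup>2 - 4 * (norm ((1/2) *\<^sub>R (x + y)))\<^sup>2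
        = 2 * J x + 2 * J y - 4 * J ((1/2) *\<^sub>R (x + y))"
      using that scale[of "x + y" "1/2"] subspace_add[OF M] by (simp add: J_def add algebra_simps)
    finally show ?thesis using I_le[OF mid] by simp
  qed
  have "Cauchy m"
  proof (rule CauchyI)
    fix e :: real assume "e > 0"
    then have "e\<^sup>2 / 4 > 0" by simp
    then obtain N where N: "1 / real (Suc N) < e\<^sup>2 / 4" using nat_approx_posE by blast
    have "norm (m i - m j) < e" if "N \<le> i" "N \<le> j" for i j
    proof -
      have "1 / real (Suc i) \<le> 1 / real (Suc N)" "1 / real (Suc j) \<le> 1 / real (Suc N)"
        using that by (simp_all add: frac_le)
      then have "J (m i) - I < e\<^sup>2 / 4" "J (m j) - I < e\<^sup>2 / 4"
        using m(2)[of i] m(2)[of j] N by linarith+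
      then have "(norm (m i - m j))\<^sup>2 < e\<^sup>2"
        using par[OF m(1)[of i] m(1)[of j]] by simp
      then show ?thesis using \<open>e > 0\<close> by (simp add: power_less_imp_less_base)
    qed
    then show "\<exists>N. \<forall>i\<ge>N. \<forall>j\<ge>N. norm (m i - m j) < e" by blast
  qed
  then obtain y where y: "m \<longlonglongrightarrow> y" using Cauchy_convergent_iff convergent_def by blast
  have "\<phi> x = inner x y" if x: "x \<in> M" for x
  proof -
    define d where "d = inner y x - \<phi> x"
    define N where "N = (norm x)\<^sup>2"
    have *: "0 \<le> 2 * t * d + t\<^sup>2 * N" for t
    proof -
      have "0 \<le> 1 / real (Suc n) + (2 * t * (inner (m n) x - \<phi> x) + t\<^sup>2 * N)" for n
      proof -
        have "m n + t *\<^sub>R x \<in> M" using m x M by (auto intro: subspace_add subspace_scale)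
        then have le: "I \<le> J (m n + t *\<^sub>R x)" by (rule I_le)
        have "(norm (m n + t *\<^sub>R x))\<^sup>2 = (norm (m n))\<^sup>2 + 2 * t * inner (m n) x + t\<^sup>2 * N"
          unfolding N_def power2_norm_eq_inner
          by (simp add: inner_add inner_commute algebra_simps power2_eq_square)
        then have "J (m n + t *\<^sub>R x) = J (m n) + (2 * t * (inner (m n) x - \<phi> x) + t\<^sup>2 * N)"
          using m x subspace_scale[OF M x] by (simp add: J_def add scale algebra_simps)
        then show ?thesis using le m(2)[of n] by linarith
      qed
      moreover have "(\<lambda>n. 1 / real (Suc n) + (2 * t * (inner (m n) x - \<phi> x) + t\<^sup>2 * N))
          \<longlonglongrightarrow> 0 + (2 * t * d + t\<^sup>2 * N)"
        unfolding d_def by (intro tendsto_intros y LIMSEQ_Suc[OF lim_1_over_n])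
      ultimately have "0 \<le> 0 + (2 * t * d + t\<^sup>2 * N)"
        by (intro LIMSEQ_le_const) blast+
      then show ?thesis by simp
    qed
    have "N \<ge> 0" by (simp add: N_def)
    define k where "k = 1 / (N + 1)"
    have k: "k > 0" "k * N < 2" using \<open>N \<ge> 0\<close> by (auto simp: k_def field_simps)
    have "0 \<le> 2 * (- d * k) * d + (- d * k)\<^sup>2 * N" by (rule *)
    also have "\<dots> = (d\<^sup>2 * k) * (k * N - 2)"
      by (simp add: power2_eq_square algebra_simps)
    finally have "d\<^sup>2 * k \<le> 0" using k by (simp add: zero_le_mult_iff)
    then have "d = 0" using k by (simp add: mult_le_0_iff)
    then show ?thesis by (simp add: d_def inner_commute)
  qed
  moreover have "y \<in> closure M" using m y closure_sequential by blast
  ultimately show ?thesis by blast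
qed

lemma subspace_closure:
  fixes M :: "'a::real_normed_vector set"
  assumes "subspace M" shows "subspace (closure M)"
proof (rule subspaceI)
  show "0 \<in> closure M" using assms closure_subset subspace_0 by blast
next
  fix x y assume "x \<in> closure M" "y \<in> closure M"
  then obtain u v where "\<forall>n. u n \<in> M" "u \<longlonglongrightarrow> x" "\<forall>n. v n \<in> M" "v \<longlonglongrightarrow> y"
    by (auto simp: closure_sequential)
  then show "x + y \<in> closure M"
    unfolding closure_sequential using assms
    by (intro exI[of _ "\<lambda>n. u n + v n"]) (auto intro: tendsto_add subspace_add)
next
  fix x and c :: real assume "x \<in> closure M"
  then obtain u where "\<forall>n. u n \<in> M" "u \<longlonglongrightarrow> x" by (auto simp: closure_sequential)
  then show "c *\<^sub>R x \<in> closure M"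
    unfolding closure_sequential using assms
    by (intro exI[of _ "\<lambda>n. c *\<^sub>R u n"]) (auto intro: tendsto_scaleR subspace_scale)
qed

text \<open>A form dominated by \<open>|Q y| |P x|\<close> factors through \<open>Q\<close>, because for fixed \<open>x\<close> it is a bounded
  functional of \<open>Q y\<close>. The representing vector is normalised by lying in the closure of the range
  of \<open>Q\<close>, which makes it unique and hence linear in \<open>x\<close>. This one lemma yields adjoints
  (\<open>Q\<close> the identity) and, applied twice, the contraction in the factorisation of a positive block.\<close>

lemma dominated_form_factors:
  fixes Q :: "'b::chilbert_space \<Rightarrow>\<^sub>L 'a::chilbert_space" and P :: "'c::chilbert_space \<Rightarrow>\<^sub>L 'd::chilbert_space"
    and \<beta> :: "'b \<Rightarrow> 'c \<Rightarrow> complex"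
  assumes Q: "clinear_op Q"
    and add1: "\<And>y y' x. \<beta> (y + y') x = \<beta> y x + \<beta> y' x"
    and add2: "\<And>y x x'. \<beta> y (x + x') = \<beta> y x + \<beta> y x'"
    and scale1: "\<And>c y x. \<beta> (c *\<^sub>C y) x = c * \<beta> y x"
    and scale2: "\<And>c y x. \<beta> y (c *\<^sub>C x) = cnj c * \<beta> y x"
    and bd: "\<And>y x. cmod (\<beta> y x) \<le> norm (blinfun_apply Q y) * norm (blinfun_apply P x)"
  obtains G :: "'c \<Rightarrow>\<^sub>L 'a" where "clinear_op G"
    "\<And>y x. \<beta> y x = cinner (blinfun_apply Q y) (blinfun_apply G x)"
    "\<And>x. norm (blinfun_apply G x) \<le> norm (blinfun_apply P x)"
proof -
  define M where "M = range (blinfun_apply Q)"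
  have M: "subspace M"
    unfolding M_def
    by (rule linear_subspace_image[OF bounded_linear.linear[OF blinfun.bounded_linear_right] subspace_UNIV])
  have clM: "subspace (closure M)" using M by (rule subspace_closure)
  have clC: "c *\<^sub>C z \<in> closure M" if "z \<in> closure M" for c z
  proof -
    have "(\<lambda>z. c *\<^sub>C z) ` M \<subseteq> M"
      unfolding M_def image_image clinear_opD[OF Q, symmetric] by blast
    then have "(\<lambda>z. c *\<^sub>C z) ` M \<subseteq> closure M"
      using closure_subset[of M] by (rule subset_trans)
    then have "(\<lambda>z. c *\<^sub>C z) ` closure M \<subseteq> closure M"
      by (rule image_closure_subset[OF linear_continuous_on[OF bounded_linear_scaleC] closed_closure])
    then show ?thesis using that by blast
  qed
  have neg: "\<beta> (- y) x = - \<beta> y x" for y x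
    using scale1[of "-1" y x] by (simp add: scaleC_minus_left)
  have wd: "\<beta> y x = \<beta> y' x" if "blinfun_apply Q y = blinfun_apply Q y'" for y y' x
  proof -
    have "cmod (\<beta> (y - y') x) \<le> 0" using bd[of "y - y'" x] that by (simp add: blinfun.diff_right)
    then show ?thesis using add1[of y "- y'" x] neg by simp
  qed
  \<comment> \<open>\<open>E x g\<close>: the vector \<open>g\<close> represents the functional belonging to \<open>x\<close> and is normalised.\<close>
  define E where "E x g \<longleftrightarrow> g \<in> closure M \<and> (\<forall>y. \<beta> y x = cinner (blinfun_apply Q y) g)" for x g
  have ex: "\<exists>g. E x g" for x
  proof -
    define \<phi> where "\<phi> m = Re (\<beta> (SOME y. blinfun_apply Q y = m) x)" for m
    have \<phi>: "\<phi> (blinfun_apply Q y) = Re (\<beta> y x)" for y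
    proof -
      have "blinfun_apply Q (SOME y'. blinfun_apply Q y' = blinfun_apply Q y) = blinfun_apply Q y"
        by (rule someI[of "\<lambda>y'. blinfun_apply Q y' = blinfun_apply Q y" y]) simp
      then show ?thesis unfolding \<phi>_def using wd by metis
    qed
    have "\<exists>g\<in>closure M. \<forall>m\<in>M. \<phi> m = inner m g"
    proof (rule riesz_subspace[OF M])
      show "\<phi> (m + m') = \<phi> m + \<phi> m'" if "m \<in> M" "m' \<in> M" for m m'
        using that unfolding M_def by (auto simp: blinfun.add_right[symmetric] \<phi> add1)
      show "\<phi> (c *\<^sub>R m) = c * \<phi> m" if "m \<in> M" for m c
        using that scale1[of "of_real c" _ x] unfolding M_def
        by (auto simp: blinfun.scaleR_right[symmetric] \<phi> scaleC_of_real)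
      show "\<phi> m \<le> norm (blinfun_apply P x) * norm m" if "m \<in> M" for m
        using that order_trans[OF complex_Re_le_cmod bd[of _ x]] unfolding M_def
        by (auto simp: \<phi> mult.commute)
    qed
    then obtain g where g: "g \<in> closure M" "\<And>y. Re (\<beta> y x) = inner (blinfun_apply Q y) g"
      using \<phi> by (auto simp: M_def)
    have "\<beta> y x = cinner (blinfun_apply Q y) g" for y
    proof (rule complex_eqI)
      show "Re (\<beta> y x) = Re (cinner (blinfun_apply Q y) g)" by (simp add: g Re_cinner)
      have "Re (\<i> * \<beta> y x) = Re (\<i> * cinner (blinfun_apply Q y) g)"
        using g(2)[of "\<i> *\<^sub>C y"]
        by (simp only: scale1 clinear_opD[OF Q] Re_cinner[symmetric] cinner_scaleC_left)
      then show "Im (\<beta> y x) = Im (cinner (blinfun_apply Q y) g)" by simp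
    qed
    then show ?thesis using g unfolding E_def by blast
  qed
  have uniq: "g = g'" if "E x g" "E x g'" for x g g'
  proof -
    have d: "g - g' \<in> closure M" using that clM unfolding E_def by (auto intro: subspace_diff)
    have "M \<subseteq> {m. cinner m (g - g') = 0}"
      using that by (auto simp: E_def M_def cinner.diff_right)
    moreover have "closed {m. cinner m (g - g') = 0}"
      by (intro closed_Collect_eq continuous_on_const linear_continuous_on cinner.bounded_linear_left)
    ultimately have "cinner (g - g') (g - g') = 0"
      using d closure_minimal by blast
    then show ?thesis by (simp add: cinner_self)
  qed
  have bdE: "norm g \<le> norm (blinfun_apply P x)" if "E x g" for x g
  proof -
    have "M \<subseteq> {m. cmod (cinner m g) \<le> norm m * norm (blinfun_apply P x)}"
      using that bd[of _ x] by (auto simp: E_def M_def)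
    moreover have "closed {m. cmod (cinner m g) \<le> norm m * norm (blinfun_apply P x)}"
      by (intro closed_Collect_le continuous_on_mult continuous_on_norm continuous_on_const
          continuous_on_id linear_continuous_on cinner.bounded_linear_left)
    ultimately have "cmod (cinner g g) \<le> norm g * norm (blinfun_apply P x)"
      using closure_minimal that unfolding E_def by blast
    then have "norm g * norm g \<le> norm g * norm (blinfun_apply P x)"
      by (simp add: cinner_self power2_eq_square norm_mult)
    then show ?thesis by (cases "norm g = 0") auto
  qed
  define g where "g x = (SOME v. E x v)" for x
  have g: "E x (g x)" for x unfolding g_def using ex by (rule someI_ex)
  have g_add: "g (x + x') = g x + g x'" for x x'
    using g[of x] g[of x'] clM
    by (intro uniq[OF g]) (auto simp: E_def add2 cinner_add_right intro: subspace_add)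
  have g_C: "g (c *\<^sub>C x) = c *\<^sub>C g x" for c x
    using g[of x] clC
    by (intro uniq[OF g]) (auto simp: E_def scale2 cinner_scaleC_right)
  have bl: "bounded_linear g"
  proof (rule bounded_linear_intro)
    show "g (c *\<^sub>R x) = c *\<^sub>R g x" for c x
      using g_C[of "of_real c" x] by (simp add: scaleC_of_real)
    show "norm (g x) \<le> norm x * norm P" for x
      using bdE[OF g[of x]] norm_blinfun[of P x] by (simp add: mult.commute)
  qed (rule g_add)
  show ?thesis
  proof (rule that[of "Blinfun g"])
    show "clinear_op (Blinfun g)"
      by (simp add: clinear_op_def bounded_linear_Blinfun_apply[OF bl] g_C)
  qed (use g bdE in \<open>auto simp: bounded_linear_Blinfun_apply[OF bl] E_def\<close>)
qed

section \<open>Adjoints\<close>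

lemma op_adj_ex1:
  fixes T :: "'a::chilbert_space \<Rightarrow>\<^sub>L 'b::chilbert_space"
  assumes "clinear_op T"
  shows "clinear_op (op_adj T) \<and>
    (\<forall>x y. cinner (blinfun_apply T x) y = cinner x (blinfun_apply (op_adj T) y))"
proof -
  have bd: "cmod (cinner (blinfun_apply T y) x) \<le>
        norm (blinfun_apply id_blinfun y) * norm (blinfun_apply (norm T *\<^sub>R id_blinfun) x)" for x y
  proof -
    have "cmod (cinner (blinfun_apply T y) x) \<le> norm (blinfun_apply T y) * norm x"
      by (rule norm_cinner_le)
    also have "\<dots> \<le> (norm T * norm y) * norm x" by (intro mult_right_mono norm_blinfun) simp
    finally show ?thesis by (simp add: blinfun.scaleR_left mult_ac)
  qed
  have "\<exists>G :: 'b \<Rightarrow>\<^sub>L 'a. clinear_op G \<and>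
    (\<forall>y x. cinner (blinfun_apply T y) x = cinner (blinfun_apply id_blinfun y) (blinfun_apply G x))"
  proof (rule dominated_form_factors[of id_blinfun "\<lambda>y x. cinner (blinfun_apply T y) x", OF _ _ _ _ _ bd])
    fix G :: "'b \<Rightarrow>\<^sub>L 'a"
    assume "clinear_op G"
      "\<And>y x. cinner (blinfun_apply T y) x = cinner (blinfun_apply id_blinfun y) (blinfun_apply G x)"
    then show ?thesis by blast
  qed (simp_all add: blinfun.add_right cinner_add_left cinner_add_right clinear_opD[OF assms]
        cinner_scaleC_left cinner_scaleC_right)
  then obtain G :: "'b \<Rightarrow>\<^sub>L 'a" where G: "clinear_op G"
    "\<And>y x. cinner (blinfun_apply T y) x = cinner y (blinfun_apply G x)"
    unfolding blinfun_apply_id_blinfun by blast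
  have "op_adj T = G"
    unfolding op_adj_def
  proof (rule the_equality)
    show "S = G" if "\<forall>x y. cinner (blinfun_apply T x) y = cinner x (blinfun_apply S y)" for S
      by (rule blinfun_eqI, rule cinner_eqI_right) (metis G(2) that)
  qed (use G in blast)
  then show ?thesis using G by blast
qed

lemma clinear_op_adj [clin]: "clinear_op T \<Longrightarrow> clinear_op (op_adj T)"
  by (rule conjunct1[OF op_adj_ex1])

lemma cinner_adj_right:
  "clinear_op T \<Longrightarrow> cinner x (blinfun_apply (op_adj T) y) = cinner (blinfun_apply T x) y"
  by (rule conjunct2[OF op_adj_ex1, THEN spec, THEN spec, symmetric])

lemma cinner_adj_left:
  assumes "clinear_op T"
  shows "cinner (blinfun_apply (op_adj T) x) y = cinner x (blinfun_apply T y)"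
proof -
  have "cnj (cinner y (blinfun_apply (op_adj T) x)) = cnj (cinner (blinfun_apply T y) x)"
    by (simp only: cinner_adj_right[OF assms])
  then show ?thesis by (simp only: cnj_cinner)
qed

lemma op_adj_eqI:
  fixes T :: "'a::chilbert_space \<Rightarrow>\<^sub>L 'b::chilbert_space"
  assumes "\<And>x y. cinner (blinfun_apply T x) y = cinner x (blinfun_apply S y)"
  shows "op_adj T = S"
  unfolding op_adj_def
proof (rule the_equality)
  fix S' assume "\<forall>x y. cinner (blinfun_apply T x) y = cinner x (blinfun_apply S' y)"
  then have "cinner x (blinfun_apply S' y) = cinner x (blinfun_apply S y)" for x y
    using assms by simp
  then show "S' = S"
    by (intro blinfun_eqI) (rule cinner_eqI_right)
qed (use assms in blast)

lemma clinear_op_Re [clin]: "clinear_op S \<Longrightarrow> clinear_op (op_Re S)"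
  unfolding op_Re_def by (intro clin)

lemma cinner_op_Re:
  assumes "clinear_op S"
  shows "cinner (blinfun_apply (op_Re S) x) x = of_real (Re (cinner (blinfun_apply S x) x))"
proof -
  have "cinner (blinfun_apply (op_adj S) x) x = cnj (cinner (blinfun_apply S x) x)"
    using assms by (simp add: cinner_adj_left)
  then show ?thesis
    by (simp del: cnj_cinner add: op_Re_def blinfun.scaleR_left blinfun.add_left cinner_scaleR_left cinner_add_left
        complex_eq_iff)
qed

lemma op_pos_op_Re:
  assumes "clinear_op S" "\<And>x. 0 \<le> Re (cinner (blinfun_apply S x) x)"
  shows "op_pos (op_Re S)"
  unfolding op_pos_def using assms by (auto simp: cinner_op_Re intro: clin)

section \<open>Positive operators\<close>

definition hermitian :: "('a::chilbert_space \<Rightarrow>\<^sub>L 'a) \<Rightarrow> bool" where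
  "hermitian A \<longleftrightarrow> (\<forall>x y. cinner (blinfun_apply A x) y = cinner x (blinfun_apply A y))"

lemma hermitianD: "hermitian A \<Longrightarrow> cinner (blinfun_apply A x) y = cinner x (blinfun_apply A y)"
  by (simp add: hermitian_def)

text \<open>Polarisation: the sesquilinear form \<open>D\<close> below vanishes on the diagonal, hence everywhere.\<close>

lemma op_pos_hermitian:
  assumes "op_pos A" shows "hermitian A"
  unfolding hermitian_def
proof (intro allI)
  fix x y
  have A: "clinear_op A" and r: "\<And>x. cinner (blinfun_apply A x) x \<in> \<real>"
    using assms by (auto simp: op_pos_def)
  define D where "D x y = cinner (blinfun_apply A x) y - cinner x (blinfun_apply A y)" for x y
  have D0: "D z z = 0" for z
    using r[of z] by (simp add: D_def Reals_cnj_iff)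
  have a: "D (u + v) (u + v) = D u u + D u v + D v u + D v v" for u v
    unfolding D_def by (simp add: blinfun.add_right cinner_add_left cinner_add_right)
  have "D x y + D y x = 0" using a[of x y] D0 by simp
  moreover have "D x (\<i> *\<^sub>C y) + D (\<i> *\<^sub>C y) x = 0" using a[of x "\<i> *\<^sub>C y"] D0 by simp
  then have "- \<i> * D x y + \<i> * D y x = 0"
    unfolding D_def
    by (simp add: clinear_opD[OF A] cinner_scaleC_left cinner_scaleC_right algebra_simps)
  then have "D y x = D x y" by (simp add: algebra_simps)
  ultimately have "D x y = 0" by simp
  then show "cinner (blinfun_apply A x) y = cinner x (blinfun_apply A y)" by (simp add: D_def)
qed

lemma op_posI:
  assumes "clinear_op A" "hermitian A" "\<And>x. 0 \<le> Re (cinner (blinfun_apply A x) x)"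
  shows "op_pos A"
proof -
  have "cinner (blinfun_apply A x) x \<in> \<real>" for x
    using hermitianD[OF assms(2), of x x] by (simp add: Reals_cnj_iff)
  then show ?thesis using assms by (auto simp: op_pos_def)
qed

lemma op_pos_clinear: "op_pos A \<Longrightarrow> clinear_op A"
  by (simp add: op_pos_def)

lemma op_posD: "op_pos A \<Longrightarrow> 0 \<le> Re (cinner (blinfun_apply A x) x)"
  by (simp add: op_pos_def)

lemma quadratic_nonneg_imp_discriminant:
  fixes a b d :: real
  assumes "\<And>t. 0 \<le> a + 2 * t * b + t\<^sup>2 * d" and "0 \<le> d"
  shows "b\<^sup>2 \<le> a * d"
proof (cases "d = 0")
  case True
  have "b = 0"
  proof (rule ccontr)
    assume "b \<noteq> 0"
    then show False using assms(1)[of "- (a + 1) / (2 * b)"] True by (simp add: field_simps)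
  qed
  then show ?thesis using True by simp
next
  case False
  with assms(2) have "d > 0" by simp
  then show ?thesis using assms(1)[of "- b / d"] by (simp add: field_simps power2_eq_square)
qed

lemma op_pos_cauchy_schwarz:
  assumes "op_pos A"
  shows "(cmod (cinner (blinfun_apply A x) y))\<^sup>2
    \<le> Re (cinner (blinfun_apply A x) x) * Re (cinner (blinfun_apply A y) y)"
proof -
  note A = op_pos_clinear[OF assms] op_pos_hermitian[OF assms]
  obtain c where c: "cmod c = 1" "c * cinner (blinfun_apply A x) y = cmod (cinner (blinfun_apply A x) y)"
    using ex_unimodular_rotation by metis
  define w where "w = cnj c *\<^sub>C y"
  have w: "cinner (blinfun_apply A x) w = cmod (cinner (blinfun_apply A x) y)"
    using c by (simp add: w_def cinner_scaleC_right)
  have w2: "cinner (blinfun_apply A w) x = cmod (cinner (blinfun_apply A x) y)"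
    using arg_cong[OF w, of cnj] hermitianD[OF A(2), of w x] by simp
  have "c * cnj c = 1" using c(1) by (simp add: complex_norm_square[symmetric])
  then have w3: "cinner (blinfun_apply A w) w = cinner (blinfun_apply A y) y"
    using A(1) by (simp add: w_def clinear_opD cinner_scaleC_left cinner_scaleC_right)
  show ?thesis
  proof (rule quadratic_nonneg_imp_discriminant)
    fix t :: real
    have "0 \<le> Re (cinner (blinfun_apply A (x + t *\<^sub>R w)) (x + t *\<^sub>R w))"
      by (rule op_posD[OF assms])
    also have "\<dots> = Re (cinner (blinfun_apply A x) x) + 2 * t * cmod (cinner (blinfun_apply A x) y)
        + t\<^sup>2 * Re (cinner (blinfun_apply A y) y)"
      by (simp add: blinfun.add_right blinfun.scaleR_right cinner_add_left cinner_add_right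
          cinner_scaleR_left cinner_scaleR_right w w2 w3 algebra_simps power2_eq_square)
    finally show "0 \<le> \<dots>" .
  qed (rule op_posD[OF assms])
qed

lemma op_pos_apply_eq_0:
  assumes "op_pos A" "Re (cinner (blinfun_apply A x) x) = 0"
  shows "blinfun_apply A x = 0"
  using op_pos_cauchy_schwarz[OF assms(1), of x "blinfun_apply A x"] assms(2) by (simp add: cinner_self)

lemma hermitian_lim:
  assumes "f \<longlonglongrightarrow> T" "\<And>n. hermitian (f n)"
  shows "hermitian T"
  unfolding hermitian_def
proof (intro allI)
  fix x y
  have "(\<lambda>n. cinner (blinfun_apply (f n) x) y) \<longlonglongrightarrow> cinner (blinfun_apply T x) y"
    by (intro cinner.tendsto tendsto_const tendsto_blinfun_apply assms)
  moreover have "(\<lambda>n. cinner x (blinfun_apply (f n) y)) \<longlonglongrightarrow> cinner x (blinfun_apply T y)"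
    by (intro cinner.tendsto tendsto_const tendsto_blinfun_apply assms)
  ultimately show "cinner (blinfun_apply T x) y = cinner x (blinfun_apply T y)"
    using assms(2) by (simp add: hermitianD LIMSEQ_unique)
qed

lemmas [simp] = cinner.zero_left cinner.zero_right

section \<open>Square roots\<close>

text \<open>For a positive \<open>A\<close> scaled to \<open>|A| \<le> 1\<close> and \<open>B = I - A\<close>, the square root of \<open>A\<close> is \<open>I - Y\<close> for the fixed
  point \<open>Y\<close> of \<open>Y \<mapsto> (B + Y\<^sup>2) / 2\<close>. Since \<open>|B| \<le> 1\<close>, the increments of the iteration are dominated by those of
  the numerical iteration \<open>y \<mapsto> (1 + y\<^sup>2) / 2\<close>, which is increasing and bounded; so the iteration converges
  in norm.\<close>

primrec sqrt_iter :: "('a::chilbert_space \<Rightarrow>\<^sub>L 'a) \<Rightarrow> nat \<Rightarrow> ('a \<Rightarrow>\<^sub>L 'a)" where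
  "sqrt_iter B 0 = 0"
| "sqrt_iter B (Suc n) = (1/2) *\<^sub>R (B + (sqrt_iter B n o\<^sub>L sqrt_iter B n))"

primrec sqrt_majorant :: "nat \<Rightarrow> real" where
  "sqrt_majorant 0 = 0"
| "sqrt_majorant (Suc n) = (1 + (sqrt_majorant n)\<^sup>2) / 2"

lemma sqrt_majorant_bounds: "0 \<le> sqrt_majorant n \<and> sqrt_majorant n \<le> 1"
  by (induction n) (auto simp: power_le_one)

lemma sqrt_majorant_le_Suc: "sqrt_majorant n \<le> sqrt_majorant (Suc n)"
proof -
  have "0 \<le> (sqrt_majorant n - 1)\<^sup>2" by simp
  then show ?thesis by (simp add: power2_diff)
qed

lemma sqrt_iter_bounds:
  assumes "norm B \<le> 1"
  shows "norm (sqrt_iter B n) \<le> sqrt_majorant n \<and>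
    norm (sqrt_iter B (Suc n) - sqrt_iter B n) \<le> sqrt_majorant (Suc n) - sqrt_majorant n"
proof (induction n)
  case 0
  then show ?case using assms by simp
next
  case (Suc n)
  define Y Y' y y' where "Y = sqrt_iter B n" and "Y' = sqrt_iter B (Suc n)"
    and "y = sqrt_majorant n" and "y' = sqrt_majorant (Suc n)"
  have IH: "norm Y \<le> y" "norm (Y' - Y) \<le> y' - y" using Suc unfolding Y_def Y'_def y_def y'_def by auto
  have y: "0 \<le> y" "y \<le> y'" "0 \<le> y'"
    using sqrt_majorant_bounds sqrt_majorant_le_Suc unfolding y_def y'_def by blast+
  have Y': "norm Y' \<le> y'"
    using norm_triangle_ineq[of "Y' - Y" Y] IH by simp
  have "norm ((Y' o\<^sub>L (Y' - Y)) + ((Y' - Y) o\<^sub>L Y)) \<le> norm Y' * norm (Y' - Y) + norm (Y' - Y) * norm Y"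
    by (intro order_trans[OF norm_triangle_ineq] add_mono norm_blinfun_compose)
  also have "\<dots> \<le> y' * (y' - y) + (y' - y) * y"
    using IH Y' y by (intro add_mono[OF mult_mono mult_mono]) simp_all
  finally have n: "norm ((Y' o\<^sub>L (Y' - Y)) + ((Y' - Y) o\<^sub>L Y)) \<le> y'\<^sup>2 - y\<^sup>2"
    by (simp add: power2_eq_square algebra_simps)
  have "sqrt_iter B (Suc (Suc n)) - Y' = (1/2) *\<^sub>R ((Y' o\<^sub>L (Y' - Y)) + ((Y' - Y) o\<^sub>L Y))"
    unfolding Y_def Y'_def
    by (intro blinfun_eqI) (simp add: blinfun.bilinear_simps algebra_simps)
  then have "norm (sqrt_iter B (Suc (Suc n)) - Y') \<le> (y'\<^sup>2 - y\<^sup>2) / 2" using n by simp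
  also have "\<dots> = sqrt_majorant (Suc (Suc n)) - y'" unfolding y_def y'_def by (simp add: field_simps)
  finally show ?case using Y' unfolding Y'_def y'_def by simp
qed

lemma convergent_sqrt_iter:
  assumes "norm B \<le> 1"
  shows "convergent (sqrt_iter B)"
proof -
  have "incseq sqrt_majorant" using sqrt_majorant_le_Suc by (rule incseq_SucI)
  then have "convergent sqrt_majorant"
    by (metis incseq_convergent convergentI sqrt_majorant_bounds)
  then have s: "summable (\<lambda>n. sqrt_majorant (Suc n) - sqrt_majorant n)"
    using telescope_summable unfolding convergent_def by blast
  have "summable (\<lambda>n. sqrt_iter B (Suc n) - sqrt_iter B n)"
    using sqrt_iter_bounds[OF assms] by (intro summable_comparison_test'[OF s, of 0]) auto
  then have "convergent (\<lambda>n. \<Sum>i<n. sqrt_iter B (Suc i) - sqrt_iter B i)"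
    by (simp add: summable_iff_convergent)
  then show ?thesis by (simp add: sum_lessThan_telescope del: sqrt_iter.simps(2))
qed

lemma sqrt_iter_intertwine:
  assumes "K o\<^sub>L B = B' o\<^sub>L K"
  shows "K o\<^sub>L sqrt_iter B n = sqrt_iter B' n o\<^sub>L K"
proof (induction n)
  case (Suc n)
  have 1: "blinfun_apply K (blinfun_apply (sqrt_iter B n) x) = blinfun_apply (sqrt_iter B' n) (blinfun_apply K x)" for x
    using Suc by (metis blinfun_apply_blinfun_compose)
  have 2: "blinfun_apply K (blinfun_apply B x) = blinfun_apply B' (blinfun_apply K x)" for x
    using assms by (metis blinfun_apply_blinfun_compose)
  show ?case by (intro blinfun_eqI) (simp add: blinfun.bilinear_simps 1 2)
qed simp

text \<open>The bound \<open>m\<close> is left free, so that one \<open>m\<close> can serve two operators; this is what makes square roots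
  inherit intertwining relations below.\<close>

lemma sqrt_construction:
  assumes A: "op_pos A" and m: "m > 0" "norm A \<le> m"
  defines "B \<equiv> id_blinfun - (1/m) *\<^sub>R A"
  obtains R where "op_pos R" "R o\<^sub>L R = A" "(\<lambda>n. sqrt m *\<^sub>R (id_blinfun - sqrt_iter B n)) \<longlonglongrightarrow> R"
proof -
  note Ac = op_pos_clinear[OF A] and Ah = op_pos_hermitian[OF A]
  have Bh: "hermitian B"
    using hermitianD[OF Ah] unfolding B_def hermitian_def
    by (simp add: blinfun.bilinear_simps cinner.diff_left cinner.diff_right cinner_scaleR_left cinner_scaleR_right)
  have Bc: "clinear_op B" unfolding B_def by (intro clin Ac)
  have ReB: "Re (cinner (blinfun_apply B x) x) = (norm x)\<^sup>2 - Re (cinner (blinfun_apply A x) x) / m" for x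
    unfolding B_def by (simp add: blinfun.bilinear_simps cinner.diff_left cinner_scaleR_left Re_cinner_self)
  have Ale: "Re (cinner (blinfun_apply A x) x) \<le> m * (norm x)\<^sup>2" for x
  proof -
    have "Re (cinner (blinfun_apply A x) x) \<le> norm (blinfun_apply A x) * norm x"
      using norm_cinner_le complex_Re_le_cmod order_trans by blast
    also have "\<dots> \<le> (m * norm x) * norm x"
      using m by (intro mult_right_mono order_trans[OF norm_blinfun]) auto
    finally show ?thesis by (simp add: power2_eq_square mult.assoc)
  qed
  have B: "op_pos B"
    using Bc Bh
  proof (rule op_posI)
    show "0 \<le> Re (cinner (blinfun_apply B x) x)" for x
      using Ale[of x] m by (simp add: ReB field_simps)
  qed
  have Ble: "Re (cinner (blinfun_apply B x) x) \<le> (norm x)\<^sup>2" for x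
    using op_posD[OF A, of x] m by (simp add: ReB)
  \<comment> \<open>From \<open>0 \<le> B \<le> 1\<close> by the Cauchy--Schwarz inequality for the form of \<open>B\<close>.\<close>
  have "norm (blinfun_apply B x) \<le> 1 * norm x" for x
  proof (cases "blinfun_apply B x = 0")
    case False
    have "((norm (blinfun_apply B x))\<^sup>2)\<^sup>2
        \<le> Re (cinner (blinfun_apply B x) x) * Re (cinner (blinfun_apply B (blinfun_apply B x)) (blinfun_apply B x))"
      using op_pos_cauchy_schwarz[OF B, of x "blinfun_apply B x"] by (simp add: cinner_self norm_power)
    also have "\<dots> \<le> (norm x)\<^sup>2 * (norm (blinfun_apply B x))\<^sup>2"
      using Ble op_posD[OF B] by (intro mult_mono) auto
    finally have "(norm (blinfun_apply B x))\<^sup>2 * (norm (blinfun_apply B x))\<^sup>2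
        \<le> (norm x)\<^sup>2 * (norm (blinfun_apply B x))\<^sup>2"
      by (simp only: power2_eq_square[of "(norm (blinfun_apply B x))\<^sup>2"])
    then have "(norm (blinfun_apply B x))\<^sup>2 \<le> (norm x)\<^sup>2"
      by (rule mult_right_le_imp_le) (use False in simp)
    then have "norm (blinfun_apply B x) \<le> norm x" by (rule power2_le_imp_le) simp
    then show ?thesis by simp
  qed simp
  then have nB: "norm B \<le> 1" by (intro norm_blinfun_bound) auto
  then obtain Y where Y: "sqrt_iter B \<longlonglongrightarrow> Y" using convergent_sqrt_iter convergent_def by blast
  have "norm (sqrt_iter B n) \<le> 1" for n
    using sqrt_iter_bounds[OF nB, of n] sqrt_majorant_bounds[of n] by linarith
  then have nY: "norm Y \<le> 1"
    by (intro tendsto_upperbound[OF tendsto_norm[OF Y]]) auto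
  have Yc: "clinear_op Y"
  proof (rule clinear_op_lim[OF Y])
    show "clinear_op (sqrt_iter B n)" for n by (induction n) (auto intro!: clin Bc)
  qed
  have Yh: "hermitian Y"
  proof (rule hermitian_lim[OF Y])
    show "hermitian (sqrt_iter B n)" for n
    proof (induction n)
      case (Suc n)
      then show ?case using hermitianD[OF Bh] unfolding hermitian_def
        by (simp add: blinfun.bilinear_simps cinner_add_left cinner_add_right cinner_scaleR_left cinner_scaleR_right)
    qed (simp add: hermitian_def)
  qed
  have "(\<lambda>n. sqrt_iter B (Suc n)) \<longlonglongrightarrow> (1/2) *\<^sub>R (B + (Y o\<^sub>L Y))"
    using Y by (auto intro!: tendsto_intros)
  then have Yeq: "Y = (1/2) *\<^sub>R (B + (Y o\<^sub>L Y))"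
    using LIMSEQ_Suc[OF Y] LIMSEQ_unique by blast
  have Yeq': "blinfun_apply Y (blinfun_apply Y x) = 2 *\<^sub>R blinfun_apply Y x - blinfun_apply B x" for x
  proof -
    have "blinfun_apply Y x = blinfun_apply ((1/2) *\<^sub>R (B + (Y o\<^sub>L Y))) x"
      by (rule arg_cong[OF Yeq, of "\<lambda>T. blinfun_apply T x"])
    also have "2 *\<^sub>R \<dots> = blinfun_apply B x + blinfun_apply Y (blinfun_apply Y x)"
      by (simp add: blinfun.bilinear_simps)
    finally show ?thesis by (simp add: algebra_simps)
  qed
  define R where "R = sqrt m *\<^sub>R (id_blinfun - Y)"
  have R_cl: "clinear_op R" unfolding R_def by (intro clin Yc)
  have "op_pos R"
  proof (rule op_posI[OF R_cl])
    show "hermitian R"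
      using hermitianD[OF Yh] unfolding R_def hermitian_def
      by (simp add: blinfun.bilinear_simps cinner.diff_left cinner.diff_right cinner_scaleR_left cinner_scaleR_right)
    fix x
    have "Re (cinner (blinfun_apply Y x) x) \<le> norm (blinfun_apply Y x) * norm x"
      using norm_cinner_le complex_Re_le_cmod order_trans by blast
    also have "\<dots> \<le> (1 * norm x) * norm x"
      using nY by (intro mult_right_mono order_trans[OF norm_blinfun]) auto
    finally have "Re (cinner (blinfun_apply Y x) x) \<le> (norm x)\<^sup>2" by (simp add: power2_eq_square)
    then show "0 \<le> Re (cinner (blinfun_apply R x) x)"
      using m unfolding R_def
      by (simp add: blinfun.bilinear_simps cinner.diff_left cinner_scaleR_left Re_cinner_self)
  qed
  moreover have "R o\<^sub>L R = A"
  proof (rule blinfun_eqI)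
    fix x
    have "blinfun_apply (R o\<^sub>L R) x = (sqrt m * sqrt m) *\<^sub>R (x - 2 *\<^sub>R blinfun_apply Y x + blinfun_apply Y (blinfun_apply Y x))"
      unfolding R_def by (simp add: blinfun.bilinear_simps algebra_simps scaleR_2)
    also have "\<dots> = m *\<^sub>R (x - blinfun_apply B x)"
      using m by (simp add: Yeq')
    also have "\<dots> = blinfun_apply A x"
      using m unfolding B_def by (simp add: blinfun.bilinear_simps)
    finally show "blinfun_apply (R o\<^sub>L R) x = blinfun_apply A x" .
  qed
  moreover have "(\<lambda>n. sqrt m *\<^sub>R (id_blinfun - sqrt_iter B n)) \<longlonglongrightarrow> R"
    unfolding R_def by (intro tendsto_intros Y)
  ultimately show thesis by (rule that)
qed

text \<open>The limit of the iteration commutes with everything that commutes with \<open>A\<close>, in particular with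
  any other positive root \<open>S\<close>; then \<open>(R - S) (R + S) = 0\<close>, and positivity of both summands makes
  \<open>R - S\<close> vanish.\<close>

lemma op_sqrt_eqI:
  assumes "op_pos S" "S o\<^sub>L S = A" "op_pos R" "R o\<^sub>L R = A"
    and lim: "(\<lambda>n. s *\<^sub>R (id_blinfun - sqrt_iter (id_blinfun - t *\<^sub>R A) n)) \<longlonglongrightarrow> R"
  shows "S = R"
proof -
  have SA: "S o\<^sub>L A = A o\<^sub>L S" using assms(2) by (metis compose_eqs(1))
  have "S o\<^sub>L (id_blinfun - t *\<^sub>R A) = (id_blinfun - t *\<^sub>R A) o\<^sub>L S"
    unfolding blinfun_compose.scaleR_left blinfun_compose.scaleR_right
      blinfun_compose.diff_left blinfun_compose.diff_right by (simp add: compose_eqs SA)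
  from sqrt_iter_intertwine[OF this]
  have c: "S o\<^sub>L (s *\<^sub>R (id_blinfun - sqrt_iter (id_blinfun - t *\<^sub>R A) n))
      = (s *\<^sub>R (id_blinfun - sqrt_iter (id_blinfun - t *\<^sub>R A) n)) o\<^sub>L S" for n
    unfolding blinfun_compose.scaleR_left blinfun_compose.scaleR_right
      blinfun_compose.diff_left blinfun_compose.diff_right by (simp add: compose_eqs)
  have "(\<lambda>n. S o\<^sub>L (s *\<^sub>R (id_blinfun - sqrt_iter (id_blinfun - t *\<^sub>R A) n))) \<longlonglongrightarrow> (S o\<^sub>L R)"
    by (intro blinfun_compose.tendsto tendsto_const lim)
  moreover have "(\<lambda>n. (s *\<^sub>R (id_blinfun - sqrt_iter (id_blinfun - t *\<^sub>R A) n)) o\<^sub>L S) \<longlonglongrightarrow> (R o\<^sub>L S)"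
    by (intro blinfun_compose.tendsto tendsto_const lim)
  ultimately have SR: "S o\<^sub>L R = R o\<^sub>L S" unfolding c using LIMSEQ_unique by blast
  show ?thesis
  proof (rule blinfun_eqI)
    fix x
    define y where "y = blinfun_apply S x - blinfun_apply R x"
    have "blinfun_apply S y + blinfun_apply R y
        = blinfun_apply (S o\<^sub>L S) x - blinfun_apply (R o\<^sub>L R) x + (blinfun_apply (R o\<^sub>L S) x - blinfun_apply (S o\<^sub>L R) x)"
      unfolding y_def by (simp add: blinfun.diff_right)
    then have sum0: "blinfun_apply S y + blinfun_apply R y = 0" by (simp add: assms(2,4) SR)
    then have "cinner (blinfun_apply S y + blinfun_apply R y) y = 0" by (simp only: cinner.zero_left)
    then have "Re (cinner (blinfun_apply S y) y + cinner (blinfun_apply R y) y) = 0"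
      by (simp only: cinner_add_left zero_complex.sel)
    then have "Re (cinner (blinfun_apply S y) y) + Re (cinner (blinfun_apply R y) y) = 0" by simp
    then have "Re (cinner (blinfun_apply S y) y) = 0" "Re (cinner (blinfun_apply R y) y) = 0"
      using op_posD[OF assms(1), of y] op_posD[OF assms(3), of y] by linarith+
    then have "blinfun_apply S y = 0" "blinfun_apply R y = 0"
      using op_pos_apply_eq_0 assms(1,3) by blast+
    moreover have "cinner y y = cinner (blinfun_apply S x) y - cinner (blinfun_apply R x) y"
      by (simp add: y_def cinner.diff_left[symmetric])
    ultimately have "cinner y y = 0"
      using hermitianD[OF op_pos_hermitian[OF assms(1)], of x y] hermitianD[OF op_pos_hermitian[OF assms(3)], of x y]
      by simp
    then show "blinfun_apply S x = blinfun_apply R x" by (simp add: cinner_self y_def)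
  qed
qed

lemma op_sqrt_limit:
  assumes A: "op_pos A" and m: "m > 0" "norm A \<le> m"
  shows "op_pos (op_sqrt A)" "op_sqrt A o\<^sub>L op_sqrt A = A"
    "(\<lambda>n. sqrt m *\<^sub>R (id_blinfun - sqrt_iter (id_blinfun - (1/m) *\<^sub>R A) n)) \<longlonglongrightarrow> op_sqrt A"
proof -
  obtain R where R: "op_pos R" "R o\<^sub>L R = A"
      "(\<lambda>n. sqrt m *\<^sub>R (id_blinfun - sqrt_iter (id_blinfun - (1/m) *\<^sub>R A) n)) \<longlonglongrightarrow> R"
    using sqrt_construction[OF A m] by blast
  have "op_sqrt A = R"
    unfolding op_sqrt_def
    by (rule the_equality) (use R op_sqrt_eqI[OF _ _ R] in blast)+
  with R show "op_pos (op_sqrt A)" "op_sqrt A o\<^sub>L op_sqrt A = A"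
    "(\<lambda>n. sqrt m *\<^sub>R (id_blinfun - sqrt_iter (id_blinfun - (1/m) *\<^sub>R A) n)) \<longlonglongrightarrow> op_sqrt A" by auto
qed

lemma op_pos_op_sqrt: "op_pos A \<Longrightarrow> op_pos (op_sqrt A)"
  and op_sqrt_square: "op_pos A \<Longrightarrow> op_sqrt A o\<^sub>L op_sqrt A = A"
  using op_sqrt_limit[of A "norm A + 1"] by (simp_all add: add_nonneg_pos)

lemma norm_op_sqrt:
  assumes "op_pos A"
  shows "(norm (blinfun_apply (op_sqrt A) x))\<^sup>2 = Re (cinner (blinfun_apply A x) x)"
proof -
  have "cinner (blinfun_apply (op_sqrt A) x) (blinfun_apply (op_sqrt A) x)
      = cinner (blinfun_apply (op_sqrt A o\<^sub>L op_sqrt A) x) x"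
    using hermitianD[OF op_pos_hermitian[OF op_pos_op_sqrt[OF assms]], of "blinfun_apply (op_sqrt A) x" x] by simp
  then show ?thesis using op_sqrt_square[OF assms] by (simp add: Re_cinner_self[symmetric])
qed

lemma op_sqrt_intertwine:
  assumes "op_pos A" "op_pos A'" "K o\<^sub>L A = A' o\<^sub>L K"
  shows "K o\<^sub>L op_sqrt A = op_sqrt A' o\<^sub>L K"
proof -
  \<comment> \<open>One normalisation for both iterations.\<close>
  define m where "m = norm A + norm A' + 1"
  have m: "m > 0" "norm A \<le> m" "norm A' \<le> m" by (auto simp: m_def add_nonneg_pos)
  let ?f = "\<lambda>A n. sqrt m *\<^sub>R (id_blinfun - sqrt_iter (id_blinfun - (1/m) *\<^sub>R A) n)"
  have "K o\<^sub>L (id_blinfun - (1/m) *\<^sub>R A) = (id_blinfun - (1/m) *\<^sub>R A') o\<^sub>L K"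
    unfolding blinfun_compose.scaleR_left blinfun_compose.scaleR_right
      blinfun_compose.diff_left blinfun_compose.diff_right by (simp add: compose_eqs assms(3))
  from sqrt_iter_intertwine[OF this] have c: "K o\<^sub>L ?f A n = ?f A' n o\<^sub>L K" for n
    unfolding blinfun_compose.scaleR_left blinfun_compose.scaleR_right
      blinfun_compose.diff_left blinfun_compose.diff_right by (simp add: compose_eqs)
  have "(\<lambda>n. K o\<^sub>L ?f A n) \<longlonglongrightarrow> (K o\<^sub>L op_sqrt A)"
    by (intro blinfun_compose.tendsto tendsto_const op_sqrt_limit assms m)
  moreover have "(\<lambda>n. ?f A' n o\<^sub>L K) \<longlonglongrightarrow> (op_sqrt A' o\<^sub>L K)"
    by (intro blinfun_compose.tendsto tendsto_const op_sqrt_limit assms m)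
  ultimately show ?thesis unfolding c using LIMSEQ_unique by blast
qed

section \<open>Positive blocks and unitary corners\<close>

lemma Re_two_mult: "Re (2 * z) = 2 * Re z"
  by simp

text \<open>Rotating \<open>z\<close> to the positive axis turns the hypothesis into a real quadratic in \<open>t\<close>.\<close>

lemma rotated_quadratic_nonneg:
  assumes "0 \<le> d" and pos: "\<And>(t::real) c. cmod c = 1 \<Longrightarrow> 0 \<le> a + t * Re (c * z) + t\<^sup>2 * d"
  shows "(cmod z / 2)\<^sup>2 \<le> a * d"
proof (rule quadratic_nonneg_imp_discriminant)
  fix t :: real
  obtain c where "cmod c = 1" "c * z = of_real (cmod z)" using ex_unimodular_rotation by blast
  then show "0 \<le> a + 2 * t * (cmod z / 2) + t\<^sup>2 * d" using pos[of c t] by simp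
qed (rule assms)

text \<open>The quadratic form of the block operator with diagonal \<open>G\<^sub>1, G\<^sub>2\<close> and corner \<open>B\<close> has
  nonnegative real part exactly if \<open>\<langle>B y, x\<rangle> / 2\<close> is dominated by
  \<open>|(Re G\<^sub>1)\<^bsup>1/2\<^esup> x| |(Re G\<^sub>2)\<^bsup>1/2\<^esup> y|\<close>, and a form so dominated factors through both roots.\<close>

lemma positive_block_iff_factorization:
  fixes G1 :: "'a::chilbert_space \<Rightarrow>\<^sub>L 'a" and G2 :: "'b::chilbert_space \<Rightarrow>\<^sub>L 'b" and B :: "'b \<Rightarrow>\<^sub>L 'a"
  assumes G: "clinear_op G1" "clinear_op G2" "clinear_op B"
    and pos1: "\<And>x. 0 \<le> Re (cinner (blinfun_apply G1 x) x)"
    and pos2: "\<And>y. 0 \<le> Re (cinner (blinfun_apply G2 y) y)"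
  shows "(\<forall>x y. 0 \<le> Re (cinner (blinfun_apply G1 x + blinfun_apply B y) x) + Re (cinner (blinfun_apply G2 y) y)) \<longleftrightarrow>
    (\<exists>K. op_contraction K \<and> (1/2) *\<^sub>R B = op_sqrt (op_Re G1) o\<^sub>L K o\<^sub>L op_sqrt (op_Re G2))"
    (is "?L \<longleftrightarrow> ?R")
proof -
  define P Q where "P = op_sqrt (op_Re G1)" and "Q = op_sqrt (op_Re G2)"
  have posP: "op_pos P" "op_pos Q"
    unfolding P_def Q_def by (intro op_pos_op_sqrt op_pos_op_Re G pos1 pos2)+
  have nP: "(norm (blinfun_apply P x))\<^sup>2 = Re (cinner (blinfun_apply G1 x) x)" for x
    unfolding P_def by (simp add: norm_op_sqrt op_pos_op_Re[OF G(1) pos1] cinner_op_Re[OF G(1)])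
  have nQ: "(norm (blinfun_apply Q x))\<^sup>2 = Re (cinner (blinfun_apply G2 x) x)" for x
    unfolding Q_def by (simp add: norm_op_sqrt op_pos_op_Re[OF G(2) pos2] cinner_op_Re[OF G(2)])
  note hP = hermitianD[OF op_pos_hermitian[OF posP(1)]]
  show ?thesis
  proof
    assume L: ?L
    have bd: "cmod (cinner (blinfun_apply ((1/2) *\<^sub>R B) y) x) \<le> norm (blinfun_apply Q y) * norm (blinfun_apply P x)" for x y
    proof -
      have "(cmod (cinner (blinfun_apply B y) x) / 2)\<^sup>2
          \<le> Re (cinner (blinfun_apply G1 x) x) * Re (cinner (blinfun_apply G2 y) y)"
      proof (rule rotated_quadratic_nonneg[OF pos2])
        fix t :: real and c :: complex assume c: "cmod c = 1"
        then have cc: "c * cnj c = 1" by (simp add: complex_norm_square[symmetric])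
        have "0 \<le> Re (cinner (blinfun_apply G1 x + blinfun_apply B (t *\<^sub>R c *\<^sub>C y)) x)
            + Re (cinner (blinfun_apply G2 (t *\<^sub>R c *\<^sub>C y)) (t *\<^sub>R c *\<^sub>C y))"
          using L by blast
        also have "cinner (blinfun_apply G2 (t *\<^sub>R c *\<^sub>C y)) (t *\<^sub>R c *\<^sub>C y) = t\<^sup>2 * cinner (blinfun_apply G2 y) y"
          using cc mult.commute[of c "cnj c"] by (simp add: blinfun.scaleR_right clinear_opD[OF G(2)] cinner_scaleR_left cinner_scaleR_right
              cinner_scaleC_left cinner_scaleC_right power2_eq_square)
        finally show "0 \<le> Re (cinner (blinfun_apply G1 x) x) + t * Re (c * cinner (blinfun_apply B y) x)
            + t\<^sup>2 * Re (cinner (blinfun_apply G2 y) y)"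
          by (simp add: blinfun.scaleR_right clinear_opD[OF G(3)] cinner_add_left cinner_scaleR_left
              cinner_scaleC_left flip: of_real_power)
      qed
      also have "\<dots> = (norm (blinfun_apply Q y) * norm (blinfun_apply P x))\<^sup>2"
        by (simp add: power_mult_distrib nP nQ)
      finally have "cmod (cinner (blinfun_apply B y) x) / 2 \<le> norm (blinfun_apply Q y) * norm (blinfun_apply P x)"
        by (rule power2_le_imp_le) simp
      then show ?thesis by (simp add: blinfun.scaleR_left cinner_scaleR_left norm_mult)
    qed
    have clB: "clinear_op ((1/2) *\<^sub>R B)" by (intro clin G)
    obtain g :: "'a \<Rightarrow>\<^sub>L 'b" where g: "clinear_op g"
      "\<And>y x. cinner (blinfun_apply ((1/2) *\<^sub>R B) y) x = cinner (blinfun_apply Q y) (blinfun_apply g x)"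
      "\<And>x. norm (blinfun_apply g x) \<le> norm (blinfun_apply P x)"
      by (rule dominated_form_factors[of Q "\<lambda>y x. cinner (blinfun_apply ((1/2) *\<^sub>R B) y) x" P,
            OF op_pos_clinear[OF posP(2)] _ _ _ _ bd])
        (simp_all add: blinfun.add_right cinner_add_left cinner_add_right clinear_opD[OF clB]
          cinner_scaleC_left cinner_scaleC_right)
    have bd': "cmod (cinner (blinfun_apply g x) z) \<le> norm (blinfun_apply P x) * norm (blinfun_apply id_blinfun z)" for x z
      using order_trans[OF norm_cinner_le mult_right_mono[OF g(3) norm_ge_zero]] by simp
    \<comment> \<open>The first application splits off \<open>Q\<close>, this one splits off \<open>P\<close> from the operator that is left.\<close>
    obtain K :: "'b \<Rightarrow>\<^sub>L 'a" where K: "clinear_op K"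
      "\<And>x z. cinner (blinfun_apply g x) z = cinner (blinfun_apply P x) (blinfun_apply K z)"
      "\<And>z. norm (blinfun_apply K z) \<le> norm (blinfun_apply id_blinfun z)"
      by (rule dominated_form_factors[of P "\<lambda>x z. cinner (blinfun_apply g x) z" "id_blinfun",
            OF op_pos_clinear[OF posP(1)] _ _ _ _ bd'])
        (simp_all add: blinfun.add_right cinner_add_left cinner_add_right clinear_opD[OF g(1)]
          cinner_scaleC_left cinner_scaleC_right)
    have "op_contraction K"
      unfolding op_contraction_def using K by (auto intro: norm_blinfun_bound)
    moreover have "(1/2) *\<^sub>R B = P o\<^sub>L K o\<^sub>L Q"
    proof (rule blinfun_eqI, rule cinner_eqI)
      fix y x
      have "cinner (blinfun_apply ((1/2) *\<^sub>R B) y) x = cnj (cinner (blinfun_apply g x) (blinfun_apply Q y))"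
        by (simp only: g(2) cnj_cinner)
      also have "\<dots> = cinner (blinfun_apply (P o\<^sub>L K o\<^sub>L Q) y) x"
        by (simp add: K(2) hP)
      finally show "cinner (blinfun_apply ((1/2) *\<^sub>R B) y) x = cinner (blinfun_apply (P o\<^sub>L K o\<^sub>L Q) y) x" .
    qed
    ultimately show ?R unfolding P_def Q_def by blast
  next
    assume ?R
    then obtain K where K: "clinear_op K" "norm K \<le> 1" "(1/2) *\<^sub>R B = P o\<^sub>L K o\<^sub>L Q"
      unfolding op_contraction_def P_def Q_def by blast
    show ?L
    proof (intro allI)
      fix x y
      have "blinfun_apply B y = 2 *\<^sub>R blinfun_apply ((1/2) *\<^sub>R B) y" by (simp add: blinfun.scaleR_left)
      also have "\<dots> = 2 *\<^sub>R blinfun_apply P (blinfun_apply K (blinfun_apply Q y))" by (simp add: K(3))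
      finally have "cinner (blinfun_apply B y) x = 2 * cinner (blinfun_apply K (blinfun_apply Q y)) (blinfun_apply P x)"
        by (simp add: cinner_scaleR_left hP)
      moreover have "cmod (cinner (blinfun_apply K (blinfun_apply Q y)) (blinfun_apply P x))
          \<le> norm (blinfun_apply Q y) * norm (blinfun_apply P x)"
      proof (rule order_trans[OF norm_cinner_le mult_right_mono])
        show "norm (blinfun_apply K (blinfun_apply Q y)) \<le> norm (blinfun_apply Q y)"
          using norm_blinfun[of K "blinfun_apply Q y"] mult_right_mono[OF K(2), of "norm (blinfun_apply Q y)"] by simp
      qed simp
      ultimately have "- Re (cinner (blinfun_apply B y) x) \<le> 2 * (norm (blinfun_apply Q y) * norm (blinfun_apply P x))"
        using abs_Re_le_cmod[of "cinner (blinfun_apply K (blinfun_apply Q y)) (blinfun_apply P x)"]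
        by (simp only: Re_two_mult)
      also have "\<dots> \<le> (norm (blinfun_apply P x))\<^sup>2 + (norm (blinfun_apply Q y))\<^sup>2"
        using sum_squares_bound[of "norm (blinfun_apply Q y)" "norm (blinfun_apply P x)"] by simp
      finally show "0 \<le> Re (cinner (blinfun_apply G1 x + blinfun_apply B y) x) + Re (cinner (blinfun_apply G2 y) y)"
        by (simp add: nP nQ cinner_add_left)
    qed
  qed
qed

lemma col_op_apply [simp]: "blinfun_apply (col_op A B) x = (blinfun_apply A x, blinfun_apply B x)"
  by (simp add: col_op.rep_eq)

lemma row_op_apply [simp]: "blinfun_apply (row_op A B) x = blinfun_apply A (fst x) + blinfun_apply B (snd x)"
  by (simp add: row_op_def blinfun.add_left)

lemma block_op_apply_fst_snd [simp]: "blinfun_apply (block_op A B C D) x =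
    (blinfun_apply A (fst x) + blinfun_apply B (snd x), blinfun_apply C (fst x) + blinfun_apply D (snd x))"
  by (simp add: block_op_def)

lemma clinear_op_col [clin]: "clinear_op A \<Longrightarrow> clinear_op B \<Longrightarrow> clinear_op (col_op A B)"
  by (simp add: clinear_op_def scaleC_prod_def)

lemma clinear_op_row [clin]: "clinear_op A \<Longrightarrow> clinear_op B \<Longrightarrow> clinear_op (row_op A B)"
  by (simp add: clinear_op_def scaleC_prod_def scaleC_add_right)

lemma clinear_op_block [clin]:
  "clinear_op A \<Longrightarrow> clinear_op B \<Longrightarrow> clinear_op C \<Longrightarrow> clinear_op D \<Longrightarrow> clinear_op (block_op A B C D)"
  unfolding block_op_def by (intro clin)

lemma clinear_op_fst: "clinear_op fst_blinfun"
  by (simp add: clinear_op_def scaleC_prod_def)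

lemma op_unitary_norm:
  assumes "op_unitary U" shows "norm (blinfun_apply U x) = norm x"
proof -
  have "clinear_op U" using assms by (simp add: op_unitary_def)
  then have "cinner (blinfun_apply U x) (blinfun_apply U x) = cinner x (blinfun_apply (op_adj U o\<^sub>L U) x)"
    by (simp only: blinfun_apply_blinfun_compose cinner_adj_right)
  also have "\<dots> = cinner x x" using assms by (simp add: op_unitary_def)
  finally show ?thesis
    by (metis Re_cinner_self norm_ge_zero power2_eq_iff_nonneg)
qed

lemma defect_op_pos:
  assumes "clinear_op (K :: 'a::chilbert_space \<Rightarrow>\<^sub>L 'b::chilbert_space)" "norm K \<le> 1"
  shows "op_pos (id_blinfun - (op_adj K o\<^sub>L K))"
proof (rule op_posI)
  show "clinear_op (id_blinfun - (op_adj K o\<^sub>L K))" by (intro clin assms)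
  show "hermitian (id_blinfun - (op_adj K o\<^sub>L K))"
    by (simp add: hermitian_def blinfun.bilinear_simps cinner.diff_left cinner.diff_right cinner_adj_left
        cinner_adj_right assms)
  fix x
  have "norm (blinfun_apply K x) \<le> 1 * norm x"
    using norm_blinfun[of K x] mult_right_mono[OF assms(2) norm_ge_zero] order_trans by blast
  then have "(norm (blinfun_apply K x))\<^sup>2 \<le> (norm x)\<^sup>2" by simp
  then show "0 \<le> Re (cinner (blinfun_apply (id_blinfun - (op_adj K o\<^sub>L K)) x) x)"
    by (simp add: blinfun.bilinear_simps cinner.diff_left cinner_adj_left assms Re_cinner_self)
qed

lemma norm_op_adj_le:
  assumes "clinear_op K" shows "norm (op_adj K) \<le> norm K"
proof (rule norm_blinfun_bound)
  fix y
  show "norm (blinfun_apply (op_adj K) y) \<le> norm K * norm y"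
  proof (cases "blinfun_apply (op_adj K) y = 0")
    case False
    have "(norm (blinfun_apply (op_adj K) y))\<^sup>2
        = Re (cinner (blinfun_apply K (blinfun_apply (op_adj K) y)) y)"
      by (simp add: Re_cinner_self[symmetric] cinner_adj_right assms)
    also have "\<dots> \<le> norm (blinfun_apply K (blinfun_apply (op_adj K) y)) * norm y"
      using norm_cinner_le complex_Re_le_cmod order_trans by blast
    also have "\<dots> \<le> (norm K * norm (blinfun_apply (op_adj K) y)) * norm y"
      by (intro mult_right_mono norm_blinfun) simp
    finally show ?thesis using False by (simp add: power2_eq_square)
  qed simp
qed simp

lemma op_adj_adj:
  assumes "clinear_op K" shows "op_adj (op_adj K) = K"
  by (rule op_adj_eqI) (simp add: cinner_adj_left assms)

text \<open>Halmos' dilation: a contraction is the corner of the unitary built from it, its adjoint and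
  the two defect operators; that it is unitary rests on \<open>K (1 - K\<^sup>* K)\<^bsup>1/2\<^esup> = (1 - K K\<^sup>*)\<^bsup>1/2\<^esup> K\<close>.\<close>

lemma contraction_iff_unitary_corner:
  fixes P :: "'a::chilbert_space \<Rightarrow>\<^sub>L 'b::chilbert_space" and Q :: "'c::chilbert_space \<Rightarrow>\<^sub>L 'a"
  shows "(\<exists>K. op_contraction K \<and> M = P o\<^sub>L K o\<^sub>L Q) \<longleftrightarrow>
    (\<exists>U :: ('a \<times> 'a) \<Rightarrow>\<^sub>L ('a \<times> 'a). op_unitary U \<and> M = row_op P 0 o\<^sub>L U o\<^sub>L col_op Q 0)"
proof
  assume "\<exists>K. op_contraction K \<and> M = P o\<^sub>L K o\<^sub>L Q"
  then obtain K where K: "clinear_op K" "norm K \<le> 1" and M: "M = P o\<^sub>L K o\<^sub>L Q"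
    unfolding op_contraction_def by blast
  define K' D D' where "K' = op_adj K" and "D = op_sqrt (id_blinfun - (K' o\<^sub>L K))"
    and "D' = op_sqrt (id_blinfun - (K o\<^sub>L K'))"
  have K': "clinear_op K'" "norm K' \<le> 1" "op_adj K' = K"
    unfolding K'_def using K norm_op_adj_le[OF K(1)] op_adj_adj by (auto intro: clin)
  have pos: "op_pos (id_blinfun - (K' o\<^sub>L K))" "op_pos (id_blinfun - (K o\<^sub>L K'))"
    using defect_op_pos[OF K] defect_op_pos[OF K'(1,2)] unfolding K'(3) by (simp_all add: K'_def)
  have D: "op_pos D" "op_pos D'" unfolding D_def D'_def by (intro op_pos_op_sqrt pos)+
  have "D o\<^sub>L D = id_blinfun - (K' o\<^sub>L K)" "D' o\<^sub>L D' = id_blinfun - (K o\<^sub>L K')"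
    unfolding D_def D'_def using op_sqrt_square pos by blast+
  then have sq: "blinfun_apply D (blinfun_apply D x) = x - blinfun_apply K' (blinfun_apply K x)"
    "blinfun_apply D' (blinfun_apply D' x) = x - blinfun_apply K (blinfun_apply K' x)" for x
    by (metis blinfun.diff_left blinfun_apply_blinfun_compose blinfun_apply_id_blinfun)+
  have "K o\<^sub>L D = D' o\<^sub>L K"
    unfolding D_def D'_def
    by (rule op_sqrt_intertwine[OF pos]) (rule blinfun_eqI, simp add: blinfun.bilinear_simps)
  then have c1: "blinfun_apply K (blinfun_apply D x) = blinfun_apply D' (blinfun_apply K x)" for x
    by (metis blinfun_apply_blinfun_compose)
  have "K' o\<^sub>L D' = D o\<^sub>L K'"
    unfolding D_def D'_def
    by (rule op_sqrt_intertwine[OF pos(2,1)]) (rule blinfun_eqI, simp add: blinfun.bilinear_simps)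
  then have c2: "blinfun_apply K' (blinfun_apply D' x) = blinfun_apply D (blinfun_apply K' x)" for x
    by (metis blinfun_apply_blinfun_compose)
  note hD = hermitianD[OF op_pos_hermitian[OF D(1)]] and hD' = hermitianD[OF op_pos_hermitian[OF D(2)]]
  define U where "U = block_op K D' D (- K')"
  have Ua: "op_adj U = block_op K' D D' (- K)"
  proof (rule op_adj_eqI)
    show "cinner (blinfun_apply U x) y = cinner x (blinfun_apply (block_op K' D D' (- K)) y)" for x y
      using cinner_adj_right[OF K(1)] cinner_adj_left[OF K(1)]
      by (simp add: U_def cinner_prod_def cinner_add_left cinner_add_right hD hD' blinfun.minus_left
          cinner.minus_left cinner.minus_right cinner.diff_left cinner.diff_right K'_def algebra_simps)
  qed
  have "op_unitary U"
    unfolding op_unitary_def Ua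
  proof (intro conjI)
    show "clinear_op U" unfolding U_def by (intro clin K K' op_pos_clinear D)
    show "block_op K' D D' (- K) o\<^sub>L U = id_blinfun" "U o\<^sub>L block_op K' D D' (- K) = id_blinfun"
      by (rule blinfun_eqI, simp add: U_def blinfun.bilinear_simps sq c1 c2)+
  qed
  moreover have "M = row_op P 0 o\<^sub>L U o\<^sub>L col_op Q 0"
    unfolding M U_def by (rule blinfun_eqI) simp
  ultimately show "\<exists>U :: ('a \<times> 'a) \<Rightarrow>\<^sub>L ('a \<times> 'a). op_unitary U \<and> M = row_op P 0 o\<^sub>L U o\<^sub>L col_op Q 0" by blast
next
  assume "\<exists>U :: ('a \<times> 'a) \<Rightarrow>\<^sub>L ('a \<times> 'a). op_unitary U \<and> M = row_op P 0 o\<^sub>L U o\<^sub>L col_op Q 0"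
  then obtain U :: "('a \<times> 'a) \<Rightarrow>\<^sub>L ('a \<times> 'a)" where U: "op_unitary U" "M = row_op P 0 o\<^sub>L U o\<^sub>L col_op Q 0" by blast
  define K where "K = fst_blinfun o\<^sub>L U o\<^sub>L col_op id_blinfun 0"
  have "norm (blinfun_apply K x) \<le> 1 * norm x" for x
    using norm_fst_le[of "fst (blinfun_apply U (x, 0))" "snd (blinfun_apply U (x, 0))"] op_unitary_norm[OF U(1), of "(x, 0)"]
    by (simp add: K_def norm_Pair)
  then have "op_contraction K"
    unfolding op_contraction_def using U
    by (auto simp: K_def op_unitary_def intro!: clin clinear_op_fst norm_blinfun_bound)
  moreover have "M = P o\<^sub>L K o\<^sub>L Q" unfolding U(2) K_def by (rule blinfun_eqI) simp
  ultimately show "\<exists>K. op_contraction K \<and> M = P o\<^sub>L K o\<^sub>L Q" by blast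
qed

section \<open>The extremal kernels of an annulus\<close>

text \<open>The reflection \<open>z \<mapsto> q/z\<close> exchanges the two boundary circles, so control of \<open>Re h\<close> near the outer circle
  suffices. The bound \<open>- d\<close> holds near the circle, not on it, because \<open>h\<close> may have a pole there.\<close>

lemma reflected_annulus_min_principle:
  fixes h :: "complex \<Rightarrow> complex" and q :: real
  assumes q: "0 < q" "q < 1"
    and hol: "h holomorphic_on {z. q < cmod z \<and> cmod z < 1}"
    and sym: "\<And>z. q < cmod z \<Longrightarrow> cmod z < 1 \<Longrightarrow> h (of_real q / z) = h z"
    and lim: "\<And>d. d > 0 \<Longrightarrow> \<exists>\<rho><1. \<forall>z. \<rho> < cmod z \<and> cmod z < 1 \<longrightarrow> - d \<le> Re (h z)"
    and z: "q < cmod z" "cmod z < 1"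
  shows "0 \<le> Re (h z)"
proof -
  have "- Re (h z) \<le> d" if d: "d > 0" for d
  proof -
    obtain \<rho> where \<rho>: "\<rho> < 1" "\<And>w. \<rho> < cmod w \<Longrightarrow> cmod w < 1 \<Longrightarrow> - d \<le> Re (h w)"
      using lim[OF d] by blast
    have "q / cmod z < 1" using z q by (simp add: divide_simps)
    then obtain s where s: "max (max \<rho> (cmod z)) (q / cmod z) < s" "s < 1"
      using dense[of "max (max \<rho> (cmod z)) (q / cmod z)" 1] \<rho> z by auto
    have s0: "0 < s" "\<rho> < s" "cmod z < s" "q < s" using s q z by auto
    have z0: "0 < cmod z" using z q by linarith
    have "q / cmod z < s" using s by simp
    then have s1: "q / s < cmod z" by (simp only: pos_divide_less_eq[OF s0(1)] pos_divide_less_eq[OF z0] mult.commute)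
    have qs: "q < q / s" using s0 s q by (simp add: divide_simps)
    define S where "S = {w. q / s \<le> cmod w \<and> cmod w \<le> s}"
    have SA: "S \<subseteq> {z. q < cmod z \<and> cmod z < 1}" unfolding S_def using qs s by auto
    have clS: "closed S"
      unfolding S_def by (intro closed_Collect_conj closed_Collect_le continuous_intros)
    have int: "{w. q / s < cmod w \<and> cmod w < s} \<subseteq> interior S"
      unfolding S_def
      by (intro interior_maximal open_Collect_conj open_Collect_less continuous_intros) auto
    have fr: "frontier S \<subseteq> {w. cmod w = s \<or> cmod w = q / s}"
    proof
      fix w assume "w \<in> frontier S"
      then have "w \<in> S" "w \<notin> interior S" unfolding frontier_def closure_closed[OF clS] by auto
      then have "q / s \<le> cmod w" "cmod w \<le> s" "\<not> (q / s < cmod w \<and> cmod w < s)"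
        using int by (auto simp: S_def)
      then show "w \<in> {w. cmod w = s \<or> cmod w = q / s}" by force
    qed
    have "Re (- h z) \<le> d"
    proof (rule maximum_real_frontier[of "\<lambda>w. - h w" S])
      show "(\<lambda>w. - h w) holomorphic_on interior S"
        using SA interior_subset by (intro holomorphic_intros holomorphic_on_subset[OF hol]) blast
      show "continuous_on (closure S) (\<lambda>w. - h w)"
        unfolding closure_closed[OF clS]
        by (intro continuous_intros holomorphic_on_imp_continuous_on holomorphic_on_subset[OF hol] SA)
      show "bounded S" unfolding S_def by (rule boundedI[of _ s]) auto
      show "z \<in> S" unfolding S_def using s0 s1 by simp
      show "Re (- h w) \<le> d" if wf: "w \<in> frontier S" for w
      proof -
        consider "cmod w = s" | "cmod w = q / s" using fr wf by blast
        then have "- d \<le> Re (h w)"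
        proof cases
          case 1 then show ?thesis using \<rho>(2) s0 s by simp
        next
          case 2
          then have "cmod (of_real q / w) = s" using q s0 by (simp add: norm_divide)
          moreover have "h (of_real q / w) = h w"
            using 2 qs s1 z by (intro sym) auto
          ultimately show ?thesis using \<rho>(2)[of "of_real q / w"] s0 s by simp
        qed
        then show ?thesis by simp
      qed
    qed
    then show ?thesis by simp
  qed
  then show ?thesis using field_le_epsilon[of "- Re (h z)" 0] by simp
qed

lemma Re_small_near_circle:
  fixes G :: "complex \<Rightarrow> complex"
  assumes \<rho>0: "\<rho>0 < 1" and cont: "continuous_on {w. \<rho>0 \<le> cmod w \<and> cmod w \<le> 1} G"
    and zero: "\<And>w. cmod w = 1 \<Longrightarrow> Re (G w) = 0" and d: "d > 0"
  shows "\<exists>\<rho><1. \<forall>z. \<rho> < cmod z \<and> cmod z < 1 \<longrightarrow> \<bar>Re (G z)\<bar> \<le> d"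
proof -
  let ?K = "{w. \<rho>0 \<le> cmod w \<and> cmod w \<le> 1}"
  have "closed ?K" by (intro closed_Collect_conj closed_Collect_le continuous_intros)
  moreover have "bounded ?K" by (rule boundedI[of _ 1]) auto
  ultimately have "uniformly_continuous_on ?K G"
    using cont compact_uniformly_continuous compact_eq_bounded_closed by blast
  then obtain \<delta> where \<delta>: "\<delta> > 0" "\<And>x y. x \<in> ?K \<Longrightarrow> y \<in> ?K \<Longrightarrow> dist y x < \<delta> \<Longrightarrow> dist (G y) (G x) < d"
    using uniformly_continuous_onE[OF _ d] by blast
  define \<rho> where "\<rho> = max (max \<rho>0 0) (1 - \<delta>)"
  have "\<bar>Re (G z)\<bar> \<le> d" if z: "\<rho> < cmod z" "cmod z < 1" for z
  proof -
    have z0: "cmod z > 0" "\<rho>0 \<le> cmod z" "1 - cmod z < \<delta>" using z unfolding \<rho>_def by auto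
    have "sgn z - z = (1 - cmod z) *\<^sub>R sgn z"
      using z0 by (simp add: sgn_div_norm algebra_simps)
    then have "dist (sgn z) z = 1 - cmod z"
      using z0 z by (simp add: dist_norm norm_sgn)
    then have "dist (G (sgn z)) (G z) < d"
      using z0 z \<rho>0 by (intro \<delta>(2)) (auto simp: norm_sgn)
    moreover have "Re (G (sgn z)) = 0" using z0 by (intro zero) (auto simp: norm_sgn)
    ultimately show ?thesis
      using abs_Re_le_cmod[of "G (sgn z) - G z"] by (simp add: dist_norm)
  qed
  moreover have "\<rho> < 1" unfolding \<rho>_def using \<rho>0 \<delta>(1) by simp
  ultimately show ?thesis by blast
qed

lemma Re_cayley: "Re ((a + z) / (a - z)) = ((cmod a)\<^sup>2 - (cmod z)\<^sup>2) / (cmod (a - z))\<^sup>2"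
proof -
  have "Re ((a + z) / (a - z)) = Re ((a + z) * cnj (a - z)) / (cmod (a - z))\<^sup>2"
    by (subst complex_div_cnj) simp
  also have "Re ((a + z) * cnj (a - z)) = (cmod a)\<^sup>2 - (cmod z)\<^sup>2"
    unfolding cmod_power2 by (simp add: power2_eq_square algebra_simps)
  finally show ?thesis .
qed

lemma Re_cayley_nonneg: "cmod z \<le> cmod a \<Longrightarrow> 0 \<le> Re ((a + z) / (a - z))"
  unfolding Re_cayley by (intro divide_nonneg_nonneg) (simp_all add: power_mono)

text \<open>The coefficients are real, so the series commutes with conjugation; on the unit circle its values at
  \<open>z\<close> and \<open>1/z\<close> are conjugate, and their difference is imaginary.\<close>

definition real_pseries :: "(nat \<Rightarrow> real) \<Rightarrow> complex \<Rightarrow> complex" where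
  "real_pseries \<mu> z = (\<Sum>n. of_real (\<mu> n) * z ^ n)"

lemma real_pseries_sums:
  assumes bd: "\<And>n. \<bar>\<mu> n\<bar> \<le> C * q ^ n" and q: "0 < q" "cmod z < 1 / q"
  shows "(\<lambda>n. of_real (\<mu> n) * z ^ n) sums real_pseries \<mu> z"
proof -
  have qz: "q * cmod z < 1" using q by (simp add: field_simps)
  have le: "norm (of_real (\<mu> n) * z ^ n) \<le> C * (q * cmod z) ^ n" for n
    using mult_right_mono[OF bd[of n], of "cmod z ^ n"]
    by (simp add: norm_mult norm_power power_mult_distrib mult.assoc)
  have "summable (\<lambda>n. C * (q * cmod z) ^ n)"
    using qz q by (intro summable_mult summable_geometric) (simp add: abs_mult)
  then have "summable (\<lambda>n. of_real (\<mu> n) * z ^ n)"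
    by (rule summable_comparison_test'[of _ 0]) (rule le)
  then show ?thesis unfolding real_pseries_def by (rule summable_sums)
qed

lemma real_pseries_holomorphic:
  assumes "\<And>n. \<bar>\<mu> n\<bar> \<le> C * q ^ n" and "0 < q"
  shows "real_pseries \<mu> holomorphic_on ball 0 (1 / q)"
  using real_pseries_sums[OF assms] by (intro power_series_holomorphic[of 0 _ "\<lambda>n. of_real (\<mu> n)"]) auto

lemma real_pseries_cnj:
  assumes "\<And>n. \<bar>\<mu> n\<bar> \<le> C * q ^ n" and "0 < q" "cmod z < 1 / q"
  shows "real_pseries \<mu> (cnj z) = cnj (real_pseries \<mu> z)"
proof -
  have "(\<lambda>n. cnj (of_real (\<mu> n) * z ^ n)) sums cnj (real_pseries \<mu> z)"
    using real_pseries_sums[OF assms] by (simp only: sums_cnj)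
  moreover have "(\<lambda>n. of_real (\<mu> n) * cnj z ^ n) sums real_pseries \<mu> (cnj z)"
    using assms by (intro real_pseries_sums) auto
  ultimately show ?thesis by (simp add: sums_iff)
qed

definition lam :: "real \<Rightarrow> nat \<Rightarrow> real" where "lam q n = 2 * q ^ (2 * n) / (1 - q ^ (2 * n))"
definition mu :: "real \<Rightarrow> nat \<Rightarrow> real" where "mu q n = 2 * q ^ n / (1 - q ^ (2 * n))"

lemma mu_lam_bound:
  assumes q: "0 < q" "q < 1"
  shows "\<bar>mu q n\<bar> \<le> 2 / (1 - q) * q ^ n" and "\<bar>lam q n\<bar> \<le> 2 / (1 - q) * q ^ n"
proof -
  have *: "\<bar>mu q n\<bar> \<le> 2 / (1 - q) * q ^ n"
  proof (cases "n = 0")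
    case False
    have "q ^ (2 * n) \<le> q ^ 1" using q False by (intro power_decreasing) auto
    then have "1 - q \<le> 1 - q ^ (2 * n)" by simp
    then have "2 * q ^ n / (1 - q ^ (2 * n)) \<le> 2 * q ^ n / (1 - q)"
      using q by (intro divide_left_mono mult_pos_pos) auto
    moreover have "0 \<le> mu q n" unfolding mu_def using q by (simp add: power_le_one)
    ultimately show ?thesis unfolding mu_def by (simp only: abs_of_nonneg) simp
  qed (use q in \<open>simp add: mu_def\<close>)
  have "lam q n = q ^ n * mu q n" unfolding lam_def mu_def mult_2 power_add by simp
  then have "\<bar>lam q n\<bar> = q ^ n * \<bar>mu q n\<bar>" using q by (simp add: abs_mult)
  also have "\<dots> \<le> 1 * \<bar>mu q n\<bar>"
    using q by (intro mult_right_mono) (simp_all add: power_le_one)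
  finally have "\<bar>lam q n\<bar> \<le> \<bar>mu q n\<bar>" by simp
  with * show "\<bar>mu q n\<bar> \<le> 2 / (1 - q) * q ^ n" "\<bar>lam q n\<bar> \<le> 2 / (1 - q) * q ^ n" by auto
qed

text \<open>Added to the kernel \<open>(a + z) / (a - z)\<close> of the disc, the first pair of series makes the real part constant on
  the inner circle, and the second pair adds the pole \<open>q b\<close> there. Neither changes the real part on the
  outer circle. The correction is regular on \<open>q < |z| < 1/q\<close>, in particular across the outer circle.\<close>

definition kern_reg :: "real \<Rightarrow> complex \<Rightarrow> complex \<Rightarrow> complex \<Rightarrow> complex" where
  "kern_reg q a b z = (real_pseries (lam q) (z / a) - real_pseries (lam q) (a / z))
    - (real_pseries (mu q) (z / b) - real_pseries (mu q) (b / z))"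

definition kern :: "real \<Rightarrow> complex \<Rightarrow> complex \<Rightarrow> complex \<Rightarrow> complex" where
  "kern q a b z = (a + z) / (a - z) + kern_reg q a b z"

lemma kern_reg_holomorphic:
  assumes q: "0 < q" "q < 1" and ab: "cmod a = 1" "cmod b = 1"
  shows "kern_reg q a b holomorphic_on {z. q < cmod z \<and> cmod z < 1 / q}"
proof -
  have "(\<lambda>z. real_pseries \<mu> (g z)) holomorphic_on {z. q < cmod z \<and> cmod z < 1 / q}"
    if "\<mu> = lam q \<or> \<mu> = mu q" "g holomorphic_on {z. q < cmod z \<and> cmod z < 1 / q}"
      "\<And>z. q < cmod z \<Longrightarrow> cmod z < 1 / q \<Longrightarrow> cmod (g z) < 1 / q" for \<mu> g
  proof -
    have "real_pseries \<mu> holomorphic_on ball 0 (1 / q)"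
      using that(1) mu_lam_bound[OF q] real_pseries_holomorphic[OF _ q(1)] by blast
    then have "(real_pseries \<mu> \<circ> g) holomorphic_on {z. q < cmod z \<and> cmod z < 1 / q}"
      by (rule holomorphic_on_compose_gen[OF that(2)]) (use that(3) in auto)
    then show ?thesis by (simp add: o_def)
  qed note * = this
  have inv: "cmod (1 / z) < 1 / q" if "q < cmod z" for z
    using that q by (auto simp: norm_divide divide_simps)
  have nz: "z \<noteq> 0" "a \<noteq> 0" "b \<noteq> 0" if "q < cmod z" for z using that q ab by auto
  show ?thesis
    unfolding kern_reg_def
    by (intro holomorphic_intros *) (use ab q nz inv in \<open>auto simp: norm_divide\<close>)
qed

lemma Re_kern_reg_circle:
  assumes q: "0 < q" "q < 1" and ab: "cmod a = 1" "cmod b = 1" and z: "cmod z = 1"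
  shows "Re (kern_reg q a b z) = 0"
proof -
  have "Re (real_pseries \<mu> (z / c) - real_pseries \<mu> (c / z)) = 0"
    if "\<mu> = lam q \<or> \<mu> = mu q" "cmod c = 1" for \<mu> c
  proof -
    have "(z / c) * cnj (z / c) = 1"
      using that z complex_norm_square[of "z / c"] by (simp only: norm_divide) simp
    then have "c / z = cnj (z / c)" using inverse_unique[of "z / c" "cnj (z / c)"] by simp
    moreover have "real_pseries \<mu> (cnj (z / c)) = cnj (real_pseries \<mu> (z / c))"
      using that mu_lam_bound[OF q] z q
      by (intro real_pseries_cnj[of _ "2 / (1 - q)" q]) (auto simp: norm_divide)
    ultimately show ?thesis by simp
  qed
  then show ?thesis unfolding kern_reg_def using ab by simp
qed

lemma sum_symmetric_int:
  fixes f :: "int \<Rightarrow> 'a::comm_monoid_add"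
  shows "(\<Sum>k\<in>{- int N..int N}. f k) = (\<Sum>n\<le>N. if n = 0 then f 0 else f (int n) + f (- int n))"
proof (induction N)
  case (Suc N)
  have "{- int (Suc N)..int (Suc N)} = insert (int (Suc N)) (insert (- int (Suc N)) {- int N..int N})"
    by auto
  then show ?case using Suc by (simp add: add.assoc add.commute add.left_commute)
qed simp

lemma power_int_neq_1:
  fixes q :: real
  assumes "0 < q" "q < 1" "k \<noteq> 0"
  shows "q powi k \<noteq> 1"
proof -
  obtain n where n: "k = int n \<or> k = - int n" "n \<noteq> 0" using assms(3) by (cases k rule: int_cases2) auto
  moreover have "q ^ n < 1" using assms n by (simp add: power_less_one_iff)
  ultimately show ?thesis by (auto simp: power_int_minus)
qed

text \<open>The Laurent coefficients of \<open>kern\<close>. They are determined by the boundary values: on the outer circle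
  \<open>kcoef k + cnj (kcoef (- k)) = 2 a\<^sup>-\<^sup>k\<close> and on the inner circle
  \<open>q\<^sup>k kcoef k + q\<^sup>-\<^sup>k cnj (kcoef (- k)) = 2 b\<^sup>-\<^sup>k\<close>, for \<open>k \<noteq> 0\<close>.\<close>

definition kcoef :: "real \<Rightarrow> complex \<Rightarrow> complex \<Rightarrow> int \<Rightarrow> complex" where
  "kcoef q a b k = (if k = 0 then 1 else
     2 * (a powi (- k) - of_real (q powi k) * b powi (- k)) / of_real (1 - q powi (2 * k)))"

lemma kcoef_pair:
  assumes q: "0 < q" "q < 1" and nz: "a \<noteq> 0" "b \<noteq> 0" "z \<noteq> 0" and n: "n \<noteq> 0"
  shows "kcoef q a b (int n) * z powi int n + kcoef q a b (- int n) * z powi (- int n)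
    = 2 * (z / a) ^ n + (of_real (lam q n) * (z / a) ^ n - of_real (lam q n) * (a / z) ^ n)
      - (of_real (mu q n) * (z / b) ^ n - of_real (mu q n) * (b / z) ^ n)"
proof -
  define Q where "Q = q ^ n"
  have Q: "0 < Q" "Q < 1" unfolding Q_def using q n by (simp_all add: power_less_one_iff)
  have Q2: "Q * Q < 1" using mult_strict_mono[of Q 1 Q 1] Q by simp
  have "(1::complex) - of_real Q * of_real Q = of_real (1 - Q * Q)" by simp
  moreover have "(of_real (1 - Q * Q) :: complex) \<noteq> 0" using Q2 by (simp only: of_real_eq_0_iff)
  ultimately have ne: "(1::complex) - of_real Q * of_real Q \<noteq> 0" "(of_real Q :: complex) \<noteq> 0"
    using Q(1) by auto
  have pa: "q ^ (2 * n) = Q * Q" unfolding Q_def mult_2 power_add ..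
  have pb: "q powi int n = Q" unfolding Q_def by (rule power_int_of_nat)
  have "2 * int n = int (2 * n)" by simp
  then have pc: "q powi (2 * int n) = Q * Q" by (simp only: power_int_of_nat pa)
  have pd: "q powi (- int n) = 1 / Q" by (simp only: power_int_minus pb inverse_eq_divide)
  have "2 * - int n = - (2 * int n)" by simp
  then have pe: "q powi (2 * - int n) = 1 / (Q * Q)" by (simp only: power_int_minus pc inverse_eq_divide)
  note p2 = pa pb pc pd pe
  have l: "lam q n = 2 * (Q * Q) / (1 - Q * Q)" "mu q n = 2 * Q / (1 - Q * Q)"
    unfolding lam_def mu_def p2 Q_def by simp_all
  define A B Z where "A = a ^ n" and "B = b ^ n" and "Z = z ^ n"
  have nz': "A \<noteq> 0" "B \<noteq> 0" "Z \<noteq> 0" unfolding A_def B_def Z_def using nz by auto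
  have k1: "kcoef q a b (int n) = 2 * (1 / A - of_real Q / B) / (1 - of_real Q * of_real Q)"
    unfolding kcoef_def p2 A_def B_def using n by (simp add: power_int_minus divide_inverse)
  have k2: "kcoef q a b (- int n) = 2 * (A - 1 / of_real Q * B) / (1 - 1 / (of_real Q * of_real Q))"
    unfolding kcoef_def p2 A_def B_def using n by (simp add: power_int_minus divide_inverse)
  have k3: "kcoef q a b (- int n) = 2 * (of_real Q * B - of_real Q * of_real Q * A) / (1 - of_real Q * of_real Q)"
  proof -
    have "(1 :: complex) - 1 / (of_real Q * of_real Q) = - (1 - of_real Q * of_real Q) / (of_real Q * of_real Q)"
      using ne by (simp add: field_simps)
    then show ?thesis unfolding k2 using ne by (simp add: divide_simps) (simp add: algebra_simps)
  qed
  show ?thesis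
    unfolding k1 k3 l power_divide power_int_minus power_int_of_nat A_def[symmetric] B_def[symmetric] Z_def[symmetric]
    using ne nz' by (simp add: divide_simps) (simp add: algebra_simps)
qed

lemma kern_laurent:
  assumes q: "0 < q" "q < 1" and ab: "cmod a = 1" "cmod b = 1" and z: "q < cmod z" "cmod z < 1"
  shows "(\<lambda>N. \<Sum>k\<in>{- int N..int N}. kcoef q a b k * z powi k) \<longlonglongrightarrow> kern q a b z"
proof -
  have nz: "a \<noteq> 0" "b \<noteq> 0" "z \<noteq> 0" using ab z q by auto
  have "1 < 1 / q" using q by simp
  then have "cmod z < 1 / q" using z(2) by (rule less_trans[rotated])
  then have b1: "cmod (z / c) < 1 / q" and b2: "cmod (c / z) < 1 / q" if "cmod c = 1" for c
    using that z q by (simp_all add: norm_divide frac_less2)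
  have s: "(\<lambda>n. of_real (\<mu> n) * w ^ n) sums real_pseries \<mu> w" if "\<mu> = lam q \<or> \<mu> = mu q" "cmod w < 1 / q" for \<mu> w
    using that mu_lam_bound[OF q] q by (intro real_pseries_sums[of _ "2 / (1 - q)" q]) auto
  have "(\<lambda>n. (z / a) ^ n) sums (1 / (1 - z / a))"
    using z ab by (intro geometric_sums) (simp add: norm_divide)
  from sums_mult[OF this, of 2] have "(\<lambda>n. 2 * (z / a) ^ n) sums (2 / (1 - z / a))" by simp
  from sums_diff[OF this sums_single[of 0 "\<lambda>_. 1"]]
  have "(\<lambda>n. 2 * (z / a) ^ n - (if n = 0 then 1 else 0)) sums (2 / (1 - z / a) - 1)" by simp
  moreover have "2 / (1 - z / a) - 1 = (a + z) / (a - z)"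
  proof -
    have "a - z \<noteq> 0" using z ab by auto
    then show ?thesis using nz by (simp add: divide_simps)
  qed
  ultimately have g: "(\<lambda>n. 2 * (z / a) ^ n - (if n = 0 then 1 else 0)) sums ((a + z) / (a - z))" by simp
  have "(\<lambda>n. (2 * (z / a) ^ n - (if n = 0 then 1 else 0))
      + ((of_real (lam q n) * (z / a) ^ n - of_real (lam q n) * (a / z) ^ n)
      - (of_real (mu q n) * (z / b) ^ n - of_real (mu q n) * (b / z) ^ n))) sums kern q a b z"
    unfolding kern_def kern_reg_def
    by (intro sums_add sums_diff s g b1 b2 ab) auto
  also have "(\<lambda>n. (2 * (z / a) ^ n - (if n = 0 then 1 else 0))
      + ((of_real (lam q n) * (z / a) ^ n - of_real (lam q n) * (a / z) ^ n)
      - (of_real (mu q n) * (z / b) ^ n - of_real (mu q n) * (b / z) ^ n)))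
    = (\<lambda>n. if n = 0 then kcoef q a b 0 * z powi 0 else
        kcoef q a b (int n) * z powi (int n) + kcoef q a b (- int n) * z powi (- int n))"
  proof
    fix n
    show "(2 * (z / a) ^ n - (if n = 0 then 1 else 0))
      + ((of_real (lam q n) * (z / a) ^ n - of_real (lam q n) * (a / z) ^ n)
      - (of_real (mu q n) * (z / b) ^ n - of_real (mu q n) * (b / z) ^ n))
      = (if n = 0 then kcoef q a b 0 * z powi 0 else
        kcoef q a b (int n) * z powi (int n) + kcoef q a b (- int n) * z powi (- int n))"
      using kcoef_pair[OF q nz, of n] by (cases "n = 0") (simp_all add: kcoef_def lam_def mu_def)
  qed
  finally show ?thesis unfolding sums_def_le sum_symmetric_int .
qed

text \<open>For \<open>a b = 1\<close>, the substitution \<open>z \<mapsto> q/z\<close> exchanges the terms of index \<open>k\<close> and \<open>- k\<close> of the Laurent series.\<close>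

lemma kern_reflect:
  assumes q: "0 < q" "q < 1" and c: "cmod c = 1" and z: "q < cmod z" "cmod z < 1"
  shows "kern q c (1 / c) (of_real q / z) = kern q c (1 / c) z"
proof -
  let ?c = "kcoef q c (1 / c)"
  have nz: "c \<noteq> 0" "z \<noteq> 0" "q \<noteq> 0" using c z q by auto
  have z': "q < cmod (of_real q / z)" "cmod (of_real q / z) < 1"
    using z q mult_strict_left_mono[OF z(2) q(1)] less_trans[OF q(1) z(1)]
    by (simp_all add: norm_divide pos_less_divide_eq pos_divide_less_eq)
  have refl: "?c (- k) * (of_real q / z) powi (- k) = ?c k * z powi k" for k
  proof (cases "k = 0")
    case False
    define Q A where "Q = q powi k" and "A = c powi k"
    have Q: "Q \<noteq> 0" "A \<noteq> 0" using nz by (auto simp: Q_def A_def)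
    have e1: "q powi (2 * k) = Q * Q" unfolding Q_def mult_2 by (rule power_int_add) (use nz in simp)
    have e2: "q powi (2 * (- k)) = 1 / (Q * Q)"
    proof -
      have "2 * (- k) = - (2 * k)" by simp
      then show ?thesis by (simp only: power_int_minus \<open>q powi (2 * k) = Q * Q\<close> inverse_eq_divide)
    qed
    have e3: "Q * Q \<noteq> 1" using power_int_neq_1[OF q, of "2 * k"] False unfolding e1 by simp
    have e4: "(of_real q / z) powi (- k) = z powi k / of_real Q"
      unfolding Q_def by (simp add: power_int_minus power_int_divide_distrib)
    have e5: "(1 / c) powi k = 1 / A" "c powi (- k) = 1 / A" "(1 / c) powi (- k) = A" "q powi (- k) = 1 / Q"
      unfolding A_def Q_def by (simp_all add: power_int_minus power_int_divide_distrib inverse_eq_divide)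
    have W: "(of_real Q :: complex) \<noteq> 0" "1 - of_real Q * of_real Q \<noteq> (0 :: complex)"
      using Q e3 by (simp, metis eq_iff_diff_eq_0 of_real_1 of_real_eq_iff of_real_mult)
    have "?c (- k) = 2 * (A - 1 / of_real Q * (1 / A)) / (1 - 1 / (of_real Q * of_real Q))"
      unfolding kcoef_def e2 e5 minus_minus A_def[symmetric] using False by simp
    also have "(1 :: complex) - 1 / (of_real Q * of_real Q) = - (1 - of_real Q * of_real Q) / (of_real Q * of_real Q)"
      using W by (simp add: field_simps)
    finally have k1: "?c (- k) = 2 * (A - 1 / of_real Q * (1 / A)) / (- (1 - of_real Q * of_real Q) / (of_real Q * of_real Q))" .
    have k2: "?c k = 2 * (1 / A - of_real Q * A) / (1 - of_real Q * of_real Q)"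
      unfolding kcoef_def e1 e5 Q_def[symmetric] using False by simp
    show ?thesis
      unfolding k1 k2 e4 using W Q by (simp add: divide_simps) (simp add: algebra_simps)
  qed (simp add: kcoef_def)
  have "(\<Sum>k\<in>{- int N..int N}. ?c k * (of_real q / z) powi k) = (\<Sum>k\<in>{- int N..int N}. ?c k * z powi k)" for N
    by (rule sum.reindex_bij_witness[of _ uminus uminus]) (use refl[of "- _"] in auto)
  moreover have "(\<lambda>N. \<Sum>k\<in>{- int N..int N}. ?c k * (of_real q / z) powi k) \<longlonglongrightarrow> kern q c (1 / c) (of_real q / z)"
    by (rule kern_laurent[OF q _ _ z']) (use c in \<open>auto simp: norm_divide\<close>)
  moreover have "(\<lambda>N. \<Sum>k\<in>{- int N..int N}. ?c k * z powi k) \<longlonglongrightarrow> kern q c (1 / c) z"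
    by (rule kern_laurent[OF q _ _ z]) (use c in \<open>auto simp: norm_divide\<close>)
  ultimately show ?thesis using LIMSEQ_unique by simp
qed

lemma annulus_subset_larger: "0 < q \<Longrightarrow> q < 1 \<Longrightarrow> {z. q < cmod z \<and> cmod z < 1} \<subseteq> {z. q < cmod z \<and> cmod z < 1 / q}"
proof -
  assume q: "0 < q" "q < 1"
  then have "1 < 1 / q" by simp
  then show ?thesis by (auto intro: less_trans)
qed

lemma collar_subset_larger:
  assumes "0 < q" "q < 1"
  shows "{w. (q + 1) / 2 \<le> cmod w \<and> cmod w \<le> 1} \<subseteq> {z. q < cmod z \<and> cmod z < 1 / q}"
proof -
  have "1 < 1 / q" "q < (q + 1) / 2" using assms by simp_all
  then show ?thesis by (auto intro: less_le_trans le_less_trans)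
qed

lemma kern_holomorphic:
  assumes q: "0 < q" "q < 1" and ab: "cmod a = 1" "cmod b = 1"
  shows "kern q a b holomorphic_on {z. q < cmod z \<and> cmod z < 1}"
proof -
  have "kern_reg q a b holomorphic_on {z. q < cmod z \<and> cmod z < 1}"
    by (rule holomorphic_on_subset[OF kern_reg_holomorphic[OF q ab] annulus_subset_larger[OF q]])
  then show ?thesis
    unfolding kern_def using ab by (intro holomorphic_intros) auto
qed

text \<open>Near the outer circle the kernel is \<open>(c + z) / (c - z)\<close>, whose real part is positive, plus a function
  whose real part tends to zero.\<close>

lemma Re_kern_nonneg:
  assumes q: "0 < q" "q < 1" and c: "cmod c = 1" and z: "q < cmod z" "cmod z < 1"
  shows "0 \<le> Re (kern q c (1 / c) z)"
proof (rule reflected_annulus_min_principle[OF q _ _ _ z])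
  have c': "cmod (1 / c) = 1" using c by (simp add: norm_divide)
  show "kern q c (1 / c) holomorphic_on {z. q < cmod z \<and> cmod z < 1}"
    by (rule kern_holomorphic[OF q c c'])
  show "kern q c (1 / c) (of_real q / z) = kern q c (1 / c) z" if "q < cmod z" "cmod z < 1" for z
    by (rule kern_reflect[OF q c that])
  fix d :: real assume d: "d > 0"
  have "continuous_on {w. (q + 1) / 2 \<le> cmod w \<and> cmod w \<le> 1} (kern_reg q c (1 / c))"
    by (rule continuous_on_subset[OF holomorphic_on_imp_continuous_on[OF kern_reg_holomorphic[OF q c c']]
          collar_subset_larger[OF q]])
  from Re_small_near_circle[OF _ this Re_kern_reg_circle[OF q c c'] d]
  obtain \<rho> where \<rho>: "\<rho> < 1" "\<And>z. \<rho> < cmod z \<Longrightarrow> cmod z < 1 \<Longrightarrow> \<bar>Re (kern_reg q c (1 / c) z)\<bar> \<le> d"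
    using q by auto
  have "- d \<le> Re (kern q c (1 / c) z)" if "\<rho> < cmod z" "cmod z < 1" for z
    using \<rho>(2)[OF that] Re_cayley_nonneg[of z c] c that by (simp add: kern_def)
  then show "\<exists>\<rho><1. \<forall>z. \<rho> < cmod z \<and> cmod z < 1 \<longrightarrow> - d \<le> Re (kern q c (1 / c) z)"
    using \<rho>(1) by blast
qed

text \<open>Towards the pole, the real part of \<open>(c + z) / (c - z)\<close> exceeds any bound on the correction. This rules out
  imaginary constants.\<close>

lemma Re_kern_pos_somewhere:
  assumes q: "0 < q" "q < 1" and c: "cmod c = 1"
  shows "\<exists>z. q < cmod z \<and> cmod z < 1 \<and> 0 < Re (kern q c (1 / c) z)"
proof -
  have c': "cmod (1 / c) = 1" using c by (simp add: norm_divide)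
  have "continuous_on {w. (q + 1) / 2 \<le> cmod w \<and> cmod w \<le> 1} (kern_reg q c (1 / c))"
    by (rule continuous_on_subset[OF holomorphic_on_imp_continuous_on[OF kern_reg_holomorphic[OF q c c']]
          collar_subset_larger[OF q]])
  from Re_small_near_circle[OF _ this Re_kern_reg_circle[OF q c c'], of 1]
  obtain \<rho> where \<rho>: "\<rho> < 1" "\<And>z. \<rho> < cmod z \<Longrightarrow> cmod z < 1 \<Longrightarrow> \<bar>Re (kern_reg q c (1 / c) z)\<bar> \<le> 1"
    using q by auto
  define t where "t = (max (max \<rho> q) (1/2) + 1) / 2"
  have t: "\<rho> < t" "q < t" "1/2 < t" "t < 1" using \<rho>(1) q unfolding t_def by auto
  have ct: "cmod (of_real t * c) = t" using c t by (simp add: norm_mult)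
  have "c \<noteq> 0" using c by auto
  have "(c + of_real t * c) / (c - of_real t * c) = (c * of_real (1 + t)) / (c * of_real (1 - t))"
    by (simp add: algebra_simps)
  also have "\<dots> = of_real ((1 + t) / (1 - t))" using \<open>c \<noteq> 0\<close> by simp
  finally have eq: "Re ((c + of_real t * c) / (c - of_real t * c)) = (1 + t) / (1 - t)" by simp
  have "(1 + t) / (1 - t) > 1" using t by (simp add: field_simps)
  moreover have "Re (kern q c (1 / c) (of_real t * c)) = (1 + t) / (1 - t) + Re (kern_reg q c (1 / c) (of_real t * c))"
    by (simp only: kern_def plus_complex.sel eq)
  moreover have "\<bar>Re (kern_reg q c (1 / c) (of_real t * c))\<bar> \<le> 1"
    using \<rho>(2)[of "of_real t * c"] t unfolding ct by blast
  ultimately have "0 < Re (kern q c (1 / c) (of_real t * c))" by linarith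
  then show ?thesis using t ct by (intro exI[of _ "of_real t * c"]) auto
qed

section \<open>Kernels with the same product of poles\<close>

text \<open>For extending identities by continuity to the finitely many poles on the circle.\<close>

lemma exists_limit_on_circle:
  assumes "cmod z0 = 1" "finite A"
  obtains f :: "nat \<Rightarrow> complex" where "f \<longlonglongrightarrow> z0" "\<And>n. cmod (f n) = 1" "\<And>n. f n \<notin> A"
proof -
  have "connected (sphere (0::complex) 1)" by (intro connected_sphere) simp
  moreover have "z0 \<in> sphere 0 1" using assms(1) by simp
  moreover have "\<not> (\<exists>x. sphere (0::complex) 1 = {x})"
  proof
    assume "\<exists>x. sphere (0::complex) 1 = {x}"
    then obtain x where "sphere (0::complex) 1 = {x}" by blast
    moreover have "(1::complex) \<in> sphere 0 1" "(-1::complex) \<in> sphere 0 1" by simp_all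
    ultimately have "(1::complex) = -1" by (metis singletonD)
    then show False by simp
  qed
  ultimately have "z0 islimpt sphere 0 1" using connected_imp_perfect by blast
  then have "z0 islimpt (sphere 0 1 - A)"
    using islimpt_Un_finite[OF assms(2), of z0 "sphere 0 1 - A"]
      islimpt_subset[of z0 "sphere 0 1" "A \<union> (sphere 0 1 - A)"] by blast
  then obtain f where "\<forall>n. f n \<in> (sphere 0 1 - A) - {z0}" "f \<longlonglongrightarrow> z0"
    unfolding islimpt_sequential by blast
  then show thesis by (intro that[of f]) auto
qed

text \<open>A kernel with \<open>a b = 1\<close> is invariant under \<open>z \<mapsto> q/z\<close> and maps the quotient of the annulus conformally onto
  the right half plane, so two such kernels differ by a Moebius map of the half plane. The proof avoids
  conformal maps. The number \<open>\<i> y\<close> is the value of the first kernel at the pole \<open>c\<close> of the second, and \<open>\<i> D\<close>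
  that of the second at the pole 1 of the first. In the product \<open>P\<close> the poles cancel, and \<open>P\<close> is real on the
  outer circle, as a product of two imaginary numbers. By the minimum principle for \<open>\<plusminus> \<i> P\<close> it is real in
  the annulus, hence constant.\<close>

lemma kern_moebius:
  assumes q: "0 < q" "q < 1" and c: "cmod c = 1" "c \<noteq> 1"
  obtains y D C :: real where "C > 0"
    "\<And>z. q < cmod z \<Longrightarrow> cmod z < 1 \<Longrightarrow>
      (kern q 1 1 z - \<i> * of_real y) * (kern q c (1 / c) z - \<i> * of_real D) = of_real C"
proof -
  define V A where "V = {z. q < cmod z \<and> cmod z < 1 / q}" and "A = {z. q < cmod z \<and> cmod z < 1}"
  have AV: "A \<subseteq> V" unfolding A_def V_def by (rule annulus_subset_larger[OF q])
  have opV: "open V" and opA: "open A" unfolding V_def A_def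
    by (intro open_Collect_conj open_Collect_less continuous_intros)+
  have conA: "connected A" unfolding A_def using connected_annulus(1)[of q "0::complex" 1] by simp
  have "1 < 1 / q" using q by simp
  then have circV: "w \<in> V" if "cmod w = 1" for w using that q unfolding V_def by auto
  have c': "cmod (1 / c) = 1" and c0: "c \<noteq> 0" using c by (auto simp: norm_divide)
  define F1 F2 where "F1 = kern_reg q 1 1" and "F2 = kern_reg q c (1 / c)"
  have F: "F1 holomorphic_on V" "F2 holomorphic_on V"
    unfolding F1_def F2_def V_def using c c' by (auto intro!: kern_reg_holomorphic q)
  have ReF: "Re (F1 w) = 0" "Re (F2 w) = 0" if "cmod w = 1" for w
    unfolding F1_def F2_def using that c c' by (auto intro!: Re_kern_reg_circle q)
  have ReM: "Re ((a + w) / (a - w)) = 0" if "cmod w = 1" "cmod a = 1" for a w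
    using that by (simp only: Re_cayley) simp
  define y D where "y = Im ((1 + c) / (1 - c) + F1 c)" and "D = Im ((c + 1) / (c - 1) + F2 1)"
  have iy: "(1 + c) / (1 - c) + F1 c = \<i> * of_real y"
    unfolding y_def using ReM[of c 1] ReF[of c] c by (intro complex_eqI) (simp_all del: Re_divide Im_divide)
  have iD: "(c + 1) / (c - 1) + F2 1 = \<i> * of_real D"
    unfolding D_def using ReM[of 1 c] ReF[of 1] c by (intro complex_eqI) (simp_all del: Re_divide Im_divide)
  \<comment> \<open>\<open>N1 z / (1 - z)\<close> and \<open>N2 z / (c - z)\<close> are the two factors; \<open>E1\<close> and \<open>E2\<close> divide the numerators by the
    linear factor belonging to the pole of the other kernel.\<close>
  define N1 N2 where "N1 z = (1 + z) + (1 - z) * (F1 z - \<i> * of_real y)"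
    and "N2 z = (c + z) + (c - z) * (F2 z - \<i> * of_real D)" for z
  have N: "N1 holomorphic_on V" "N2 holomorphic_on V"
    unfolding N1_def N2_def by (intro holomorphic_intros F)+
  have "N1 c = 0" unfolding N1_def iy[symmetric] using c(2) by (simp add: algebra_simps divide_simps)
  have "N2 1 = 0" unfolding N2_def iD[symmetric] using c(2) by (simp add: algebra_simps divide_simps)
  define E1 E2 where "E1 z = (if z = c then deriv N1 c else N1 z / (z - c))"
    and "E2 z = (if z = 1 then deriv N2 1 else N2 z / (z - 1))" for z
  have E1: "E1 holomorphic_on V"
    by (rule pole_theorem_open_0[OF N(1) opV, of c]) (auto simp: E1_def \<open>N1 c = 0\<close>)
  have E2: "E2 holomorphic_on V"
    by (rule pole_theorem_open_0[OF N(2) opV, of 1]) (auto simp: E2_def \<open>N2 1 = 0\<close>)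
  define P where "P z = (kern q 1 1 z - \<i> * of_real y) * (kern q c (1 / c) z - \<i> * of_real D)" for z
  have PE: "P z = E1 z * E2 z" if "z \<noteq> 1" "z \<noteq> c" for z
  proof -
    have nz: "1 - z \<noteq> 0" "c - z \<noteq> 0" "z - 1 \<noteq> 0" "z - c \<noteq> 0" using that by auto
    have "kern q 1 1 z - \<i> * of_real y = N1 z / (1 - z)"
      unfolding kern_def N1_def F1_def using nz by (simp add: field_simps)
    moreover have "kern q c (1 / c) z - \<i> * of_real D = N2 z / (c - z)"
      unfolding kern_def N2_def F2_def using nz by (simp add: field_simps)
    moreover have "(1 - z) * (c - z) = (z - c) * (z - 1)" by (simp add: algebra_simps)
    ultimately show ?thesis unfolding P_def E1_def E2_def using that by simp
  qed
  have contE: "continuous_on V (\<lambda>z. E1 z * E2 z)"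
    by (intro continuous_intros holomorphic_on_imp_continuous_on E1 E2)
  have Im0: "Im (E1 w * E2 w) = 0" if w: "cmod w = 1" for w
  proof -
    obtain f where f: "f \<longlonglongrightarrow> w" "\<And>n. cmod (f n) = 1" "\<And>n. f n \<notin> {1, c}"
      using exists_limit_on_circle[OF w, of "{1, c}"] by auto
    have "Im (P (f n)) = 0" for n
    proof -
      have "Re (kern q 1 1 (f n)) = 0" "Re (kern q c (1 / c) (f n)) = 0"
        using ReM[of "f n"] ReF[of "f n"] f(2)[of n] c unfolding kern_def F1_def F2_def
        by (simp_all del: Re_divide)
      then show ?thesis unfolding P_def by simp
    qed
    moreover have "P (f n) = E1 (f n) * E2 (f n)" for n using PE[of "f n"] f(3)[of n] by blast
    ultimately have "Im (E1 (f n) * E2 (f n)) = 0" for n by metis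
    moreover have "(\<lambda>n. E1 (f n) * E2 (f n)) \<longlonglongrightarrow> E1 w * E2 w"
      using continuous_on_tendsto_compose[OF contE f(1)] circV w f(2) by simp
    then have "(\<lambda>n. Im (E1 (f n) * E2 (f n))) \<longlonglongrightarrow> Im (E1 w * E2 w)" by (rule tendsto_Im)
    ultimately show ?thesis by (simp add: LIMSEQ_const_iff)
  qed
  have holP: "P holomorphic_on A"
    unfolding P_def A_def using c c' by (intro holomorphic_intros kern_holomorphic q) auto
  have symP: "P (of_real q / z) = P z" if "q < cmod z" "cmod z < 1" for z
    unfolding P_def using kern_reflect[OF q _ that, of 1] kern_reflect[OF q c(1) that] by simp
  have one_sided: "0 \<le> Re (s * P z)" if s: "s = \<i> \<or> s = - \<i>" and z: "z \<in> A" for s z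
  proof (rule reflected_annulus_min_principle[where h = "\<lambda>z. s * P z", OF q])
    show "q < cmod z" "cmod z < 1" using z by (auto simp: A_def)
    show "(\<lambda>z. s * P z) holomorphic_on {z. q < cmod z \<and> cmod z < 1}"
      using holP unfolding A_def by (intro holomorphic_intros)
    show "s * P (of_real q / z) = s * P z" if "q < cmod z" "cmod z < 1" for z using symP[OF that] by simp
    fix d :: real assume d: "d > 0"
    have "continuous_on {w. (q + 1) / 2 \<le> cmod w \<and> cmod w \<le> 1} (\<lambda>z. s * (E1 z * E2 z))"
      by (intro continuous_on_mult continuous_on_const continuous_on_subset[OF contE])
        (use collar_subset_larger[OF q] in \<open>auto simp: V_def\<close>)
    from Re_small_near_circle[OF _ this _ d]
    obtain \<rho> where \<rho>: "\<rho> < 1" "\<And>z. \<rho> < cmod z \<Longrightarrow> cmod z < 1 \<Longrightarrow> \<bar>Re (s * (E1 z * E2 z))\<bar> \<le> d"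
      using q s Im0 by auto
    have "- d \<le> Re (s * P z)" if "\<rho> < cmod z" "cmod z < 1" for z
    proof -
      have "P z = E1 z * E2 z" using that c by (intro PE) auto
      then show ?thesis using \<rho>(2)[OF that] by (simp only: abs_le_iff) linarith
    qed
    then show "\<exists>\<rho><1. \<forall>z. \<rho> < cmod z \<and> cmod z < 1 \<longrightarrow> - d \<le> Re (s * P z)"
      using \<rho>(1) by blast
  qed
  have ImP: "Im (P z) = 0" if "z \<in> A" for z
    using one_sided[of \<i>, OF _ that] one_sided[of "- \<i>", OF _ that] by simp
  \<comment> \<open>A nonconstant holomorphic function would have an open image, not one on the real line.\<close>
  have "P constant_on A"
  proof (rule ccontr)
    assume "\<not> P constant_on A"
    then have op: "open (P ` A)" using open_mapping_thm[OF holP opA conA opA subset_refl] by blast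
    obtain z0 where z0: "z0 \<in> A" using Re_kern_pos_somewhere[OF q, of 1] by (auto simp: A_def)
    then obtain e where e: "e > 0" "ball (P z0) e \<subseteq> P ` A" using op open_contains_ball by blast
    have "P z0 + \<i> * of_real (e / 2) \<in> ball (P z0) e" using e by (simp add: dist_norm norm_mult)
    then obtain z1 where "z1 \<in> A" "P z0 + \<i> * of_real (e / 2) = P z1" using e by blast
    then have "Im (P z0 + \<i> * of_real (e / 2)) = 0" using ImP by simp
    then show False using ImP[OF z0] e by simp
  qed
  then obtain C0 where C0: "\<And>z. z \<in> A \<Longrightarrow> P z = C0" unfolding constant_on_def by blast
  obtain z0 where z0: "z0 \<in> A" and pos0: "0 < Re (kern q c (1 / c) z0)"
    using Re_kern_pos_somewhere[OF q c(1)] by (auto simp: A_def)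
  define C where "C = Re C0"
  have CC: "P z = of_real C" if "z \<in> A" for z
    using C0[OF z0] C0[OF that] ImP[OF z0] unfolding C_def by (intro complex_eqI) simp_all
  have Re_pos: "0 \<le> Re (kern q 1 1 z)" if "z \<in> A" for z
    using Re_kern_nonneg[OF q, of 1 z] that by (simp add: A_def)
  \<comment> \<open>If \<open>u g = C\<close> is real, then \<open>C Re g = |g|\<^sup>2 Re u\<close>, and both real parts are nonnegative.\<close>
  have "C \<ge> 0"
  proof -
    define u g where "u = kern q 1 1 z0 - \<i> * of_real y" and "g = kern q c (1 / c) z0 - \<i> * of_real D"
    have ug: "u * g = of_real C" using CC[OF z0] unfolding P_def u_def g_def by simp
    define R where "R = (cmod g)\<^sup>2"
    have e: "of_real C * cnj g = u * of_real R"
      using ug complex_norm_square[of g] unfolding R_def by (metis mult.assoc)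
    have "C * Re g = Re u * R"
      using arg_cong[OF e, of Re] by simp
    moreover have "0 \<le> R" unfolding R_def by simp
    moreover have "Re u \<ge> 0" "Re g > 0" unfolding u_def g_def using Re_pos[OF z0] pos0 by auto
    ultimately have "0 \<le> C * Re g" by simp
    then show ?thesis using \<open>Re g > 0\<close> by (simp add: zero_le_mult_iff)
  qed
  \<comment> \<open>If \<open>C = 0\<close>, one factor vanishes on an open set, and the first kernel would be constant and imaginary.\<close>
  moreover have "C \<noteq> 0"
  proof
    assume "C = 0"
    define B where "B = {z \<in> A. 0 < Re (kern q c (1 / c) z)}"
    have "open B"
    proof -
      have "continuous_on A (\<lambda>z. Re (kern q c (1 / c) z))"
        unfolding A_def by (intro continuous_intros holomorphic_on_imp_continuous_on kern_holomorphic q c c')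
      then have "open (A \<inter> (\<lambda>z. Re (kern q c (1 / c) z)) -` {0<..})"
        using opA by (intro continuous_open_preimage) auto
      moreover have "A \<inter> (\<lambda>z. Re (kern q c (1 / c) z)) -` {0<..} = B" unfolding B_def by auto
      ultimately show ?thesis by simp
    qed
    moreover have "kern q 1 1 z = \<i> * of_real y" if "z \<in> B" for z
    proof -
      have "P z = 0" using CC[of z] that \<open>C = 0\<close> by (simp add: B_def)
      moreover have "kern q c (1 / c) z - \<i> * of_real D \<noteq> 0"
      proof
        assume "kern q c (1 / c) z - \<i> * of_real D = 0"
        then have "Re (kern q c (1 / c) z - \<i> * of_real D) = 0" by simp
        then show False using that by (simp add: B_def)
      qed
      ultimately show ?thesis unfolding P_def by simp
    qed
    moreover obtain z1 where z1: "z1 \<in> A" "0 < Re (kern q 1 1 z1)"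
      using Re_kern_pos_somewhere[OF q, of 1] by (auto simp: A_def)
    moreover have "kern q 1 1 holomorphic_on A" unfolding A_def by (intro kern_holomorphic q) auto
    ultimately have "kern q 1 1 z1 = \<i> * of_real y"
      using z0 pos0 opA conA
      by (intro analytic_continuation_open[of B A "kern q 1 1" "\<lambda>_. \<i> * of_real y" z1])
        (auto simp: B_def)
    then have "Re (kern q 1 1 z1) = 0" by simp
    then show False using z1 by simp
  qed
  ultimately have "C > 0" by simp
  then show thesis
    using CC by (intro that[of C y D]) (auto simp: A_def P_def)
qed

section \<open>Positive functions as averages of kernels\<close>

lemma has_integral_cis_powi:
  "((\<lambda>t. cis (2 * pi * t) powi k) has_integral (if k = 0 then 1 else 0)) {0..1}"
proof (cases "k = 0")
  case True
  then show ?thesis using has_integral_const_real[of "1::complex" 0 1] by simp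
next
  case False
  define s where "s = 2 * of_real pi * of_int k * \<i>"
  have s0: "s \<noteq> 0" using False by (simp add: s_def)
  have "((\<lambda>t. exp (s * of_real t)) has_integral (exp (s * of_real 1) / s - exp (s * of_real 0) / s)) {0..1::real}"
  proof (rule fundamental_theorem_of_calculus)
    fix t :: real assume "t \<in> {0..1}"
    have "((\<lambda>z. exp (s * z) / s) has_field_derivative exp (s * of_real t)) (at (of_real t))"
      using s0 by (auto intro!: derivative_eq_intros)
    then show "((\<lambda>t. exp (s * of_real t) / s) has_vector_derivative exp (s * of_real t)) (at t within {0..1})"
      by (rule has_vector_derivative_real_field)
  qed simp
  moreover have "exp (s * of_real 1) = 1"
  proof -
    have "s * of_real 1 = of_int (2 * k) * (of_real pi * \<i>)" by (simp add: s_def)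
    then show ?thesis unfolding exp_eq_1 by (simp add: s_def)
  qed
  moreover have "exp (s * of_real t) = cis (2 * pi * t) powi k" for t
    unfolding cis_power_int unfolding cis_conv_exp by (rule arg_cong[of _ _ exp]) (simp add: s_def mult_ac)
  ultimately show ?thesis using False by simp
qed

lemma has_integral_trig_product:
  assumes I: "finite I"
  shows "((\<lambda>t. (\<Sum>j\<in>I. x j * cis (2 * pi * t) powi j) * (\<Sum>k\<in>I. y k * cis (2 * pi * t) powi (- k)))
    has_integral (\<Sum>k\<in>I. x k * y k)) {0..1}"
proof -
  have eq: "(\<Sum>j\<in>I. x j * cis a powi j) * (\<Sum>k\<in>I. y k * cis a powi (- k))
      = (\<Sum>j\<in>I. \<Sum>k\<in>I. (x j * y k) * cis a powi (j - k))" for a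
  proof -
    have "(x j * cis a powi j) * (y k * cis a powi (- k)) = (x j * y k) * cis a powi (j - k)" for j k
      using power_int_add[of "cis a" j "- k"] by (simp add: mult_ac)
    then show ?thesis unfolding sum_product by (intro sum.cong refl)
  qed
  have "((\<lambda>t. \<Sum>j\<in>I. \<Sum>k\<in>I. (x j * y k) * cis (2 * pi * t) powi (j - k))
      has_integral (\<Sum>j\<in>I. \<Sum>k\<in>I. (x j * y k) * (if j - k = 0 then 1 else 0))) {0..1}"
    by (intro has_integral_sum I has_integral_mult_right has_integral_cis_powi)
  moreover have "(\<Sum>j\<in>I. \<Sum>k\<in>I. (x j * y k) * (if j - k = 0 then 1 else 0)) = (\<Sum>k\<in>I. x k * y k)"
    using I by (intro sum.cong refl) (simp add: if_distrib cong: if_cong)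
  ultimately show ?thesis by (simp only: eq)
qed

text \<open>Cauchy's estimate on the unit circle.\<close>

lemma trig_coefficient_bound:
  assumes I: "finite I" "j \<in> I" and bd: "\<And>w. cmod w = 1 \<Longrightarrow> cmod (\<Sum>k\<in>I. x k * w powi k) \<le> m"
  shows "cmod (x j) \<le> m"
proof -
  let ?f = "\<lambda>t. (\<Sum>i\<in>I. x i * cis (2 * pi * t) powi i) * (\<Sum>k\<in>I. (if k = j then 1 else 0) * cis (2 * pi * t) powi (- k))"
  have "(?f has_integral (\<Sum>k\<in>I. x k * (if k = j then 1 else 0))) {0..1}"
    by (rule has_integral_trig_product[OF I(1)])
  moreover have "(\<Sum>k\<in>I. x k * (if k = j then 1 else 0)) = x j"
    using I by (simp add: if_distrib cong: if_cong)
  ultimately have "(?f has_integral x j) (cbox 0 1)" by simp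
  moreover have "norm (?f t) \<le> m" for t
  proof -
    have "(\<Sum>k\<in>I. (if k = j then 1 else 0) * cis (2 * pi * t) powi (- k)) = cis (2 * pi * t) powi (- j)"
      using I by (simp add: if_distrib[of "\<lambda>z. z * _"] cong: if_cong)
    then show ?thesis
      using bd[of "cis (2 * pi * t)"] by (simp add: norm_mult norm_power_int)
  qed
  moreover have "0 \<le> m" using order_trans[OF norm_ge_zero bd[of 1]] by simp
  ultimately have "cmod (x j) \<le> m * measure lborel (cbox 0 (1::real))"
    by (intro has_integral_bound) auto
  then show ?thesis by simp
qed

text \<open>The sum is the mean of \<open>2 Re x Re y\<close> over the circle, by orthogonality; the two summands come from
  \<open>2 Re y = y + cnj y\<close>.\<close>

lemma integral_Re_product_nonneg:
  fixes N :: nat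
  defines "I \<equiv> {- int N..int N}"
  assumes X: "\<And>w. cmod w = 1 \<Longrightarrow> 0 \<le> Re (\<Sum>k\<in>I. x k * w powi k)"
    and Y: "\<And>w. cmod w = 1 \<Longrightarrow> 0 \<le> Re (\<Sum>k\<in>I. y k * w powi (- k))"
  shows "0 \<le> Re (\<Sum>k\<in>I. x k * (y k + cnj (y (- k))))"
proof -
  have fin: "finite I" by (simp add: I_def)
  let ?X = "\<lambda>t. \<Sum>k\<in>I. x k * cis (2 * pi * t) powi k" and ?Y = "\<lambda>t. \<Sum>k\<in>I. y k * cis (2 * pi * t) powi (- k)"
  let ?Z = "\<lambda>t. \<Sum>k\<in>I. cnj (y (- k)) * cis (2 * pi * t) powi (- k)"
  have Z: "?Z t = cnj (?Y t)" for t
  proof -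
    have "cnj (?Y t) = (\<Sum>k\<in>I. cnj (y k) * cis (2 * pi * t) powi k)"
      by (simp add: cis_power_int cis_cnj)
    also have "\<dots> = ?Z t"
      by (rule sum.reindex_bij_witness[of _ uminus uminus]) (auto simp: I_def)
    finally show ?thesis by simp
  qed
  have "((\<lambda>t. ?X t * ?Y t + ?X t * ?Z t) has_integral (\<Sum>k\<in>I. x k * y k) + (\<Sum>k\<in>I. x k * cnj (y (- k)))) {0..1}"
    by (intro has_integral_add has_integral_trig_product fin)
  from has_integral_Re[OF this]
  have "((\<lambda>t. Re (?X t * ?Y t + ?X t * ?Z t)) has_integral Re (\<Sum>k\<in>I. x k * (y k + cnj (y (- k))))) {0..1}"
    by (simp add: distrib_left sum.distrib)
  moreover have "0 \<le> Re (?X t * ?Y t + ?X t * ?Z t)" for t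
  proof -
    have "Re (A * B + A * cnj B) = 2 * (Re A * Re B)" for A B by (simp add: algebra_simps)
    then have "Re (?X t * ?Y t + ?X t * ?Z t) = 2 * (Re (?X t) * Re (?Y t))" unfolding Z .
    moreover have "0 \<le> Re (?X t) * Re (?Y t)" by (intro mult_nonneg_nonneg X Y) simp_all
    ultimately show ?thesis by simp
  qed
  ultimately show ?thesis by (rule has_integral_nonneg)
qed

text \<open>This form separates the dependence on the two poles.\<close>

lemma kcoef_alt:
  "kcoef q a b k = (if k = 0 then 1 else 0)
    + of_real (2 / (1 - q powi (2 * k))) * (a powi (- k) - of_real (q powi k) * b powi (- k))"
  unfolding kcoef_def by auto

text \<open>Here \<open>t\<close> is a sequence of moments and \<open>\<eta>\<close> an error from truncating series. By \<open>kcoef_alt\<close>, the pairing of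
  \<open>t\<close> with the kernel is a function of \<open>a\<close> minus a function of \<open>b\<close>. If it is nonnegative for all \<open>a, b\<close>, a
  constant \<open>c\<close> separates the two functions. Integrating the boundary values of \<open>Re h\<close> on the two circles, which
  are nonnegative, against the two nonnegative differences and adding gives the pairing of \<open>t\<close> with \<open>h\<close>; the
  constant \<open>c\<close> drops out, since \<open>Re h\<close> has equal means over both circles.\<close>

lemma kernel_positivity_imp_pairing:
  fixes N :: nat and t h :: "int \<Rightarrow> complex"
  defines "I \<equiv> {- int N..int N}"
  assumes q: "0 < q" "q < 1" and t0: "Im (t 0) = 0"
    and ker: "\<And>a b. cmod a = 1 \<Longrightarrow> cmod b = 1 \<Longrightarrow> - \<eta> \<le> Re (\<Sum>k\<in>I. kcoef q a b k * t k)"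
    and h1: "\<And>w. cmod w = 1 \<Longrightarrow> 0 \<le> Re (\<Sum>k\<in>I. h k * w powi k)"
    and h2: "\<And>w. cmod w = 1 \<Longrightarrow> 0 \<le> Re (\<Sum>k\<in>I. h k * of_real (q powi k) * w powi k)"
  shows "- \<eta> * Re (h 0) \<le> Re (\<Sum>k\<in>I. h k * t k)"
proof -
  have fin: "finite I" "0 \<in> I" by (simp_all add: I_def)
  define \<kappa> where "\<kappa> k = 2 / (1 - q powi (2 * k))" for k
  define p where "p a = Re (\<Sum>k\<in>I. of_real (\<kappa> k) * t k * a powi (- k))" for a
  define w where "w b = Re (\<Sum>k\<in>I. of_real (\<kappa> k * q powi k) * t k * b powi (- k))" for b
  have sep: "w b \<le> p a + Re (t 0) + \<eta>" if "cmod a = 1" "cmod b = 1" for a b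
  proof -
    have "(\<Sum>k\<in>I. kcoef q a b k * t k) = (\<Sum>k\<in>I. (if k = 0 then t 0 else 0)
        + (of_real (\<kappa> k) * t k * a powi (- k) - of_real (\<kappa> k * q powi k) * t k * b powi (- k)))"
      unfolding kcoef_alt \<kappa>_def[symmetric] by (intro sum.cong refl) (auto simp: algebra_simps)
    also have "\<dots> = t 0 + ((\<Sum>k\<in>I. of_real (\<kappa> k) * t k * a powi (- k))
        - (\<Sum>k\<in>I. of_real (\<kappa> k * q powi k) * t k * b powi (- k)))"
      unfolding sum.distrib sum_subtractf using fin by simp
    finally have "Re (\<Sum>k\<in>I. kcoef q a b k * t k) = Re (t 0) + (p a - w b)"
      unfolding p_def w_def by (simp only: plus_complex.sel minus_complex.sel)
    then show ?thesis using ker[OF that] by simp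
  qed
  \<comment> \<open>The constant that separates the two functions.\<close>
  define c where "c = (SUP b\<in>sphere 0 1. w b)"
  have bdd: "bdd_above (w ` sphere 0 1)"
    using sep[of 1] by (intro bdd_aboveI2[of _ _ "p 1 + Re (t 0) + \<eta>"]) simp
  have c1: "w b \<le> c" if "cmod b = 1" for b
    unfolding c_def using bdd that by (intro cSUP_upper) auto
  have c2: "c \<le> p a + Re (t 0) + \<eta>" if "cmod a = 1" for a
    unfolding c_def using sep[OF that] by (intro cSUP_least) auto
  define y1 where "y1 k = of_real (\<kappa> k) * t k + (if k = 0 then of_real (Re (t 0) + \<eta> - c) else 0)" for k
  define y2 where "y2 k = (if k = 0 then of_real c else 0) - of_real (\<kappa> k * q powi k) * t k" for k
  have Y1: "0 \<le> Re (\<Sum>k\<in>I. y1 k * a powi (- k))" if "cmod a = 1" for a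
  proof -
    have "(\<Sum>k\<in>I. y1 k * a powi (- k)) = (\<Sum>k\<in>I. of_real (\<kappa> k) * t k * a powi (- k)
        + (if k = 0 then of_real (Re (t 0) + \<eta> - c) else 0))"
      unfolding y1_def by (intro sum.cong refl) (auto simp: algebra_simps)
    also have "\<dots> = (\<Sum>k\<in>I. of_real (\<kappa> k) * t k * a powi (- k)) + of_real (Re (t 0) + \<eta> - c)"
      unfolding sum.distrib using fin by simp
    finally show ?thesis using c2[OF that] unfolding p_def by (simp only: plus_complex.sel Re_complex_of_real)
  qed
  have Y2: "0 \<le> Re (\<Sum>k\<in>I. y2 k * b powi (- k))" if "cmod b = 1" for b
  proof -
    have "(\<Sum>k\<in>I. y2 k * b powi (- k)) = (\<Sum>k\<in>I. (if k = 0 then of_real c else 0)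
        - of_real (\<kappa> k * q powi k) * t k * b powi (- k))"
      unfolding y2_def by (intro sum.cong refl) (auto simp: algebra_simps)
    also have "\<dots> = of_real c - (\<Sum>k\<in>I. of_real (\<kappa> k * q powi k) * t k * b powi (- k))"
      unfolding sum_subtractf using fin by simp
    finally show ?thesis using c1[OF that] unfolding w_def by (simp only: minus_complex.sel Re_complex_of_real)
  qed
  have P1: "0 \<le> Re (\<Sum>k\<in>I. h k * (y1 k + cnj (y1 (- k))))"
    unfolding I_def by (rule integral_Re_product_nonneg) (use h1 Y1 in \<open>auto simp: I_def\<close>)
  have P2: "0 \<le> Re (\<Sum>k\<in>I. (h k * of_real (q powi k)) * (y2 k + cnj (y2 (- k))))"
    unfolding I_def by (rule integral_Re_product_nonneg) (use h2 Y2 in \<open>auto simp: I_def\<close>)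
  have t0': "cnj (t 0) = t 0" using t0 by (simp add: complex_eq_iff)
  have t0'': "complex_of_real (Re (t 0)) = t 0" using t0 by (simp add: complex_eq_iff)
  have "h k * (y1 k + cnj (y1 (- k))) + (h k * of_real (q powi k)) * (y2 k + cnj (y2 (- k)))
      = 2 * (h k * t k) + (if k = 0 then 2 * of_real \<eta> * h 0 else 0)" for k
  proof (cases "k = 0")
    case True
    then show ?thesis using t0' t0''
      by (simp add: y1_def y2_def \<kappa>_def algebra_simps)
  next
    case False
    have q0: "q powi k \<noteq> 0" using q by simp
    have inv: "q powi k * q powi (- k) = 1" using q0 by (simp add: power_int_minus)
    have "q powi (2 * k) = q powi k * q powi k" unfolding mult_2 by (rule power_int_add) (use q in simp)
    moreover have "q powi (2 * k) \<noteq> 1" using power_int_neq_1[OF q, of "2 * k"] False by simp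
    ultimately have "\<kappa> k = 2 / (1 - q powi k * q powi k)" "1 - q powi k * q powi k \<noteq> 0"
      unfolding \<kappa>_def by simp_all
    then have k2: "\<kappa> k * (1 - q powi k * q powi k) = 2"
      using nonzero_eq_divide_eq by blast
    have "h k * (y1 k + cnj (y1 (- k))) + (h k * of_real (q powi k)) * (y2 k + cnj (y2 (- k)))
      = h k * t k * of_real (\<kappa> k * (1 - q powi k * q powi k))
        + h k * cnj (t (- k)) * of_real (\<kappa> (- k)) * (1 - of_real (q powi k * q powi (- k)))"
      using False unfolding y1_def y2_def by (simp add: algebra_simps)
    then show ?thesis unfolding k2 inv using False by simp
  qed
  then have eq: "(\<Sum>k\<in>I. h k * (y1 k + cnj (y1 (- k)))) + (\<Sum>k\<in>I. (h k * of_real (q powi k)) * (y2 k + cnj (y2 (- k))))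
      = 2 * (\<Sum>k\<in>I. h k * t k) + 2 * of_real \<eta> * h 0"
    unfolding sum.distrib[symmetric] using fin by (simp add: sum.distrib sum_distrib_left)
  have "0 \<le> Re (2 * (\<Sum>k\<in>I. h k * t k) + 2 * of_real \<eta> * h 0)"
    unfolding eq[symmetric] plus_complex.sel by (rule add_nonneg_nonneg[OF P1 P2])
  then show ?thesis by simp
qed

section \<open>Cauchy's theorem for cycles\<close>

definition cycle_in :: "complex set \<Rightarrow> (real \<Rightarrow> complex) list \<Rightarrow> bool" where
  "cycle_in U gs \<longleftrightarrow> (\<forall>g\<in>set gs. valid_path g \<and> pathfinish g = pathstart g \<and> path_image g \<subseteq> U)"

definition cycle_winding :: "(real \<Rightarrow> complex) list \<Rightarrow> complex \<Rightarrow> complex" where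
  "cycle_winding gs z = (\<Sum>g\<leftarrow>gs. winding_number g z)"

definition cycle_integral :: "(real \<Rightarrow> complex) list \<Rightarrow> (complex \<Rightarrow> complex) \<Rightarrow> complex" where
  "cycle_integral gs f = (\<Sum>g\<leftarrow>gs. contour_integral g f)"

lemma cycle_in_subset: "cycle_in U gs \<Longrightarrow> U \<subseteq> V \<Longrightarrow> cycle_in V gs"
  unfolding cycle_in_def by blast

lemma cycle_winding_constant_on:
  assumes "cycle_in U gs" "connected S" "S \<inter> U = {}" "w \<in> S" "z \<in> S"
  shows "cycle_winding gs w = cycle_winding gs z"
proof -
  have "winding_number g w = winding_number g z" if "g \<in> set gs" for g
    using assms that unfolding cycle_in_def
    by (intro winding_number_eq[of g w S z]) (auto intro: valid_path_imp_path)
  then show ?thesis unfolding cycle_winding_def by (metis map_cong)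
qed

lemma closed_cycle_images:
  assumes "cycle_in U gs" shows "closed (\<Union>g\<in>set gs. path_image g)"
  using assms unfolding cycle_in_def
  by (intro closed_UN) (auto intro!: closed_path_image intro: valid_path_imp_path)

lemma cycle_in_images: "cycle_in U gs \<Longrightarrow> cycle_in (\<Union>g\<in>set gs. path_image g) gs"
  unfolding cycle_in_def by blast

text \<open>Winding numbers vanish far out; this fixes locally constant functions below.\<close>

lemma cycle_winding_at_infinity:
  assumes "cycle_in U gs"
  shows "\<exists>B. \<forall>z. B \<le> cmod z \<longrightarrow> cycle_winding gs z = 0"
  using assms
proof (induction gs)
  case (Cons g gs)
  then obtain B where "\<forall>z. B \<le> cmod z \<longrightarrow> cycle_winding gs z = 0" unfolding cycle_in_def by auto
  moreover obtain B' where "\<forall>z. B' \<le> cmod z \<longrightarrow> winding_number g z = 0"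
    using Cons.prems winding_number_zero_at_infinity[of g] valid_path_imp_path unfolding cycle_in_def by auto
  ultimately show ?case
    by (intro exI[of _ "max B B'"]) (auto simp: cycle_winding_def)
qed (simp add: cycle_winding_def)

text \<open>The loops of a cycle in a connected open set can be strung together on one loop, the connecting
  arcs being traversed in both directions.\<close>

lemma cycle_as_single_loop:
  assumes U: "open U" "connected U" "p \<in> U" and gs: "cycle_in U gs"
  shows "\<exists>g. valid_path g \<and> pathstart g = p \<and> pathfinish g = p \<and> path_image g \<subseteq> U \<and>
    (\<forall>f. f holomorphic_on U \<longrightarrow> contour_integral g f = cycle_integral gs f)"
  using gs
proof (induction gs)
  case Nil
  have "contour_integral (linepath p p) f = 0" for f by (rule contour_integral_trivial)
  moreover have "path_image (linepath p p) \<subseteq> U" using U(3) by simp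
  ultimately show ?case
    using valid_path_linepath[of p p] pathstart_linepath[of p p] pathfinish_linepath[of p p]
    by (intro exI[of _ "linepath p p"]) (simp only: cycle_integral_def list.map sum_list.Nil, blast)
next
  case (Cons g1 gs)
  then obtain g where g: "valid_path g" "pathstart g = p" "pathfinish g = p" "path_image g \<subseteq> U"
    "\<And>f. f holomorphic_on U \<Longrightarrow> contour_integral g f = cycle_integral gs f"
    unfolding cycle_in_def by auto
  have g1: "valid_path g1" "pathfinish g1 = pathstart g1" "path_image g1 \<subseteq> U"
    using Cons.prems unfolding cycle_in_def by auto
  then have "pathstart g1 \<in> U" using pathstart_in_path_image by blast
  from connected_open_polynomial_connected[OF U(1,2,3) this]
  obtain c where c: "polynomial_function c" "path_image c \<subseteq> U" "pathstart c = p" "pathfinish c = pathstart g1"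
    by blast
  have vc: "valid_path c" using c(1) by (rule valid_path_polynomial_function)
  define h where "h = c +++ (g1 +++ (reversepath c +++ g))"
  have "contour_integral h f = cycle_integral (g1 # gs) f" if f: "f holomorphic_on U" for f
  proof -
    have i: "f contour_integrable_on k" if "valid_path k" "path_image k \<subseteq> U" for k
      using contour_integrable_holomorphic_simple[OF f U(1) that] .
    have "f contour_integrable_on reversepath c" using i[OF vc c(2)] vc
      by (simp add: contour_integrable_reversepath_eq)
    then show ?thesis
      unfolding h_def using i[OF vc c(2)] i[OF g1(1,3)] i[OF g(1,4)] vc g1 g c g(5)[OF f]
      by (simp add: cycle_integral_def contour_integral_reversepath)
  qed
  moreover have "valid_path h" "pathstart h = p" "pathfinish h = p" "path_image h \<subseteq> U"
    unfolding h_def using vc g1 g c by (auto simp: path_image_join)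
  ultimately show ?case by blast
qed

text \<open>Winding numbers are integrals of \<open>1 / (w - z)\<close>, so the single loop representing the cycle has the
  winding numbers of the cycle, and Cauchy's theorem for one loop applies.\<close>

lemma cauchy_cycle_connected:
  assumes U: "open U" "connected U" and gs: "cycle_in U gs"
    and zero: "\<And>z. z \<notin> U \<Longrightarrow> cycle_winding gs z = 0" and f: "f holomorphic_on U"
  shows "cycle_integral gs f = 0"
proof (cases "gs = []")
  case False
  then obtain g1 where "g1 \<in> set gs" by (cases gs) auto
  then have "pathstart g1 \<in> U" using gs pathstart_in_path_image unfolding cycle_in_def by blast
  from cycle_as_single_loop[OF U this gs]
  obtain g p where g: "valid_path g" "pathstart g = p" "pathfinish g = p" "path_image g \<subseteq> U"
    "\<And>f. f holomorphic_on U \<Longrightarrow> contour_integral g f = cycle_integral gs f" by blast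
  have "winding_number g z = 0" if z: "z \<notin> U" for z
  proof -
    have "(\<lambda>w. 1 / (w - z)) holomorphic_on U" using z by (intro holomorphic_intros) auto
    then have "contour_integral g (\<lambda>w. 1 / (w - z)) = cycle_integral gs (\<lambda>w. 1 / (w - z))" by (rule g(5))
    also have "\<dots> = (\<Sum>g\<leftarrow>gs. 2 * of_real pi * \<i> * winding_number g z)"
      unfolding cycle_integral_def
    proof (intro arg_cong[of _ _ sum_list] map_cong refl)
      fix k assume "k \<in> set gs"
      then have "valid_path k" "z \<notin> path_image k" using gs z unfolding cycle_in_def by auto
      then show "contour_integral k (\<lambda>w. 1 / (w - z)) = 2 * of_real pi * \<i> * winding_number k z"
        by (simp add: winding_number_valid_path)
    qed
    also have "\<dots> = 2 * of_real pi * \<i> * cycle_winding gs z"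
      unfolding cycle_winding_def by (simp add: sum_list_const_mult)
    also have "\<dots> = 0" using zero[OF z] by simp
    finally have "contour_integral g (\<lambda>w. 1 / (w - z)) = 0" .
    then show ?thesis using g z by (subst winding_number_valid_path) auto
  qed
  then have "(f has_contour_integral 0) g"
    using g by (intro Cauchy_theorem_global[OF U(1) f]) auto
  then show ?thesis using g(5)[OF f] by (simp add: contour_integral_unique)
qed (simp add: cycle_integral_def)

text \<open>If a cycle is null-homologous in a disjoint union of open sets, so is each of its parts: the
  winding number of the first part off \<open>U\<^sub>1\<close> and minus that of the second part off \<open>U\<^sub>2\<close> agree
  wherever both are defined, and together they make a locally constant function on the whole plane,
  which vanishes at infinity.\<close>

lemma cycle_winding_split:
  assumes U: "open U1" "open U2" "U1 \<inter> U2 = {}" and gs: "cycle_in U1 gs1" "cycle_in U2 gs2"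
    and zero: "\<And>z. z \<notin> U1 \<union> U2 \<Longrightarrow> cycle_winding gs1 z + cycle_winding gs2 z = 0"
    and z: "z \<notin> U1"
  shows "cycle_winding gs1 z = 0"
proof -
  \<comment> \<open>Outside both sets the two branches agree by \<open>zero\<close>.\<close>
  define G where "G z = (if z \<in> U1 then - cycle_winding gs2 z else cycle_winding gs1 z)" for z
  have "G constant_on UNIV"
  proof (rule locally_constant_imp_constant)
    fix z :: complex
    have *: "\<exists>T. open T \<and> z \<in> T \<and> (\<forall>w\<in>T. G w = G z)"
    proof -
      consider "z \<in> U1" | "z \<in> U2" | "z \<notin> U1" "z \<notin> U2" by blast
      then show ?thesis
      proof cases
        case 1
        then obtain e where e: "e > 0" "ball z e \<subseteq> U1" using U(1) open_contains_ball by blast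
        have "G w = G z" if "w \<in> ball z e" for w
        proof -
          have "cycle_winding gs2 w = cycle_winding gs2 z"
            using e U(3) that by (intro cycle_winding_constant_on[OF gs(2), of "ball z e"]) auto
          then show ?thesis using e that 1 unfolding G_def by auto
        qed
        then show ?thesis using open_ball[of z e] centre_in_ball[of z e] e(1) by blast
      next
        case 2
        then obtain e where e: "e > 0" "ball z e \<subseteq> U2" using U(2) open_contains_ball by blast
        have "G w = G z" if "w \<in> ball z e" for w
        proof -
          have "cycle_winding gs1 w = cycle_winding gs1 z"
            using e U(3) that by (intro cycle_winding_constant_on[OF gs(1), of "ball z e"]) auto
          then show ?thesis using e that U(3) 2 unfolding G_def by auto
        qed
        then show ?thesis using open_ball[of z e] centre_in_ball[of z e] e(1) by blast
      next
        case 3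
        define K1 K2 where "K1 = (\<Union>g\<in>set gs1. path_image g)" and "K2 = (\<Union>g\<in>set gs2. path_image g)"
        have op: "open (- (K1 \<union> K2))"
          unfolding K1_def K2_def by (intro open_Compl closed_Un closed_cycle_images[OF gs(1)] closed_cycle_images[OF gs(2)])
        have "K1 \<subseteq> U1" "K2 \<subseteq> U2" using gs unfolding K1_def K2_def cycle_in_def by blast+
        then have zK: "z \<in> - (K1 \<union> K2)" using 3 by blast
        obtain e where e: "e > 0" "ball z e \<subseteq> - (K1 \<union> K2)" by (rule openE[OF op zK])
        then have e': "ball z e \<inter> K1 = {}" "ball z e \<inter> K2 = {}" "z \<in> ball z e" by auto
        have "G w = G z" if "w \<in> ball z e" for w
        proof -
          have "cycle_winding gs1 w = cycle_winding gs1 z"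
            by (rule cycle_winding_constant_on[OF cycle_in_images[OF gs(1)] connected_ball e'(1)[unfolded K1_def] that e'(3)])
          moreover have "cycle_winding gs2 w = cycle_winding gs2 z"
            by (rule cycle_winding_constant_on[OF cycle_in_images[OF gs(2)] connected_ball e'(2)[unfolded K2_def] that e'(3)])
          moreover have "cycle_winding gs1 z + cycle_winding gs2 z = 0" using zero 3 by simp
          ultimately show ?thesis using 3 unfolding G_def by (simp add: add_eq_0_iff)
        qed
        then show ?thesis using open_ball[of z e] centre_in_ball[of z e] e(1) by blast
      qed
    qed
    then show "\<exists>T. openin (top_of_set UNIV) T \<and> z \<in> T \<and> (\<forall>x\<in>T. G x = G z)" by simp
  qed (rule connected_UNIV)
  then obtain c where c: "\<And>z. G z = c" unfolding constant_on_def by auto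
  obtain B1 B2 where B: "\<And>z. B1 \<le> cmod z \<Longrightarrow> cycle_winding gs1 z = 0" "\<And>z. B2 \<le> cmod z \<Longrightarrow> cycle_winding gs2 z = 0"
    using cycle_winding_at_infinity[OF gs(1)] cycle_winding_at_infinity[OF gs(2)] by blast
  have "G (of_real (\<bar>B1\<bar> + \<bar>B2\<bar>)) = 0"
    unfolding G_def by (auto intro!: B simp del: of_real_add)
  then have "G z = 0" using c by metis
  then show ?thesis using z by (simp add: G_def)
qed

lemma sum_list_filter_split:
  fixes h :: "'a \<Rightarrow> 'b::comm_monoid_add"
  shows "(\<Sum>x\<leftarrow>xs. h x) = (\<Sum>x\<leftarrow>filter P xs. h x) + (\<Sum>x\<leftarrow>filter (\<lambda>x. \<not> P x) xs. h x)"
  by (induction xs) (auto simp: ac_simps)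

text \<open>Induction on the number of loops: the connected component that contains the first loop is split off with
  the loops in it, and \<open>cycle_winding_split\<close> shows that both parts are null-homologous.\<close>

lemma cauchy_cycle:
  assumes "open U" "f holomorphic_on U" "cycle_in U gs" "\<And>z. z \<notin> U \<Longrightarrow> cycle_winding gs z = 0"
  shows "cycle_integral gs f = 0"
  using assms
proof (induction "length gs" arbitrary: gs U rule: less_induct)
  case less
  show ?case
  proof (cases gs)
    case Nil
    then show ?thesis by (simp add: cycle_integral_def)
  next
    case (Cons g0 rest)
    define C where "C = connected_component_set U (pathstart g0)"
    define gs1 gs2 where "gs1 = filter (\<lambda>g. path_image g \<subseteq> C) gs" and "gs2 = filter (\<lambda>g. \<not> path_image g \<subseteq> C) gs"
    have C: "open C" "connected C" "C \<subseteq> U"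
      unfolding C_def using less.prems(1) by (auto intro: open_connected_component connected_component_subset[THEN subsetD])
    have sub: "path_image g \<subseteq> C" if gx: "g \<in> set gs" "path_image g \<inter> C \<noteq> {}" for g
    proof -
      have g: "connected (path_image g)" "path_image g \<subseteq> U"
        using less.prems(3) gx(1) unfolding cycle_in_def by (auto intro: connected_path_image valid_path_imp_path)
      obtain x where x: "x \<in> path_image g" "x \<in> C" using gx(2) by blast
      have "path_image g \<subseteq> connected_component_set U x" by (rule connected_component_maximal[OF x(1) g])
      then show ?thesis using x(2) connected_component_eq[of x U "pathstart g0"] unfolding C_def by simp
    qed
    have D: "open (U - C)"
    proof (subst open_subopen, intro ballI)
      fix x assume x: "x \<in> U - C"
      have "connected_component_set U x \<inter> C = {}"
        using x connected_component_nonoverlap[of U x "pathstart g0"] connected_component_refl[of x U]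
        unfolding C_def by (metis DiffD1 DiffD2 connected_component_eq mem_Collect_eq disjoint_iff)
      then show "\<exists>T. open T \<and> x \<in> T \<and> T \<subseteq> U - C"
        using x less.prems(1) connected_component_subset[of U x]
        by (intro exI[of _ "connected_component_set U x"]) (auto intro: open_connected_component)
    qed
    have gs1: "cycle_in C gs1" using less.prems(3) unfolding gs1_def cycle_in_def by auto
    have gs2: "cycle_in (U - C) gs2"
      using less.prems(3) sub unfolding gs2_def cycle_in_def by fastforce
    have w: "cycle_winding gs z = cycle_winding gs1 z + cycle_winding gs2 z" for z
      unfolding cycle_winding_def gs1_def gs2_def by (rule sum_list_filter_split)
    have z1: "cycle_winding gs1 z = 0" if "z \<notin> C" for z
    proof (rule cycle_winding_split[OF C(1) D _ gs1 gs2 _ that])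
      show "cycle_winding gs1 z + cycle_winding gs2 z = 0" if "z \<notin> C \<union> (U - C)" for z
        using less.prems(4)[of z] w[of z] that by auto
    qed blast
    have z2: "cycle_winding gs2 z = 0" if "z \<notin> U - C" for z
    proof (rule cycle_winding_split[OF D C(1) _ gs2 gs1 _ that])
      show "cycle_winding gs2 z + cycle_winding gs1 z = 0" if "z \<notin> U - C \<union> C" for z
        using less.prems(4)[of z] w[of z] that by (auto simp: add.commute)
    qed blast
    have "g0 \<in> set gs" using Cons by simp
    then have "pathstart g0 \<in> U"
      using less.prems(3) pathstart_in_path_image unfolding cycle_in_def by blast
    then have "pathstart g0 \<in> C" unfolding C_def by simp
    then have "path_image g0 \<subseteq> C" using sub[OF \<open>g0 \<in> set gs\<close>] pathstart_in_path_image by blast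
    then have "length gs2 < length gs"
      unfolding gs2_def by (intro length_filter_less[OF \<open>g0 \<in> set gs\<close>]) simp
    then have "cycle_integral gs2 f = 0"
      using less.hyps[OF _ D _ gs2 z2] holomorphic_on_subset[OF less.prems(2)] by blast
    moreover have "cycle_integral gs1 f = 0"
      using cauchy_cycle_connected[OF C(1,2) gs1 z1] holomorphic_on_subset[OF less.prems(2) C(3)] by blast
    moreover have "cycle_integral gs f = cycle_integral gs1 f + cycle_integral gs2 f"
      unfolding cycle_integral_def gs1_def gs2_def by (rule sum_list_filter_split)
    ultimately show ?thesis by simp
  qed
qed

section \<open>Powers and Laurent polynomials of an operator\<close>

lemma scaleC_blinfun_simps:
  fixes A B :: "'a::real_normed_vector \<Rightarrow>\<^sub>L 'b::chilbert_space"
  shows "(0::complex) *\<^sub>C A = 0" "(1::complex) *\<^sub>C A = A" "c *\<^sub>C (0 :: 'a \<Rightarrow>\<^sub>L 'b) = 0"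
    "(c + d) *\<^sub>C A = c *\<^sub>C A + d *\<^sub>C A" "c *\<^sub>C (A + B) = c *\<^sub>C A + c *\<^sub>C B"
    "(c - d) *\<^sub>C A = c *\<^sub>C A - d *\<^sub>C A" "c *\<^sub>C (A - B) = c *\<^sub>C A - c *\<^sub>C B"
    "c *\<^sub>C d *\<^sub>C A = (c * d) *\<^sub>C A"
  by (auto intro!: blinfun_eqI simp: blinfun.bilinear_simps scaleC_add_left scaleC_add_right scaleC_diff_left
      scaleC_diff_right scaleC_scaleC)

lemma scaleC_blinfun_sum: "c *\<^sub>C (\<Sum>i\<in>I. f i) = (\<Sum>i\<in>I. c *\<^sub>C (f i :: 'a::real_normed_vector \<Rightarrow>\<^sub>L 'b::chilbert_space))"
  by (induction I rule: infinite_finite_induct) (auto simp: scaleC_blinfun_simps)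

lemma scaleC_compose_left: "(c *\<^sub>C A) o\<^sub>L B = c *\<^sub>C (A o\<^sub>L B)"
  by (rule blinfun_eqI) simp

lemma scaleC_compose_right: "clinear_op A \<Longrightarrow> A o\<^sub>L (c *\<^sub>C B) = c *\<^sub>C (A o\<^sub>L B)"
  by (rule blinfun_eqI) (simp add: clinear_opD)

lemma clinear_op_power [clin]: "clinear_op T \<Longrightarrow> clinear_op (op_power T n)"
  by (induction n) (auto intro: clin)

lemma op_power_add: "op_power T (m + n) = op_power T m o\<^sub>L op_power T n"
  by (induction m) (simp_all add: compose_eqs)

lemma op_power_commute: "op_power T n o\<^sub>L T = T o\<^sub>L op_power T n"
  using op_power_add[of T n 1] op_power_add[of T 1 n] by (simp add: compose_eqs)

text \<open>Stated for two operators, as an intertwining relation, of which commutation is the case \<open>T = T'\<close>.\<close>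

lemma compose_power_commute:
  assumes "X o\<^sub>L T = T' o\<^sub>L X" shows "X o\<^sub>L op_power T n = op_power T' n o\<^sub>L X"
proof (induction n)
  case (Suc n)
  have "X o\<^sub>L (T o\<^sub>L op_power T n) = T' o\<^sub>L (X o\<^sub>L op_power T n)"
    using assms by (metis compose_eqs(1))
  then show ?case using Suc by (simp add: compose_eqs)
qed (simp add: compose_eqs)

lemma norm_op_power_le: "norm (op_power T n) \<le> norm T ^ n"
proof (induction n)
  case 0
  then show ?case by (simp add: norm_blinfun_id_le)
next
  case (Suc n)
  have "norm (T o\<^sub>L op_power T n) \<le> norm T * norm (op_power T n)" by (rule norm_blinfun_compose)
  also have "\<dots> \<le> norm T * norm T ^ n" using Suc by (intro mult_left_mono) auto
  finally show ?case by simp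
qed

lemma poly_op_upto: "degree p \<le> N \<Longrightarrow> poly_op p T = (\<Sum>i\<le>N. coeff p i *\<^sub>C op_power T i)"
  unfolding poly_op_def
  by (rule sum.mono_neutral_left) (auto simp: coeff_eq_0 scaleC_blinfun_simps)

lemma clinear_poly_op [clin]: "clinear_op T \<Longrightarrow> clinear_op (poly_op p T)"
  unfolding poly_op_def by (intro clin)

lemma poly_op_add: "poly_op (p + q) T = poly_op p T + poly_op q T"
proof -
  define N where "N = max (degree p) (degree q)"
  have "degree p \<le> N" "degree q \<le> N" "degree (p + q) \<le> N"
    unfolding N_def using degree_add_le_max[of p q] by auto
  then show ?thesis
    by (simp add: poly_op_upto[of _ N] scaleC_blinfun_simps sum.distrib)
qed

lemma poly_op_smult: "poly_op (smult c p) T = c *\<^sub>C poly_op p T"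
  using degree_smult_le[of c p]
  by (simp add: poly_op_upto[of _ "degree p"] scaleC_blinfun_sum scaleC_blinfun_simps)

lemma poly_op_diff: "poly_op (p - q) T = poly_op p T - poly_op q T"
proof -
  have "p - q = p + smult (-1) q" by simp
  then have "poly_op (p - q) T = poly_op p T + (-1) *\<^sub>C poly_op q T"
    by (simp only: poly_op_add poly_op_smult)
  also have "\<dots> = poly_op p T - poly_op q T"
    by (rule blinfun_eqI) (simp add: blinfun.bilinear_simps scaleC_minus_left)
  finally show ?thesis .
qed

lemma poly_op_0 [simp]: "poly_op 0 T = 0"
  by (simp add: poly_op_def scaleC_blinfun_simps)

lemma poly_op_1 [simp]: "poly_op 1 T = id_blinfun"
  by (simp add: poly_op_def scaleC_blinfun_simps)

lemma poly_op_pCons: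
  assumes "clinear_op T"
  shows "poly_op (pCons a p) T = a *\<^sub>C id_blinfun + (T o\<^sub>L poly_op p T)"
proof -
  have "degree (pCons a p) \<le> Suc (degree p)" by (rule degree_pCons_le)
  then have "poly_op (pCons a p) T = (\<Sum>i\<le>Suc (degree p). coeff (pCons a p) i *\<^sub>C op_power T i)"
    by (rule poly_op_upto)
  also have "\<dots> = a *\<^sub>C id_blinfun + (\<Sum>i\<le>degree p. coeff p i *\<^sub>C (T o\<^sub>L op_power T i))"
    by (subst sum.atMost_Suc_shift) simp
  also have "(\<Sum>i\<le>degree p. coeff p i *\<^sub>C (T o\<^sub>L op_power T i)) = T o\<^sub>L poly_op p T"
    unfolding poly_op_def blinfun_compose.sum_right by (simp add: scaleC_compose_right[OF assms])
  finally show ?thesis .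
qed

lemma poly_op_mult:
  assumes "clinear_op T"
  shows "poly_op (p * q) T = poly_op p T o\<^sub>L poly_op q T"
proof (induction p)
  case (pCons a p)
  have "poly_op (pCons a p * q) T = a *\<^sub>C poly_op q T + (T o\<^sub>L (poly_op p T o\<^sub>L poly_op q T))"
    by (simp add: mult_pCons_left poly_op_add poly_op_smult poly_op_pCons[OF assms] pCons.IH scaleC_blinfun_simps)
  also have "\<dots> = poly_op (pCons a p) T o\<^sub>L poly_op q T"
    by (simp add: poly_op_pCons[OF assms] blinfun_compose.add_left scaleC_compose_left compose_eqs)
  finally show ?case .
qed simp

lemma poly_op_monom: "poly_op (monom c n) T = c *\<^sub>C op_power T n"
proof -
  have "poly_op (monom c n) T = (\<Sum>i\<le>n. coeff (monom c n) i *\<^sub>C op_power T i)"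
    by (rule poly_op_upto) (rule degree_monom_le)
  also have "\<dots> = (\<Sum>i\<le>n. if i = n then c *\<^sub>C op_power T n else 0)"
    by (intro sum.cong refl) (auto simp: scaleC_blinfun_simps)
  also have "\<dots> = c *\<^sub>C op_power T n" by simp
  finally show ?thesis .
qed

lemma compose_poly_op_commute:
  assumes "X o\<^sub>L T = T' o\<^sub>L X" "clinear_op X"
  shows "X o\<^sub>L poly_op p T = poly_op p T' o\<^sub>L X"
  unfolding poly_op_def blinfun_compose.sum_right blinfun_compose.sum_left scaleC_compose_left
    scaleC_compose_right[OF assms(2)] compose_power_commute[OF assms(1)] ..

lemma is_inverse_op_unique:
  assumes "is_inverse_op A B" "is_inverse_op A B'" shows "B = B'"
proof -
  have "B = B o\<^sub>L (A o\<^sub>L B')" using assms by (simp add: is_inverse_op_def compose_eqs)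
  also have "\<dots> = (B o\<^sub>L A) o\<^sub>L B'" by (simp only: compose_eqs)
  also have "\<dots> = B'" using assms by (simp add: is_inverse_op_def compose_eqs)
  finally show ?thesis .
qed

lemma op_inv_eqI: "is_inverse_op A B \<Longrightarrow> op_inv A = B"
  unfolding op_inv_def using is_inverse_op_unique by blast

lemma is_inverse_op_apply:
  assumes "is_inverse_op A B"
  shows "blinfun_apply A (blinfun_apply B x) = x" "blinfun_apply B (blinfun_apply A x) = x"
  using assms unfolding is_inverse_op_def by (metis blinfun_apply_blinfun_compose blinfun_apply_id_blinfun)+

lemma is_inverse_opI:
  assumes "clinear_op B" "\<And>x. blinfun_apply A (blinfun_apply B x) = x" "\<And>x. blinfun_apply B (blinfun_apply A x) = x"
  shows "is_inverse_op A B"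
  unfolding is_inverse_op_def using assms by (auto intro!: blinfun_eqI)

lemma is_inverse_op_compose:
  assumes "is_inverse_op A B" "is_inverse_op A' B'"
  shows "is_inverse_op (A o\<^sub>L A') (B' o\<^sub>L B)"
  using is_inverse_op_apply[OF assms(1)] is_inverse_op_apply[OF assms(2)] assms
  by (intro is_inverse_opI) (auto intro: clin simp: is_inverse_op_def)

lemma is_inverse_op_power:
  assumes "is_inverse_op A B" shows "is_inverse_op (op_power A n) (op_power B n)"
proof (induction n)
  case (Suc n)
  then show ?case using is_inverse_op_compose[OF assms Suc] by (simp add: op_power_commute)
qed (simp add: is_inverse_op_def compose_eqs)

text \<open>The inverse is a separate argument, so that powers need no choice of an inverse.\<close>

definition int_power :: "('a::chilbert_space \<Rightarrow>\<^sub>L 'a) \<Rightarrow> ('a \<Rightarrow>\<^sub>L 'a) \<Rightarrow> int \<Rightarrow> ('a \<Rightarrow>\<^sub>L 'a)" where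
  "int_power T B k = (if 0 \<le> k then op_power T (nat k) else op_power B (nat (- k)))"

lemma int_power_of_nat [simp]: "int_power T B (int n) = op_power T n"
  and int_power_neg_of_nat [simp]: "int_power T B (- int n) = op_power B n"
  and int_power_0 [simp]: "int_power T B 0 = id_blinfun"
  by (auto simp: int_power_def)

lemma clinear_int_power [clin]: "clinear_op T \<Longrightarrow> clinear_op B \<Longrightarrow> clinear_op (int_power T B k)"
  unfolding int_power_def by (auto intro: clin)

lemma int_power_step:
  assumes "is_inverse_op T B" shows "T o\<^sub>L int_power T B k = int_power T B (k + 1)"
proof (cases "0 \<le> k")
  case True
  then have "nat (k + 1) = Suc (nat k)" by simp
  then show ?thesis using True by (simp add: int_power_def)
next
  case False
  then have n: "nat (- k) = Suc (nat (- (k + 1)))" by simp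
  have "T o\<^sub>L int_power T B k = (T o\<^sub>L B) o\<^sub>L op_power B (nat (- (k + 1)))"
    using False n by (simp add: int_power_def compose_eqs)
  also have "\<dots> = op_power B (nat (- (k + 1)))" using assms by (simp add: is_inverse_op_def compose_eqs)
  also have "\<dots> = int_power T B (k + 1)"
    using False by (cases "k = -1") (simp_all add: int_power_def)
  finally show ?thesis .
qed

lemma op_power_int_power:
  assumes "is_inverse_op T B" shows "op_power T i o\<^sub>L int_power T B k = int_power T B (int i + k)"
proof (induction i)
  case (Suc i)
  then show ?case using int_power_step[OF assms, of "int i + k"] by (simp add: compose_eqs add_ac)
qed (simp add: compose_eqs)

lemma op_power_shift:
  assumes "is_inverse_op T B" shows "op_power T i o\<^sub>L op_power B n = int_power T B (int i - int n)"
  using op_power_int_power[OF assms, of i "- int n"] by simp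

text \<open>The pair \<open>p, n\<close> stands for the Laurent polynomial \<open>p(z) / z\<^sup>n\<close>; each has many such representations.\<close>

definition laurent_coeff :: "complex poly \<Rightarrow> nat \<Rightarrow> int \<Rightarrow> complex" where
  "laurent_coeff p n k = (if 0 \<le> k + int n then coeff p (nat (k + int n)) else 0)"

definition laurent_op :: "complex poly \<Rightarrow> nat \<Rightarrow> ('a::chilbert_space \<Rightarrow>\<^sub>L 'a) \<Rightarrow> ('a \<Rightarrow>\<^sub>L 'a) \<Rightarrow> ('a \<Rightarrow>\<^sub>L 'a)" where
  "laurent_op p n T B = poly_op p T o\<^sub>L op_power B n"

definition laurent_fun :: "complex poly \<Rightarrow> nat \<Rightarrow> complex \<Rightarrow> complex" where
  "laurent_fun p n z = poly p z / z ^ n"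

lemma laurent_sum_shift:
  fixes g :: "complex \<Rightarrow> int \<Rightarrow> 'b::comm_monoid_add"
  assumes g0: "\<And>k. g 0 k = 0" and N: "n \<le> N" "degree p \<le> N + n"
  shows "(\<Sum>i\<le>degree p. g (coeff p i) (int i - int n)) = (\<Sum>k\<in>{- int N..int N}. g (laurent_coeff p n k) k)"
proof -
  have "(\<Sum>i\<le>degree p. g (coeff p i) (int i - int n)) = (\<Sum>k\<in>(\<lambda>i. int i - int n) ` {..degree p}. g (laurent_coeff p n k) k)"
    by (subst sum.reindex) (auto simp: inj_on_def laurent_coeff_def)
  also have "\<dots> = (\<Sum>k\<in>{- int N..int N}. g (laurent_coeff p n k) k)"
  proof (rule sum.mono_neutral_left)
    show "(\<lambda>i. int i - int n) ` {..degree p} \<subseteq> {- int N..int N}" using N by auto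
    show "\<forall>k\<in>{- int N..int N} - (\<lambda>i. int i - int n) ` {..degree p}. g (laurent_coeff p n k) k = 0"
    proof
      fix k assume k: "k \<in> {- int N..int N} - (\<lambda>i. int i - int n) ` {..degree p}"
      have "laurent_coeff p n k = 0"
      proof (cases "0 \<le> k + int n")
        case True
        then have "k = int (nat (k + int n)) - int n" by simp
        then have "nat (k + int n) \<notin> {..degree p}" using k by blast
        then show ?thesis by (simp add: laurent_coeff_def coeff_eq_0)
      qed (simp add: laurent_coeff_def)
      then show "g (laurent_coeff p n k) k = 0" by (simp add: g0)
    qed
  qed simp
  finally show ?thesis .
qed

lemma laurent_fun_sum:
  assumes "z \<noteq> 0" "n \<le> N" "degree p \<le> N + n"
  shows "laurent_fun p n z = (\<Sum>k\<in>{- int N..int N}. laurent_coeff p n k * z powi k)"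
proof -
  have "laurent_fun p n z = (\<Sum>i\<le>degree p. coeff p i * z powi (int i - int n))"
    unfolding laurent_fun_def poly_altdef sum_divide_distrib
    using assms(1) by (intro sum.cong refl) (simp add: power_int_diff)
  also have "\<dots> = (\<Sum>k\<in>{- int N..int N}. laurent_coeff p n k * z powi k)"
    by (rule laurent_sum_shift) (use assms in auto)
  finally show ?thesis .
qed

lemma laurent_op_sum:
  assumes "is_inverse_op T B" "n \<le> N" "degree p \<le> N + n"
  shows "laurent_op p n T B = (\<Sum>k\<in>{- int N..int N}. laurent_coeff p n k *\<^sub>C int_power T B k)"
proof -
  have "laurent_op p n T B = (\<Sum>i\<le>degree p. coeff p i *\<^sub>C int_power T B (int i - int n))"
    unfolding laurent_op_def poly_op_def blinfun_compose.sum_left scaleC_compose_left op_power_shift[OF assms(1)] ..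
  also have "\<dots> = (\<Sum>k\<in>{- int N..int N}. laurent_coeff p n k *\<^sub>C int_power T B k)"
    by (rule laurent_sum_shift) (use assms in \<open>auto simp: scaleC_blinfun_simps\<close>)
  finally show ?thesis .
qed

lemma laurent_of_sum:
  obtains p :: "complex poly" and n where
    "\<And>z. z \<noteq> 0 \<Longrightarrow> laurent_fun p n z = (\<Sum>k\<in>{- int N..int N}. c k * z powi k)"
    "\<And>(T :: 'a::chilbert_space \<Rightarrow>\<^sub>L 'a) B. is_inverse_op T B \<Longrightarrow>
        laurent_op p n T B = (\<Sum>k\<in>{- int N..int N}. c k *\<^sub>C int_power T B k)"
proof -
  define p where "p = (\<Sum>i\<le>2 * N. monom (c (int i - int N)) i)"
  have cp: "coeff p i = (if i \<le> 2 * N then c (int i - int N) else 0)" for i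
    unfolding p_def coeff_sum by simp
  then have deg: "degree p \<le> N + N" by (intro degree_le) auto
  have lc: "laurent_coeff p N k = c k" if "k \<in> {- int N..int N}" for k
    using that unfolding laurent_coeff_def cp by auto
  show thesis
    by (rule that[of p N])
      (simp_all add: laurent_fun_sum[OF _ _ deg] laurent_op_sum[OF _ _ deg], auto intro!: sum.cong simp: lc)
qed

section \<open>Resolvents\<close>

lemma neumann_series:
  assumes E: "clinear_op E" "norm E < 1"
  obtains B where "is_inverse_op (id_blinfun - E) B" "norm B \<le> 1 / (1 - norm E)"
proof -
  have "summable (\<lambda>n. norm E ^ n)" using E by (intro summable_geometric) simp
  then have sm: "summable (\<lambda>n. op_power E n)"
    by (rule summable_comparison_test'[of _ 0]) (rule norm_op_power_le)
  define B where "B = (\<Sum>n. op_power E n)"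
  have lim: "(\<lambda>n. \<Sum>i<n. op_power E i) \<longlonglongrightarrow> B"
    using sm unfolding B_def by (rule summable_LIMSEQ)
  have clB: "clinear_op B" by (rule clinear_op_lim[OF lim]) (intro clin E)
  have "(\<lambda>n. norm E ^ n) \<longlonglongrightarrow> 0" using E by (intro LIMSEQ_realpow_zero) auto
  then have p0: "(\<lambda>n. op_power E n) \<longlonglongrightarrow> 0"
    by (rule Lim_null_comparison[rotated]) (auto intro!: always_eventually norm_op_power_le)
  have tel: "(id_blinfun - E) o\<^sub>L (\<Sum>i<n. op_power E i) = id_blinfun - op_power E n" for n
    by (induction n) (simp_all add: blinfun_compose.diff_left blinfun_compose.add_right compose_eqs)
  have tel': "(\<Sum>i<n. op_power E i) o\<^sub>L (id_blinfun - E) = id_blinfun - op_power E n" for n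
  proof -
    have "(\<Sum>i<n. op_power E i) o\<^sub>L E = E o\<^sub>L (\<Sum>i<n. op_power E i)"
      unfolding blinfun_compose.sum_left blinfun_compose.sum_right op_power_commute ..
    then show ?thesis
      using tel[of n] by (simp add: blinfun_compose.diff_left blinfun_compose.diff_right compose_eqs)
  qed
  have pl: "(\<lambda>n. id_blinfun - op_power E n) \<longlonglongrightarrow> id_blinfun - 0" by (intro tendsto_intros p0)
  have "(\<lambda>n. (id_blinfun - E) o\<^sub>L (\<Sum>i<n. op_power E i)) \<longlonglongrightarrow> ((id_blinfun - E) o\<^sub>L B)"
    by (intro blinfun_compose.tendsto tendsto_const lim)
  from LIMSEQ_unique[OF this[unfolded tel] pl] have 1: "(id_blinfun - E) o\<^sub>L B = id_blinfun" by simp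
  have "(\<lambda>n. (\<Sum>i<n. op_power E i) o\<^sub>L (id_blinfun - E)) \<longlonglongrightarrow> (B o\<^sub>L (id_blinfun - E))"
    by (intro blinfun_compose.tendsto tendsto_const lim)
  from LIMSEQ_unique[OF this[unfolded tel'] pl] have 2: "B o\<^sub>L (id_blinfun - E) = id_blinfun" by simp
  have "B = id_blinfun + (E o\<^sub>L B)"
    using 1 by (simp add: blinfun_compose.diff_left compose_eqs algebra_simps)
  then have "norm B \<le> norm (id_blinfun :: 'a \<Rightarrow>\<^sub>L 'a) + norm (E o\<^sub>L B)" by (metis norm_triangle_ineq)
  also have "\<dots> \<le> 1 + norm E * norm B" by (intro add_mono norm_blinfun_id_le norm_blinfun_compose)
  finally have "norm B \<le> 1 / (1 - norm E)" using E(2) by (simp add: field_simps)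
  with 1 2 clB show thesis by (intro that[of B]) (auto simp: is_inverse_op_def)
qed

definition resolvent :: "('a::chilbert_space \<Rightarrow>\<^sub>L 'a) \<Rightarrow> complex \<Rightarrow> ('a \<Rightarrow>\<^sub>L 'a)" where
  "resolvent T z = op_inv (z *\<^sub>C id_blinfun - T)"

lemma resolvent_inverse:
  "z \<notin> op_spectrum T \<Longrightarrow> is_inverse_op (z *\<^sub>C id_blinfun - T) (resolvent T z)"
  unfolding op_spectrum_def resolvent_def using op_inv_eqI by auto

lemma resolvent_apply:
  assumes "z \<notin> op_spectrum T"
  shows "z *\<^sub>C blinfun_apply (resolvent T z) x = x + blinfun_apply T (blinfun_apply (resolvent T z) x)"
    "blinfun_apply (resolvent T z) (blinfun_apply T x) = z *\<^sub>C blinfun_apply (resolvent T z) x - x"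
    "blinfun_apply T (blinfun_apply (resolvent T z) x) = z *\<^sub>C blinfun_apply (resolvent T z) x - x"
proof -
  have cl: "clinear_op (resolvent T z)" using resolvent_inverse[OF assms] by (simp add: is_inverse_op_def)
  have "z *\<^sub>C blinfun_apply (resolvent T z) x - blinfun_apply T (blinfun_apply (resolvent T z) x) = x"
    using is_inverse_op_apply(1)[OF resolvent_inverse[OF assms], of x] by (simp add: blinfun.bilinear_simps)
  then show "z *\<^sub>C blinfun_apply (resolvent T z) x = x + blinfun_apply T (blinfun_apply (resolvent T z) x)"
    "blinfun_apply T (blinfun_apply (resolvent T z) x) = z *\<^sub>C blinfun_apply (resolvent T z) x - x"
    by (simp_all add: algebra_simps)
  have "z *\<^sub>C blinfun_apply (resolvent T z) x - blinfun_apply (resolvent T z) (blinfun_apply T x) = x"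
    using is_inverse_op_apply(2)[OF resolvent_inverse[OF assms], of x]
    by (simp add: blinfun.bilinear_simps clinear_opD[OF cl])
  then show "blinfun_apply (resolvent T z) (blinfun_apply T x) = z *\<^sub>C blinfun_apply (resolvent T z) x - x"
    by (simp add: algebra_simps)
qed

lemma resolvent_identity:
  assumes T: "clinear_op T" and z: "z \<notin> op_spectrum T" "w \<notin> op_spectrum T"
  shows "resolvent T z - resolvent T w = (w - z) *\<^sub>C (resolvent T z o\<^sub>L resolvent T w)"
proof (rule blinfun_eqI)
  fix x
  define v where "v = blinfun_apply (resolvent T w) x"
  have cl: "clinear_op (resolvent T z)" using resolvent_inverse[OF z(1)] by (simp add: is_inverse_op_def)
  have x: "x = w *\<^sub>C v - blinfun_apply T v"
    using resolvent_apply(1)[OF z(2), of x] unfolding v_def by simp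
  have "blinfun_apply (resolvent T z) x = w *\<^sub>C blinfun_apply (resolvent T z) v - (z *\<^sub>C blinfun_apply (resolvent T z) v - v)"
    by (subst x) (simp add: blinfun.bilinear_simps clinear_opD[OF cl] resolvent_apply(2)[OF z(1)])
  then show "blinfun_apply (resolvent T z - resolvent T w) x = blinfun_apply ((w - z) *\<^sub>C (resolvent T z o\<^sub>L resolvent T w)) x"
    by (simp add: blinfun.bilinear_simps v_def[symmetric] scaleC_diff_left)
qed

text \<open>Perturbation of \<open>z\<^sub>0 - T\<close> by less than half the reciprocal of the norm of its inverse at most doubles that norm.\<close>

lemma resolvent_near:
  assumes T: "clinear_op T" and z0: "z0 \<notin> op_spectrum T"
    and z: "cmod (z - z0) * (2 * norm (resolvent T z0) + 1) < 1"
  shows "z \<notin> op_spectrum T" "norm (resolvent T z) \<le> 2 * norm (resolvent T z0)"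
proof -
  define R0 where "R0 = resolvent T z0"
  have R0: "is_inverse_op (z0 *\<^sub>C id_blinfun - T) R0" "clinear_op R0"
    unfolding R0_def using resolvent_inverse[OF z0] by (auto simp: is_inverse_op_def)
  define E where "E = (z0 - z) *\<^sub>C R0"
  have nE: "norm E = cmod (z - z0) * norm R0" unfolding E_def by (simp add: norm_scaleC_blinfun norm_minus_commute)
  have "2 * norm E + cmod (z - z0) < 1" using z unfolding nE R0_def[symmetric] by (simp add: algebra_simps)
  then have nE': "2 * norm E < 1" using norm_ge_zero[of "z - z0"] by linarith
  then have "norm E < 1" using norm_ge_zero[of E] by linarith
  moreover have "clinear_op E" unfolding E_def by (intro clin R0)
  ultimately obtain B where B: "is_inverse_op (id_blinfun - E) B" "norm B \<le> 1 / (1 - norm E)"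
    using neumann_series by blast
  have "z *\<^sub>C id_blinfun - T = (z0 *\<^sub>C id_blinfun - T) o\<^sub>L (id_blinfun - E)"
  proof (rule blinfun_eqI)
    fix x
    have "blinfun_apply (z0 *\<^sub>C id_blinfun - T) (blinfun_apply E x) = (z0 - z) *\<^sub>C x"
    proof -
      have "clinear_op (z0 *\<^sub>C id_blinfun - T)" by (intro clin T)
      then show ?thesis unfolding E_def by (simp only: blinfun_apply_scaleC clinear_opD is_inverse_op_apply[OF R0(1)])
    qed
    then show "blinfun_apply (z *\<^sub>C id_blinfun - T) x = blinfun_apply ((z0 *\<^sub>C id_blinfun - T) o\<^sub>L (id_blinfun - E)) x"
      by (simp add: blinfun.bilinear_simps scaleC_diff_left algebra_simps)
  qed
  then have inv: "is_inverse_op (z *\<^sub>C id_blinfun - T) (B o\<^sub>L R0)"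
    using is_inverse_op_compose[OF R0(1) B(1)] by simp
  then show "z \<notin> op_spectrum T" unfolding op_spectrum_def by blast
  have "norm (B o\<^sub>L R0) \<le> norm B * norm R0" by (rule norm_blinfun_compose)
  also have "\<dots> \<le> 2 * norm R0"
  proof (rule mult_right_mono)
    have "1 / (1 - norm E) \<le> 2" using nE' by (simp add: field_simps)
    then show "norm B \<le> 2" using B(2) by linarith
  qed simp
  finally show "norm (resolvent T z) \<le> 2 * norm (resolvent T z0)"
    using op_inv_eqI[OF inv] unfolding resolvent_def R0_def by simp
qed

lemma closed_op_spectrum:
  assumes T: "clinear_op T" shows "closed (op_spectrum T)"
proof -
  have "open (- op_spectrum T)"
  proof (subst open_dist, intro ballI)
    fix z0 assume "z0 \<in> - op_spectrum T"
    then have z0: "z0 \<notin> op_spectrum T" by simp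
    define c where "c = 2 * norm (resolvent T z0) + 1"
    have c: "c > 0" unfolding c_def by (simp add: add_nonneg_pos)
    have "z \<in> - op_spectrum T" if "dist z z0 < 1 / c" for z
      using resolvent_near(1)[OF T z0, of z] that c unfolding c_def[symmetric]
      by (simp add: dist_norm field_simps)
    then show "\<exists>e>0. \<forall>y. dist y z0 < e \<longrightarrow> y \<in> - op_spectrum T"
      using c by (intro exI[of _ "1 / c"]) auto
  qed
  then show ?thesis by (simp add: closed_def)
qed

lemma resolvent_tendsto:
  assumes T: "clinear_op T" and z0: "z0 \<notin> op_spectrum T"
  shows "(resolvent T \<longlongrightarrow> resolvent T z0) (at z0)"
proof -
  define c where "c = 2 * norm (resolvent T z0) + 1"
  have c: "c > 0" unfolding c_def by (simp add: add_nonneg_pos)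
  have ev: "\<forall>\<^sub>F z in at z0. norm (resolvent T z - resolvent T z0)
      \<le> cmod (z0 - z) * (2 * norm (resolvent T z0) * norm (resolvent T z0))"
    unfolding eventually_at
  proof (intro exI[of _ "1 / c"] conjI ballI impI)
    fix z assume "z \<noteq> z0 \<and> dist z z0 < 1 / c"
    then have "cmod (z - z0) * c < 1" using c by (simp add: dist_norm field_simps)
    note z = resolvent_near[OF T z0 this[unfolded c_def]]
    have "norm (resolvent T z - resolvent T z0) = cmod (z0 - z) * norm (resolvent T z o\<^sub>L resolvent T z0)"
      by (simp add: resolvent_identity[OF T z(1) z0] norm_scaleC_blinfun)
    also have "\<dots> \<le> cmod (z0 - z) * (norm (resolvent T z) * norm (resolvent T z0))"
      by (intro mult_left_mono norm_blinfun_compose) simp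
    also have "\<dots> \<le> cmod (z0 - z) * (2 * norm (resolvent T z0) * norm (resolvent T z0))"
      using z(2) by (intro mult_left_mono mult_right_mono) auto
    finally show "norm (resolvent T z - resolvent T z0)
        \<le> cmod (z0 - z) * (2 * norm (resolvent T z0) * norm (resolvent T z0))" .
  qed (use c in auto)
  have "((\<lambda>z. cmod (z0 - z) * (2 * norm (resolvent T z0) * norm (resolvent T z0))) \<longlongrightarrow>
      cmod (z0 - z0) * (2 * norm (resolvent T z0) * norm (resolvent T z0))) (at z0)"
    by (intro tendsto_intros)
  then have "((\<lambda>z. resolvent T z - resolvent T z0) \<longlongrightarrow> 0) (at z0)"
    by (intro Lim_null_comparison[OF ev]) simp
  then show ?thesis by (rule LIM_zero_cancel)
qed

lemma continuous_on_resolvent: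
  assumes "clinear_op T" shows "continuous_on (- op_spectrum T) (resolvent T)"
  using resolvent_tendsto[OF assms] by (auto simp: continuous_on_def intro: tendsto_within_subset)

text \<open>By the resolvent identity, difference quotients at \<open>z\<^sub>0\<close> are entries of \<open>- R(z) R(z\<^sub>0)\<close>, which is continuous
  in \<open>z\<close>.\<close>

lemma resolvent_weakly_holomorphic:
  assumes T: "clinear_op T"
  shows "(\<lambda>z. cinner (blinfun_apply (resolvent T z) x) y) holomorphic_on (- op_spectrum T)"
  unfolding holomorphic_on_def
proof
  fix z0 assume "z0 \<in> - op_spectrum T"
  then have z0: "z0 \<notin> op_spectrum T" by simp
  let ?\<phi> = "\<lambda>z. cinner (blinfun_apply (resolvent T z) x) y"
  let ?\<psi> = "\<lambda>z. - cinner (blinfun_apply (resolvent T z) (blinfun_apply (resolvent T z0) x)) y"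
  have op: "open (- op_spectrum T)" using closed_op_spectrum[OF T] by (rule open_Compl)
  have "(?\<psi> \<longlongrightarrow> ?\<psi> z0) (at z0)"
    by (intro tendsto_minus cinner.tendsto tendsto_const tendsto_blinfun_apply resolvent_tendsto T z0)
  moreover have "\<forall>\<^sub>F z in at z0. ?\<psi> z = (?\<phi> z - ?\<phi> z0) / (z - z0)"
  proof -
    have "\<forall>\<^sub>F z in at z0. z \<in> - op_spectrum T - {z0}"
      using op z0 by (intro eventually_at_in_open) auto
    then show ?thesis
    proof eventually_elim
      case (elim z)
      then have "?\<phi> z - ?\<phi> z0 = (z0 - z) * cinner (blinfun_apply (resolvent T z) (blinfun_apply (resolvent T z0) x)) y"
        using arg_cong[OF resolvent_identity[OF T _ z0, of z], of "\<lambda>A. cinner (blinfun_apply A x) y"]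
        by (simp add: blinfun.bilinear_simps cinner.diff_left cinner_scaleC_left)
      then show ?case using elim by (simp add: field_simps)
    qed
  qed
  ultimately have "((\<lambda>z. (?\<phi> z - ?\<phi> z0) / (z - z0)) \<longlongrightarrow> ?\<psi> z0) (at z0)"
    by (rule Lim_transform_eventually)
  then have "(?\<phi> has_field_derivative ?\<psi> z0) (at z0)" by (simp add: has_field_derivative_iff)
  then show "?\<phi> field_differentiable at z0 within - op_spectrum T"
    by (meson field_differentiable_def field_differentiable_at_within)
qed

section \<open>Contour integrals of operator-valued functions\<close>

lemma has_derivative_scaleC_path:
  fixes P :: "complex \<Rightarrow> 'a::real_normed_vector \<Rightarrow>\<^sub>L 'b::chilbert_space"
  assumes g: "(g has_vector_derivative g') (at t)"
    and P: "(P has_derivative (\<lambda>h. h *\<^sub>C A)) (at (g t))"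
  shows "((\<lambda>t. P (g t)) has_vector_derivative g' *\<^sub>C A) (at t)"
proof -
  have "((P \<circ> g) has_derivative ((\<lambda>h. h *\<^sub>C A) \<circ> (\<lambda>s. s *\<^sub>R g'))) (at t)"
    using g P unfolding has_vector_derivative_def by (rule diff_chain_at)
  moreover have "(\<lambda>h. h *\<^sub>C A) \<circ> (\<lambda>s. s *\<^sub>R g') = (\<lambda>s. s *\<^sub>R (g' *\<^sub>C A))"
  proof (rule ext)
    fix s
    have "(s *\<^sub>R g') *\<^sub>C A = s *\<^sub>R (g' *\<^sub>C A)"
      by (rule blinfun_eqI)
        (simp add: blinfun.bilinear_simps scaleR_conv_of_real scaleC_scaleC[symmetric] scaleC_of_real)
    then show "((\<lambda>h. h *\<^sub>C A) \<circ> (\<lambda>s. s *\<^sub>R g')) s = s *\<^sub>R (g' *\<^sub>C A)" by simp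
  qed
  ultimately show ?thesis unfolding has_vector_derivative_def by (simp add: o_def)
qed

text \<open>Together with norm continuity, holomorphy of the matrix entries is all that the integrals below need;
  identities between them are checked on entries.\<close>

definition weakly_holomorphic :: "complex set \<Rightarrow> (complex \<Rightarrow> 'a::chilbert_space \<Rightarrow>\<^sub>L 'a) \<Rightarrow> bool" where
  "weakly_holomorphic U F \<longleftrightarrow> continuous_on U F \<and>
     (\<forall>x y. (\<lambda>z. cinner (blinfun_apply (F z) x) y) holomorphic_on U)"

lemma bounded_linear_matrix_entry:
  fixes x :: "'a::real_normed_vector" and y :: "'b::chilbert_space"
  shows "bounded_linear (\<lambda>A :: 'a \<Rightarrow>\<^sub>L 'b. cinner (blinfun_apply A x) y)"
  by (rule bounded_linear_compose[OF cinner.bounded_linear_left blinfun.bounded_linear_left])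

lemma continuous_on_scaleC_blinfun:
  fixes F :: "'c::topological_space \<Rightarrow> 'a::real_normed_vector \<Rightarrow>\<^sub>L 'b::chilbert_space"
  assumes "continuous_on S f" "continuous_on S F"
  shows "continuous_on S (\<lambda>z. f z *\<^sub>C F z)"
proof -
  have "bounded_bilinear (\<lambda>(c::complex) (A :: 'a \<Rightarrow>\<^sub>L 'b). c *\<^sub>C A)"
  proof
    show "\<exists>K. \<forall>a (b :: 'a \<Rightarrow>\<^sub>L 'b). norm (a *\<^sub>C b) \<le> norm a * norm b * K"
      by (intro exI[of _ 1]) (simp add: norm_scaleC_blinfun)
    show "(s *\<^sub>R a) *\<^sub>C A = s *\<^sub>R (a *\<^sub>C A)" for s a and A :: "'a \<Rightarrow>\<^sub>L 'b"
      by (rule blinfun_eqI) (simp add: blinfun.bilinear_simps scaleR_conv_of_real scaleC_scaleC[symmetric] scaleC_of_real)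
    show "a *\<^sub>C (s *\<^sub>R A) = s *\<^sub>R (a *\<^sub>C A)" for s a and A :: "'a \<Rightarrow>\<^sub>L 'b"
      by (rule blinfun_eqI) (simp add: blinfun.bilinear_simps scaleC_scaleR)
  qed (simp_all add: scaleC_blinfun_simps)
  then show ?thesis using assms by (rule bounded_bilinear.continuous_on)
qed

lemma blinfun_eqI_cinner:
  assumes "\<And>x y. cinner (blinfun_apply A x) y = cinner (blinfun_apply B x) y" shows "A = B"
  by (rule blinfun_eqI, rule cinner_eqI) (rule assms)

text \<open>On a disc an operator-valued holomorphic function has a primitive, the integral along radii;
  additivity over triangles is checked on matrix entries.\<close>

lemma weakly_holomorphic_primitive:
  fixes F :: "complex \<Rightarrow> 'a::chilbert_space \<Rightarrow>\<^sub>L 'a"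
  assumes F: "weakly_holomorphic (ball z0 d) F"
  shows "\<exists>P. \<forall>w\<in>ball z0 d. (P has_derivative (\<lambda>h. h *\<^sub>C F w)) (at w)"
proof -
  define I where "I w z = integral {0..1} (\<lambda>t. (z - w) *\<^sub>C F (linepath w z t))" for w z
  have cont: "continuous_on (ball z0 d) F" using F by (simp add: weakly_holomorphic_def)
  have seg: "linepath w z t \<in> ball z0 d" if "w \<in> ball z0 d" "z \<in> ball z0 d" "t \<in> {0..1}" for w z t
    using that convex_ball[of z0 d] by (meson closed_segment_subset linepath_in_path subsetD)
  have c: "continuous_on {0..1} (\<lambda>t. (z - w) *\<^sub>C F (linepath w z t))" if "w \<in> ball z0 d" "z \<in> ball z0 d" for w z
    using that seg
    by (intro continuous_on_scaleC_blinfun continuous_on_const continuous_on_compose2[OF cont continuous_on_linepath]) auto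
  have entry: "cinner (blinfun_apply (I w z) x) y = contour_integral (linepath w z) (\<lambda>z. cinner (blinfun_apply (F z) x) y)"
    if "w \<in> ball z0 d" "z \<in> ball z0 d" for w z x y
  proof -
    have "cinner (blinfun_apply (I w z) x) y = integral {0..1} (\<lambda>t. cinner (blinfun_apply ((z - w) *\<^sub>C F (linepath w z t)) x) y)"
      unfolding I_def
      using integral_linear[OF integrable_continuous_real[OF c[OF that]] bounded_linear_matrix_entry[of x y]]
      by (simp add: o_def)
    then show ?thesis
      unfolding contour_integral_integral by (simp add: cinner_scaleC_left vector_derivative_linepath_within mult.commute)
  qed
  have add: "I z0 z - I z0 w = I w z" if wz: "w \<in> ball z0 d" "z \<in> ball z0 d" for w z
  proof (rule blinfun_eqI_cinner)
    fix x y
    let ?f = "\<lambda>z. cinner (blinfun_apply (F z) x) y"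
    have z0: "z0 \<in> ball z0 d" using wz(1) by (simp) (metis dist_commute le_less_trans zero_le_dist)
    have f: "?f holomorphic_on ball z0 d" using F by (simp add: weakly_holomorphic_def)
    have "convex hull {z0, w, z} \<subseteq> ball z0 d" using wz z0 by (intro hull_minimal) auto
    then have "?f holomorphic_on (convex hull {z0, w, z})" by (rule holomorphic_on_subset[OF f])
    from Cauchy_theorem_triangle[OF this]
    have 1: "contour_integral (linepath z0 w +++ linepath w z +++ linepath z z0) ?f = 0"
      by (rule contour_integral_unique)
    have i: "?f contour_integrable_on linepath u v" if "u \<in> ball z0 d" "v \<in> ball z0 d" for u v
      by (rule contour_integrable_holomorphic_simple[OF f open_ball valid_path_linepath])
        (simp only: path_image_linepath closed_segment_subset[OF that convex_ball])
    have "contour_integral (linepath z z0) ?f = - contour_integral (linepath z0 z) ?f"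
      by (rule contour_integral_reverse_linepath
          [OF continuous_on_subset[OF holomorphic_on_imp_continuous_on[OF f] closed_segment_subset[OF wz(2) z0 convex_ball]]])
    then have "contour_integral (linepath z0 z) ?f - contour_integral (linepath z0 w) ?f = contour_integral (linepath w z) ?f"
      using 1 i[OF z0 wz(1)] i[OF wz] i[OF wz(2) z0] by (simp add: algebra_simps)
    then show "cinner (blinfun_apply (I z0 z - I z0 w) x) y = cinner (blinfun_apply (I w z) x) y"
      by (simp only: blinfun.diff_left cinner.diff_left entry[OF z0 wz(1)] entry[OF z0 wz(2)] entry[OF wz])
  qed
  have "(I z0 has_derivative (\<lambda>h. h *\<^sub>C F w)) (at w)" if w: "w \<in> ball z0 d" for w
    unfolding has_derivative_at_alt
  proof (intro conjI allI impI)
    show "bounded_linear (\<lambda>h. h *\<^sub>C F w)"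
      by (rule bounded_linear_intro[of _ "norm (F w)"])
        (auto intro!: blinfun_eqI simp: scaleC_blinfun_simps norm_scaleC_blinfun blinfun.bilinear_simps
          scaleR_conv_of_real scaleC_scaleC[symmetric] scaleC_of_real)
    fix e :: real assume e: "e > 0"
    have "isCont F w" using cont w by (simp add: continuous_on_eq_continuous_at)
    then obtain s where s: "s > 0" "\<And>u. dist u w < s \<Longrightarrow> dist (F u) (F w) < e"
      using e unfolding continuous_at_eps_delta by blast
    obtain s' where s': "s' > 0" "ball w s' \<subseteq> ball z0 d" by (rule openE[OF open_ball w])
    have "norm (I z0 z - I z0 w - (z - w) *\<^sub>C F w) \<le> e * norm (z - w)" if z: "norm (z - w) < min s s'" for z
    proof -
      have zb: "z \<in> ball z0 d" using z s' by (auto simp: dist_norm norm_minus_commute)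
      have "((\<lambda>t. (z - w) *\<^sub>C F (linepath w z t) - (z - w) *\<^sub>C F w) has_integral (I w z - (z - w) *\<^sub>C F w)) (cbox 0 (1::real))"
        unfolding I_def using integrable_integral[OF integrable_continuous_real[OF c[OF w zb]]]
          has_integral_const_real[of "(z - w) *\<^sub>C F w" 0 1]
        by (intro has_integral_diff) auto
      moreover have "norm ((z - w) *\<^sub>C F (linepath w z t) - (z - w) *\<^sub>C F w) \<le> e * norm (z - w)"
        if t: "t \<in> cbox 0 1" for t
      proof -
        have "linepath w z t - w = t *\<^sub>R (z - w)" by (simp add: linepath_def algebra_simps)
        then have "dist (linepath w z t) w = t * norm (z - w)" using t by (simp add: dist_norm)
        also have "\<dots> \<le> 1 * norm (z - w)" using t by (intro mult_right_mono) auto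
        finally have "dist (linepath w z t) w < s" using z by simp
        then have "norm (F (linepath w z t) - F w) \<le> e" using s(2) by (fastforce simp: dist_norm)
        then have "cmod (z - w) * norm (F (linepath w z t) - F w) \<le> cmod (z - w) * e"
          by (intro mult_left_mono) auto
        then show ?thesis
          by (simp add: norm_scaleC_blinfun scaleC_blinfun_simps(7)[symmetric] mult.commute)
      qed
      ultimately have "norm (I w z - (z - w) *\<^sub>C F w) \<le> e * norm (z - w) * measure lborel (cbox 0 (1::real))"
        using e by (intro has_integral_bound) auto
      then show ?thesis using add[OF w zb] by simp
    qed
    then show "\<exists>s>0. \<forall>z. norm (z - w) < s \<longrightarrow> norm (I z0 z - I z0 w - (z - w) *\<^sub>C F w) \<le> e * norm (z - w)"
      using s(1) s'(1) by (intro exI[of _ "min s s'"]) auto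
  qed
  then show ?thesis by blast
qed

text \<open>The derivative of a path is defined piecewise, and integrability of a product with it is not immediate
  for operator values. On a short piece of the path the integrand is the derivative of \<open>P (g t)\<close> for a
  primitive \<open>P\<close>, so the integral exists by the fundamental theorem.\<close>

lemma op_contour_integrable:
  fixes F :: "complex \<Rightarrow> 'a::chilbert_space \<Rightarrow>\<^sub>L 'a"
  assumes g: "valid_path g" "path_image g \<subseteq> U" and U: "open U" and F: "weakly_holomorphic U F"
  shows "(\<lambda>t. vector_derivative g (at t within {0..1}) *\<^sub>C F (g t)) integrable_on {0..1}"
proof -
  obtain S where S: "finite S" "g C1_differentiable_on ({0..1} - S)" and contg: "continuous_on {0..1} g"
    using g(1) unfolding valid_path_def piecewise_C1_differentiable_on_def by blast
  have "\<exists>e>0. \<forall>u v. x \<in> {u..v} \<and> {u..v} \<subseteq> ball x e \<and> {u..v} \<subseteq> {0..1} \<longrightarrow>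
      (\<lambda>t. vector_derivative g (at t within {0..1}) *\<^sub>C F (g t)) integrable_on {u..v}" if x: "x \<in> {0..1}" for x
  proof -
    have "g x \<in> U" using g(2) x unfolding path_image_def by blast
    then obtain d where d: "d > 0" "ball (g x) d \<subseteq> U" using U by (meson openE)
    have "weakly_holomorphic (ball (g x) d) F"
      using F d unfolding weakly_holomorphic_def by (meson continuous_on_subset holomorphic_on_subset)
    then obtain P where P: "\<And>w. w \<in> ball (g x) d \<Longrightarrow> (P has_derivative (\<lambda>h. h *\<^sub>C F w)) (at w)"
      using weakly_holomorphic_primitive by blast
    obtain e where e: "e > 0" "\<And>t. t \<in> {0..1} \<Longrightarrow> dist t x < e \<Longrightarrow> dist (g t) (g x) < d"
      using contg x d(1) unfolding continuous_on_iff by metis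
    have "(\<lambda>t. vector_derivative g (at t within {0..1}) *\<^sub>C F (g t)) integrable_on {u..v}"
      if uv: "x \<in> {u..v}" "{u..v} \<subseteq> ball x e" "{u..v} \<subseteq> {0..1}" for u v
    proof -
      have gb: "g t \<in> ball (g x) d" if "t \<in> {u..v}" for t
      proof -
        have "t \<in> {0..1}" "dist t x < e" using uv that by (auto simp: dist_commute)
        then show ?thesis using e(2) by (simp add: dist_commute)
      qed
      have "continuous_on (ball (g x) d) P"
        by (intro continuous_at_imp_continuous_on ballI) (use P has_derivative_continuous in blast)
      then have cP: "continuous_on {u..v} (\<lambda>t. P (g t))"
        by (rule continuous_on_compose2[OF _ continuous_on_subset[OF contg uv(3)]]) (use gb in auto)
      have "((\<lambda>t. P (g t)) has_vector_derivative vector_derivative g (at t within {0..1}) *\<^sub>C F (g t)) (at t)"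
        if t: "t \<in> {u<..<v} - S" for t
      proof (rule has_derivative_scaleC_path)
        have t01: "t \<in> {u..v}" "0 < t" "t < 1"
        proof -
          have "u \<in> {0..1}" "v \<in> {0..1}" using uv(1,3) by auto
          then show "t \<in> {u..v}" "0 < t" "t < 1" using t by auto
        qed
        have "g differentiable at t" using S(2) t t01 unfolding C1_differentiable_on_eq by auto
        then have "(g has_vector_derivative vector_derivative g (at t)) (at t)"
          by (simp add: vector_derivative_works)
        then show "(g has_vector_derivative vector_derivative g (at t within {0..1})) (at t)"
          using at_within_Icc_at[OF t01(2,3)] by simp
        show "(P has_derivative (\<lambda>h. h *\<^sub>C F (g t))) (at (g t))" using gb t01 P by blast
      qed
      then have "((\<lambda>t. vector_derivative g (at t within {0..1}) *\<^sub>C F (g t)) has_integral (P (g v) - P (g u))) {u..v}"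
        using uv(1) by (intro fundamental_theorem_of_calculus_interior_strong[OF S(1) _ _ cP]) auto
      then show ?thesis by blast
    qed
    then show ?thesis using e(1) by blast
  qed
  then show ?thesis
    using integrable_on_little_subintervals[of 0 1 "\<lambda>t. vector_derivative g (at t within {0..1}) *\<^sub>C F (g t)"]
    by simp
qed

lemma cinner_op_contour_integral:
  fixes F :: "complex \<Rightarrow> 'a::chilbert_space \<Rightarrow>\<^sub>L 'a"
  assumes "valid_path g" "path_image g \<subseteq> U" "open U" "weakly_holomorphic U F"
  shows "cinner (blinfun_apply (op_contour_integral g F) x) y
    = contour_integral g (\<lambda>z. cinner (blinfun_apply (F z) x) y)"
proof -
  have "((\<lambda>t. vector_derivative g (at t within {0..1}) *\<^sub>C F (g t)) has_integral op_contour_integral g F) {0..1}"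
    unfolding op_contour_integral_def by (rule integrable_integral[OF op_contour_integrable[OF assms]])
  from has_integral_linear[OF this bounded_linear_matrix_entry[of x y]]
  have "((\<lambda>z. cinner (blinfun_apply (F z) x) y) has_contour_integral
      cinner (blinfun_apply (op_contour_integral g F) x) y) g"
    unfolding has_contour_integral_def by (simp only: o_def blinfun_apply_scaleC cinner_scaleC_left mult.commute)
  then show ?thesis by (rule contour_integral_unique[symmetric])
qed

lemma entry_sum_list:
  "cinner (blinfun_apply (\<Sum>g\<leftarrow>gs. A g) x) y = (\<Sum>g\<leftarrow>gs. cinner (blinfun_apply (A g) x) y)"
  by (induction gs) (simp_all add: blinfun.add_left cinner_add_left)

section \<open>Independence of the Riesz--Dunford integral from the cycle\<close>

definition dunford :: "(real \<Rightarrow> complex) list \<Rightarrow> (complex \<Rightarrow> complex) \<Rightarrow> ('a::chilbert_space \<Rightarrow>\<^sub>L 'a) \<Rightarrow> ('a \<Rightarrow>\<^sub>L 'a)" where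
  "dunford gs f T = (1 / (2 * complex_of_real pi * \<i>)) *\<^sub>C
     (\<Sum>\<gamma>\<leftarrow>gs. op_contour_integral \<gamma> (\<lambda>z. f z *\<^sub>C op_inv (z *\<^sub>C id_blinfun - T)))"

lemma surrounds_iff:
  "surrounds gs S U \<longleftrightarrow> cycle_in (U - S) gs \<and> (\<forall>z\<in>S. cycle_winding gs z = 1) \<and> (\<forall>z. z \<notin> U \<longrightarrow> cycle_winding gs z = 0)"
  unfolding surrounds_def cycle_in_def cycle_winding_def by auto

lemma dunford_entry:
  assumes T: "clinear_op T" and U: "open U" "f holomorphic_on U" and gs: "cycle_in (U - op_spectrum T) gs"
  shows "cinner (blinfun_apply (dunford gs f T) x) y
    = 1 / (2 * complex_of_real pi * \<i>) * cycle_integral gs (\<lambda>z. f z * cinner (blinfun_apply (resolvent T z) x) y)"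
proof -
  let ?F = "\<lambda>z. f z *\<^sub>C op_inv (z *\<^sub>C id_blinfun - T)"
  have op: "open (U - op_spectrum T)" using U(1) closed_op_spectrum[OF T] by (rule open_Diff)
  have hol: "f holomorphic_on (U - op_spectrum T)" by (rule holomorphic_on_subset[OF U(2)]) auto
  have wh: "weakly_holomorphic (U - op_spectrum T) ?F"
    unfolding weakly_holomorphic_def resolvent_def[symmetric]
  proof (intro conjI allI)
    show "continuous_on (U - op_spectrum T) (\<lambda>z. f z *\<^sub>C resolvent T z)"
      by (intro continuous_on_scaleC_blinfun holomorphic_on_imp_continuous_on[OF hol]
          continuous_on_subset[OF continuous_on_resolvent[OF T]]) auto
    fix x y
    have "(\<lambda>z. cinner (blinfun_apply (resolvent T z) x) y) holomorphic_on (U - op_spectrum T)"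
      by (rule holomorphic_on_subset[OF resolvent_weakly_holomorphic[OF T]]) auto
    then show "(\<lambda>z. cinner (blinfun_apply (f z *\<^sub>C resolvent T z) x) y) holomorphic_on (U - op_spectrum T)"
      unfolding blinfun_apply_scaleC cinner_scaleC_left by (intro holomorphic_on_mult hol)
  qed
  have "cinner (blinfun_apply (op_contour_integral g ?F) x) y
      = contour_integral g (\<lambda>z. f z * cinner (blinfun_apply (resolvent T z) x) y)" if "g \<in> set gs" for g
  proof -
    have "valid_path g" "path_image g \<subseteq> U - op_spectrum T" using gs that unfolding cycle_in_def by auto
    from cinner_op_contour_integral[OF this op wh]
    show ?thesis by (simp add: resolvent_def cinner_scaleC_left)
  qed
  then have "(\<Sum>g\<leftarrow>gs. cinner (blinfun_apply (op_contour_integral g ?F) x) y)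
      = cycle_integral gs (\<lambda>z. f z * cinner (blinfun_apply (resolvent T z) x) y)"
    unfolding cycle_integral_def by (intro arg_cong[of _ _ sum_list] map_cong refl) auto
  then show ?thesis
    unfolding dunford_def blinfun_apply_scaleC cinner_scaleC_left entry_sum_list by simp
qed

text \<open>One cycle followed by the reverse of the other has winding number 0 about the spectrum and outside the two
  neighbourhoods; Cauchy's theorem for cycles applies on their union without the spectrum.\<close>

lemma dunford_unique:
  assumes T: "clinear_op T"
    and U: "open U" "op_spectrum T \<subseteq> U" "f holomorphic_on U" "surrounds gs (op_spectrum T) U"
    and V: "open V" "op_spectrum T \<subseteq> V" "f holomorphic_on V" "surrounds hs (op_spectrum T) V"
  shows "dunford gs f T = dunford hs f T"
proof (rule blinfun_eqI_cinner)
  fix x y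
  let ?S = "op_spectrum T"
  let ?g = "\<lambda>z. f z * cinner (blinfun_apply (resolvent T z) x) y"
  note U' = U(4)[unfolded surrounds_iff] and V' = V(4)[unfolded surrounds_iff]
  define W where "W = (U \<union> V) - ?S"
  have opW: "open W" unfolding W_def using U(1) V(1) closed_op_spectrum[OF T] by (intro open_Diff open_Un)
  have f: "f holomorphic_on W"
    by (rule holomorphic_on_subset[OF holomorphic_on_Un[OF U(3) V(3) U(1) V(1)]]) (auto simp: W_def)
  have g: "?g holomorphic_on W"
    by (intro holomorphic_on_mult f holomorphic_on_subset[OF resolvent_weakly_holomorphic[OF T]]) (auto simp: W_def)
  let ?c = "gs @ map reversepath hs"
  have hs: "cycle_in W hs" by (rule cycle_in_subset[of "V - ?S"]) (use V' in \<open>auto simp: W_def\<close>)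
  have gs: "cycle_in W gs" by (rule cycle_in_subset[of "U - ?S"]) (use U' in \<open>auto simp: W_def\<close>)
  have c: "cycle_in W ?c"
    unfolding cycle_in_def
  proof
    fix g assume "g \<in> set ?c"
    then consider "g \<in> set gs" | h where "h \<in> set hs" "g = reversepath h" by auto
    then show "valid_path g \<and> pathfinish g = pathstart g \<and> path_image g \<subseteq> W"
      by cases (use gs hs in \<open>simp_all add: cycle_in_def\<close>)
  qed
  have rev_w: "cycle_winding (map reversepath hs) z = - cycle_winding hs z" if z: "\<And>h. h \<in> set hs \<Longrightarrow> z \<notin> path_image h" for z
  proof -
    have "map (\<lambda>g. winding_number g z) (map reversepath hs) = map (\<lambda>h. - winding_number h z) hs"
      using hs z unfolding cycle_in_def by (auto intro!: winding_number_reversepath valid_path_imp_path)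
    then show ?thesis unfolding cycle_winding_def by (simp only: uminus_sum_list_map o_def)
  qed
  have rev_i: "cycle_integral (map reversepath hs) ?g = - cycle_integral hs ?g"
  proof -
    have "map (\<lambda>g. contour_integral g ?g) (map reversepath hs) = map (\<lambda>h. - contour_integral h ?g) hs"
      using hs unfolding cycle_in_def by (auto intro!: contour_integral_reversepath)
    then show ?thesis unfolding cycle_integral_def by (simp only: uminus_sum_list_map o_def)
  qed
  have "cycle_integral ?c ?g = 0"
  proof (rule cauchy_cycle[OF opW g c])
    fix z assume z: "z \<notin> W"
    have zh: "z \<notin> path_image h" if "h \<in> set hs" for h using hs that z unfolding cycle_in_def by auto
    have "cycle_winding gs z = cycle_winding hs z"
      using z U' V' U(2) V(2) unfolding W_def by auto
    then show "cycle_winding ?c z = 0" using rev_w[OF zh] unfolding cycle_winding_def by simp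
  qed
  then have "cycle_integral gs ?g = cycle_integral hs ?g"
    using rev_i unfolding cycle_integral_def by simp
  then show "cinner (blinfun_apply (dunford gs f T) x) y = cinner (blinfun_apply (dunford hs f T) x) y"
    using U' V' by (simp add: dunford_entry[OF T U(1,3)] dunford_entry[OF T V(1,3)])
qed

lemma hol_calc_eq_dunford:
  assumes T: "clinear_op T"
    and U: "open U" "op_spectrum T \<subseteq> U" "f holomorphic_on U" "surrounds gs (op_spectrum T) U"
  shows "hol_calc f T = dunford gs f T"
  unfolding hol_calc_def dunford_def[symmetric]
proof (rule the_equality)
  show "\<exists>V hs. open V \<and> op_spectrum T \<subseteq> V \<and> f holomorphic_on V \<and> surrounds hs (op_spectrum T) V \<and>
      dunford gs f T = dunford hs f T" using U by blast
  fix S assume "\<exists>V hs. open V \<and> op_spectrum T \<subseteq> V \<and> f holomorphic_on V \<and>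
      surrounds hs (op_spectrum T) V \<and> S = dunford hs f T"
  then obtain V hs where V: "open V" "op_spectrum T \<subseteq> V" "f holomorphic_on V"
    "surrounds hs (op_spectrum T) V" "S = dunford hs f T" by blast
  show "S = dunford gs f T" unfolding V(5) by (rule dunford_unique[OF T V(1-4) U])
qed

definition ring_cycle :: "real \<Rightarrow> real \<Rightarrow> (real \<Rightarrow> complex) list" where
  "ring_cycle \<rho> R = [circlepath 0 R, reversepath (circlepath 0 \<rho>)]"

lemma ring_cycle_in:
  assumes "0 < \<rho>" "0 < R" "\<And>z. cmod z = \<rho> \<or> cmod z = R \<Longrightarrow> z \<in> U"
  shows "cycle_in U (ring_cycle \<rho> R)"
  using assms unfolding cycle_in_def ring_cycle_def by auto

lemma winding_circle_outside:
  assumes "0 < R" "R < cmod z" shows "winding_number (circlepath 0 R) z = 0"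
  by (rule winding_number_zero_outside[of _ "cball 0 R"]) (use assms in auto)

lemma ring_cycle_winding:
  assumes "0 < \<rho>" "\<rho> < R"
  shows "\<rho> < cmod z \<Longrightarrow> cmod z < R \<Longrightarrow> cycle_winding (ring_cycle \<rho> R) z = 1"
    "cmod z < \<rho> \<or> R < cmod z \<Longrightarrow> cycle_winding (ring_cycle \<rho> R) z = 0"
proof -
  have rev: "winding_number (reversepath (circlepath 0 \<rho>)) z = - winding_number (circlepath 0 \<rho>) z" if "cmod z \<noteq> \<rho>"
    using that assms by (intro winding_number_reversepath) auto
  show "\<rho> < cmod z \<Longrightarrow> cmod z < R \<Longrightarrow> cycle_winding (ring_cycle \<rho> R) z = 1"
    using rev assms winding_circle_outside[of \<rho> z] winding_number_circlepath[of z 0 R]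
    by (simp add: cycle_winding_def ring_cycle_def)
  show "cmod z < \<rho> \<or> R < cmod z \<Longrightarrow> cycle_winding (ring_cycle \<rho> R) z = 0"
    using rev assms winding_circle_outside[of \<rho> z] winding_circle_outside[of R z]
      winding_number_circlepath[of z 0 R] winding_number_circlepath[of z 0 \<rho>]
    by (auto simp: cycle_winding_def ring_cycle_def)
qed

lemma ring_cycle_integral:
  "cycle_integral (ring_cycle \<rho> R) f = contour_integral (circlepath 0 R) f - contour_integral (circlepath 0 \<rho>) f"
  by (simp add: cycle_integral_def ring_cycle_def contour_integral_reversepath)

lemma ring_cauchy:
  assumes "0 < \<rho>" "\<rho> < R" "open U" "f holomorphic_on U" "\<And>z. \<rho> \<le> cmod z \<Longrightarrow> cmod z \<le> R \<Longrightarrow> z \<in> U"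
  shows "contour_integral (circlepath 0 R) f = contour_integral (circlepath 0 \<rho>) f"
proof -
  have "cycle_integral (ring_cycle \<rho> R) f = 0"
  proof (rule cauchy_cycle[OF assms(3,4)])
    show "cycle_in U (ring_cycle \<rho> R)" using assms by (intro ring_cycle_in) auto
    show "cycle_winding (ring_cycle \<rho> R) z = 0" if "z \<notin> U" for z
      using assms(5)[of z] that by (intro ring_cycle_winding(2) assms) force
  qed
  then show ?thesis by (simp add: ring_cycle_integral)
qed

section \<open>Laurent polynomials of an annular operator\<close>

definition annular_op :: "real \<Rightarrow> ('a::chilbert_space \<Rightarrow>\<^sub>L 'a) \<Rightarrow> ('a \<Rightarrow>\<^sub>L 'a) \<Rightarrow> bool" where
  "annular_op r T B \<longleftrightarrow> clinear_op T \<and> is_inverse_op T B \<and> norm T \<le> 1 \<and> norm B \<le> 1 / r"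

lemma is_inverse_scaleC_id:
  "c \<noteq> 0 \<Longrightarrow> is_inverse_op (c *\<^sub>C (id_blinfun :: 'a::chilbert_space \<Rightarrow>\<^sub>L 'a)) ((1 / c) *\<^sub>C id_blinfun)"
  by (rule is_inverse_opI) (auto intro: clin simp: scaleC_scaleC)

text \<open>Neumann series of \<open>1 - T/z\<close> outside the unit disc and of \<open>1 - z T\<^sup>-\<^sup>1\<close> inside the disc of radius \<open>r\<close>.\<close>

lemma annular_op_spectrum:
  assumes "annular_op r T B" "0 < r" "z \<in> op_spectrum T"
  shows "r \<le> cmod z \<and> cmod z \<le> 1"
proof (rule ccontr)
  assume neg: "\<not> (r \<le> cmod z \<and> cmod z \<le> 1)"
  have T: "clinear_op T" "is_inverse_op T B" "norm T \<le> 1" "norm B \<le> 1 / r" "clinear_op B"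
    using assms(1) by (auto simp: annular_op_def is_inverse_op_def)
  have "\<exists>A. is_inverse_op (z *\<^sub>C id_blinfun - T) A"
  proof (cases "cmod z \<le> 1")
    case False
    then have z: "z \<noteq> 0" by auto
    have "norm ((1 / z) *\<^sub>C T) = norm T / cmod z"
      by (simp add: norm_scaleC_blinfun norm_divide)
    also have "\<dots> < 1" using T(3) False by (simp add: divide_less_eq)
    finally obtain A where A: "is_inverse_op (id_blinfun - (1 / z) *\<^sub>C T) A"
      using neumann_series[of "(1 / z) *\<^sub>C T"] T(1) by (blast intro: clin)
    have "z *\<^sub>C id_blinfun - T = (z *\<^sub>C id_blinfun) o\<^sub>L (id_blinfun - (1 / z) *\<^sub>C T)"
      using z by (intro blinfun_eqI) (simp add: blinfun.bilinear_simps scaleC_diff_right scaleC_scaleC)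
    then show ?thesis using is_inverse_op_compose[OF is_inverse_scaleC_id[OF z] A] by auto
  next
    case True
    then have zr: "cmod z < r" using neg by simp
    have "norm (z *\<^sub>C B) = cmod z * norm B" by (simp add: norm_scaleC_blinfun)
    also have "\<dots> \<le> cmod z * (1 / r)" using T(4) by (intro mult_left_mono) auto
    also have "\<dots> < 1" using zr assms(2) by simp
    finally obtain A where A: "is_inverse_op (id_blinfun - z *\<^sub>C B) A"
      using neumann_series[of "z *\<^sub>C B"] T(5) by (blast intro: clin)
    have "is_inverse_op (- T) (- B)"
      using is_inverse_op_apply[OF T(2)] T(5) by (intro is_inverse_opI) (auto intro: clin simp: blinfun.bilinear_simps)
    moreover have "z *\<^sub>C id_blinfun - T = (- T) o\<^sub>L (id_blinfun - z *\<^sub>C B)"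
      using is_inverse_op_apply[OF T(2)]
      by (intro blinfun_eqI) (simp add: blinfun.bilinear_simps clinear_opD[OF T(1)])
    ultimately show ?thesis using is_inverse_op_compose[OF _ A] by auto
  qed
  then show False using assms(3) by (simp add: op_spectrum_def)
qed

lemma contour_integral_bound_circlepath:
  assumes "f contour_integrable_on circlepath z r" "0 \<le> B" "0 < r"
    and "\<And>x. cmod (x - z) = r \<Longrightarrow> cmod (f x) \<le> B"
  shows "cmod (contour_integral (circlepath z r) f) \<le> B * (2 * pi * r)"
  using has_contour_integral_bound_circlepath[OF has_contour_integral_integral[OF assms(1)]] assms by blast

text \<open>The moments \<open>\<oint> z\<^sup>k (z - T)\<^sup>-\<^sup>1 dz\<close> over the ring obey the recursion of the powers of \<open>T\<close>; only the
  moment of order 0 has to be computed, and it is \<open>2 \<pi> \<i>\<close> because the resolvent is holomorphic inside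
  the inner circle and asymptotic to \<open>1/z\<close> at infinity.\<close>

locale annular_resolvent =
  fixes r \<rho> R :: real and T B :: "'a::chilbert_space \<Rightarrow>\<^sub>L 'a" and y :: 'a
  assumes ann: "annular_op r T B" and r: "0 < r" "r < 1" and radii: "0 < \<rho>" "\<rho> < r" "1 < R"
begin

definition entry :: "'a \<Rightarrow> complex \<Rightarrow> complex" where
  "entry x z = cinner (blinfun_apply (resolvent T z) x) y"

definition ring_int :: "(complex \<Rightarrow> complex) \<Rightarrow> complex" where
  "ring_int f = contour_integral (circlepath 0 R) f - contour_integral (circlepath 0 \<rho>) f"

definition V :: "complex set" where "V = - op_spectrum T - {0}"

lemma Tcl: "clinear_op T" and Binv: "is_inverse_op T B" and nT: "norm T \<le> 1"
  using ann by (auto simp: annular_op_def)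

lemma off_spectrum: "cmod z < r \<or> 1 < cmod z \<Longrightarrow> z \<notin> op_spectrum T"
  using annular_op_spectrum[OF ann r(1), of z] by auto

lemma V_open: "open V"
  unfolding V_def using closed_op_spectrum[OF Tcl] by (intro open_Diff open_Compl) auto

lemma circles_V: "cmod z = R \<or> cmod z = \<rho> \<Longrightarrow> z \<in> V"
  using off_spectrum[of z] radii r unfolding V_def by auto

lemma entry_holomorphic: "entry x holomorphic_on - op_spectrum T"
  unfolding entry_def[abs_def] by (rule resolvent_weakly_holomorphic[OF Tcl])

lemma entry_holomorphic_V: "entry x holomorphic_on V"
  by (rule holomorphic_on_subset[OF entry_holomorphic]) (auto simp: V_def)

lemma powi_holomorphic_V: "(\<lambda>z. z powi k) holomorphic_on V"
  by (intro holomorphic_intros) (auto simp: V_def)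

lemma integrable_circles:
  assumes "f holomorphic_on V"
  shows "f contour_integrable_on circlepath 0 R" "f contour_integrable_on circlepath 0 \<rho>"
  using circles_V radii
  by (auto intro!: contour_integrable_holomorphic_simple[OF assms V_open])

lemma ring_int_add:
  "f holomorphic_on V \<Longrightarrow> g holomorphic_on V \<Longrightarrow> ring_int (\<lambda>z. f z + g z) = ring_int f + ring_int g"
  unfolding ring_int_def by (simp add: contour_integral_add integrable_circles)

lemma ring_int_cmul: "f holomorphic_on V \<Longrightarrow> ring_int (\<lambda>z. c * f z) = c * ring_int f"
  unfolding ring_int_def by (simp add: contour_integral_lmul integrable_circles algebra_simps)

lemma ring_int_sum:
  "finite I \<Longrightarrow> (\<And>i. i \<in> I \<Longrightarrow> f i holomorphic_on V) \<Longrightarrow> ring_int (\<lambda>z. \<Sum>i\<in>I. f i z) = (\<Sum>i\<in>I. ring_int (f i))"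
  unfolding ring_int_def by (simp add: contour_integral_sum integrable_circles sum_subtractf)

lemma ring_int_cong:
  assumes "\<And>z. z \<in> V \<Longrightarrow> f z = g z" shows "ring_int f = ring_int g"
proof -
  have "contour_integral (circlepath 0 R) f = contour_integral (circlepath 0 R) g"
    "contour_integral (circlepath 0 \<rho>) f = contour_integral (circlepath 0 \<rho>) g"
    using circles_V radii by (auto intro!: contour_integral_cong assms)
  then show ?thesis by (simp add: ring_int_def)
qed

lemma ring_int_powi: "ring_int (\<lambda>z. z powi k) = 0"
proof -
  have "contour_integral (circlepath 0 R) (\<lambda>z. z powi k) = contour_integral (circlepath 0 \<rho>) (\<lambda>z. z powi k)"
    using radii r by (intro ring_cauchy[of _ _ "- {0}"] holomorphic_intros) auto
  then show ?thesis by (simp add: ring_int_def)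
qed

lemma entry_recursion: "z \<in> V \<Longrightarrow> z * entry x z = cinner x y + entry (blinfun_apply T x) z"
proof -
  assume "z \<in> V"
  then have "z \<notin> op_spectrum T" by (simp add: V_def)
  from resolvent_apply(2)[OF this, of x] show ?thesis
    unfolding entry_def by (simp add: cinner.diff_left cinner_scaleC_left)
qed

lemma moment_recursion:
  "ring_int (\<lambda>z. z powi (k + 1) * entry x z) = ring_int (\<lambda>z. z powi k * entry (blinfun_apply T x) z)"
proof -
  have "ring_int (\<lambda>z. z powi (k + 1) * entry x z)
      = ring_int (\<lambda>z. cinner x y * z powi k + z powi k * entry (blinfun_apply T x) z)"
  proof (rule ring_int_cong)
    fix z assume z: "z \<in> V"
    then have "z powi (k + 1) = z powi k * z" by (simp add: V_def power_int_add)
    then show "z powi (k + 1) * entry x z = cinner x y * z powi k + z powi k * entry (blinfun_apply T x) z"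
      using entry_recursion[OF z, of x] by (simp add: mult.assoc) (simp add: algebra_simps)
  qed
  also have "\<dots> = ring_int (\<lambda>z. cinner x y * z powi k) + ring_int (\<lambda>z. z powi k * entry (blinfun_apply T x) z)"
    by (intro ring_int_add holomorphic_on_mult holomorphic_on_const powi_holomorphic_V entry_holomorphic_V)
  also have "ring_int (\<lambda>z. cinner x y * z powi k) = 0"
    by (simp add: ring_int_cmul powi_holomorphic_V ring_int_powi)
  finally show ?thesis by simp
qed

text \<open>The integrand decays like \<open>1 / |z|\<^sup>2\<close>, and the radius of the circle can be increased.\<close>

lemma outer_tail: "contour_integral (circlepath 0 R) (\<lambda>z. entry x z / z) = 0"
proof -
  define C where "C = norm x * norm y"
  let ?f = "\<lambda>z. entry x z / z"
  have fV: "?f holomorphic_on V"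
    by (intro holomorphic_on_divide entry_holomorphic_V holomorphic_on_ident) (auto simp: V_def)
  have big: "norm (contour_integral (circlepath 0 R) ?f) \<le> 2 * pi * C / (R' - 1)" if R': "R < R'" for R'
  proof -
    have sub: "z \<in> V" if "R \<le> cmod z" for z using off_spectrum[of z] that radii unfolding V_def by auto
    have "contour_integral (circlepath 0 R') ?f = contour_integral (circlepath 0 R) ?f"
      using R' radii r sub by (intro ring_cauchy[OF _ _ V_open fV]) auto
    moreover have "norm (contour_integral (circlepath 0 R') ?f) \<le> (C / ((R' - 1) * R')) * (2 * pi * R')"
    proof (rule contour_integral_bound_circlepath)
      show "?f contour_integrable_on circlepath 0 R'"
        using sub R' radii by (intro contour_integrable_holomorphic_simple[OF fV V_open]) auto
      show "0 \<le> C / ((R' - 1) * R')" using R' radii unfolding C_def by simp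
      show "0 < R'" using R' radii by simp
      fix z assume z: "cmod (z - 0) = R'"
      then have zs: "z \<notin> op_spectrum T" using off_spectrum[of z] R' radii by auto
      define v where "v = blinfun_apply (resolvent T z) x"
      have "norm (z *\<^sub>C v) \<le> norm x + norm (blinfun_apply T v)"
        unfolding v_def resolvent_apply(1)[OF zs] by (rule norm_triangle_ineq)
      moreover have "norm (blinfun_apply T v) \<le> norm v"
        using norm_blinfun[of T v] mult_right_mono[OF nT, of "norm v"] by simp
      ultimately have "(R' - 1) * norm v \<le> norm x" using z by (simp add: norm_scaleC algebra_simps)
      then have "norm v \<le> norm x / (R' - 1)" using R' radii by (simp add: field_simps)
      moreover have "cmod (entry x z) \<le> norm v * norm y" unfolding entry_def v_def by (rule norm_cinner_le)
      ultimately have "cmod (entry x z) \<le> C / (R' - 1)"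
        using mult_right_mono[of "norm v" "norm x / (R' - 1)" "norm y"] unfolding C_def by simp
      then have "cmod (entry x z) / R' \<le> C / (R' - 1) / R'"
        using R' radii by (intro divide_right_mono) auto
      then show "cmod (entry x z / z) \<le> C / ((R' - 1) * R')" using z by (simp add: norm_divide)
    qed
    moreover have "(C / ((R' - 1) * R')) * (2 * pi * R') = 2 * pi * C / (R' - 1)"
      using R' radii by (simp add: field_simps)
    ultimately show ?thesis by simp
  qed
  have C0: "0 \<le> C" by (simp add: C_def)
  have "norm (contour_integral (circlepath 0 R) ?f) \<le> 0 + e" if e: "e > 0" for e
  proof -
    define R' where "R' = R + 1 + 2 * pi * C / e"
    have pos: "0 \<le> 2 * pi * C / e" using C0 e by simp
    have "2 * pi * C / (R' - 1) \<le> e"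
    proof -
      have "2 * pi * C / e \<le> R' - 1" "0 < R' - 1" unfolding R'_def using radii pos by auto
      then show ?thesis using e by (simp add: field_simps)
    qed
    then show ?thesis using big[of R'] pos unfolding R'_def by simp
  qed
  then have "norm (contour_integral (circlepath 0 R) ?f) \<le> 0" by (rule field_le_epsilon)
  then show ?thesis by simp
qed

lemma moment_0: "ring_int (entry x) = 2 * of_real pi * \<i> * cinner x y"
proof -
  have inner: "contour_integral (circlepath 0 \<rho>) (entry x) = 0"
  proof -
    have "entry x holomorphic_on ball 0 r"
      by (rule holomorphic_on_subset[OF entry_holomorphic]) (use off_spectrum in auto)
    then have "(entry x has_contour_integral 0) (circlepath 0 \<rho>)"
      using radii r by (intro Cauchy_theorem_convex_simple[of _ "ball 0 r"]) auto
    then show ?thesis by (rule contour_integral_unique)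
  qed
  have h1: "(\<lambda>z. cinner x y * (1 / z)) holomorphic_on V"
    by (intro holomorphic_intros) (auto simp: V_def)
  have h2: "(\<lambda>z. entry (blinfun_apply T x) z / z) holomorphic_on V"
    by (intro holomorphic_on_divide entry_holomorphic_V holomorphic_on_ident) (auto simp: V_def)
  have "contour_integral (circlepath 0 R) (entry x)
      = contour_integral (circlepath 0 R) (\<lambda>z. cinner x y * (1 / z) + entry (blinfun_apply T x) z / z)"
  proof (rule contour_integral_cong[OF refl])
    fix z assume "z \<in> path_image (circlepath 0 R)"
    then have z: "z \<in> V" using circles_V radii by auto
    then have "z \<noteq> 0" by (auto simp: V_def)
    then show "entry x z = cinner x y * (1 / z) + entry (blinfun_apply T x) z / z"
      using entry_recursion[OF z, of x] by (simp add: field_simps)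
  qed
  also have "\<dots> = contour_integral (circlepath 0 R) (\<lambda>z. cinner x y * (1 / z))
      + contour_integral (circlepath 0 R) (\<lambda>z. entry (blinfun_apply T x) z / z)"
    by (intro contour_integral_add integrable_circles h1 h2)
  also have "contour_integral (circlepath 0 R) (\<lambda>z. cinner x y * (1 / z)) = cinner x y * (2 * of_real pi * \<i>)"
  proof -
    have i: "(\<lambda>z. 1 / z) holomorphic_on V" by (intro holomorphic_intros) (auto simp: V_def)
    have "contour_integral (circlepath 0 R) (\<lambda>z. 1 / (z - 0)) = 2 * of_real pi * \<i> * winding_number (circlepath 0 R) 0"
      using radii by (subst winding_number_valid_path) auto
    then have "contour_integral (circlepath 0 R) (\<lambda>z. 1 / z) = 2 * of_real pi * \<i>"
      using radii by (simp add: winding_number_circlepath_centre)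
    then show ?thesis by (simp only: contour_integral_lmul[OF integrable_circles(1)[OF i]])
  qed
  finally have "contour_integral (circlepath 0 R) (entry x) = cinner x y * (2 * of_real pi * \<i>)"
    by (simp add: outer_tail)
  then show ?thesis unfolding ring_int_def inner by simp
qed

lemma moment: "ring_int (\<lambda>z. z powi k * entry x z) = 2 * of_real pi * \<i> * cinner (blinfun_apply (int_power T B k) x) y"
proof -
  have pos: "ring_int (\<lambda>z. z powi (int n) * entry x z) = 2 * of_real pi * \<i> * cinner (blinfun_apply (op_power T n) x) y" for n x
  proof (induction n arbitrary: x)
    case 0
    then show ?case by (simp add: moment_0)
  next
    case (Suc n)
    have "blinfun_apply (op_power T n) (blinfun_apply T x) = blinfun_apply (op_power T (Suc n)) x"
      using op_power_commute[of T n] by (metis blinfun_apply_blinfun_compose op_power.simps(2))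
    then show ?case using moment_recursion[of "int n" x] Suc[of "blinfun_apply T x"] by (simp add: add.commute)
  qed
  have neg: "ring_int (\<lambda>z. z powi (- int n) * entry x z) = 2 * of_real pi * \<i> * cinner (blinfun_apply (op_power B n) x) y" for n x
  proof (induction n arbitrary: x)
    case 0
    then show ?case by (simp add: moment_0)
  next
    case (Suc n)
    have 1: "blinfun_apply (op_power B n) (blinfun_apply B x) = blinfun_apply (op_power B (Suc n)) x"
      using op_power_commute[of B n] by (metis blinfun_apply_blinfun_compose op_power.simps(2))
    have 2: "- int (Suc n) + 1 = - int n" by simp
    have "ring_int (\<lambda>z. z powi (- int (Suc n) + 1) * entry (blinfun_apply B x) z)
        = ring_int (\<lambda>z. z powi (- int (Suc n)) * entry x z)"
      using moment_recursion[of "- int (Suc n)" "blinfun_apply B x"] is_inverse_op_apply(1)[OF Binv] by simp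
    then have "ring_int (\<lambda>z. z powi (- int (Suc n)) * entry x z) = ring_int (\<lambda>z. z powi (- int n) * entry (blinfun_apply B x) z)"
      unfolding 2 by simp
    also have "\<dots> = 2 * of_real pi * \<i> * cinner (blinfun_apply (op_power B n) (blinfun_apply B x)) y" by (rule Suc)
    finally show ?case unfolding 1 .
  qed
  show ?thesis
  proof (cases "0 \<le> k")
    case True
    then show ?thesis using pos[of "nat k" x] by (simp add: int_power_def)
  next
    case False
    then show ?thesis using neg[of "nat (- k)" x] by (simp add: int_power_def)
  qed
qed

lemma entry_scaled_sum:
  "cinner (blinfun_apply (\<Sum>k\<in>I. c k *\<^sub>C A k) x) z = (\<Sum>k\<in>I. c k * cinner (blinfun_apply (A k) x) z)"
  by (induction I rule: infinite_finite_induct) (simp_all add: blinfun.add_left cinner_add_left cinner_scaleC_left)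

lemma ring_int_laurent:
  "ring_int (\<lambda>z. laurent_fun p n z * entry x z) = 2 * of_real pi * \<i> * cinner (blinfun_apply (laurent_op p n T B) x) y"
proof -
  define N where "N = n + degree p"
  have N: "n \<le> N" "degree p \<le> N + n" unfolding N_def by auto
  let ?I = "{- int N..int N}" and ?c = "laurent_coeff p n"
  have "ring_int (\<lambda>z. laurent_fun p n z * entry x z) = ring_int (\<lambda>z. \<Sum>k\<in>?I. ?c k * (z powi k * entry x z))"
    by (rule ring_int_cong)
      (auto simp: V_def laurent_fun_sum[OF _ N] sum_distrib_right mult.assoc)
  also have "\<dots> = (\<Sum>k\<in>?I. ?c k * ring_int (\<lambda>z. z powi k * entry x z))"
    by (simp add: ring_int_sum ring_int_cmul holomorphic_on_mult powi_holomorphic_V entry_holomorphic_V)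
  also have "\<dots> = 2 * of_real pi * \<i> * (\<Sum>k\<in>?I. ?c k * cinner (blinfun_apply (int_power T B k) x) y)"
    unfolding moment by (simp add: sum_distrib_left mult_ac)
  also have "(\<Sum>k\<in>?I. ?c k * cinner (blinfun_apply (int_power T B k) x) y) = cinner (blinfun_apply (laurent_op p n T B) x) y"
    unfolding laurent_op_sum[OF Binv N] entry_scaled_sum ..
  finally show ?thesis .
qed

text \<open>The bound \<open>M\<close> is uniform in \<open>f\<close> and \<open>g\<close>, so that \<open>g\<close> can run through approximations of \<open>f\<close>.\<close>

lemma ring_int_bound:
  obtains M where "0 \<le> M" "\<And>f g e W. open W \<Longrightarrow> (\<And>z. cmod z = R \<or> cmod z = \<rho> \<Longrightarrow> z \<in> W) \<Longrightarrow> W \<subseteq> V \<Longrightarrow>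
      f holomorphic_on W \<Longrightarrow> g holomorphic_on W \<Longrightarrow> 0 \<le> e \<Longrightarrow>
      (\<And>z. cmod z = R \<or> cmod z = \<rho> \<Longrightarrow> cmod (g z - f z) \<le> e) \<Longrightarrow>
      cmod (ring_int (\<lambda>z. g z * entry x z) - ring_int (\<lambda>z. f z * entry x z)) \<le> M * e"
proof -
  have c: "compact (sphere (0::complex) R \<union> sphere 0 \<rho>)" by (intro compact_Un compact_sphere)
  have "continuous_on (sphere 0 R \<union> sphere 0 \<rho>) (entry x)"
    by (rule continuous_on_subset[OF holomorphic_on_imp_continuous_on[OF entry_holomorphic_V]]) (use circles_V in auto)
  then have "bounded (entry x ` (sphere 0 R \<union> sphere 0 \<rho>))"
    using c by (intro compact_imp_bounded compact_continuous_image)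
  then obtain b where b: "b > 0" "\<And>z. cmod z = R \<or> cmod z = \<rho> \<Longrightarrow> cmod (entry x z) \<le> b"
    unfolding bounded_pos by auto
  define M where "M = b * (2 * pi * R) + b * (2 * pi * \<rho>)"
  show thesis
  proof (rule that[of M])
    show "0 \<le> M" unfolding M_def using b radii by simp
    fix f g e W
    assume W: "open W" "\<And>z. cmod z = R \<or> cmod z = \<rho> \<Longrightarrow> z \<in> W" "W \<subseteq> V"
      and fg: "f holomorphic_on W" "g holomorphic_on W" and e: "0 \<le> e"
      and le: "\<And>z. cmod z = R \<or> cmod z = \<rho> \<Longrightarrow> cmod (g z - f z) \<le> e"
    have i: "h contour_integrable_on circlepath 0 R" "h contour_integrable_on circlepath 0 \<rho>"
      if "h holomorphic_on W" for h
      using W(2) radii by (auto intro!: contour_integrable_holomorphic_simple[OF that W(1)])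
    have ent: "entry x holomorphic_on W" by (rule holomorphic_on_subset[OF entry_holomorphic_V W(3)])
    have hf: "(\<lambda>z. f z * entry x z) holomorphic_on W" and hg: "(\<lambda>z. g z * entry x z) holomorphic_on W"
      and h: "(\<lambda>z. g z * entry x z - f z * entry x z) holomorphic_on W"
      by (intro holomorphic_on_diff holomorphic_on_mult fg ent)+
    have pt: "cmod (g z * entry x z - f z * entry x z) \<le> e * b" if "cmod z = R \<or> cmod z = \<rho>" for z
      unfolding left_diff_distrib[symmetric] norm_mult using le[OF that] b(2)[OF that] e by (intro mult_mono) auto
    have 1: "cmod (contour_integral (circlepath 0 R) (\<lambda>z. g z * entry x z - f z * entry x z)) \<le> (e * b) * (2 * pi * R)"
      using pt e b radii by (intro contour_integral_bound_circlepath i h) auto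
    have 2: "cmod (contour_integral (circlepath 0 \<rho>) (\<lambda>z. g z * entry x z - f z * entry x z)) \<le> (e * b) * (2 * pi * \<rho>)"
      using pt e b radii by (intro contour_integral_bound_circlepath i h) auto
    have "ring_int (\<lambda>z. g z * entry x z) - ring_int (\<lambda>z. f z * entry x z)
        = contour_integral (circlepath 0 R) (\<lambda>z. g z * entry x z - f z * entry x z)
          - contour_integral (circlepath 0 \<rho>) (\<lambda>z. g z * entry x z - f z * entry x z)"
      unfolding ring_int_def contour_integral_diff[OF i(1)[OF hg] i(1)[OF hf]]
        contour_integral_diff[OF i(2)[OF hg] i(2)[OF hf]] by simp
    also have "cmod \<dots> \<le> (e * b) * (2 * pi * R) + (e * b) * (2 * pi * \<rho>)"
      by (rule order_trans[OF norm_triangle_ineq4 add_mono[OF 1 2]])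
    also have "\<dots> = M * e" unfolding M_def by (simp add: algebra_simps)
    finally show "cmod (ring_int (\<lambda>z. g z * entry x z) - ring_int (\<lambda>z. f z * entry x z)) \<le> M * e" .
  qed
qed

end

text \<open>Hence the Riesz--Dunford calculus of an operator with \<open>|T| \<le> 1\<close> and \<open>|T\<^sup>-\<^sup>1| \<le> 1/r\<close> agrees with the
  elementary calculus of uniform limits of Laurent polynomials.\<close>

lemma hol_calc_eq_laurent_limit:
  fixes T B :: "'a::chilbert_space \<Rightarrow>\<^sub>L 'a"
  assumes ann: "annular_op r T B" and r: "0 < r" "r < 1"
    and rads: "0 \<le> r1" "r1 < \<rho>" "\<rho> < r" "1 < R" "R < R1"
    and f: "f holomorphic_on {z. r1 < cmod z \<and> cmod z < R1}"
    and approx: "\<And>e. e > 0 \<Longrightarrow> \<exists>p n. (\<forall>z. cmod z = R \<or> cmod z = \<rho> \<longrightarrow> cmod (laurent_fun p n z - f z) \<le> e)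
        \<and> norm (laurent_op p n T B - A) \<le> e"
  shows "hol_calc f T = A"
proof -
  define U where "U = {z. r1 < cmod z \<and> cmod z < R1}"
  have opU: "open U" unfolding U_def by (intro open_Collect_conj open_Collect_less continuous_intros)
  have T: "clinear_op T" using ann by (simp add: annular_op_def)
  note spec = annular_op_spectrum[OF ann r(1)]
  have sU: "op_spectrum T \<subseteq> U" unfolding U_def using spec rads by fastforce
  have \<rho>0: "0 < \<rho>" "\<rho> < R" using rads r by auto
  have cyc: "cycle_in (U - op_spectrum T) (ring_cycle \<rho> R)"
  proof (rule ring_cycle_in)
    fix z assume "cmod z = \<rho> \<or> cmod z = R"
    then have "z \<in> U" "z \<notin> op_spectrum T" unfolding U_def using rads r spec[of z] by auto
    then show "z \<in> U - op_spectrum T" by simp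
  qed (use \<rho>0 in auto)
  have sur: "surrounds (ring_cycle \<rho> R) (op_spectrum T) U"
    unfolding surrounds_iff
  proof (intro conjI ballI allI impI cyc)
    fix z assume "z \<in> op_spectrum T"
    then show "cycle_winding (ring_cycle \<rho> R) z = 1"
      using spec[of z] rads by (intro ring_cycle_winding(1)[OF \<rho>0]) auto
  next
    fix z assume "z \<notin> U"
    then show "cycle_winding (ring_cycle \<rho> R) z = 0"
      using rads unfolding U_def by (intro ring_cycle_winding(2)[OF \<rho>0]) auto
  qed
  have "hol_calc f T = dunford (ring_cycle \<rho> R) f T"
    by (rule hol_calc_eq_dunford[OF T opU sU _ sur]) (use f in \<open>simp add: U_def\<close>)
  also have "\<dots> = A"
  proof (rule blinfun_eqI_cinner)
    fix x y
    interpret annular_resolvent r \<rho> R T B y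
      by unfold_locales (use ann r rads \<rho>0 in auto)
    let ?D = "cinner (blinfun_apply (dunford (ring_cycle \<rho> R) f T) x) y" and ?c = "2 * complex_of_real pi * \<i>"
    have D: "?D = 1 / ?c * ring_int (\<lambda>z. f z * entry x z)"
      using dunford_entry[OF T opU _ cyc, of f x y] f unfolding U_def[symmetric] ring_cycle_integral ring_int_def entry_def
      by simp
    obtain M where M: "0 \<le> M" "\<And>f g e W. open W \<Longrightarrow> (\<And>z. cmod z = R \<or> cmod z = \<rho> \<Longrightarrow> z \<in> W) \<Longrightarrow> W \<subseteq> V \<Longrightarrow>
      f holomorphic_on W \<Longrightarrow> g holomorphic_on W \<Longrightarrow> 0 \<le> e \<Longrightarrow>
      (\<And>z. cmod z = R \<or> cmod z = \<rho> \<Longrightarrow> cmod (g z - f z) \<le> e) \<Longrightarrow>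
      cmod (ring_int (\<lambda>z. g z * entry x z) - ring_int (\<lambda>z. f z * entry x z)) \<le> M * e"
      by (rule ring_int_bound[of x]) blast
    define W where "W = U \<inter> V"
    have W: "open W" "W \<subseteq> V" unfolding W_def using opU V_open by auto
    have circ: "z \<in> W" if "cmod z = R \<or> cmod z = \<rho>" for z
      using circles_V[OF that] that rads r unfolding W_def U_def by auto
    have fW: "f holomorphic_on W" by (rule holomorphic_on_subset[OF f]) (auto simp: W_def U_def)
    define K where "K = M / cmod ?c + norm x * norm y"
    have K0: "0 \<le> K" unfolding K_def using M(1) by simp
    have "cmod (?D - cinner (blinfun_apply A x) y) \<le> K * e" if e: "e > 0" for e
    proof -
      obtain p n where pn: "\<And>z. cmod z = R \<or> cmod z = \<rho> \<Longrightarrow> cmod (laurent_fun p n z - f z) \<le> e"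
        "norm (laurent_op p n T B - A) \<le> e" using approx[OF e] by blast
      have L: "laurent_fun p n holomorphic_on W"
        unfolding laurent_fun_def[abs_def] by (intro holomorphic_intros) (auto simp: W_def V_def)
      have "cmod (ring_int (\<lambda>z. laurent_fun p n z * entry x z) - ring_int (\<lambda>z. f z * entry x z)) \<le> M * e"
        using e by (intro M(2)[OF W(1) circ W(2) fW L _ pn(1)]) auto
      then have "cmod (?c * (cinner (blinfun_apply (laurent_op p n T B) x) y - ?D)) \<le> M * e"
        unfolding ring_int_laurent D by (simp add: right_diff_distrib)
      then have 1: "cmod (cinner (blinfun_apply (laurent_op p n T B) x) y - ?D) \<le> M / cmod ?c * e"
        unfolding norm_mult by (simp add: field_simps)
      have "cinner (blinfun_apply (laurent_op p n T B) x) y - cinner (blinfun_apply A x) y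
          = cinner (blinfun_apply (laurent_op p n T B - A) x) y"
        by (simp add: blinfun.diff_left cinner.diff_left)
      also have "cmod \<dots> \<le> norm (blinfun_apply (laurent_op p n T B - A) x) * norm y" by (rule norm_cinner_le)
      also have "\<dots> \<le> (e * norm x) * norm y"
        using pn(2) by (intro mult_right_mono order_trans[OF norm_blinfun]) auto
      finally have 2: "cmod (cinner (blinfun_apply (laurent_op p n T B) x) y - cinner (blinfun_apply A x) y) \<le> norm x * norm y * e"
        by (simp add: mult_ac)
      have "cmod (?D - cinner (blinfun_apply A x) y) \<le>
          cmod (cinner (blinfun_apply (laurent_op p n T B) x) y - ?D)
          + cmod (cinner (blinfun_apply (laurent_op p n T B) x) y - cinner (blinfun_apply A x) y)"
        using norm_triangle_ineq4[of "cinner (blinfun_apply (laurent_op p n T B) x) y - cinner (blinfun_apply A x) y"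
            "cinner (blinfun_apply (laurent_op p n T B) x) y - ?D"] by simp
      also have "\<dots> \<le> K * e" using add_mono[OF 1 2] unfolding K_def by (simp add: algebra_simps)
      finally show ?thesis .
    qed
    note le = this
    have "cmod (?D - cinner (blinfun_apply A x) y) \<le> 0 + e" if e: "e > 0" for e
    proof -
      have "cmod (?D - cinner (blinfun_apply A x) y) \<le> K * (e / (K + 1))" using K0 e by (intro le) simp
      also have "\<dots> \<le> e" using K0 e by (simp add: field_simps)
      finally show ?thesis by simp
    qed
    then have "cmod (?D - cinner (blinfun_apply A x) y) \<le> 0" by (rule field_le_epsilon)
    then show "?D = cinner (blinfun_apply A x) y" by simp
  qed
  finally show ?thesis .
qed

section \<open>Uniform limits of Laurent polynomials\<close>

text \<open>The tail estimate is explicit because it is needed uniformly in \<open>z\<close> when the terms are \<open>c\<^sub>k z\<^sup>k\<close>.\<close>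

lemma symmetric_series:
  fixes a :: "int \<Rightarrow> 'b::banach"
  assumes bd: "\<And>k. norm (a k) \<le> C * \<theta> ^ nat \<bar>k\<bar>" and \<theta>: "0 \<le> \<theta>" "\<theta> < 1"
  obtains s where "(\<lambda>N. \<Sum>k\<in>{- int N..int N}. a k) \<longlonglongrightarrow> s"
    "\<And>N. norm ((\<Sum>k\<in>{- int N..int N}. a k) - s) \<le> 2 * C / (1 - \<theta>) * \<theta> ^ N"
proof -
  define b where "b n = (if n = 0 then a 0 else a (int n) + a (- int n))" for n
  have C: "0 \<le> C" using order_trans[OF norm_ge_zero bd[of 0]] by simp
  have b: "norm (b n) \<le> 2 * C * \<theta> ^ n" for n
  proof (cases "n = 0")
    case True
    then show ?thesis using bd[of 0] C by (simp add: b_def)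
  next
    case False
    have "norm (b n) \<le> norm (a (int n)) + norm (a (- int n))"
      using False unfolding b_def by (simp add: norm_triangle_ineq)
    also have "\<dots> \<le> C * \<theta> ^ n + C * \<theta> ^ n"
      using bd[of "int n"] bd[of "- int n"] by (intro add_mono) auto
    finally show ?thesis by simp
  qed
  have g: "summable (\<lambda>n. 2 * C * \<theta> ^ n)" using \<theta> by (intro summable_mult summable_geometric) auto
  have sb: "summable b" by (rule summable_comparison_test'[OF g, of 0]) (rule b)
  have part: "(\<Sum>k\<in>{- int N..int N}. a k) = (\<Sum>n<Suc N. b n)" for N
    unfolding sum_symmetric_int b_def lessThan_Suc_atMost ..
  have "(\<lambda>N. \<Sum>n<Suc N. b n) \<longlonglongrightarrow> suminf b"
    using summable_LIMSEQ[OF sb] by (rule LIMSEQ_Suc)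
  moreover have "norm ((\<Sum>n<Suc N. b n) - suminf b) \<le> 2 * C / (1 - \<theta>) * \<theta> ^ N" for N
  proof -
    have "(\<Sum>n<Suc N. b n) - suminf b = - (\<Sum>n. b (n + Suc N))"
      using suminf_split_initial_segment[OF sb, of "Suc N"] by simp
    then have "norm ((\<Sum>n<Suc N. b n) - suminf b) = norm (\<Sum>n. b (n + Suc N))" by simp
    also have "\<dots> \<le> (\<Sum>n. 2 * C * \<theta> ^ (n + Suc N))"
    proof (rule norm_suminf_le)
      show "norm (b (n + Suc N)) \<le> 2 * C * \<theta> ^ (n + Suc N)" for n by (rule b)
      show "summable (\<lambda>n. 2 * C * \<theta> ^ (n + Suc N))" by (rule summable_ignore_initial_segment[OF g])
    qed
    also have "\<dots> = (\<Sum>n. (2 * C * \<theta> ^ Suc N) * \<theta> ^ n)" by (simp add: power_add mult_ac)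
    also have "\<dots> = 2 * C * \<theta> ^ Suc N * (1 / (1 - \<theta>))"
      using \<theta> by (subst suminf_mult) (auto simp: suminf_geometric summable_geometric)
    also have "\<dots> \<le> 2 * C / (1 - \<theta>) * \<theta> ^ N"
    proof -
      have "\<theta> ^ Suc N \<le> \<theta> ^ N" using \<theta> by (intro power_decreasing) auto
      then have "2 * C / (1 - \<theta>) * \<theta> ^ Suc N \<le> 2 * C / (1 - \<theta>) * \<theta> ^ N"
        using C \<theta> by (intro mult_left_mono) auto
      then show ?thesis by (simp add: mult_ac)
    qed
    finally show ?thesis .
  qed
  ultimately show thesis using part that[of "suminf b"] by simp
qed

lemma symmetric_series_infsum:
  fixes a :: "int \<Rightarrow> complex"
  assumes bd: "\<And>k. norm (a k) \<le> C * \<theta> ^ nat \<bar>k\<bar>" and \<theta>: "0 \<le> \<theta>" "\<theta> < 1"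
  shows "(\<lambda>N. \<Sum>k\<in>{- int N..int N}. a k) \<longlonglongrightarrow> (\<Sum>\<^sub>\<infinity>k. a k)"
proof -
  have C: "0 \<le> C" using order_trans[OF norm_ge_zero bd[of 0]] by simp
  have "(\<lambda>k. norm (a k)) summable_on UNIV"
  proof (rule nonneg_bounded_partial_sums_imp_summable_on[of _ _ "2 * C / (1 - \<theta>)"])
    have "sum (\<lambda>k. norm (a k)) F \<le> 2 * C / (1 - \<theta>)" if F: "finite F" for F
    proof -
      obtain N where N: "F \<subseteq> {- int N..int N}"
      proof -
        define N where "N = nat (Max (insert 0 (abs ` F)))"
        have "\<bar>k\<bar> \<le> Max (insert 0 (abs ` F))" if "k \<in> F" for k using F that by (intro Max_ge) auto
        then have "F \<subseteq> {- int N..int N}" unfolding N_def by force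
        then show ?thesis by (rule that)
      qed
      have "sum (\<lambda>k. norm (a k)) F \<le> (\<Sum>k\<in>{- int N..int N}. norm (a k))"
        using N by (intro sum_mono2) auto
      also have "\<dots> \<le> (\<Sum>k\<in>{- int N..int N}. C * \<theta> ^ nat \<bar>k\<bar>)" by (intro sum_mono bd)
      also have "\<dots> = (\<Sum>n\<le>N. if n = 0 then C else 2 * C * \<theta> ^ n)"
        unfolding sum_symmetric_int by (intro sum.cong refl) auto
      also have "\<dots> \<le> (\<Sum>n\<le>N. 2 * C * \<theta> ^ n)" using C by (intro sum_mono) auto
      also have "\<dots> \<le> (\<Sum>n. 2 * C * \<theta> ^ n)"
        using \<theta> C by (intro sum_le_suminf summable_mult summable_geometric) auto
      also have "\<dots> = 2 * C / (1 - \<theta>)"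
        using \<theta> by (subst suminf_mult) (auto simp: suminf_geometric summable_geometric)
      finally show ?thesis .
    qed
    then show "\<forall>\<^sub>F F in finite_subsets_at_top UNIV. sum (\<lambda>k. norm (a k)) F \<le> 2 * C / (1 - \<theta>)"
      by (intro eventually_finite_subsets_at_top_weakI) auto
  qed auto
  then have "a summable_on UNIV" by (rule abs_summable_summable)
  then have "(sum a \<longlongrightarrow> infsum a UNIV) (finite_subsets_at_top UNIV)"
    using has_sum_infsum unfolding has_sum_def by blast
  moreover have "filterlim (\<lambda>N. {- int N..int N}) (finite_subsets_at_top UNIV) sequentially"
    unfolding filterlim_finite_subsets_at_top
  proof (intro allI impI)
    fix X :: "int set" assume X: "finite X \<and> X \<subseteq> UNIV"
    define N where "N = nat (Max (insert 0 (abs ` X)))"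
    have "\<bar>k\<bar> \<le> Max (insert 0 (abs ` X))" if "k \<in> X" for k using X that by (intro Max_ge) auto
    then have "X \<subseteq> {- int n..int n}" if "N \<le> n" for n using that unfolding N_def by force
    then show "\<forall>\<^sub>F n in sequentially. finite {- int n..int n} \<and> X \<subseteq> {- int n..int n} \<and> {- int n..int n} \<subseteq> UNIV"
      by (auto simp: eventually_sequentially)
  qed
  ultimately show ?thesis by (rule filterlim_compose)
qed

text \<open>A neighbourhood of the closed annulus when \<open>R > 1\<close>, and the closed annulus itself when \<open>R = 1\<close>.\<close>

definition ring :: "real \<Rightarrow> real \<Rightarrow> complex set" where
  "ring r R = {z. r / R \<le> cmod z \<and> cmod z \<le> R}"

lemma compact_ring: "compact (ring r R)"
proof -
  have "closed (ring r R)" unfolding ring_def by (intro closed_Collect_conj closed_Collect_le continuous_intros)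
  moreover have "bounded (ring r R)" unfolding ring_def by (rule boundedI[of _ R]) auto
  ultimately show ?thesis by (simp add: compact_eq_bounded_closed)
qed

text \<open>A functional calculus as a relation: \<open>A\<close> is \<open>h(T)\<close>, approximated by the same Laurent polynomials that
  approximate \<open>h\<close> uniformly on \<open>K\<close>.\<close>

definition laurent_limit :: "complex set \<Rightarrow> ('a::chilbert_space \<Rightarrow>\<^sub>L 'a) \<Rightarrow> ('a \<Rightarrow>\<^sub>L 'a) \<Rightarrow> (complex \<Rightarrow> complex) \<Rightarrow> ('a \<Rightarrow>\<^sub>L 'a) \<Rightarrow> bool" where
  "laurent_limit K T B h A \<longleftrightarrow> (\<forall>e>0. \<exists>p n. (\<forall>z\<in>K. cmod (laurent_fun p n z - h z) \<le> e) \<and> norm (laurent_op p n T B - A) \<le> e)"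

lemma laurent_limitE:
  assumes "laurent_limit K T B h A" "e > 0"
  obtains p n where "\<And>z. z \<in> K \<Longrightarrow> cmod (laurent_fun p n z - h z) \<le> e" "norm (laurent_op p n T B - A) \<le> e"
  using assms unfolding laurent_limit_def by blast

lemma laurent_limit_self: "laurent_limit K T B (laurent_fun p n) (laurent_op p n T B)"
  unfolding laurent_limit_def by (auto intro!: exI[of _ p] exI[of _ n])

lemma laurent_limit_cong: "laurent_limit K T B h A \<Longrightarrow> (\<And>z. z \<in> K \<Longrightarrow> h z = h' z) \<Longrightarrow> laurent_limit K T B h' A"
  unfolding laurent_limit_def by simp

text \<open>These bounds survive for the triangular operator of the theorem, whose norm may exceed 1.\<close>

locale power_bounded_annular =
  fixes r M :: real and T B :: "'a::chilbert_space \<Rightarrow>\<^sub>L 'a"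
  assumes r: "0 < r" "r < 1" and Tcl: "clinear_op T" and Binv: "is_inverse_op T B"
    and powT: "\<And>n. norm (op_power T n) \<le> M" and powB: "\<And>n. norm (op_power B n) \<le> M / r ^ n"
begin

lemma Bcl: "clinear_op B"
  using Binv by (simp add: is_inverse_op_def)

lemma M0: "0 \<le> M"
  using order_trans[OF norm_ge_zero powT] .

lemma power_B_commute: "op_power B n o\<^sub>L poly_op p T = poly_op p T o\<^sub>L op_power B n"
proof -
  have "B o\<^sub>L T = T o\<^sub>L B" using Binv by (simp add: is_inverse_op_def)
  then have "T o\<^sub>L op_power B n = op_power B n o\<^sub>L T" by (intro compose_power_commute) simp
  then show ?thesis by (intro compose_poly_op_commute clin Bcl) simp
qed

lemma laurent_op_mult:
  "laurent_op (p * p') (n + n') T B = laurent_op p n T B o\<^sub>L laurent_op p' n' T B"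
proof -
  have "laurent_op p n T B o\<^sub>L laurent_op p' n' T B
      = poly_op p T o\<^sub>L (op_power B n o\<^sub>L poly_op p' T) o\<^sub>L op_power B n'"
    by (simp only: laurent_op_def compose_eqs)
  also have "\<dots> = laurent_op (p * p') (n + n') T B"
    unfolding power_B_commute by (simp only: laurent_op_def poly_op_mult[OF Tcl] op_power_add compose_eqs)
  finally show ?thesis by simp
qed

lemma laurent_fun_mult: "laurent_fun (p * p') (n + n') z = laurent_fun p n z * laurent_fun p' n' z"
  by (simp add: laurent_fun_def power_add)

lemma laurent_common: "z \<noteq> 0 \<Longrightarrow> laurent_fun (p * monom 1 k) (n + k) z = laurent_fun p n z"
  by (simp add: laurent_fun_def poly_monom power_add)

lemma laurent_op_common: "laurent_op (p * monom 1 k) (n + k) T B = laurent_op p n T B"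
proof -
  have "laurent_op (monom 1 k) k T B = id_blinfun"
    using is_inverse_op_power[OF Binv, of k]
    by (simp add: laurent_op_def poly_op_monom scaleC_blinfun_simps is_inverse_op_def)
  then show ?thesis by (simp add: laurent_op_mult compose_eqs)
qed

lemma laurent_const: "laurent_fun [:c:] 0 z = c" "laurent_op [:c:] 0 T B = c *\<^sub>C id_blinfun"
  by (simp_all add: laurent_fun_def laurent_op_def poly_op_def compose_eqs)

lemma laurent_diff_const:
  "z \<noteq> 0 \<Longrightarrow> laurent_fun (p - monom c n) n z = laurent_fun p n z - c"
  "laurent_op (p - monom c n) n T B = laurent_op p n T B - c *\<^sub>C id_blinfun"
proof -
  show "z \<noteq> 0 \<Longrightarrow> laurent_fun (p - monom c n) n z = laurent_fun p n z - c"
    by (simp add: laurent_fun_def poly_monom diff_divide_distrib)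
  have "op_power T n o\<^sub>L op_power B n = id_blinfun"
    using is_inverse_op_power[OF Binv, of n] by (simp add: is_inverse_op_def)
  then show "laurent_op (p - monom c n) n T B = laurent_op p n T B - c *\<^sub>C id_blinfun"
    by (simp add: laurent_op_def poly_op_diff poly_op_monom blinfun_compose.diff_left scaleC_compose_left)
qed

lemma laurent_limit_diff_const:
  assumes "laurent_limit K T B h A" "0 \<notin> K" shows "laurent_limit K T B (\<lambda>z. h z - c) (A - c *\<^sub>C id_blinfun)"
  unfolding laurent_limit_def
proof (intro allI impI)
  fix e :: real assume "e > 0"
  from laurent_limitE[OF assms(1) this] obtain p n where
    pn: "\<And>z. z \<in> K \<Longrightarrow> cmod (laurent_fun p n z - h z) \<le> e" "norm (laurent_op p n T B - A) \<le> e" by blast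
  have "cmod (laurent_fun (p - monom c n) n z - (h z - c)) \<le> e" if "z \<in> K" for z
  proof -
    have "z \<noteq> 0" using assms(2) that by auto
    then show ?thesis using pn(1)[OF that] by (simp add: laurent_diff_const)
  qed
  moreover have "norm (laurent_op (p - monom c n) n T B - (A - c *\<^sub>C id_blinfun)) \<le> e"
    using pn(2) by (simp add: laurent_diff_const)
  ultimately show "\<exists>p n. (\<forall>z\<in>K. cmod (laurent_fun p n z - (h z - c)) \<le> e)
      \<and> norm (laurent_op p n T B - (A - c *\<^sub>C id_blinfun)) \<le> e" by blast
qed

lemma laurent_limit_bounded:
  assumes "laurent_limit K T B h A" "compact K" "0 \<notin> K"
  obtains H where "0 \<le> H" "\<And>z. z \<in> K \<Longrightarrow> cmod (h z) \<le> H"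
proof -
  obtain p n where pn: "\<And>z. z \<in> K \<Longrightarrow> cmod (laurent_fun p n z - h z) \<le> 1"
    using laurent_limitE[OF assms(1) zero_less_one] by blast
  have "continuous_on K (laurent_fun p n)"
    unfolding laurent_fun_def[abs_def] using assms(3) by (intro continuous_intros) auto
  then have "bounded (laurent_fun p n ` K)"
    using assms(2) by (intro compact_imp_bounded compact_continuous_image)
  then obtain b where b: "b > 0" "\<And>z. z \<in> K \<Longrightarrow> cmod (laurent_fun p n z) \<le> b"
    unfolding bounded_pos by auto
  have "cmod (h z) \<le> b + 1" if "z \<in> K" for z
    using norm_triangle_ineq4[of "laurent_fun p n z" "laurent_fun p n z - h z"] b(2)[OF that] pn[OF that] by simp
  then show thesis using b(1) by (intro that[of "b + 1"]) auto
qed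

text \<open>The product is kept general to cover numbers and operators alike.\<close>

lemma product_approx:
  fixes mul :: "'x::real_normed_vector \<Rightarrow> 'y::real_normed_vector \<Rightarrow> 'z::real_normed_vector"
  assumes "bounded_bilinear mul" and nm: "\<And>a b. norm (mul a b) \<le> norm a * norm b"
    and "norm (a' - a) \<le> d" "norm (b' - b) \<le> d" "norm a \<le> H" "norm b \<le> H" "d \<le> 1" "0 \<le> H"
  shows "norm (mul a' b' - mul a b) \<le> d * (2 * H + 1)"
proof -
  interpret bounded_bilinear mul by fact
  have d: "0 \<le> d" using order_trans[OF norm_ge_zero assms(3)] .
  have "norm b' \<le> norm b + norm (b' - b)" using norm_triangle_ineq[of b "b' - b"] by simp
  then have b': "norm b' \<le> H + 1" using assms by linarith
  have "mul a' b' - mul a b = mul (a' - a) b' + mul a (b' - b)" by (simp add: diff_left diff_right)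
  also have "norm \<dots> \<le> norm (a' - a) * norm b' + norm a * norm (b' - b)"
    by (intro order_trans[OF norm_triangle_ineq] add_mono nm)
  also have "\<dots> \<le> d * (H + 1) + H * d"
    using assms b' d by (intro add_mono mult_mono) auto
  finally show ?thesis by (simp add: algebra_simps)
qed

lemma laurent_limit_mult:
  assumes A: "laurent_limit K T B h A" and C: "laurent_limit K T B k C" and K: "compact K" "0 \<notin> K"
  shows "laurent_limit K T B (\<lambda>z. h z * k z) (A o\<^sub>L C)"
  unfolding laurent_limit_def
proof (intro allI impI)
  fix e :: real assume e: "e > 0"
  obtain H1 where H1: "0 \<le> H1" "\<And>z. z \<in> K \<Longrightarrow> cmod (h z) \<le> H1" using laurent_limit_bounded[OF A K] by blast
  obtain H2 where H2: "0 \<le> H2" "\<And>z. z \<in> K \<Longrightarrow> cmod (k z) \<le> H2" using laurent_limit_bounded[OF C K] by blast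
  define H where "H = H1 + H2 + norm A + norm C"
  have H: "0 \<le> H" "H1 \<le> H" "H2 \<le> H" "norm A \<le> H" "norm C \<le> H" unfolding H_def using H1(1) H2(1) by auto
  define d where "d = min 1 (e / (2 * H + 1))"
  have d: "d > 0" "d \<le> 1" unfolding d_def using e H by auto
  have de: "d * (2 * H + 1) \<le> e"
  proof -
    have "d * (2 * H + 1) \<le> e / (2 * H + 1) * (2 * H + 1)" unfolding d_def using H by (intro mult_right_mono) auto
    then show ?thesis using H by simp
  qed
  obtain p n where pn: "\<And>z. z \<in> K \<Longrightarrow> cmod (laurent_fun p n z - h z) \<le> d" "norm (laurent_op p n T B - A) \<le> d"
    using laurent_limitE[OF A d(1)] by blast
  obtain p' n' where pn': "\<And>z. z \<in> K \<Longrightarrow> cmod (laurent_fun p' n' z - k z) \<le> d" "norm (laurent_op p' n' T B - C) \<le> d"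
    using laurent_limitE[OF C d(1)] by blast
  have "cmod (laurent_fun (p * p') (n + n') z - h z * k z) \<le> e" if z: "z \<in> K" for z
  proof -
    have "cmod (laurent_fun p n z * laurent_fun p' n' z - h z * k z) \<le> d * (2 * H + 1)"
      using pn(1)[OF z] pn'(1)[OF z] H1(2)[OF z] H2(2)[OF z] H d
      by (intro product_approx[OF bounded_bilinear_mult]) (auto simp: norm_mult)
    then show ?thesis using de by (simp add: laurent_fun_mult)
  qed
  moreover have "norm (laurent_op (p * p') (n + n') T B - (A o\<^sub>L C)) \<le> e"
  proof -
    have "norm ((laurent_op p n T B o\<^sub>L laurent_op p' n' T B) - (A o\<^sub>L C)) \<le> d * (2 * H + 1)"
      using pn(2) pn'(2) H d
      by (intro product_approx[OF bounded_bilinear_blinfun_compose]) (auto intro: norm_blinfun_compose)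
    then show ?thesis using de by (simp add: laurent_op_mult)
  qed
  ultimately show "\<exists>p n. (\<forall>z\<in>K. cmod (laurent_fun p n z - h z * k z) \<le> e) \<and> norm (laurent_op p n T B - (A o\<^sub>L C)) \<le> e"
    by blast
qed

lemma norm_int_power:
  "norm (int_power T B (int n)) \<le> M" "norm (int_power T B (- int n)) \<le> M / r ^ n"
  using powT powB by simp_all

text \<open>On a ring properly containing the closed annulus, Cauchy's estimates for the coefficients beat
  the growth of the powers, so the operator depends on the values of the Laurent polynomial only.\<close>

lemma laurent_op_norm_bound:
  assumes R: "1 < R" and m: "\<And>z. z \<in> ring r R \<Longrightarrow> cmod (laurent_fun p n z) \<le> m"
  shows "norm (laurent_op p n T B) \<le> 2 * M / (1 - 1 / R) * m"
proof -
  define N where "N = n + degree p"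
  have N: "n \<le> N" "degree p \<le> N + n" unfolding N_def by auto
  let ?I = "{- int N..int N}" and ?c = "laurent_coeff p n"
  have rR: "r / R < R" using R r by (simp add: divide_simps) (metis less_1_mult less_trans mult.commute mult_1)
  have coef: "cmod (?c k) * \<rho> powi k \<le> m" if k: "k \<in> ?I" and \<rho>: "\<rho> = R \<or> \<rho> = r / R" for k \<rho>
  proof -
    have \<rho>0: "\<rho> > 0" using \<rho> R r by auto
    have "cmod (?c k * of_real \<rho> powi k) \<le> m"
    proof (rule trig_coefficient_bound[of ?I k "\<lambda>k. ?c k * of_real \<rho> powi k"])
      fix w :: complex assume w: "cmod w = 1"
      have "of_real \<rho> * w \<in> ring r R" unfolding ring_def using w \<rho> \<rho>0 rR by (auto simp: norm_mult)
      moreover have "(\<Sum>k\<in>?I. ?c k * of_real \<rho> powi k * w powi k) = laurent_fun p n (of_real \<rho> * w)"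
        using w \<rho>0 by (subst laurent_fun_sum[OF _ N]) (auto simp: power_int_mult_distrib mult.assoc)
      ultimately show "cmod (\<Sum>k\<in>?I. ?c k * of_real \<rho> powi k * w powi k) \<le> m" using m by simp
    qed (use k in auto)
    then show ?thesis using \<rho>0 by (simp add: norm_mult norm_power_int)
  qed
  have m0: "0 \<le> m"
  proof -
    have "of_real R \<in> ring r R" unfolding ring_def using rR R by auto
    then show ?thesis using order_trans[OF norm_ge_zero m] by blast
  qed
  define \<theta> where "\<theta> = 1 / R"
  have \<theta>: "0 \<le> \<theta>" "\<theta> < 1" using R by (auto simp: \<theta>_def)
  have tm: "norm (?c k *\<^sub>C int_power T B k) \<le> (m * M) * \<theta> ^ nat \<bar>k\<bar>" if k: "k \<in> ?I" for k
  proof (cases "0 \<le> k")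
    case True
    then obtain j where j: "k = int j" using nonneg_int_cases by blast
    have "cmod (?c k) \<le> m * \<theta> ^ j"
      using coef[OF k, of R] R j by (simp add: \<theta>_def power_divide field_simps)
    then show ?thesis
      using norm_int_power(1)[of j] j m0 \<theta> M0
      by (simp add: norm_scaleC_blinfun mult.assoc) (metis (no_types, lifting) mult.commute mult.left_commute mult_mono norm_ge_zero zero_le_mult_iff zero_le_power)
  next
    case False
    then obtain j where j: "k = - int j" by (metis int_cases2 of_nat_0_le_iff)
    have "cmod (?c k) * (R / r) ^ j \<le> m"
      using coef[OF k, of "r / R"] j by (simp add: power_int_minus power_divide)
    then have "cmod (?c k) / r ^ j \<le> m * \<theta> ^ j"
      using R r by (simp add: \<theta>_def power_divide field_simps)
    then have "cmod (?c k) * (M / r ^ j) \<le> (m * \<theta> ^ j) * M"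
      using mult_right_mono[of "cmod (?c k) / r ^ j" "m * \<theta> ^ j" M] M0 by simp
    moreover have "cmod (?c k) * norm (int_power T B k) \<le> cmod (?c k) * (M / r ^ j)"
      using norm_int_power(2)[of j] j by (intro mult_left_mono) auto
    ultimately show ?thesis using j by (simp add: norm_scaleC_blinfun mult_ac)
  qed
  define a where "a k = (if k \<in> ?I then ?c k *\<^sub>C int_power T B k else 0)" for k
  have a: "norm (a k) \<le> (m * M) * \<theta> ^ nat \<bar>k\<bar>" for k
    using tm[of k] m0 M0 \<theta> unfolding a_def by auto
  have "norm (laurent_op p n T B) \<le> (\<Sum>k\<in>?I. norm (a k))"
    unfolding laurent_op_sum[OF Binv N] by (rule order_trans[OF norm_sum]) (simp add: a_def)
  also have "\<dots> \<le> (\<Sum>k\<in>?I. (m * M) * \<theta> ^ nat \<bar>k\<bar>)" by (intro sum_mono a)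
  also have "\<dots> = (\<Sum>n\<le>N. if n = 0 then m * M else 2 * (m * M) * \<theta> ^ n)"
    unfolding sum_symmetric_int by (intro sum.cong refl) auto
  also have "\<dots> \<le> (\<Sum>n\<le>N. 2 * (m * M) * \<theta> ^ n)" using m0 M0 by (intro sum_mono) auto
  also have "\<dots> \<le> (\<Sum>n. 2 * (m * M) * \<theta> ^ n)"
    using \<theta> m0 M0 by (intro sum_le_suminf summable_mult summable_geometric) auto
  also have "\<dots> = 2 * M / (1 - 1 / R) * m"
    using \<theta> by (subst suminf_mult) (auto simp: suminf_geometric summable_geometric \<theta>_def)
  finally show ?thesis .
qed

text \<open>The difference of two approximations is uniformly small on the ring, hence small on the operator.\<close>

lemma laurent_limit_unique:
  assumes R: "1 < R" and A: "laurent_limit (ring r R) T B h A" and C: "laurent_limit (ring r R) T B h C"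
  shows "A = C"
proof -
  define D where "D = 2 * M / (1 - 1 / R)"
  have D0: "0 \<le> D" unfolding D_def using M0 R by simp
  have "0 < r / R" using r R by simp
  then have nz: "0 \<notin> ring r R" unfolding ring_def by auto
  have le: "norm (A - C) \<le> (2 * D + 2) * e" if e: "e > 0" for e
  proof -
    obtain p n where pn: "\<And>z. z \<in> ring r R \<Longrightarrow> cmod (laurent_fun p n z - h z) \<le> e" "norm (laurent_op p n T B - A) \<le> e"
      using laurent_limitE[OF A e] by blast
    obtain p' n' where pn': "\<And>z. z \<in> ring r R \<Longrightarrow> cmod (laurent_fun p' n' z - h z) \<le> e" "norm (laurent_op p' n' T B - C) \<le> e"
      using laurent_limitE[OF C e] by blast
    define P where "P = p * monom 1 n' - p' * monom 1 n"
    have eq: "laurent_fun P (n + n') z = laurent_fun p n z - laurent_fun p' n' z" if "z \<noteq> 0" for z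
      using that laurent_common[of z p n' n] laurent_common[of z p' n n']
      unfolding P_def by (simp add: laurent_fun_def diff_divide_distrib add.commute)
    have "cmod (laurent_fun P (n + n') z) \<le> 2 * e" if z: "z \<in> ring r R" for z
    proof -
      have "z \<noteq> 0" using z nz by auto
      have "laurent_fun p n z - laurent_fun p' n' z = (laurent_fun p n z - h z) - (laurent_fun p' n' z - h z)" by simp
      also have "cmod \<dots> \<le> e + e"
        by (rule order_trans[OF norm_triangle_ineq4 add_mono[OF pn(1)[OF z] pn'(1)[OF z]]])
      finally show ?thesis unfolding eq[OF \<open>z \<noteq> 0\<close>] by simp
    qed
    then have "norm (laurent_op P (n + n') T B) \<le> D * (2 * e)"
      unfolding D_def by (rule laurent_op_norm_bound[OF R])
    moreover have "laurent_op P (n + n') T B = laurent_op p n T B - laurent_op p' n' T B"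
      using laurent_op_common[of p n' n] laurent_op_common[of p' n n']
      unfolding P_def by (simp add: laurent_op_def poly_op_diff blinfun_compose.diff_left add.commute)
    ultimately have 1: "norm (laurent_op p n T B - laurent_op p' n' T B) \<le> D * (2 * e)" by simp
    have "A - C = (laurent_op p n T B - laurent_op p' n' T B) - (laurent_op p n T B - A) + (laurent_op p' n' T B - C)"
      by simp
    also have "norm \<dots> \<le> D * (2 * e) + e + e"
      by (intro order_trans[OF norm_triangle_ineq] order_trans[OF norm_triangle_ineq4] add_mono 1 pn(2) pn'(2))
    finally show ?thesis by (simp add: algebra_simps)
  qed
  have "norm (A - C) \<le> 0 + e" if e: "e > 0" for e
  proof -
    have "0 < 2 * D + 2" using D0 by simp
    then have "norm (A - C) \<le> (2 * D + 2) * (e / (2 * D + 2))" using e by (intro le divide_pos_pos)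
    also have "\<dots> = e" using \<open>0 < 2 * D + 2\<close> by simp
    finally show ?thesis by simp
  qed
  then have "norm (A - C) \<le> 0" by (rule field_le_epsilon)
  then show ?thesis by simp
qed

end

section \<open>Kernels of an operator\<close>

text \<open>The factor \<open>q\<^sup>n\<close> at index \<open>- n\<close> makes the series of the kernel converge inwards down to \<open>|z| = q\<close>.\<close>

lemma kcoef_bound:
  assumes q: "0 < q" "q < 1" and ab: "cmod a = 1" "cmod b = 1"
  shows "cmod (kcoef q a b (int n)) \<le> 4 / (1 - q)" "cmod (kcoef q a b (- int n)) \<le> 4 / (1 - q) * q ^ n"
proof -
  have four: "1 \<le> 4 / (1 - q)" using q by (simp add: field_simps)
  have *: "cmod (kcoef q a b (int n)) \<le> 4 / (1 - q) \<and> cmod (kcoef q a b (- int n)) \<le> 4 / (1 - q) * q ^ n"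
  proof (cases "n = 0")
    case True
    then show ?thesis using four by (simp add: kcoef_def)
  next
    case False
    have n0: "int n \<noteq> 0" "- int n \<noteq> 0" using False by auto
    define Q where "Q = q ^ n"
    have Q: "0 < Q" "Q < 1" unfolding Q_def using q False by (simp_all add: power_less_one_iff)
    have QQ: "Q * Q \<le> q"
    proof -
      have "Q * Q = q ^ (2 * n)" unfolding Q_def mult_2 power_add ..
      also have "\<dots> \<le> q ^ 1" using q False by (intro power_decreasing) auto
      finally show ?thesis by simp
    qed
    have pb: "q powi int n = Q" unfolding Q_def by (rule power_int_of_nat)
    have "2 * int n = int (2 * n)" by simp
    then have pc: "q powi (2 * int n) = Q * Q" unfolding Q_def by (simp only: power_int_of_nat mult_2 power_add)
    have pd: "q powi (- int n) = 1 / Q" by (simp only: power_int_minus pb inverse_eq_divide)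
    have "2 * - int n = - (2 * int n)" by simp
    then have pe: "q powi (2 * - int n) = 1 / (Q * Q)" by (simp only: power_int_minus pc inverse_eq_divide)
    have u: "cmod (a powi k) = 1" "cmod (b powi k) = 1" for k using ab by (simp_all add: norm_power_int)
    have num: "cmod (a powi k - of_real t * b powi k) \<le> 1 + \<bar>t\<bar>" for k t
    proof -
      have "cmod (a powi k - of_real t * b powi k) \<le> cmod (a powi k) + cmod (of_real t * b powi k)"
        by (rule norm_triangle_ineq4)
      then show ?thesis by (simp only: norm_mult norm_of_real u mult_1_right)
    qed
    have "cmod (kcoef q a b (int n)) = 2 * cmod (a powi (- int n) - of_real Q * b powi (- int n)) / \<bar>1 - Q * Q\<bar>"
      using False unfolding kcoef_def pb pc by (simp only: n0 if_False norm_divide norm_mult norm_of_real norm_numeral)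
    also have "\<bar>1 - Q * Q\<bar> = 1 - Q * Q" using QQ q by simp
    also have "2 * cmod (a powi (- int n) - of_real Q * b powi (- int n)) / (1 - Q * Q) \<le> 4 / (1 - q)"
    proof (rule frac_le)
      show "2 * cmod (a powi (- int n) - of_real Q * b powi (- int n)) \<le> 4" using num[of "- int n" Q] Q by simp
    qed (use q QQ in auto)
    finally have 1: "cmod (kcoef q a b (int n)) \<le> 4 / (1 - q)" .
    have "cmod (kcoef q a b (- int n)) = 2 * cmod (a powi (- (- int n)) - of_real (1 / Q) * b powi (- (- int n))) / \<bar>1 - 1 / (Q * Q)\<bar>"
      using False unfolding kcoef_def pd pe by (simp only: n0 if_False norm_divide norm_mult norm_of_real norm_numeral)
    also have "\<bar>1 - 1 / (Q * Q)\<bar> = (1 - Q * Q) / (Q * Q)"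
    proof -
      have "1 - 1 / (Q * Q) = - ((1 - Q * Q) / (Q * Q))" using Q by (simp add: field_simps)
      moreover have "0 \<le> (1 - Q * Q) / (Q * Q)" using QQ q Q by simp
      ultimately show ?thesis by (simp only: abs_minus_cancel abs_of_nonneg)
    qed
    also have "2 * cmod (a powi (- (- int n)) - of_real (1 / Q) * b powi (- (- int n))) / ((1 - Q * Q) / (Q * Q))
        = 2 * (Q * cmod (a powi (- (- int n)) - of_real (1 / Q) * b powi (- (- int n)))) / (1 - Q * Q) * Q"
      by simp
    also have "\<dots> \<le> 4 / (1 - q) * Q"
    proof (intro mult_right_mono frac_le)
      have "Q * cmod (a powi (- (- int n)) - of_real (1 / Q) * b powi (- (- int n))) \<le> Q * (1 + 1 / Q)"
        using num[of "- (- int n)" "1 / Q"] Q by (intro mult_left_mono) auto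
      also have "\<dots> \<le> 2" using Q by (simp add: distrib_left)
      finally show "2 * (Q * cmod (a powi (- (- int n)) - of_real (1 / Q) * b powi (- (- int n)))) \<le> 4" by simp
    qed (use q QQ Q in auto)
    finally show ?thesis using 1 unfolding Q_def by simp
  qed
  then show "cmod (kcoef q a b (int n)) \<le> 4 / (1 - q)" "cmod (kcoef q a b (- int n)) \<le> 4 / (1 - q) * q ^ n" by auto
qed

text \<open>The weights \<open>\<nu>\<close> will be the sizes of powers, of a number or of an operator.\<close>

lemma kcoef_weighted_bound:
  fixes \<nu> :: "int \<Rightarrow> real"
  assumes q: "0 < q" "q < 1" and ab: "cmod a = 1" "cmod b = 1"
    and \<nu>: "\<And>n. 0 \<le> \<nu> (int n)" "\<And>n. 0 \<le> \<nu> (- int n)" "\<And>n. \<nu> (int n) \<le> W * \<theta> ^ n" "\<And>n. q ^ n * \<nu> (- int n) \<le> W * \<theta> ^ n"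
  shows "cmod (kcoef q a b k) * \<nu> k \<le> 4 / (1 - q) * W * \<theta> ^ nat \<bar>k\<bar>"
proof (cases "0 \<le> k")
  case True
  then obtain n where n: "k = int n" using nonneg_int_cases by blast
  have "cmod (kcoef q a b k) * \<nu> k \<le> 4 / (1 - q) * (W * \<theta> ^ n)"
    unfolding n using kcoef_bound(1)[OF q ab] \<nu>(1,3) q by (intro mult_mono) auto
  then show ?thesis by (simp add: n)
next
  case False
  then obtain n where n: "k = - int n" by (metis int_cases2 of_nat_0_le_iff)
  have "cmod (kcoef q a b k) * \<nu> k \<le> 4 / (1 - q) * q ^ n * \<nu> (- int n)"
    unfolding n using kcoef_bound(2)[OF q ab] \<nu>(2) by (intro mult_right_mono) auto
  also have "\<dots> \<le> 4 / (1 - q) * (W * \<theta> ^ n)"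
    using mult_left_mono[OF \<nu>(4)[of n], of "4 / (1 - q)"] q by (simp add: mult.assoc)
  finally show ?thesis by (simp add: n)
qed

lemma kcoef_series_bound:
  assumes q: "0 < q" "q < 1" and ab: "cmod a = 1" "cmod b = 1"
    and w: "0 < cmod w" "cmod w \<le> \<theta>" "q / cmod w \<le> \<theta>"
  shows "cmod (kcoef q a b k * w powi k) \<le> 4 / (1 - q) * 1 * \<theta> ^ nat \<bar>k\<bar>"
  unfolding norm_mult
proof (rule kcoef_weighted_bound[OF q ab])
  fix n
  show "0 \<le> cmod (w powi int n)" "0 \<le> cmod (w powi (- int n))" by simp_all
  show "cmod (w powi int n) \<le> 1 * \<theta> ^ n" using power_mono[OF w(2)] by (simp add: norm_power)
  have "cmod (w powi (- int n)) = inverse (cmod w ^ n)"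
    unfolding norm_power_int unfolding power_int_minus power_int_of_nat ..
  then have "q ^ n * cmod (w powi (- int n)) = (q / cmod w) ^ n"
    by (simp only: power_divide divide_inverse[of "q ^ n"])
  also have "\<dots> \<le> \<theta> ^ n" using w q by (intro power_mono) auto
  finally show "q ^ n * cmod (w powi (- int n)) \<le> 1 * \<theta> ^ n" by simp
qed

text \<open>The kernel with poles \<open>a, b\<close> at \<open>\<beta> T\<close>. The number \<open>\<beta>\<close> is kept apart because \<open>T\<close> and \<open>B\<close>, not their
  multiples, satisfy the power bounds.\<close>

definition kernel_op :: "real \<Rightarrow> complex \<Rightarrow> complex \<Rightarrow> complex \<Rightarrow> ('a::chilbert_space \<Rightarrow>\<^sub>L 'a) \<Rightarrow> ('a \<Rightarrow>\<^sub>L 'a) \<Rightarrow> ('a \<Rightarrow>\<^sub>L 'a)" where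
  "kernel_op q a b \<beta> T B = lim (\<lambda>N. \<Sum>k\<in>{- int N..int N}. (kcoef q a b k * \<beta> powi k) *\<^sub>C int_power T B k)"

text \<open>Rotating both poles amounts to rotating the operator.\<close>

lemma kernel_op_rotate:
  assumes "\<alpha> \<noteq> 0"
  shows "kernel_op q (c * \<alpha>) (d * \<alpha>) \<beta> T B = kernel_op q c d (\<beta> / \<alpha>) T B"
proof -
  have "kcoef q (c * \<alpha>) (d * \<alpha>) k = kcoef q c d k * \<alpha> powi (- k)" for k
    by (cases "k = 0") (simp_all add: kcoef_def power_int_mult_distrib left_diff_distrib mult.assoc)
  then have "kcoef q (c * \<alpha>) (d * \<alpha>) k * \<beta> powi k = kcoef q c d k * (\<beta> / \<alpha>) powi k" for k
    unfolding power_int_divide_distrib by (simp add: power_int_minus divide_inverse mult_ac)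
  then show ?thesis unfolding kernel_op_def by simp
qed

text \<open>The parameter \<open>\<beta>\<close> scales \<open>T\<close> by \<open>s = |\<beta>| < 1\<close>, which moves the closed annulus into the interior of
  the annulus \<open>q < |z| < 1\<close> of the kernels, \<open>q = s\<^sup>2 r\<close>; this is where all series converge geometrically.\<close>

context power_bounded_annular
begin

lemma scaled_param:
  assumes "0 < s" "s < 1" shows "0 < s\<^sup>2 * r" "s\<^sup>2 * r < 1"
proof -
  show "0 < s\<^sup>2 * r" using assms r by simp
  have "s\<^sup>2 \<le> 1" using assms by (intro power_le_one) auto
  then have "s\<^sup>2 * r \<le> 1 * r" using r(1) by (intro mult_right_mono) auto
  then show "s\<^sup>2 * r < 1" using r(2) by linarith
qed

lemma kernel_op_limit:
  assumes s: "0 < s" "s < 1" and \<beta>: "cmod \<beta> = s" and ab: "cmod a = 1" "cmod b = 1"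
  defines "q \<equiv> s\<^sup>2 * r"
  defines "psum \<equiv> \<lambda>N. \<Sum>k\<in>{- int N..int N}. (kcoef q a b k * \<beta> powi k) *\<^sub>C int_power T B k"
  shows "psum \<longlonglongrightarrow> kernel_op q a b \<beta> T B"
    "norm (psum N - kernel_op q a b \<beta> T B) \<le> 2 * (4 / (1 - q) * M) / (1 - s) * s ^ N"
proof -
  have q: "0 < q" "q < 1" unfolding q_def using scaled_param[OF s] by auto
  have b: "norm ((kcoef q a b k * \<beta> powi k) *\<^sub>C int_power T B k) \<le> 4 / (1 - q) * M * s ^ nat \<bar>k\<bar>" for k
  proof -
    have "norm ((kcoef q a b k * \<beta> powi k) *\<^sub>C int_power T B k) = cmod (kcoef q a b k) * (s powi k * norm (int_power T B k))"
      using \<beta> by (simp add: norm_scaleC_blinfun norm_mult norm_power_int)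
    also have "\<dots> \<le> 4 / (1 - q) * M * s ^ nat \<bar>k\<bar>"
    proof (rule kcoef_weighted_bound[OF q ab])
      fix n
      show "0 \<le> s powi int n * norm (int_power T B (int n))" "0 \<le> s powi (- int n) * norm (int_power T B (- int n))"
        using s by simp_all
      show "s powi int n * norm (int_power T B (int n)) \<le> M * s ^ n"
        using mult_left_mono[OF powT, of "s ^ n" n] s by (simp add: mult.commute)
      have "q ^ n * (s powi (- int n) * norm (int_power T B (- int n))) \<le> q ^ n * (s powi (- int n) * (M / r ^ n))"
        using norm_int_power(2) s q by (intro mult_left_mono) auto
      also have "\<dots> = M * s ^ n"
        using s r by (simp add: q_def power_int_minus power_mult_distrib power2_eq_square field_simps)
      finally show "q ^ n * (s powi (- int n) * norm (int_power T B (- int n))) \<le> M * s ^ n" .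
    qed
    finally show ?thesis .
  qed
  obtain A where A: "psum \<longlonglongrightarrow> A" "\<And>N. norm (psum N - A) \<le> 2 * (4 / (1 - q) * M) / (1 - s) * s ^ N"
    using symmetric_series[OF b less_imp_le[OF s(1)] s(2)] unfolding psum_def by blast
  have "kernel_op q a b \<beta> T B = A" unfolding kernel_op_def using A(1) unfolding psum_def by (rule limI)
  then show "psum \<longlonglongrightarrow> kernel_op q a b \<beta> T B"
    "norm (psum N - kernel_op q a b \<beta> T B) \<le> 2 * (4 / (1 - q) * M) / (1 - s) * s ^ N" using A by auto
qed

lemma clinear_kernel_op:
  assumes "0 < s" "s < 1" "cmod \<beta> = s" "cmod a = 1" "cmod b = 1"
  shows "clinear_op (kernel_op (s\<^sup>2 * r) a b \<beta> T B)"
  by (rule clinear_op_lim[OF kernel_op_limit(1)[OF assms]]) (intro clin Tcl Bcl)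

lemma scaled_ring:
  assumes s: "0 < s" "s < 1" and R: "0 < R" "s * R < 1" and z: "z \<in> ring r R" and \<beta>: "cmod \<beta> = s"
  shows "s\<^sup>2 * r < cmod (\<beta> * z)" "cmod (\<beta> * z) < 1" "s\<^sup>2 * r / cmod (\<beta> * z) \<le> s * R" "cmod (\<beta> * z) \<le> s * R" "0 < cmod z"
proof -
  have z': "r / R \<le> cmod z" "cmod z \<le> R" using z by (auto simp: ring_def)
  have "0 < r / R" using r R by simp
  then show z0: "0 < cmod z" using z' by linarith
  show le: "cmod (\<beta> * z) \<le> s * R" using z' s \<beta> by (simp add: norm_mult)
  then show "cmod (\<beta> * z) < 1" using R by linarith
  have "r \<le> cmod z * R" using z' R by (simp add: field_simps)
  then have "s * r \<le> s * (cmod z * R)" using s by (intro mult_left_mono) auto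
  then have sr: "s * r \<le> (s * R) * cmod z" by (simp add: mult_ac)
  have "s\<^sup>2 * r / cmod (\<beta> * z) = s * r / cmod z"
    using s \<beta> by (simp add: norm_mult power2_eq_square)
  also have "\<dots> \<le> s * R" using sr z0 by (simp add: field_simps)
  finally show d: "s\<^sup>2 * r / cmod (\<beta> * z) \<le> s * R" .
  have "0 < cmod (\<beta> * z)" using s \<beta> z0 by (simp add: norm_mult)
  moreover have "s\<^sup>2 * r / cmod (\<beta> * z) < 1" using d R by linarith
  ultimately show "s\<^sup>2 * r < cmod (\<beta> * z)" by (simp add: pos_divide_less_eq)
qed

lemma kern_partial_sum_error:
  assumes s: "0 < s" "s < 1" and R: "0 < R" "s * R < 1" and \<beta>: "cmod \<beta> = s" and ab: "cmod a = 1" "cmod b = 1"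
    and z: "z \<in> ring r R"
  defines "q \<equiv> s\<^sup>2 * r"
  shows "cmod ((\<Sum>k\<in>{- int N..int N}. (kcoef q a b k * \<beta> powi k) * z powi k) - kern q a b (\<beta> * z))
    \<le> 2 * (4 / (1 - q) * 1) / (1 - s * R) * (s * R) ^ N"
proof -
  have q: "0 < q" "q < 1" unfolding q_def using scaled_param[OF s] by auto
  note sr = scaled_ring[OF s R z \<beta>, folded q_def]
  have pos: "0 < cmod (\<beta> * z)" using sr(1) q by linarith
  have eq: "(kcoef q a b k * \<beta> powi k) * z powi k = kcoef q a b k * (\<beta> * z) powi k" for k
    by (simp add: power_int_mult_distrib mult.assoc)
  note b = kcoef_series_bound[OF q ab pos sr(4,3)]
  have sR: "0 \<le> s * R" using s R by simp
  from symmetric_series[OF b this R(2)] obtain v where v: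
    "(\<lambda>N. \<Sum>k\<in>{- int N..int N}. kcoef q a b k * (\<beta> * z) powi k) \<longlonglongrightarrow> v"
    "\<And>N. norm ((\<Sum>k\<in>{- int N..int N}. kcoef q a b k * (\<beta> * z) powi k) - v) \<le> 2 * (4 / (1 - q) * 1) / (1 - s * R) * (s * R) ^ N"
    by blast
  have "v = kern q a b (\<beta> * z)"
    using v(1) kern_laurent[OF q ab sr(1,2)] by (rule LIMSEQ_unique)
  then show ?thesis using v(2)[of N] by (simp only: eq)
qed

lemma kernel_op_laurent_limit:
  assumes s: "0 < s" "s < 1" and R: "0 < R" "s * R < 1" and \<beta>: "cmod \<beta> = s" and ab: "cmod a = 1" "cmod b = 1"
  defines "q \<equiv> s\<^sup>2 * r"
  shows "laurent_limit (ring r R) T B (\<lambda>z. kern q a b (\<beta> * z)) (kernel_op q a b \<beta> T B)"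
  unfolding laurent_limit_def
proof (intro allI impI)
  fix e :: real assume e: "e > 0"
  have sR: "0 \<le> s * R" using s R by simp
  have l: "(\<lambda>N. C * \<theta> ^ N) \<longlonglongrightarrow> 0" if "0 \<le> \<theta>" "\<theta> < 1" for C \<theta> :: real
    using tendsto_mult_right_zero[OF LIMSEQ_realpow_zero[OF that]] by simp
  have "\<forall>\<^sub>F N in sequentially. 2 * (4 / (1 - q) * M) / (1 - s) * s ^ N < e"
    by (rule order_tendstoD(2)[OF l[OF less_imp_le[OF s(1)] s(2)] e])
  moreover have "\<forall>\<^sub>F N in sequentially. 2 * (4 / (1 - q) * 1) / (1 - s * R) * (s * R) ^ N < e"
    by (rule order_tendstoD(2)[OF l[OF sR R(2)] e])
  ultimately have "\<forall>\<^sub>F N in sequentially. 2 * (4 / (1 - q) * M) / (1 - s) * s ^ N < e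
      \<and> 2 * (4 / (1 - q) * 1) / (1 - s * R) * (s * R) ^ N < e"
    by (rule eventually_conj)
  then obtain N where N: "2 * (4 / (1 - q) * M) / (1 - s) * s ^ N < e" "2 * (4 / (1 - q) * 1) / (1 - s * R) * (s * R) ^ N < e"
    by (auto simp: eventually_sequentially)
  obtain p n where pn1: "\<And>z. z \<noteq> 0 \<Longrightarrow> laurent_fun p n z = (\<Sum>k\<in>{- int N..int N}. (kcoef q a b k * \<beta> powi k) * z powi k)"
    and pn2: "\<And>(S :: 'a \<Rightarrow>\<^sub>L 'a) S'. is_inverse_op S S' \<Longrightarrow>
      laurent_op p n S S' = (\<Sum>k\<in>{- int N..int N}. (kcoef q a b k * \<beta> powi k) *\<^sub>C int_power S S' k)"
    by (rule laurent_of_sum[where N = N and c = "\<lambda>k. kcoef q a b k * \<beta> powi k"]) (rule that)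
  note pn = pn1 pn2[OF Binv]
  have "cmod (laurent_fun p n z - kern q a b (\<beta> * z)) \<le> e" if z: "z \<in> ring r R" for z
  proof -
    have "z \<noteq> 0" using scaled_ring(5)[OF s R z \<beta>] by auto
    then show ?thesis
      using kern_partial_sum_error[OF s R \<beta> ab z, of N] N(2) unfolding pn(1)[OF \<open>z \<noteq> 0\<close>] q_def[symmetric] by linarith
  qed
  moreover have "norm (laurent_op p n T B - kernel_op q a b \<beta> T B) \<le> e"
    using kernel_op_limit(2)[OF s \<beta> ab, of N] N(1) unfolding pn(2) q_def[symmetric] by linarith
  ultimately show "\<exists>p n. (\<forall>z\<in>ring r R. cmod (laurent_fun p n z - kern q a b (\<beta> * z)) \<le> e)
      \<and> norm (laurent_op p n T B - kernel_op q a b \<beta> T B) \<le> e" by blast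
qed

text \<open>Positivity spreads from the one-parameter family of aligned poles to all pairs of poles: a pair
  \<open>a, b\<close> is, after rotation by a square root \<open>\<alpha>\<close> of \<open>a b\<close>, of the form \<open>c, 1/c\<close>, and there
  \<open>(\<Gamma> - \<i> y) (f - \<i> D) = C > 0\<close> holds for the operators as it does for the functions.\<close>

lemma kernel_op_positive_all_poles:
  assumes s: "0 < s" "s < 1" and ab: "cmod a = 1" "cmod b = 1"
    and pos: "\<And>\<alpha> x. cmod \<alpha> = 1 \<Longrightarrow> 0 \<le> Re (cinner (blinfun_apply (kernel_op (s\<^sup>2 * r) 1 1 (of_real s * \<alpha>) T B) x) x)"
  shows "0 \<le> Re (cinner (blinfun_apply (kernel_op (s\<^sup>2 * r) a b (of_real s) T B) x) x)"
proof -
  define q where "q = s\<^sup>2 * r"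
  have q: "0 < q" "q < 1" unfolding q_def using scaled_param[OF s] by auto
  define \<alpha> where "\<alpha> = csqrt (a * b)"
  have \<alpha>2: "\<alpha> * \<alpha> = a * b" unfolding \<alpha>_def by (metis power2_csqrt power2_eq_square)
  have "cmod \<alpha> * cmod \<alpha> = 1" using arg_cong[OF \<alpha>2, of cmod] ab by (simp add: norm_mult)
  then have \<alpha>1: "cmod \<alpha> = 1" by (metis norm_ge_zero real_sqrt_abs2 real_sqrt_one abs_of_nonneg)
  then have \<alpha>0: "\<alpha> \<noteq> 0" by auto
  define c where "c = a / \<alpha>"
  have c1: "cmod c = 1" unfolding c_def using ab \<alpha>1 by (simp add: norm_divide)
  have nz: "a \<noteq> 0" "c \<noteq> 0" using ab c1 by auto
  have ca: "a = c * \<alpha>" unfolding c_def using \<alpha>0 by simp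
  have cb: "b = (1 / c) * \<alpha>" unfolding c_def using \<alpha>0 \<alpha>2 nz by (simp add: field_simps)
  define \<beta> where "\<beta> = of_real s / \<alpha>"
  have \<beta>: "cmod \<beta> = s" unfolding \<beta>_def using \<alpha>1 s by (simp add: norm_divide)
  have \<beta>': "\<beta> = of_real s * (1 / \<alpha>)" "cmod (1 / \<alpha>) = 1" unfolding \<beta>_def using \<alpha>1 by (simp_all add: norm_divide)
  have eq: "kernel_op q a b (of_real s) T B = kernel_op q c (1 / c) \<beta> T B"
    unfolding ca cb \<beta>_def by (rule kernel_op_rotate[OF \<alpha>0])
  have c1': "cmod (1 / c) = 1" using c1 by (simp add: norm_divide)
  define G F where "G = kernel_op q 1 1 \<beta> T B" and "F = kernel_op q c (1 / c) \<beta> T B"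
  have G: "0 \<le> Re (cinner (blinfun_apply G v) v)" for v
    using pos[OF \<beta>'(2), of v] unfolding \<beta>'(1)[symmetric] q_def[symmetric] G_def .
  have "0 \<le> Re (cinner (blinfun_apply F x) x)"
  proof (cases "c = 1")
    case True
    then show ?thesis using G[of x] by (simp add: F_def G_def)
  next
    case False
    obtain y D C :: real where C: "C > 0" and
      id: "\<And>z. q < cmod z \<Longrightarrow> cmod z < 1 \<Longrightarrow>
        (kern q 1 1 z - \<i> * of_real y) * (kern q c (1 / c) z - \<i> * of_real D) = of_real C"
      using kern_moebius[OF q c1 False] by blast
    define R where "R = (1 + 1 / s) / 2"
    have R: "1 < R" "s * R < 1" "0 < R" unfolding R_def using s by (auto simp: field_simps)
    have K: "compact (ring r R)" "0 \<notin> ring r R"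
      using compact_ring scaled_ring(5)[OF s R(3,2) _ \<beta>, of 0] by auto
    have "laurent_limit (ring r R) T B (\<lambda>z. kern q 1 1 (\<beta> * z)) G"
      unfolding G_def q_def by (rule kernel_op_laurent_limit[OF s R(3,2) \<beta>]) auto
    from laurent_limit_diff_const[OF this K(2), of "\<i> * of_real y"]
    have 1: "laurent_limit (ring r R) T B (\<lambda>z. kern q 1 1 (\<beta> * z) - \<i> * of_real y) (G - (\<i> * of_real y) *\<^sub>C id_blinfun)" .
    have "laurent_limit (ring r R) T B (\<lambda>z. kern q c (1 / c) (\<beta> * z)) F"
      unfolding F_def q_def by (rule kernel_op_laurent_limit[OF s R(3,2) \<beta> c1 c1'])
    from laurent_limit_diff_const[OF this K(2), of "\<i> * of_real D"]
    have 2: "laurent_limit (ring r R) T B (\<lambda>z. kern q c (1 / c) (\<beta> * z) - \<i> * of_real D) (F - (\<i> * of_real D) *\<^sub>C id_blinfun)" .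
    have "laurent_limit (ring r R) T B (\<lambda>z. laurent_fun [:of_real C:] 0 z)
        ((G - (\<i> * of_real y) *\<^sub>C id_blinfun) o\<^sub>L (F - (\<i> * of_real D) *\<^sub>C id_blinfun))"
      by (rule laurent_limit_cong[OF laurent_limit_mult[OF 1 2 K]])
        (use id scaled_ring[OF s R(3,2) _ \<beta>] in \<open>simp add: laurent_const q_def\<close>)
    from laurent_limit_unique[OF R(1) this laurent_limit_self]
    have op: "(G - (\<i> * of_real y) *\<^sub>C id_blinfun) o\<^sub>L (F - (\<i> * of_real D) *\<^sub>C id_blinfun) = of_real C *\<^sub>C id_blinfun"
      by (simp add: laurent_const)
    \<comment> \<open>With \<open>v = (F - \<i> D) x\<close> one has \<open>(G - \<i> y) v = C x\<close>, and imaginary constants do not affect real parts.\<close>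
    define v where "v = blinfun_apply (F - (\<i> * of_real D) *\<^sub>C id_blinfun) x"
    have Gv: "blinfun_apply G v - (\<i> * of_real y) *\<^sub>C v = C *\<^sub>R x"
      using arg_cong[OF op, of "\<lambda>A. blinfun_apply A x"]
      by (simp add: v_def[symmetric] scaleC_of_real) (simp add: blinfun.diff_left v_def)
    have "C * Re (cinner v x) = Re (cinner v (C *\<^sub>R x))" by (simp add: cinner_scaleR_right)
    also have "\<dots> = Re (cinner (C *\<^sub>R x) v)" by (simp only: Re_cinner inner_commute)
    also have "\<dots> = Re (cinner (blinfun_apply G v) v)"
      unfolding Gv[symmetric] by (simp add: cinner.diff_left cinner_scaleC_left cinner_self)
    finally have "0 \<le> C * Re (cinner v x)" using G by simp
    then have "0 \<le> Re (cinner v x)" using C by (simp add: zero_le_mult_iff)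
    moreover have "Re (cinner v x) = Re (cinner (blinfun_apply F x) x)"
      unfolding v_def by (simp add: blinfun.diff_left cinner.diff_left cinner_scaleC_left cinner_self)
    ultimately show ?thesis by simp
  qed
  then show ?thesis unfolding q_def[symmetric] eq F_def .
qed

text \<open>The numbers \<open>t k\<close> are the moments \<open>s\<^sup>k \<langle>T\<^sup>k x, x\<rangle>\<close>, and \<open>h\<close> is the Laurent polynomial in the variable \<open>s z\<close>, whose
  boundary circles \<open>|s z| = 1\<close> and \<open>|s z| = q\<close> are \<open>|z| = 1/s\<close> and \<open>|z| = r s\<close>. Truncating the kernels costs
  \<open>\<eta> N\<close>, which tends to 0.\<close>

lemma laurent_positive_scaled:
  assumes s: "0 < s" "s < 1"
    and pos: "\<And>\<alpha> x. cmod \<alpha> = 1 \<Longrightarrow> 0 \<le> Re (cinner (blinfun_apply (kernel_op (s\<^sup>2 * r) 1 1 (of_real s * \<alpha>) T B) x) x)"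
    and L: "\<And>z. cmod z = 1 / s \<or> cmod z = r * s \<Longrightarrow> 0 \<le> Re (laurent_fun p n z)"
  shows "0 \<le> Re (cinner (blinfun_apply (laurent_op p n T B) x) x)"
proof -
  define q where "q = s\<^sup>2 * r"
  have q: "0 < q" "q < 1" unfolding q_def using scaled_param[OF s] by auto
  let ?lc = "laurent_coeff p n"
  define t where "t k = of_real s powi k * cinner (blinfun_apply (int_power T B k) x) x" for k
  define h where "h k = ?lc k * of_real (1 / s) powi k" for k
  define \<eta> where "\<eta> N = 2 * (4 / (1 - q) * M) / (1 - s) * s ^ N * (norm x)\<^sup>2" for N
  have step: "- \<eta> N * Re (h 0) \<le> Re (cinner (blinfun_apply (laurent_op p n T B) x) x)" if N: "n + degree p \<le> N" for N
  proof -
    let ?I = "{- int N..int N}"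
    have N': "n \<le> N" "degree p \<le> N + n" using N by auto
    have "- \<eta> N * Re (h 0) \<le> Re (\<Sum>k\<in>?I. h k * t k)"
    proof (rule kernel_positivity_imp_pairing[OF q])
      show "Im (t 0) = 0" by (simp add: t_def cinner_self)
    next
      fix a b :: complex assume ab: "cmod a = 1" "cmod b = 1"
      let ?A = "\<Sum>k\<in>?I. (kcoef q a b k * of_real s powi k) *\<^sub>C int_power T B k"
      let ?K = "kernel_op q a b (of_real s) T B"
      have cs: "cmod (of_real s) = s" using s by simp
      have "norm (?A - ?K) \<le> 2 * (4 / (1 - q) * M) / (1 - s) * s ^ N"
        unfolding q_def by (rule kernel_op_limit(2)[OF s cs ab])
      then have "norm (blinfun_apply (?A - ?K) x) * norm x \<le> (2 * (4 / (1 - q) * M) / (1 - s) * s ^ N * norm x) * norm x"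
        by (intro mult_right_mono order_trans[OF norm_blinfun]) auto
      then have "cmod (cinner (blinfun_apply (?A - ?K) x) x) \<le> \<eta> N"
        using norm_cinner_le[of "blinfun_apply (?A - ?K) x" x] unfolding \<eta>_def by (simp add: power2_eq_square mult.assoc)
      then have "- \<eta> N \<le> Re (cinner (blinfun_apply (?A - ?K) x) x)"
        using abs_Re_le_cmod[of "cinner (blinfun_apply (?A - ?K) x) x"] by linarith
      moreover have "0 \<le> Re (cinner (blinfun_apply ?K x) x)"
        using kernel_op_positive_all_poles[OF s ab pos] unfolding q_def by blast
      ultimately have "- \<eta> N \<le> Re (cinner (blinfun_apply ?A x) x)"
        by (simp add: blinfun.diff_left cinner.diff_left)
      moreover have "cinner (blinfun_apply ?A x) x = (\<Sum>k\<in>?I. kcoef q a b k * t k)"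
        unfolding blinfun.sum_left cinner.sum_left t_def by (simp add: cinner_scaleC_left mult.assoc)
      ultimately show "- \<eta> N \<le> Re (\<Sum>k\<in>?I. kcoef q a b k * t k)" by simp
    next
      fix w :: complex assume w: "cmod w = 1"
      have nz: "w * of_real (1 / s) \<noteq> 0" "w * of_real (r * s) \<noteq> 0" using w s r by auto
      have "(\<Sum>k\<in>?I. h k * w powi k) = laurent_fun p n (w * of_real (1 / s))"
        unfolding laurent_fun_sum[OF nz(1) N'] h_def by (simp only: power_int_mult_distrib mult_ac)
      moreover have "cmod (w * of_real (1 / s)) = 1 / s" using w s by (simp add: norm_divide)
      ultimately show "0 \<le> Re (\<Sum>k\<in>?I. h k * w powi k)" using L by simp
      have rs: "r * s = (1 / s) * q" unfolding q_def using s by (simp add: power2_eq_square)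
      have e: "of_real (r * s) powi k = of_real (1 / s) powi k * (of_real (q powi k) :: complex)" for k
        unfolding rs of_real_mult power_int_mult_distrib of_real_power_int ..
      have "(\<Sum>k\<in>?I. h k * of_real (q powi k) * w powi k) = laurent_fun p n (w * of_real (r * s))"
        unfolding laurent_fun_sum[OF nz(2) N'] h_def power_int_mult_distrib e
        by (intro sum.cong refl) (simp only: mult_ac)
      moreover have "cmod (w * of_real (r * s)) = r * s" using w s r by (simp add: norm_mult)
      ultimately show "0 \<le> Re (\<Sum>k\<in>?I. h k * of_real (q powi k) * w powi k)" using L by simp
    qed
    also have "(\<Sum>k\<in>?I. h k * t k) = cinner (blinfun_apply (laurent_op p n T B) x) x"
    proof -
      have "of_real (1 / s) powi k * of_real s powi k = (1 :: complex)" for k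
        unfolding power_int_mult_distrib[symmetric] using s by simp
      then have "h k * t k = cinner (blinfun_apply (?lc k *\<^sub>C int_power T B k) x) x" for k
        unfolding h_def t_def by (simp add: cinner_scaleC_left)
      then show ?thesis unfolding laurent_op_sum[OF Binv N'] blinfun.sum_left cinner.sum_left by simp
    qed
    finally show ?thesis .
  qed
  have "(\<lambda>N. - (2 * (4 / (1 - q) * M) / (1 - s) * s ^ N * (norm x)\<^sup>2) * Re (h 0)) \<longlonglongrightarrow>
      - (2 * (4 / (1 - q) * M) / (1 - s) * 0 * (norm x)\<^sup>2) * Re (h 0)"
    using s by (intro tendsto_intros LIMSEQ_realpow_zero) auto
  then have "(\<lambda>N. - \<eta> N * Re (h 0)) \<longlonglongrightarrow> 0" unfolding \<eta>_def by simp
  then show ?thesis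
    by (rule LIMSEQ_le_const2) (use step in blast)
qed

text \<open>As \<open>s\<close> tends to 1, the circles \<open>|z| = 1/s\<close> and \<open>|z| = r s\<close> approach the annulus; a small constant added to
  the polynomial absorbs the difference.\<close>

lemma laurent_positive:
  assumes pos: "\<And>e \<alpha> x. 0 < e \<Longrightarrow> e < 1 \<Longrightarrow> cmod \<alpha> = 1 \<Longrightarrow>
      0 \<le> Re (cinner (blinfun_apply (kernel_op ((1 - e)\<^sup>2 * r) 1 1 (of_real (1 - e) * \<alpha>) T B) x) x)"
    and L: "\<And>z. z \<in> ring r 1 \<Longrightarrow> 0 \<le> Re (laurent_fun p n z)"
  shows "0 \<le> Re (cinner (blinfun_apply (laurent_op p n T B) x) x)"
proof -
  have le: "0 \<le> Re (cinner (blinfun_apply (laurent_op p n T B) x) x) + d * (norm x)\<^sup>2" if d: "d > 0" for d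
  proof -
    have "0 < r / 2" using r by simp
    then have "0 \<notin> ring r 2" unfolding ring_def by auto
    then have "continuous_on (ring r 2) (laurent_fun p n)"
      unfolding laurent_fun_def[abs_def] by (intro continuous_intros) auto
    then have "uniformly_continuous_on (ring r 2) (laurent_fun p n)"
      using compact_uniformly_continuous compact_ring by blast
    from uniformly_continuous_onE[OF this d] obtain \<delta> where
      \<delta>: "\<delta> > 0" "\<And>z w. z \<in> ring r 2 \<Longrightarrow> w \<in> ring r 2 \<Longrightarrow> dist w z < \<delta> \<Longrightarrow> dist (laurent_fun p n w) (laurent_fun p n z) < d"
      by blast
    define e where "e = min (1 / 2) (\<delta> / 4)"
    have e: "0 < e" "e < 1" "e \<le> 1 / 2" "2 * e < \<delta>" unfolding e_def using \<delta>(1) by auto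
    define s where "s = 1 - e"
    have s: "0 < s" "s < 1" "1 / 2 \<le> s" unfolding s_def using e by auto
    have near: "- d \<le> Re (laurent_fun p n z)" if "z \<in> ring r 2" "w \<in> ring r 1" "w \<in> ring r 2" "dist z w < \<delta>" for z w
    proof -
      have "cmod (laurent_fun p n z - laurent_fun p n w) < d" using \<delta>(2)[OF that(3,1,4)] by (simp add: dist_norm)
      then have "\<bar>Re (laurent_fun p n z) - Re (laurent_fun p n w)\<bar> < d"
        using abs_Re_le_cmod[of "laurent_fun p n z - laurent_fun p n w"] by simp
      then show ?thesis using L[OF that(2)] by linarith
    qed
    have "- d \<le> Re (laurent_fun p n z)" if z: "cmod z = 1 / s \<or> cmod z = r * s" for z
      using z
    proof
      assume z: "cmod z = 1 / s"
      have s2: "1 / s \<le> 2" "1 \<le> 1 / s" using s by (auto simp: field_simps)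
      have b: "r / 2 \<le> 1 / s" using s2 r by linarith
      show ?thesis
      proof (rule near[of z "of_real s * z"])
        show "z \<in> ring r 2" "of_real s * z \<in> ring r 1" "of_real s * z \<in> ring r 2"
          unfolding ring_def using z s s2 r b by (auto simp: norm_mult)
        have "z - of_real s * z = of_real e * z" unfolding s_def by (simp add: algebra_simps)
        then have "dist z (of_real s * z) = e * (1 / s)" using e z by (simp add: dist_norm norm_mult)
        also have "\<dots> \<le> e * 2" using e s2 by (intro mult_left_mono) auto
        finally show "dist z (of_real s * z) < \<delta>" using e by simp
      qed
    next
      assume z: "cmod z = r * s"
      have cw: "cmod (z / of_real s) = r" using z s by (simp add: norm_divide)
      have rs: "r / 2 \<le> r * s" "r * s \<le> 2" using s r mult_left_mono[of "1 / 2" s r] mult_mono[of r 1 s 1] by auto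
      show ?thesis
      proof (rule near[of z "z / of_real s"])
        show "z \<in> ring r 2" "z / of_real s \<in> ring r 1" "z / of_real s \<in> ring r 2"
          unfolding ring_def mem_Collect_eq cw z using rs r by auto
        have "z - z / of_real s = - (of_real e * (z / of_real s))" using s unfolding s_def by (simp add: field_simps)
        then have "dist z (z / of_real s) = \<bar>e\<bar> * r"
          by (simp only: dist_norm norm_minus_cancel norm_mult norm_of_real cw)
        then have "dist z (z / of_real s) = e * r" using e by simp
        also have "\<dots> \<le> e * 1" using e r by (intro mult_left_mono) auto
        finally show "dist z (z / of_real s) < \<delta>" using e by simp
      qed
    qed
    note lower = this
    define P where "P = p - monom (- of_real d) n"
    have "0 \<le> Re (cinner (blinfun_apply (laurent_op P n T B) x) x)"
    proof (rule laurent_positive_scaled[OF s(1,2)])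
      show "0 \<le> Re (cinner (blinfun_apply (kernel_op (s\<^sup>2 * r) 1 1 (of_real s * \<alpha>) T B) x) x)" if "cmod \<alpha> = 1" for \<alpha> x
        unfolding s_def by (rule pos[OF e(1,2) that])
      show "0 \<le> Re (laurent_fun P n z)" if z: "cmod z = 1 / s \<or> cmod z = r * s" for z
      proof -
        have "0 < r * s" "0 < 1 / s" using r s by simp_all
        then have "z \<noteq> 0" using z by auto
        then show ?thesis using lower[OF z] unfolding P_def by (simp add: laurent_diff_const)
      qed
    qed
    then show ?thesis
      unfolding P_def laurent_diff_const
      by (simp add: blinfun.diff_left cinner.diff_left cinner_scaleC_left cinner_self)
  qed
  have "0 \<le> Re (cinner (blinfun_apply (laurent_op p n T B) x) x) + e" if e: "e > 0" for e
  proof -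
    have "0 < (norm x)\<^sup>2 + 1" by (simp add: add_nonneg_pos)
    then have "e / ((norm x)\<^sup>2 + 1) * (norm x)\<^sup>2 \<le> e" using e by (simp add: field_simps)
    moreover have "0 < e / ((norm x)\<^sup>2 + 1)" using e \<open>0 < (norm x)\<^sup>2 + 1\<close> by simp
    ultimately show ?thesis using le[of "e / ((norm x)\<^sup>2 + 1)"] by linarith
  qed
  then show ?thesis by (rule field_le_epsilon)
qed

text \<open>The hypothesis \<open>L\<close> is stated for all Laurent polynomials, because the approximations of \<open>h\<close> are shifted
  by a constant to make their real part nonnegative.\<close>

lemma laurent_limit_positive:
  assumes A: "laurent_limit K T B h A" and K: "0 \<notin> K" and h: "\<And>z. z \<in> K \<Longrightarrow> 0 \<le> Re (h z)"
    and L: "\<And>p n x. (\<And>z. z \<in> K \<Longrightarrow> 0 \<le> Re (laurent_fun p n z)) \<Longrightarrow> 0 \<le> Re (cinner (blinfun_apply (laurent_op p n T B) x) x)"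
  shows "0 \<le> Re (cinner (blinfun_apply A x) x)"
proof -
  have le: "0 \<le> Re (cinner (blinfun_apply A x) x) + e * (2 * (norm x)\<^sup>2)" if e: "e > 0" for e
  proof -
    obtain p n where pn: "\<And>z. z \<in> K \<Longrightarrow> cmod (laurent_fun p n z - h z) \<le> e" "norm (laurent_op p n T B - A) \<le> e"
      using laurent_limitE[OF A e] by blast
    have "0 \<le> Re (laurent_fun (p - monom (- of_real e) n) n z)" if z: "z \<in> K" for z
    proof -
      have "z \<noteq> 0" using z K by auto
      moreover have "\<bar>Re (laurent_fun p n z) - Re (h z)\<bar> \<le> e"
        using abs_Re_le_cmod[of "laurent_fun p n z - h z"] pn(1)[OF z] by simp
      ultimately show ?thesis using h[OF z] by (simp add: laurent_diff_const)
    qed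
    then have "0 \<le> Re (cinner (blinfun_apply (laurent_op (p - monom (- of_real e) n) n T B) x) x)" by (rule L)
    then have 1: "0 \<le> Re (cinner (blinfun_apply (laurent_op p n T B) x) x) + e * (norm x)\<^sup>2"
      unfolding laurent_diff_const by (simp add: blinfun.diff_left cinner.diff_left cinner_scaleC_left cinner_self)
    have "norm (blinfun_apply (laurent_op p n T B - A) x) * norm x \<le> (e * norm x) * norm x"
      using pn(2) by (intro mult_right_mono order_trans[OF norm_blinfun]) auto
    then have "cmod (cinner (blinfun_apply (laurent_op p n T B - A) x) x) \<le> e * (norm x)\<^sup>2"
      using norm_cinner_le[of "blinfun_apply (laurent_op p n T B - A) x" x] by (simp add: power2_eq_square mult.assoc)
    then have "Re (cinner (blinfun_apply (laurent_op p n T B - A) x) x) \<le> e * (norm x)\<^sup>2"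
      using complex_Re_le_cmod order_trans by blast
    then show ?thesis using 1 by (simp add: blinfun.diff_left cinner.diff_left algebra_simps)
  qed
  have "0 \<le> Re (cinner (blinfun_apply A x) x) + e" if e: "e > 0" for e
  proof -
    have "0 < 2 * (norm x)\<^sup>2 + 1" by (simp add: add_nonneg_pos)
    then have "e / (2 * (norm x)\<^sup>2 + 1) * (2 * (norm x)\<^sup>2) \<le> e" using e by (simp add: field_simps)
    moreover have "0 < e / (2 * (norm x)\<^sup>2 + 1)" using e \<open>0 < 2 * (norm x)\<^sup>2 + 1\<close> by simp
    ultimately show ?thesis using le[of "e / (2 * (norm x)\<^sup>2 + 1)"] by linarith
  qed
  then show ?thesis by (rule field_le_epsilon)
qed

end

section \<open>Agler's criterion for annulus contractions\<close>

lemma closure_annulus: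
  assumes r: "0 < r" "r < 1" shows "closure (annulus r) = ring r 1"
proof
  have "annulus r \<subseteq> ring r 1" by (auto simp: annulus_def ring_def)
  then show "closure (annulus r) \<subseteq> ring r 1"
    using closure_minimal compact_imp_closed[OF compact_ring] by blast
  show "ring r 1 \<subseteq> closure (annulus r)"
  proof
    fix z assume z: "z \<in> ring r 1"
    then have z': "r \<le> cmod z" "cmod z \<le> 1" "z \<noteq> 0" using r by (auto simp: ring_def)
    define m where "m = (r + 1) / 2"
    have m: "r < m" "m < 1" using r by (auto simp: m_def)
    define c where "c n = cmod z + (m - cmod z) * (1 / real (n + 2))" for n
    define f where "f n = of_real (c n) * sgn z" for n
    have "f n \<in> annulus r" for n
    proof -
      define t where "t = 1 / real (n + 2)"
      have t: "0 < t" "t < 1" by (auto simp: t_def)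
      have "c n = cmod z + (m - cmod z) * t" unfolding c_def t_def ..
      then have c: "c n = (1 - t) * cmod z + t * m" by (simp add: algebra_simps)
      have "(1 - t) * r \<le> (1 - t) * cmod z" "(1 - t) * cmod z \<le> (1 - t) * 1" "t * r < t * m" "t * m < t * 1"
        using z' t m by (auto intro: mult_left_mono)
      then have "r < c n" "c n < 1" unfolding c by (auto simp: algebra_simps)
      then show ?thesis using z'(3) r unfolding annulus_def f_def by (simp add: norm_mult norm_sgn)
    qed
    moreover have "f \<longlonglongrightarrow> z"
    proof -
      have "(\<lambda>n. 1 / real (n + 2)) \<longlonglongrightarrow> 0"
        using LIMSEQ_ignore_initial_segment[OF lim_1_over_n, of 2] by simp
      then have "f \<longlonglongrightarrow> of_real (cmod z + (m - cmod z) * 0) * sgn z"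
        unfolding f_def c_def by (intro tendsto_intros)
      then show ?thesis using z'(3) by (simp add: sgn_eq)
    qed
    ultimately show "z \<in> closure (annulus r)" unfolding closure_sequential by blast
  qed
qed

context power_bounded_annular
begin

text \<open>A Laurent polynomial that is almost inverse to \<open>z - w\<close>, both on \<open>K\<close> and at \<open>T\<close>, is close to the inverse there.\<close>

lemma inverse_laurent_limit:
  assumes K: "compact K" "0 \<notin> K" and Q: "is_inverse_op (poly_op [:- w, 1:] T) Q" and d: "d > 0" "\<And>z. z \<in> K \<Longrightarrow> d \<le> cmod (z - w)"
    and approx: "\<And>e. e > 0 \<Longrightarrow> \<exists>p n. (\<forall>z\<in>K. cmod ((z - w) * laurent_fun p n z - 1) \<le> e)
        \<and> norm ((poly_op [:- w, 1:] T o\<^sub>L laurent_op p n T B) - id_blinfun) \<le> e"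
  shows "laurent_limit K T B (\<lambda>z. 1 / (z - w)) Q"
  unfolding laurent_limit_def
proof (intro allI impI)
  fix e :: real assume e: "e > 0"
  define e' where "e' = min (e * d) (e / (norm Q + 1))"
  have Q1: "0 < norm Q + 1" by (simp add: add_nonneg_pos)
  have e': "e' > 0" "e' \<le> e * d" "e' \<le> e / (norm Q + 1)" unfolding e'_def using e d Q1 by auto
  obtain p n where pn: "\<And>z. z \<in> K \<Longrightarrow> cmod ((z - w) * laurent_fun p n z - 1) \<le> e'"
    "norm ((poly_op [:- w, 1:] T o\<^sub>L laurent_op p n T B) - id_blinfun) \<le> e'" using approx[OF e'(1)] by blast
  have "cmod (laurent_fun p n z - 1 / (z - w)) \<le> e" if z: "z \<in> K" for z
  proof -
    have zw: "0 < cmod (z - w)" using d(1) d(2)[OF z] by linarith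
    then have "z - w \<noteq> 0" by auto
    then have "laurent_fun p n z - 1 / (z - w) = ((z - w) * laurent_fun p n z - 1) / (z - w)"
      by (simp add: diff_divide_distrib)
    then have "cmod (laurent_fun p n z - 1 / (z - w)) = cmod ((z - w) * laurent_fun p n z - 1) / cmod (z - w)"
      by (simp only: norm_divide)
    also have "\<dots> \<le> (e * d) / d" using pn(1)[OF z] e' d(1) d(2)[OF z] by (intro frac_le) auto
    finally show ?thesis using d(1) by simp
  qed
  moreover have "norm (laurent_op p n T B - Q) \<le> e"
  proof -
    have "laurent_op p n T B - Q = Q o\<^sub>L ((poly_op [:- w, 1:] T o\<^sub>L laurent_op p n T B) - id_blinfun)"
    proof -
      have "Q o\<^sub>L (poly_op [:- w, 1:] T o\<^sub>L laurent_op p n T B) = (Q o\<^sub>L poly_op [:- w, 1:] T) o\<^sub>L laurent_op p n T B"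
        by (simp only: compose_eqs)
      also have "\<dots> = laurent_op p n T B" using Q by (simp add: is_inverse_op_def compose_eqs)
      finally show ?thesis by (simp add: blinfun_compose.diff_right compose_eqs)
    qed
    then have "norm (laurent_op p n T B - Q) \<le> norm Q * e'"
      using order_trans[OF norm_blinfun_compose mult_left_mono[OF pn(2) norm_ge_zero]] by simp
    also have "\<dots> \<le> (norm Q + 1) * (e / (norm Q + 1))" using e' by (intro mult_mono) auto
    finally show ?thesis using Q1 by simp
  qed
  ultimately show "\<exists>p n. (\<forall>z\<in>K. cmod (laurent_fun p n z - 1 / (z - w)) \<le> e) \<and> norm (laurent_op p n T B - Q) \<le> e" by blast
qed

lemma poly_op_linear: "poly_op [:- w, 1:] T = T - w *\<^sub>C id_blinfun"
  by (rule blinfun_eqI)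
    (simp add: poly_op_pCons[OF Tcl] blinfun.bilinear_simps scaleC_minus_left scaleC_blinfun_simps)

text \<open>The approximate inverses are partial geometric series, in \<open>z/w\<close> when \<open>|w| > 1\<close> and in \<open>w/z\<close> when
  \<open>|w| < r\<close>: \<open>z - w\<close> divides \<open>z\<^sup>N - w\<^sup>N\<close>, and dividing by \<open>- w\<^sup>N\<close> or by \<open>z\<^sup>N\<close> leaves \<open>1\<close> up to an error that decays
  geometrically. The operator exists as an inverse because \<open>w\<close> is not in the spectrum.\<close>

lemma linear_factor_laurent_limit:
  assumes spec: "op_spectrum T \<subseteq> ring r 1" and w: "w \<notin> ring r 1"
  obtains Q where "is_inverse_op (poly_op [:- w, 1:] T) Q" "laurent_limit (ring r 1) T B (\<lambda>z. 1 / (z - w)) Q"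
proof -
  have K: "compact (ring r 1)" by (rule compact_ring)
  have K0: "0 \<notin> ring r 1" using r by (simp add: ring_def)
  note K = K K0
  obtain R where R: "is_inverse_op (w *\<^sub>C id_blinfun - T) R"
    using spec w unfolding op_spectrum_def by blast
  have Q: "is_inverse_op (poly_op [:- w, 1:] T) (- R)"
    using is_inverse_op_apply[OF R] R
    by (intro is_inverse_opI)
      (auto simp: poly_op_linear is_inverse_op_def blinfun.bilinear_simps intro: clin)
  have fact: "\<exists>p. monom 1 N - [:w ^ N:] = [:- w, 1:] * p" for N
    using poly_eq_0_iff_dvd[of "monom 1 N - [:w ^ N:]" w] by (simp add: poly_monom dvd_def)
  have l: "\<exists>N. C * \<theta> ^ N \<le> e" if "0 \<le> \<theta>" "\<theta> < 1" "e > 0" for C \<theta> e :: real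
  proof -
    have "(\<lambda>N. C * \<theta> ^ N) \<longlonglongrightarrow> 0" using tendsto_mult_right_zero[OF LIMSEQ_realpow_zero[OF that(1,2)]] by simp
    then have "\<forall>\<^sub>F N in sequentially. C * \<theta> ^ N < e" by (rule order_tendstoD(2)) (rule that)
    then show ?thesis by (auto simp: eventually_sequentially intro: less_imp_le)
  qed
  have pw: "poly_op [:- w, 1:] T o\<^sub>L poly_op p T = op_power T N - w ^ N *\<^sub>C id_blinfun"
    if "monom 1 N - [:w ^ N:] = [:- w, 1:] * p" for p N
  proof -
    have "poly_op [:- w, 1:] T o\<^sub>L poly_op p T = poly_op (monom 1 N - [:w ^ N:]) T"
      unfolding that by (rule poly_op_mult[OF Tcl, symmetric])
    also have "\<dots> = op_power T N - w ^ N *\<^sub>C id_blinfun"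
      by (simp add: poly_op_diff poly_op_monom scaleC_blinfun_simps poly_op_pCons[OF Tcl])
    finally show ?thesis .
  qed
  have pf: "(z - w) * poly p z = z ^ N - w ^ N" if "monom 1 N - [:w ^ N:] = [:- w, 1:] * p" for p N z
    using arg_cong[OF that, of "\<lambda>p. poly p z"] by (simp add: poly_monom algebra_simps)
  have "laurent_limit (ring r 1) T B (\<lambda>z. 1 / (z - w)) (- R)"
  proof (cases "cmod w > 1")
    case True
    then have w0: "w \<noteq> 0" by auto
    show ?thesis
    proof (rule inverse_laurent_limit[OF K Q, of "cmod w - 1"])
      show "0 < cmod w - 1" using True by simp
      show "cmod w - 1 \<le> cmod (z - w)" if "z \<in> ring r 1" for z
        using norm_triangle_ineq2[of w z] that unfolding ring_def by (simp add: norm_minus_commute)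
      fix e :: real assume "e > 0"
      moreover have "0 \<le> 1 / cmod w" "1 / cmod w < 1" using True by (auto simp: divide_less_eq)
      ultimately obtain N where N: "(M + 1) * (1 / cmod w) ^ N \<le> e" using l by blast
      obtain p where p: "monom 1 N - [:w ^ N:] = [:- w, 1:] * p" using fact by blast
      define P where "P = smult (- 1 / w ^ N) p"
      have "cmod ((z - w) * laurent_fun P 0 z - 1) \<le> e" if z: "z \<in> ring r 1" for z
      proof -
        have "(z - w) * laurent_fun P 0 z = (- 1 / w ^ N) * ((z - w) * poly p z)"
          by (simp add: laurent_fun_def P_def)
        also have "\<dots> = 1 - (z / w) ^ N" unfolding pf[OF p] using w0 by (simp add: field_simps power_divide)
        finally have "cmod ((z - w) * laurent_fun P 0 z - 1) = cmod ((z / w) ^ N)" by simp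
        also have "\<dots> = cmod z ^ N * (1 / cmod w) ^ N" by (simp add: norm_power norm_divide power_divide)
        also have "\<dots> \<le> 1 * (1 / cmod w) ^ N" using z by (intro mult_right_mono power_le_one) (auto simp: ring_def)
        also have "\<dots> \<le> (M + 1) * (1 / cmod w) ^ N" using M0 by (intro mult_right_mono) auto
        finally show ?thesis using N by linarith
      qed
      moreover have "norm ((poly_op [:- w, 1:] T o\<^sub>L laurent_op P 0 T B) - id_blinfun) \<le> e"
      proof -
        have "poly_op [:- w, 1:] T o\<^sub>L laurent_op P 0 T B = (- 1 / w ^ N) *\<^sub>C (op_power T N - w ^ N *\<^sub>C id_blinfun)"
          unfolding laurent_op_def P_def poly_op_smult pw[OF p, symmetric]
          by (simp add: compose_eqs scaleC_compose_right[OF clinear_poly_op[OF Tcl]])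
        also have "\<dots> - id_blinfun = (- 1 / w ^ N) *\<^sub>C op_power T N"
          using w0 by (intro blinfun_eqI) (simp add: blinfun.bilinear_simps scaleC_diff_right scaleC_scaleC scaleC_minus_left)
        also have "norm \<dots> = (1 / cmod w) ^ N * norm (op_power T N)"
          by (simp add: norm_scaleC_blinfun norm_divide norm_power power_divide)
        also have "\<dots> \<le> (1 / cmod w) ^ N * (M + 1)"
          by (intro mult_left_mono order_trans[OF powT]) auto
        finally show ?thesis using N by (simp add: mult.commute)
      qed
      ultimately show "\<exists>p n. (\<forall>z\<in>ring r 1. cmod ((z - w) * laurent_fun p n z - 1) \<le> e)
        \<and> norm ((poly_op [:- w, 1:] T o\<^sub>L laurent_op p n T B) - id_blinfun) \<le> e" by blast
    qed
  next
    case False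
    then have wr: "cmod w < r" using w by (auto simp: ring_def)
    show ?thesis
    proof (rule inverse_laurent_limit[OF K Q, of "r - cmod w"])
      show "0 < r - cmod w" using wr by simp
      show "r - cmod w \<le> cmod (z - w)" if "z \<in> ring r 1" for z
        using norm_triangle_ineq2[of z w] that unfolding ring_def by simp
      fix e :: real assume "e > 0"
      then obtain N where N: "(M + 1) * (cmod w / r) ^ N \<le> e" using l[of "cmod w / r" e "M + 1"] wr r by auto
      obtain p where p: "monom 1 N - [:w ^ N:] = [:- w, 1:] * p" using fact by blast
      have "cmod ((z - w) * laurent_fun p N z - 1) \<le> e" if z: "z \<in> ring r 1" for z
      proof -
        have z0: "z \<noteq> 0" "r \<le> cmod z" using z K(2) by (auto simp: ring_def)
        have "(z - w) * laurent_fun p N z = ((z - w) * poly p z) / z ^ N" by (simp add: laurent_fun_def)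
        also have "\<dots> = 1 - (w / z) ^ N" unfolding pf[OF p] using z0 by (simp add: field_simps power_divide)
        finally have "cmod ((z - w) * laurent_fun p N z - 1) = (cmod w / cmod z) ^ N"
          by (simp add: norm_power norm_divide)
        also have "\<dots> \<le> (cmod w / r) ^ N" using z0 r by (intro power_mono divide_left_mono) auto
        also have "\<dots> \<le> (M + 1) * (cmod w / r) ^ N"
          using M0 mult_right_mono[of 1 "M + 1" "(cmod w / r) ^ N"] r by simp
        finally show ?thesis using N by linarith
      qed
      moreover have "norm ((poly_op [:- w, 1:] T o\<^sub>L laurent_op p N T B) - id_blinfun) \<le> e"
      proof -
        have TB: "op_power T N o\<^sub>L op_power B N = id_blinfun"
          using is_inverse_op_power[OF Binv, of N] by (simp add: is_inverse_op_def)
        have "poly_op [:- w, 1:] T o\<^sub>L laurent_op p N T B = (op_power T N - w ^ N *\<^sub>C id_blinfun) o\<^sub>L op_power B N"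
          unfolding laurent_op_def pw[OF p, symmetric] by (simp only: compose_eqs)
        also have "\<dots> - id_blinfun = (- (w ^ N)) *\<^sub>C op_power B N"
          unfolding blinfun_compose.diff_left TB
          by (intro blinfun_eqI) (simp add: blinfun.bilinear_simps scaleC_minus_left)
        also have "norm \<dots> = cmod w ^ N * norm (op_power B N)"
          by (simp add: norm_scaleC_blinfun norm_power)
        also have "\<dots> \<le> cmod w ^ N * (M / r ^ N)" by (intro mult_left_mono powB) auto
        also have "\<dots> = M * (cmod w / r) ^ N" by (simp add: power_divide)
        also have "\<dots> \<le> (M + 1) * (cmod w / r) ^ N" using r by (intro mult_right_mono) auto
        finally show ?thesis using N by linarith
      qed
      ultimately show "\<exists>p n. (\<forall>z\<in>ring r 1. cmod ((z - w) * laurent_fun p n z - 1) \<le> e)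
        \<and> norm ((poly_op [:- w, 1:] T o\<^sub>L laurent_op p n T B) - id_blinfun) \<le> e" by blast
    qed
  qed
  then show thesis using Q that by blast
qed

lemma one_in_ring: "1 \<in> ring r 1"
  using r by (simp add: ring_def)

text \<open>The roots of \<open>q\<close> lie off the ring, so its linear factors can be inverted one by one.\<close>

lemma reciprocal_laurent_limit:
  assumes spec: "op_spectrum T \<subseteq> ring r 1"
  shows "(\<And>z. z \<in> ring r 1 \<Longrightarrow> poly q z \<noteq> 0) \<Longrightarrow>
    \<exists>Q. is_inverse_op (poly_op q T) Q \<and> laurent_limit (ring r 1) T B (\<lambda>z. 1 / poly q z) Q"
proof (induction "degree q" arbitrary: q)
  case 0
  then obtain c where c: "q = [:c:]" using degree_eq_zeroE by metis
  have c0: "c \<noteq> 0" using 0(2)[OF one_in_ring] c by simp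
  have "poly_op q T = c *\<^sub>C id_blinfun" unfolding c using laurent_const(2)[of c] by (simp add: laurent_op_def compose_eqs)
  then have "is_inverse_op (poly_op q T) ((1 / c) *\<^sub>C id_blinfun)" using is_inverse_scaleC_id[OF c0] by simp
  moreover have "laurent_limit (ring r 1) T B (\<lambda>z. 1 / poly q z) ((1 / c) *\<^sub>C id_blinfun)"
    using laurent_limit_self[of "ring r 1" T B "[:1 / c:]" 0] unfolding laurent_const(2)
    by (rule laurent_limit_cong) (simp add: laurent_const c)
  ultimately show ?case by blast
next
  case (Suc d)
  have "\<not> constant (poly q)" using Suc(2) by (simp add: constant_degree)
  then obtain w where w: "poly q w = 0" using fundamental_theorem_of_algebra by blast
  then obtain q' where q': "q = [:- w, 1:] * q'" using poly_eq_0_iff_dvd by (auto simp: dvd_def)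
  have "q' \<noteq> 0" using Suc(2) q' by auto
  then have "degree q = Suc (degree q')" unfolding q' by (subst degree_mult_eq) auto
  then have d: "d = degree q'" using Suc(2) by simp
  have nz: "poly q' z \<noteq> 0" if "z \<in> ring r 1" for z using Suc(3)[OF that] unfolding q' by auto
  have w1: "w \<notin> ring r 1" using Suc(3) w by blast
  obtain Q' where Q': "is_inverse_op (poly_op q' T) Q'" "laurent_limit (ring r 1) T B (\<lambda>z. 1 / poly q' z) Q'"
    using Suc(1)[OF d nz] by blast
  obtain Q where Q: "is_inverse_op (poly_op [:- w, 1:] T) Q" "laurent_limit (ring r 1) T B (\<lambda>z. 1 / (z - w)) Q"
    using linear_factor_laurent_limit[OF spec w1] by blast
  have "is_inverse_op (poly_op q T) (Q' o\<^sub>L Q)"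
    unfolding q' poly_op_mult[OF Tcl] by (rule is_inverse_op_compose[OF Q(1) Q'(1)])
  moreover have "laurent_limit (ring r 1) T B (\<lambda>z. 1 / poly q z) (Q' o\<^sub>L Q)"
  proof (rule laurent_limit_cong[OF laurent_limit_mult[OF Q'(2) Q(2) compact_ring]])
    show "0 \<notin> ring r 1" using r by (auto simp: ring_def)
    show "1 / poly q' z * (1 / (z - w)) = 1 / poly q z" for z
    proof -
      have "poly q z = poly q' z * (z - w)" unfolding q' by (simp add: algebra_simps)
      then show ?thesis by simp
    qed
  qed
  ultimately show ?case by blast
qed

text \<open>Von Neumann's inequality for rational functions is the positivity of
  \<open>(m + f) / (m - f)\<close> on the operator, for every \<open>m\<close> above the supremum of \<open>|f|\<close>.\<close>

lemma annulus_contraction_if_positive: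
  assumes spec: "op_spectrum T \<subseteq> ring r 1"
    and pos: "\<And>e \<alpha> x. 0 < e \<Longrightarrow> e < 1 \<Longrightarrow> cmod \<alpha> = 1 \<Longrightarrow>
      0 \<le> Re (cinner (blinfun_apply (kernel_op ((1 - e)\<^sup>2 * r) 1 1 (of_real (1 - e) * \<alpha>) T B) x) x)"
  shows "annulus_contraction r T"
  unfolding annulus_contraction_def spectral_set_def closure_annulus[OF r]
proof (intro conjI allI impI Tcl compact_ring spec)
  fix p q assume q: "\<forall>z\<in>ring r 1. poly q z \<noteq> 0"
  have nz: "0 \<notin> ring r 1" using r by (auto simp: ring_def)
  define m where "m = (SUP z\<in>ring r 1. cmod (poly p z / poly q z))"
  have "continuous_on (ring r 1) (\<lambda>z. cmod (poly p z / poly q z))"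
    using q by (intro continuous_intros) auto
  then have "bdd_above ((\<lambda>z. cmod (poly p z / poly q z)) ` ring r 1)"
    by (intro bounded_imp_bdd_above compact_imp_bounded compact_continuous_image compact_ring)
  then have m: "cmod (poly p z / poly q z) \<le> m" if "z \<in> ring r 1" for z
    unfolding m_def using that by (intro cSUP_upper)
  have m0: "0 \<le> m" using order_trans[OF norm_ge_zero m[OF one_in_ring]] .
  obtain Q where Q: "is_inverse_op (poly_op q T) Q" using reciprocal_laurent_limit[OF spec] q by blast
  have "norm (poly_op p T o\<^sub>L Q) \<le> m + e" if e: "e > 0" for e
  proof (rule norm_blinfun_bound)
    define m' where "m' = m + e"
    have m': "m < m'" "0 < m'" unfolding m'_def using e m0 by auto
    show "0 \<le> m + e" using m0 e by simp
    \<comment> \<open>The function \<open>u/d\<close> is \<open>(m' + f) / (m' - f)\<close> for \<open>f = p/q\<close>.\<close>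
    define d u where "d = smult (of_real m') q - p" and "u = smult (of_real m') q + p"
    have dz: "poly d z \<noteq> 0" if "z \<in> ring r 1" for z
    proof
      assume "poly d z = 0"
      then have "poly p z / poly q z = of_real m'" using q that by (simp add: d_def field_simps)
      then have "cmod (poly p z / poly q z) = m'" using m' by simp
      then show False using m[OF that] m' by simp
    qed
    obtain D where D: "is_inverse_op (poly_op d T) D" "laurent_limit (ring r 1) T B (\<lambda>z. 1 / poly d z) D"
      using reciprocal_laurent_limit[OF spec dz] by blast
    have "laurent_limit (ring r 1) T B (laurent_fun u 0) (poly_op u T)"
      using laurent_limit_self[of "ring r 1" T B u 0] by (simp add: laurent_op_def compose_eqs)
    note h = laurent_limit_mult[OF this D(2) compact_ring nz]
    have "0 \<le> Re (laurent_fun u 0 z * (1 / poly d z))" if z: "z \<in> ring r 1" for z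
    proof -
      define g where "g = poly p z / poly q z"
      have pz: "poly p z = g * poly q z" unfolding g_def using q z by simp
      have "laurent_fun u 0 z * (1 / poly d z) = ((of_real m' + g) * poly q z) / ((of_real m' - g) * poly q z)"
        unfolding laurent_fun_def u_def d_def by (simp add: pz algebra_simps)
      also have "\<dots> = (of_real m' + g) / (of_real m' - g)" using q z by simp
      finally show ?thesis
        using Re_cayley_nonneg[of g "of_real m'"] m[OF z] m' unfolding g_def[symmetric] by simp
    qed
    then have P: "0 \<le> Re (cinner (blinfun_apply (poly_op u T o\<^sub>L D) v) v)" for v
      by (rule laurent_limit_positive[OF h nz]) (auto intro: laurent_positive pos)
    have key: "norm (blinfun_apply (poly_op p T) x) \<le> m' * norm (blinfun_apply (poly_op q T) x)" for x
    proof -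
      define a b where "a = m' *\<^sub>R blinfun_apply (poly_op q T) x" and "b = blinfun_apply (poly_op p T) x"
      \<comment> \<open>Positivity at the vector \<open>d(T) x\<close>, on which the inverse of \<open>d(T)\<close> can be evaluated.\<close>
      have P': "0 \<le> Re (cinner (blinfun_apply (poly_op u T) x) (blinfun_apply (poly_op d T) x))"
        using P[of "blinfun_apply (poly_op d T) x"] is_inverse_op_apply(2)[OF D(1)] by simp
      have ab: "blinfun_apply (poly_op u T) x = a + b" "blinfun_apply (poly_op d T) x = a - b"
        unfolding u_def d_def a_def b_def poly_op_add poly_op_diff poly_op_smult
        by (simp_all add: blinfun.bilinear_simps scaleC_of_real)
      have "0 \<le> Re (cinner (a + b) (a - b))" using P' unfolding ab .
      also have "\<dots> = (norm a)\<^sup>2 - (norm b)\<^sup>2"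
        unfolding Re_cinner by (simp add: inner_add_left inner_diff_right inner_commute[of b a] power2_norm_eq_inner)
      finally have "(norm b)\<^sup>2 \<le> (norm a)\<^sup>2" by simp
      then have "norm b \<le> norm a" by (rule power2_le_imp_le) simp
      then have "norm b \<le> \<bar>m'\<bar> * norm (blinfun_apply (poly_op q T) x)" unfolding a_def norm_scaleR .
      then show ?thesis unfolding b_def using m'(2) by (simp only: abs_of_pos)
    qed
    fix y
    show "norm (blinfun_apply (poly_op p T o\<^sub>L Q) y) \<le> (m + e) * norm y"
      using key[of "blinfun_apply Q y"]
      unfolding is_inverse_op_apply(1)[OF Q] m'_def blinfun_apply_blinfun_compose .
  qed
  then have "norm (poly_op p T o\<^sub>L Q) \<le> m" by (rule field_le_epsilon)
  then show "norm (poly_op p T o\<^sub>L op_inv (poly_op q T)) \<le> (SUP z\<in>ring r 1. cmod (poly p z / poly q z))"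
    unfolding op_inv_eqI[OF Q] m_def .
qed

end

text \<open>A Laurent polynomial is a rational function with its pole at 0, off the annulus.\<close>

lemma annulus_contraction_laurent_bound:
  assumes r: "0 < r" "r < 1" and T: "annulus_contraction r T" and B: "is_inverse_op T B"
    and m: "\<And>z. z \<in> ring r 1 \<Longrightarrow> cmod (laurent_fun p n z) \<le> m"
  shows "norm (laurent_op p n T B) \<le> m"
proof -
  have nz: "0 \<notin> ring r 1" using r by (auto simp: ring_def)
  have ss: "spectral_set (ring r 1) T" using T unfolding annulus_contraction_def closure_annulus[OF r] by simp
  have "\<forall>z\<in>ring r 1. poly (monom 1 n) z \<noteq> (0::complex)" using nz by (auto simp: poly_monom)
  then have "norm (poly_op p T o\<^sub>L op_inv (poly_op (monom 1 n) T)) \<le> (SUP z\<in>ring r 1. cmod (poly p z / poly (monom 1 n) z))"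
    using ss unfolding spectral_set_def by blast
  also have "poly_op (monom 1 n) T = op_power T n" by (simp add: poly_op_monom scaleC_blinfun_simps)
  also have "op_inv (op_power T n) = op_power B n" by (rule op_inv_eqI[OF is_inverse_op_power[OF B]])
  also have "(SUP z\<in>ring r 1. cmod (poly p z / poly (monom 1 n) z)) \<le> m"
  proof (rule cSUP_least)
    have "1 \<in> ring r 1" using r by (simp add: ring_def)
    then show "ring r 1 \<noteq> {}" by blast
    show "cmod (poly p z / poly (monom 1 n) z) \<le> m" if "z \<in> ring r 1" for z
      using m[OF that] by (simp add: laurent_fun_def poly_monom)
  qed
  finally show ?thesis by (simp add: laurent_op_def)
qed

lemma annular_op_power_bounded:
  assumes r: "0 < r" "r < 1" and ann: "annular_op r T B"
  shows "power_bounded_annular r 1 T B"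
proof
  show "norm (op_power T n) \<le> 1" for n
  proof -
    have "norm T ^ n \<le> 1" using ann by (intro power_le_one) (auto simp: annular_op_def)
    then show ?thesis using norm_op_power_le[of T n] by linarith
  qed
  show "norm (op_power B n) \<le> 1 / r ^ n" for n
  proof -
    have "norm B ^ n \<le> (1 / r) ^ n" using ann by (intro power_mono) (auto simp: annular_op_def)
    then show ?thesis using norm_op_power_le[of B n] by (simp add: power_divide)
  qed
qed (use r ann in \<open>auto simp: annular_op_def\<close>)

text \<open>The functions \<open>z\<close> and \<open>1/z\<close> give the two norm bounds.\<close>

lemma annulus_contraction_annular:
  assumes r: "0 < r" "r < 1" and T: "annulus_contraction r T"
  obtains B where "annular_op r T B"
proof -
  have cl: "clinear_op T" and spec: "op_spectrum T \<subseteq> ring r 1"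
    using T unfolding annulus_contraction_def spectral_set_def closure_annulus[OF r] by auto
  have "0 \<notin> ring r 1" using r by (simp add: ring_def)
  then have "0 \<notin> op_spectrum T" using spec by blast
  then obtain C where C: "is_inverse_op (0 *\<^sub>C id_blinfun - T) C" unfolding op_spectrum_def by blast
  have B: "is_inverse_op T (- C)"
    using is_inverse_op_apply[OF C] C
    by (intro is_inverse_opI) (auto simp: blinfun.bilinear_simps is_inverse_op_def intro: clin)
  have "norm (laurent_op [:0, 1:] 0 T (- C)) \<le> 1"
    by (rule annulus_contraction_laurent_bound[OF r T B]) (simp add: laurent_fun_def ring_def)
  then have "norm T \<le> 1"
    by (simp add: laurent_op_def poly_op_pCons[OF cl] compose_eqs scaleC_blinfun_simps)
  moreover have "norm (laurent_op 1 1 T (- C)) \<le> 1 / r"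
  proof (rule annulus_contraction_laurent_bound[OF r T B])
    show "cmod (laurent_fun 1 1 z) \<le> 1 / r" if "z \<in> ring r 1" for z
    proof -
      have "1 / cmod z \<le> 1 / r" using that r by (intro frac_le) (auto simp: ring_def)
      then show ?thesis by (simp add: laurent_fun_def norm_divide)
    qed
  qed
  then have "norm (- C) \<le> 1 / r" by (simp add: laurent_op_def compose_eqs)
  ultimately show thesis using that[of "- C"] cl B by (simp add: annular_op_def)
qed

context power_bounded_annular
begin

text \<open>If \<open>Re L \<ge> 0\<close> and \<open>|L| \<le> H\<close>, then \<open>|L - t|\<^sup>2 \<le> H\<^sup>2 + t\<^sup>2\<close>. The spectral set condition carries this
  over to the operator. When \<open>|(L(T) - t) x|\<^sup>2\<close> is expanded, the terms with \<open>t\<^sup>2\<close> cancel, and those with \<open>t\<close> give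
  the positivity as \<open>t\<close> grows.\<close>

lemma annulus_contraction_laurent_positive:
  assumes T: "annulus_contraction r T" and L: "\<And>z. z \<in> ring r 1 \<Longrightarrow> 0 \<le> Re (laurent_fun p n z)"
  shows "0 \<le> Re (cinner (blinfun_apply (laurent_op p n T B) x) x)"
proof (rule ccontr)
  have nz: "0 \<notin> ring r 1" using r by (simp add: ring_def)
  obtain H where H: "0 \<le> H" "\<And>z. z \<in> ring r 1 \<Longrightarrow> cmod (laurent_fun p n z) \<le> H"
    by (rule laurent_limit_bounded[OF laurent_limit_self[of "ring r 1" T B p n] compact_ring nz]) blast
  define v where "v = blinfun_apply (laurent_op p n T B) x"
  define C where "C = H\<^sup>2 * (norm x)\<^sup>2"
  have key: "0 \<le> C + 2 * t * (v \<bullet> x)" if t: "t > 0" for t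
  proof -
    have "cmod (laurent_fun (p - monom (of_real t) n) n z) \<le> sqrt (H\<^sup>2 + t\<^sup>2)" if z: "z \<in> ring r 1" for z
    proof -
      have z0: "z \<noteq> 0" using z nz by auto
      define w where "w = laurent_fun p n z"
      have w: "0 \<le> Re w" "cmod w \<le> H" unfolding w_def using L[OF z] H(2)[OF z] by auto
      have "(cmod w)\<^sup>2 \<le> H\<^sup>2" using w(2) by (intro power_mono) auto
      moreover have "0 \<le> 2 * (t * Re w)" using t w(1) by simp
      moreover have "(cmod (w - of_real t))\<^sup>2 = (cmod w)\<^sup>2 - 2 * (t * Re w) + t\<^sup>2"
        unfolding cmod_power2 by (simp add: power2_eq_square algebra_simps)
      ultimately have "(cmod (w - of_real t))\<^sup>2 \<le> H\<^sup>2 + t\<^sup>2" by linarith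
      then show ?thesis unfolding laurent_diff_const(1)[OF z0] w_def by (rule real_le_rsqrt)
    qed
    then have "norm (laurent_op (p - monom (of_real t) n) n T B) \<le> sqrt (H\<^sup>2 + t\<^sup>2)"
      by (rule annulus_contraction_laurent_bound[OF r T Binv])
    then have "norm (laurent_op p n T B - of_real t *\<^sub>C id_blinfun) \<le> sqrt (H\<^sup>2 + t\<^sup>2)"
      unfolding laurent_diff_const(2) .
    then have "norm (blinfun_apply (laurent_op p n T B - of_real t *\<^sub>C id_blinfun) x) \<le> sqrt (H\<^sup>2 + t\<^sup>2) * norm x"
      by (intro order_trans[OF norm_blinfun] mult_right_mono) auto
    then have "norm (v - t *\<^sub>R x) \<le> sqrt (H\<^sup>2 + t\<^sup>2) * norm x"
      by (simp add: v_def blinfun.bilinear_simps scaleC_of_real)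
    then have "(norm (v - t *\<^sub>R x))\<^sup>2 \<le> (sqrt (H\<^sup>2 + t\<^sup>2) * norm x)\<^sup>2" by (rule power_mono) simp
    also have "\<dots> = C + t\<^sup>2 * (norm x)\<^sup>2" by (simp add: power_mult_distrib C_def algebra_simps)
    also have "(norm (v - t *\<^sub>R x))\<^sup>2 = (norm v)\<^sup>2 - 2 * t * (v \<bullet> x) + t\<^sup>2 * (norm x)\<^sup>2"
      unfolding power2_norm_eq_inner
      by (simp add: inner_diff_left inner_diff_right inner_commute[of x v] power2_eq_square algebra_simps)
    finally show ?thesis using zero_le_power2[of "norm v"] by linarith
  qed
  assume "\<not> 0 \<le> Re (cinner (blinfun_apply (laurent_op p n T B) x) x)"
  then have neg: "v \<bullet> x < 0" unfolding v_def Re_cinner by simp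
  have C0: "0 \<le> C" unfolding C_def by simp
  define t where "t = (C + 1) / (- (v \<bullet> x))"
  have t: "t > 0" unfolding t_def using neg C0 by (intro divide_pos_pos) auto
  have "t * (v \<bullet> x) = - (C + 1)" unfolding t_def using neg by simp
  then show False using key[OF t] C0 by simp
qed

text \<open>Agler's theorem: the kernels with \<open>a = b\<close> decide whether the closed annulus is
  a spectral set.\<close>

lemma annulus_contraction_iff_kernels_positive:
  assumes spec: "op_spectrum T \<subseteq> ring r 1"
  shows "annulus_contraction r T \<longleftrightarrow> (\<forall>e\<in>{0<..<1::real}. \<forall>\<alpha>\<in>sphere 0 1. \<forall>x.
    0 \<le> Re (cinner (blinfun_apply (kernel_op ((1 - e)\<^sup>2 * r) 1 1 (of_real (1 - e) * \<alpha>) T B) x) x))"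
proof (intro iffI ballI allI)
  assume T: "annulus_contraction r T"
  fix e \<alpha> x assume e: "e \<in> {0<..<1::real}" and \<alpha>: "\<alpha> \<in> sphere (0::complex) 1"
  have s: "0 < 1 - e" "1 - e < 1" using e by auto
  have \<beta>: "cmod (of_real (1 - e) * \<alpha>) = 1 - e" using \<alpha> s by (simp add: norm_mult del: of_real_diff)
  have R: "(0::real) < 1" "(1 - e) * 1 < 1" using s by auto
  have one: "cmod 1 = 1" by simp
  have nz: "0 \<notin> ring r 1" using r by (simp add: ring_def)
  show "0 \<le> Re (cinner (blinfun_apply (kernel_op ((1 - e)\<^sup>2 * r) 1 1 (of_real (1 - e) * \<alpha>) T B) x) x)"
  proof (rule laurent_limit_positive[OF kernel_op_laurent_limit[OF s R \<beta> one one] nz])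
    show "0 \<le> Re (kern ((1 - e)\<^sup>2 * r) 1 1 (of_real (1 - e) * \<alpha> * z))" if "z \<in> ring r 1" for z
      using Re_kern_nonneg[OF scaled_param[OF s] one scaled_ring(1,2)[OF s R that \<beta>]] by simp
  qed (rule annulus_contraction_laurent_positive[OF T])
next
  assume pos: "\<forall>e\<in>{0<..<1::real}. \<forall>\<alpha>\<in>sphere 0 1. \<forall>x.
    0 \<le> Re (cinner (blinfun_apply (kernel_op ((1 - e)\<^sup>2 * r) 1 1 (of_real (1 - e) * \<alpha>) T B) x) x)"
  show "annulus_contraction r T"
  proof (rule annulus_contraction_if_positive[OF spec])
    fix e :: real and \<alpha> x assume "0 < e" "e < 1" "cmod \<alpha> = 1"
    then have "e \<in> {0<..<1}" "\<alpha> \<in> sphere 0 1" by auto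
    then show "0 \<le> Re (cinner (blinfun_apply (kernel_op ((1 - e)\<^sup>2 * r) 1 1 (of_real (1 - e) * \<alpha>) T B) x) x)"
      using pos by blast
  qed
qed

end

section \<open>The operators in the theorem are kernels\<close>

lemma kern_infsum:
  assumes q: "0 < q" "q < 1" and ab: "cmod a = 1" "cmod b = 1" and w: "q < cmod w" "cmod w < 1"
  shows "kern q a b w = (\<Sum>\<^sub>\<infinity>k. kcoef q a b k * w powi k)"
proof -
  define \<theta> where "\<theta> = max (cmod w) (q / cmod w)"
  have w0: "0 < cmod w" using w q by linarith
  have "q / cmod w < 1" using w w0 by simp
  then have \<theta>: "0 \<le> \<theta>" "\<theta> < 1" unfolding \<theta>_def using w w0 by (simp_all add: le_max_iff_disj)
  have b: "cmod (kcoef q a b k * w powi k) \<le> 4 / (1 - q) * 1 * \<theta> ^ nat \<bar>k\<bar>" for k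
    by (rule kcoef_series_bound[OF q ab w0]) (auto simp: \<theta>_def)
  show ?thesis
    using kern_laurent[OF q ab w] symmetric_series_infsum[OF b \<theta>] by (rule LIMSEQ_unique)
qed

lemma kcoef_equal_poles:
  assumes q: "0 < q" "q < 1"
  shows "kcoef q 1 1 k = of_real (2 / (1 + q powi k))"
proof (cases "k = 0")
  case False
  define y where "y = q powi k"
  have y0: "y > 0" unfolding y_def using q by simp
  have y1: "y \<noteq> 1" unfolding y_def by (rule power_int_neq_1[OF q False])
  have "q powi (2 * k) = y * y" using q unfolding y_def mult_2 by (intro power_int_add) simp
  then have "kcoef q 1 1 k = of_real (2 * (1 - y) / (1 - y * y))"
    using False unfolding kcoef_def y_def[symmetric] by simp
  also have "2 * (1 - y) / (1 - y * y) = 2 / (1 + y)"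
  proof -
    have "1 - y * y = (1 - y) * (1 + y)" by (simp add: algebra_simps)
    moreover have "1 - y \<noteq> 0" using y1 by simp
    ultimately show ?thesis using y0 by (simp add: divide_eq_eq eq_divide_eq)
  qed
  finally show ?thesis unfolding y_def .
qed (simp add: kcoef_def)

text \<open>For \<open>q = s\<^sup>2 r\<close> the coefficient \<open>2 s\<^sup>k / (1 + s\<^sup>2\<^sup>k r\<^sup>k)\<close> is \<open>s\<^sup>k\<close> times \<open>2 / (1 + q\<^sup>k)\<close>.\<close>

lemma Gamma_fun_eq_kern:
  assumes r: "0 < r" "r < 1" and s: "0 < s" "s < 1" and z: "s * r < cmod z" "cmod z < 1 / s"
  shows "Gamma_fun r (1 - s) z = kern (s\<^sup>2 * r) 1 1 (of_real s * z)"
proof -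
  define q where "q = s\<^sup>2 * r"
  have q: "0 < q" unfolding q_def using r s by simp
  have "s\<^sup>2 \<le> 1" using s by (intro power_le_one) auto
  then have "s\<^sup>2 * r \<le> 1 * r" using r(1) by (intro mult_right_mono) auto
  then have q1: "q < 1" unfolding q_def using r(2) by linarith
  have w1: "q < cmod (of_real s * z)"
    unfolding q_def using s mult_strict_left_mono[OF z(1) s(1)] by (simp add: norm_mult power2_eq_square mult_ac)
  have w2: "cmod (of_real s * z) < 1" using s z(2) by (simp add: norm_mult field_simps)
  have one: "cmod 1 = 1" by simp
  have qk: "q powi k = s powi (2 * k) * r powi k" for k
    unfolding q_def power_int_mult_distrib by (simp add: power_int_power)
  have eq: "kcoef q 1 1 k * (of_real s * z) powi k
      = 2 * (complex_of_real (s powi k / (1 + s powi (2 * k) * r powi k)) * z powi k)" for k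
    unfolding kcoef_equal_poles[OF q q1] qk power_int_mult_distrib by simp
  have "kern q 1 1 (of_real s * z)
      = (\<Sum>\<^sub>\<infinity>k\<in>UNIV. 2 * (complex_of_real (s powi k / (1 + s powi (2 * k) * r powi k)) * z powi k))"
    unfolding kern_infsum[OF q q1 one one w1 w2] eq ..
  also have "\<dots> = Gamma_fun r (1 - s) z" unfolding Gamma_fun_def infsum_cmult_right' by simp
  finally show ?thesis unfolding q_def by simp
qed

lemma int_power_scaleC:
  assumes T: "clinear_op T" "clinear_op B"
  shows "int_power (\<alpha> *\<^sub>C T) ((1 / \<alpha>) *\<^sub>C B) k = \<alpha> powi k *\<^sub>C int_power T B k"
proof -
  have p: "op_power (c *\<^sub>C A) n = c ^ n *\<^sub>C op_power A n" if A: "clinear_op A" for c n and A :: "'a \<Rightarrow>\<^sub>L 'a"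
  proof (induction n)
    case (Suc n)
    then show ?case
      by (simp add: scaleC_compose_left scaleC_compose_right[OF A] scaleC_blinfun_simps)
  qed (simp add: scaleC_blinfun_simps)
  show ?thesis
    unfolding int_power_def p[OF T(1)] p[OF T(2)]
    by (auto simp: power_int_def power_divide inverse_eq_divide)
qed

text \<open>The Laurent series converges uniformly on the circles \<open>|z| = R\<close> and \<open>|z| = r/R\<close> for every \<open>R\<close> between 1 and \<open>1/s\<close>,
  and so does the series of operators.\<close>

lemma Gamma_op_eq_kernel_op:
  assumes r: "0 < r" "r < 1" and ann: "annular_op r T B" and e: "0 < e" "e < 1" and \<alpha>: "cmod \<alpha> = 1"
  shows "Gamma_op r e \<alpha> T = kernel_op ((1 - e)\<^sup>2 * r) 1 1 (of_real (1 - e) * \<alpha>) T B"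
proof -
  define s R where "s = 1 - e" and "R = (1 + 1 / s) / 2"
  have s: "0 < s" "s < 1" unfolding s_def using e by auto
  have s1: "1 < 1 / s" using s by simp
  have R: "1 < R" "R < 1 / s" unfolding R_def using s1 by auto
  have sR: "s * R < 1" using R(2) s by (simp add: field_simps)
  have R0: "0 < R" using R by simp
  have \<rho>: "s * r < r / R" "r / R < r"
  proof -
    have "(s * R) * r < 1 * r" using sR r(1) by (intro mult_strict_right_mono) auto
    then show "s * r < r / R" using R0 by (simp add: field_simps)
    have "1 / R < 1" using R by simp
    from mult_strict_left_mono[OF this r(1)] show "r / R < r" by simp
  qed
  have \<alpha>0: "\<alpha> \<noteq> 0" using \<alpha> by auto
  define T' B' where "T' = \<alpha> *\<^sub>C T" and "B' = (1 / \<alpha>) *\<^sub>C B"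
  have cl: "clinear_op T" "clinear_op B" and TB: "is_inverse_op T B"
    using ann by (auto simp: annular_op_def is_inverse_op_def)
  have inv': "is_inverse_op T' B'"
  proof (rule is_inverse_opI)
    show "clinear_op B'" unfolding B'_def by (intro clin cl)
    fix x
    show "blinfun_apply T' (blinfun_apply B' x) = x" "blinfun_apply B' (blinfun_apply T' x) = x"
      unfolding T'_def B'_def using \<alpha>0
      by (simp_all add: clinear_opD[OF cl(1)] clinear_opD[OF cl(2)] scaleC_scaleC is_inverse_op_apply[OF TB])
  qed
  have "clinear_op T'" unfolding T'_def by (intro clin cl)
  then have ann': "annular_op r T' B'"
    using ann inv' \<alpha> unfolding annular_op_def T'_def B'_def
    by (simp add: norm_scaleC_blinfun norm_divide)
  interpret P: power_bounded_annular r 1 T' B' by (rule annular_op_power_bounded[OF r ann'])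
  define q where "q = s\<^sup>2 * r"
  have q: "0 < q" "q < 1" unfolding q_def by (rule P.scaled_param[OF s])+
  have one: "cmod 1 = 1" and cs: "cmod (of_real s) = s" using s by auto
  have laurent_limit: "laurent_limit (ring r R) T' B' (\<lambda>z. kern q 1 1 (of_real s * z)) (kernel_op q 1 1 (of_real s) T' B')"
    unfolding q_def by (rule P.kernel_op_laurent_limit[OF s R0 sR cs one one])
  have G: "Gamma_fun r e z = kern q 1 1 (of_real s * z)" if "s * r < cmod z" "cmod z < 1 / s" for z
    using Gamma_fun_eq_kern[OF r s that] unfolding q_def s_def by simp
  have "hol_calc (Gamma_fun r e) T' = kernel_op q 1 1 (of_real s) T' B'"
  proof (rule hol_calc_eq_laurent_limit[OF ann' r, of "s * r" "r / R" R "1 / s"])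
    show "0 \<le> s * r" using s r by simp
    have sub: "(\<lambda>z. of_real s * z) ` {z. s * r < cmod z \<and> cmod z < 1 / s} \<subseteq> {z. q < cmod z \<and> cmod z < 1}"
    proof clarify
      fix z assume z: "s * r < cmod z" "cmod z < 1 / s"
      show "q < cmod (of_real s * z) \<and> cmod (of_real s * z) < 1"
        using mult_strict_left_mono[OF z(1) s(1)] mult_strict_left_mono[OF z(2) s(1)] s
        by (simp add: norm_mult q_def power2_eq_square mult_ac)
    qed
    have "(kern q 1 1 \<circ> (\<lambda>z. of_real s * z)) holomorphic_on {z. s * r < cmod z \<and> cmod z < 1 / s}"
      by (rule holomorphic_on_compose_gen[OF _ kern_holomorphic[OF q one one] sub]) (intro holomorphic_intros)
    then show "Gamma_fun r e holomorphic_on {z. s * r < cmod z \<and> cmod z < 1 / s}"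
      by (rule holomorphic_transform) (simp add: G)
    fix d :: real assume "d > 0"
    from laurent_limitE[OF laurent_limit this] obtain p n where
      pn: "\<And>z. z \<in> ring r R \<Longrightarrow> cmod (laurent_fun p n z - kern q 1 1 (of_real s * z)) \<le> d"
        "norm (laurent_op p n T' B' - kernel_op q 1 1 (of_real s) T' B') \<le> d" by blast
    have "cmod (laurent_fun p n z - Gamma_fun r e z) \<le> d" if z: "cmod z = R \<or> cmod z = r / R" for z
    proof -
      have "r / R \<le> cmod z" "cmod z \<le> R" using z \<rho>(2) R(1) r by auto
      then show ?thesis using pn(1)[of z] G[of z] \<rho>(1) R(2) by (simp add: ring_def)
    qed
    then show "\<exists>p n. (\<forall>z. cmod z = R \<or> cmod z = r / R \<longrightarrow> cmod (laurent_fun p n z - Gamma_fun r e z) \<le> d)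
        \<and> norm (laurent_op p n T' B' - kernel_op q 1 1 (of_real s) T' B') \<le> d"
      using pn(2) by blast
  qed (use \<rho> R in auto)
  also have "kernel_op q 1 1 (of_real s) T' B' = kernel_op q 1 1 (of_real s * \<alpha>) T B"
    unfolding kernel_op_def T'_def B'_def int_power_scaleC[OF cl]
    by (simp add: scaleC_blinfun_simps power_int_mult_distrib mult.assoc)
  finally show ?thesis unfolding Gamma_op_def T'_def q_def s_def .
qed

section \<open>Functions of the upper triangular operator\<close>

text \<open>When \<open>X\<close> commutes with the operators involved, this is the conjugate of the diagonal operator
  with entries \<open>A1, A2\<close> by the unipotent operator with corner \<open>X\<close>. Hence it is multiplicative and a function
  of it is computed entrywise.\<close>

definition upper :: "('a::chilbert_space \<Rightarrow>\<^sub>L 'a) \<Rightarrow> ('a \<Rightarrow>\<^sub>L 'a) \<Rightarrow> ('a \<Rightarrow>\<^sub>L 'a) \<Rightarrow> (('a \<times> 'a) \<Rightarrow>\<^sub>L ('a \<times> 'a))" where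
  "upper X A1 A2 = block_op A1 (X o\<^sub>L (A1 - A2)) 0 A2"

lemma upper_apply:
  "blinfun_apply (upper X A1 A2) u =
    (blinfun_apply A1 (fst u) + blinfun_apply X (blinfun_apply A1 (snd u) - blinfun_apply A2 (snd u)), blinfun_apply A2 (snd u))"
  by (cases u) (simp add: upper_def block_op_apply blinfun.bilinear_simps)

lemma upper_compose:
  assumes "X o\<^sub>L A1 = A1 o\<^sub>L X"
  shows "upper X A1 A2 o\<^sub>L upper X C1 C2 = upper X (A1 o\<^sub>L C1) (A2 o\<^sub>L C2)"
proof (rule blinfun_eqI)
  fix u
  have "blinfun_apply X (blinfun_apply A1 v) = blinfun_apply A1 (blinfun_apply X v)" for v
    using arg_cong[OF assms, of "\<lambda>S. blinfun_apply S v"] by simp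
  then show "blinfun_apply (upper X A1 A2 o\<^sub>L upper X C1 C2) u = blinfun_apply (upper X (A1 o\<^sub>L C1) (A2 o\<^sub>L C2)) u"
    by (simp add: upper_apply blinfun.bilinear_simps)
qed

lemma upper_id: "upper X id_blinfun id_blinfun = id_blinfun"
  by (rule blinfun_eqI) (simp add: upper_apply)

lemma upper_diff: "upper X (A1 - C1) (A2 - C2) = upper X A1 A2 - upper X C1 C2"
  by (rule blinfun_eqI) (simp add: upper_apply blinfun.bilinear_simps algebra_simps)

lemma upper_sum: "upper X (\<Sum>i\<in>I. f i) (\<Sum>i\<in>I. g i) = (\<Sum>i\<in>I. upper X (f i) (g i))"
proof -
  have "upper X 0 0 = 0" by (rule blinfun_eqI) (simp add: upper_apply zero_prod_def)
  moreover have "upper X (A1 + C1) (A2 + C2) = upper X A1 A2 + upper X C1 C2" for A1 A2 C1 C2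
    by (rule blinfun_eqI) (simp add: upper_apply blinfun.bilinear_simps algebra_simps)
  ultimately show ?thesis by (induction I rule: infinite_finite_induct) simp_all
qed

lemma upper_scaleC:
  assumes "clinear_op X" shows "upper X (c *\<^sub>C A1) (c *\<^sub>C A2) = c *\<^sub>C upper X A1 A2"
  by (rule blinfun_eqI)
    (simp add: upper_apply scaleC_prod_def scaleC_add_right clinear_opD[OF assms] scaleC_diff_right[symmetric])

lemma clinear_upper [clin]: "clinear_op X \<Longrightarrow> clinear_op A1 \<Longrightarrow> clinear_op A2 \<Longrightarrow> clinear_op (upper X A1 A2)"
  unfolding clinear_op_def[of "upper X A1 A2"]
  by (simp add: upper_apply scaleC_prod_def scaleC_add_right clinear_opD scaleC_diff_right[symmetric])

text \<open>Linear in the diagonal entries, so that power bounds and limits pass to the triangular operator.\<close>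

lemma norm_upper_le:
  fixes A1 A2 :: "'a::chilbert_space \<Rightarrow>\<^sub>L 'a"
  shows "norm (upper X A1 A2) \<le> (1 + norm X) * (norm A1 + norm A2)"
proof (rule norm_blinfun_bound)
  fix u :: "'a \<times> 'a"
  have u: "norm (fst u) \<le> norm u" "norm (snd u) \<le> norm u"
    using norm_fst_le[of "fst u" "snd u"] norm_snd_le[of "snd u" "fst u"] by simp_all
  have A: "norm (blinfun_apply A v) \<le> norm A * norm u" if "norm v \<le> norm u" for A :: "'a \<Rightarrow>\<^sub>L 'a" and v
    using that by (intro order_trans[OF norm_blinfun] mult_left_mono) auto
  have "norm (blinfun_apply X (blinfun_apply A1 (snd u) - blinfun_apply A2 (snd u)))
      \<le> norm X * (norm A1 * norm u + norm A2 * norm u)"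
    by (intro order_trans[OF norm_blinfun] mult_left_mono order_trans[OF norm_triangle_ineq4] add_mono A u) auto
  then have "norm (blinfun_apply A1 (fst u) + blinfun_apply X (blinfun_apply A1 (snd u) - blinfun_apply A2 (snd u)))
      \<le> norm A1 * norm u + norm X * (norm A1 * norm u + norm A2 * norm u)"
    using A[OF u(1), of A1] by (intro order_trans[OF norm_triangle_ineq] add_mono)
  moreover have "norm (blinfun_apply A2 (snd u)) \<le> norm A2 * norm u" by (rule A[OF u(2)])
  ultimately have "norm (blinfun_apply (upper X A1 A2) u)
      \<le> norm A1 * norm u + norm X * (norm A1 * norm u + norm A2 * norm u) + norm A2 * norm u"
    unfolding upper_apply by (intro order_trans[OF norm_Pair_le] add_mono)
  also have "\<dots> = (1 + norm X) * (norm A1 + norm A2) * norm u" by (simp add: algebra_simps)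
  finally show "norm (blinfun_apply (upper X A1 A2) u) \<le> (1 + norm X) * (norm A1 + norm A2) * norm u" .
qed simp

lemma upper_tendsto:
  assumes "f \<longlonglongrightarrow> A1" "g \<longlonglongrightarrow> A2"
  shows "(\<lambda>n. upper X (f n) (g n)) \<longlonglongrightarrow> upper X A1 A2"
proof -
  have "(\<lambda>n. norm (f n - A1)) \<longlonglongrightarrow> 0" "(\<lambda>n. norm (g n - A2)) \<longlonglongrightarrow> 0"
    using assms by (simp_all add: LIM_zero tendsto_norm_zero)
  then have "(\<lambda>n. (1 + norm X) * (norm (f n - A1) + norm (g n - A2))) \<longlonglongrightarrow> (1 + norm X) * (0 + 0)"
    by (intro tendsto_intros)
  then have "(\<lambda>n. (1 + norm X) * (norm (f n - A1) + norm (g n - A2))) \<longlonglongrightarrow> 0" by simp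
  then have "(\<lambda>n. upper X (f n) (g n) - upper X A1 A2) \<longlonglongrightarrow> 0"
    by (rule Lim_null_comparison[rotated]) (simp add: upper_diff[symmetric] norm_upper_le)
  then show ?thesis by (rule LIM_zero_cancel)
qed

lemma op_power_upper:
  assumes "X o\<^sub>L A1 = A1 o\<^sub>L X"
  shows "op_power (upper X A1 A2) n = upper X (op_power A1 n) (op_power A2 n)"
  by (induction n) (simp_all add: upper_id upper_compose[OF assms])

lemma inverse_commute:
  assumes "X o\<^sub>L A = A o\<^sub>L X" "is_inverse_op A B" shows "X o\<^sub>L B = B o\<^sub>L X"
proof -
  have "X o\<^sub>L B = (B o\<^sub>L A) o\<^sub>L (X o\<^sub>L B)" using assms(2) by (simp add: is_inverse_op_def compose_eqs)
  also have "\<dots> = B o\<^sub>L (A o\<^sub>L X) o\<^sub>L B" by (simp only: compose_eqs)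
  also have "\<dots> = B o\<^sub>L X o\<^sub>L (A o\<^sub>L B)" unfolding assms(1)[symmetric] by (simp only: compose_eqs)
  also have "\<dots> = B o\<^sub>L X" using assms(2) by (simp add: is_inverse_op_def compose_eqs)
  finally show ?thesis .
qed

lemma is_inverse_upper:
  assumes X: "clinear_op X" "X o\<^sub>L A1 = A1 o\<^sub>L X" and inv: "is_inverse_op A1 B1" "is_inverse_op A2 B2"
  shows "is_inverse_op (upper X A1 A2) (upper X B1 B2)"
  using inv unfolding is_inverse_op_def upper_compose[OF X(2)] upper_compose[OF inverse_commute[OF X(2) inv(1)]]
  by (auto simp: upper_id intro: clin X)

text \<open>The resolvent of the triangular operator is the triangular operator of the resolvents.\<close>

lemma op_spectrum_upper:
  assumes X: "clinear_op X" "X o\<^sub>L A1 = A1 o\<^sub>L X"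
  shows "op_spectrum (upper X A1 A2) \<subseteq> op_spectrum A1 \<union> op_spectrum A2"
proof
  fix z assume z: "z \<in> op_spectrum (upper X A1 A2)"
  show "z \<in> op_spectrum A1 \<union> op_spectrum A2"
  proof (rule ccontr)
    assume "z \<notin> op_spectrum A1 \<union> op_spectrum A2"
    then obtain R1 R2 where R: "is_inverse_op (z *\<^sub>C id_blinfun - A1) R1" "is_inverse_op (z *\<^sub>C id_blinfun - A2) R2"
      unfolding op_spectrum_def by blast
    have "X o\<^sub>L (z *\<^sub>C id_blinfun - A1) = (z *\<^sub>C id_blinfun - A1) o\<^sub>L X"
      unfolding blinfun_compose.diff_right blinfun_compose.diff_left scaleC_compose_right[OF X(1)] scaleC_compose_left X(2)
      by (simp add: compose_eqs)
    from is_inverse_upper[OF X(1) this R]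
    have "is_inverse_op (z *\<^sub>C id_blinfun - upper X A1 A2) (upper X R1 R2)"
      by (simp add: upper_diff upper_scaleC[OF X(1)] upper_id)
    then show False using z unfolding op_spectrum_def by blast
  qed
qed

lemma kernel_op_upper:
  assumes X: "clinear_op X" "X o\<^sub>L T1 = T1 o\<^sub>L X"
    and P1: "power_bounded_annular r M1 T1 B1" and P2: "power_bounded_annular r M2 T2 B2"
    and s: "0 < s" "s < 1" and \<beta>: "cmod \<beta> = s" and ab: "cmod a = 1" "cmod b = 1"
  shows "kernel_op (s\<^sup>2 * r) a b \<beta> (upper X T1 T2) (upper X B1 B2)
    = upper X (kernel_op (s\<^sup>2 * r) a b \<beta> T1 B1) (kernel_op (s\<^sup>2 * r) a b \<beta> T2 B2)"
proof -
  have XB: "X o\<^sub>L B1 = B1 o\<^sub>L X"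
    using inverse_commute[OF X(2)] power_bounded_annular.Binv[OF P1] by blast
  have ip: "int_power (upper X T1 T2) (upper X B1 B2) k = upper X (int_power T1 B1 k) (int_power T2 B2 k)" for k
    unfolding int_power_def by (simp add: op_power_upper[OF X(2)] op_power_upper[OF XB])
  note lim = power_bounded_annular.kernel_op_limit(1)[OF _ s \<beta> ab]
  have "(\<lambda>N. upper X (\<Sum>k\<in>{- int N..int N}. (kcoef (s\<^sup>2 * r) a b k * \<beta> powi k) *\<^sub>C int_power T1 B1 k)
        (\<Sum>k\<in>{- int N..int N}. (kcoef (s\<^sup>2 * r) a b k * \<beta> powi k) *\<^sub>C int_power T2 B2 k))
      \<longlonglongrightarrow> upper X (kernel_op (s\<^sup>2 * r) a b \<beta> T1 B1) (kernel_op (s\<^sup>2 * r) a b \<beta> T2 B2)"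
    by (rule upper_tendsto[OF lim[OF P1] lim[OF P2]])
  then show ?thesis
    unfolding upper_sum upper_scaleC[OF X(1)] ip[symmetric] kernel_op_def[of _ _ _ _ "upper X T1 T2"] by (rule limI)
qed

lemma power_bounded_upper:
  assumes X: "clinear_op X" "X o\<^sub>L T1 = T1 o\<^sub>L X"
    and P1: "power_bounded_annular r M1 T1 B1" and P2: "power_bounded_annular r M2 T2 B2"
  shows "power_bounded_annular r ((1 + norm X) * (M1 + M2)) (upper X T1 T2) (upper X B1 B2)"
proof -
  interpret P1: power_bounded_annular r M1 T1 B1 by fact
  interpret P2: power_bounded_annular r M2 T2 B2 by fact
  have XB: "X o\<^sub>L B1 = B1 o\<^sub>L X" by (rule inverse_commute[OF X(2) P1.Binv])
  show ?thesis
  proof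
    show "0 < r" "r < 1" by (rule P1.r)+
    show "clinear_op (upper X T1 T2)" by (intro clin X P1.Tcl P2.Tcl)
    show "is_inverse_op (upper X T1 T2) (upper X B1 B2)" by (rule is_inverse_upper[OF X P1.Binv P2.Binv])
    fix n
    show "norm (op_power (upper X T1 T2) n) \<le> (1 + norm X) * (M1 + M2)"
      unfolding op_power_upper[OF X(2)]
      by (intro order_trans[OF norm_upper_le] mult_left_mono add_mono P1.powT P2.powT) auto
    have "norm (op_power (upper X B1 B2) n) \<le> (1 + norm X) * (M1 / r ^ n + M2 / r ^ n)"
      unfolding op_power_upper[OF XB]
      by (intro order_trans[OF norm_upper_le] mult_left_mono add_mono P1.powB P2.powB) auto
    then show "norm (op_power (upper X B1 B2) n) \<le> (1 + norm X) * (M1 + M2) / r ^ n"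
      by (simp add: add_divide_distrib distrib_left)
  qed
qed

theorem theorem2p5:
  fixes r :: real and T1 T2 X :: "'h::chilbert_space \<Rightarrow>\<^sub>L 'h"
  assumes "0 < r" and "r < 1"
    and "annulus_contraction r T1" and "annulus_contraction r T2"
    and "clinear_op X"
    and "X o\<^sub>L T1 = T1 o\<^sub>L X" and "X o\<^sub>L T2 = T2 o\<^sub>L X"
  shows
    "(annulus_contraction r (block_op T1 (X o\<^sub>L (T1 - T2)) 0 T2) \<longleftrightarrow>
       (\<forall>e\<in>{0<..<1}. \<forall>\<alpha>\<in>sphere 0 1. \<exists>K :: 'h \<Rightarrow>\<^sub>L 'h. op_contraction K \<and>
          (1/2) *\<^sub>R (X o\<^sub>L (Gamma_op r e \<alpha> T1 - Gamma_op r e \<alpha> T2)) =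
            op_sqrt (op_Re (Gamma_op r e \<alpha> T1)) o\<^sub>L K o\<^sub>L op_sqrt (op_Re (Gamma_op r e \<alpha> T2)))) \<and>
     (annulus_contraction r (block_op T1 (X o\<^sub>L (T1 - T2)) 0 T2) \<longleftrightarrow>
       (\<forall>e\<in>{0<..<1}. \<forall>\<alpha>\<in>sphere 0 1. \<exists>U :: ('h \<times> 'h) \<Rightarrow>\<^sub>L ('h \<times> 'h). op_unitary U \<and>
          (1/2) *\<^sub>R (X o\<^sub>L (Gamma_op r e \<alpha> T1 - Gamma_op r e \<alpha> T2)) =
            row_op (op_sqrt (op_Re (Gamma_op r e \<alpha> T1))) 0 o\<^sub>L U o\<^sub>L
            col_op (op_sqrt (op_Re (Gamma_op r e \<alpha> T2))) 0))"
proof -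
  note r = assms(1,2) and X = assms(5,6)
  obtain B1 where ann1: "annular_op r T1 B1" using annulus_contraction_annular[OF r assms(3)] by blast
  obtain B2 where ann2: "annular_op r T2 B2" using annulus_contraction_annular[OF r assms(4)] by blast
  note P1 = annular_op_power_bounded[OF r ann1] and P2 = annular_op_power_bounded[OF r ann2]
  interpret P: power_bounded_annular r "(1 + norm X) * (1 + 1)" "upper X T1 T2" "upper X B1 B2"
    by (rule power_bounded_upper[OF X P1 P2])
  have spec: "op_spectrum T1 \<subseteq> ring r 1" "op_spectrum T2 \<subseteq> ring r 1"
    using assms(3,4) unfolding annulus_contraction_def spectral_set_def closure_annulus[OF r] by auto
  have spec': "op_spectrum (upper X T1 T2) \<subseteq> ring r 1"
    using op_spectrum_upper[OF X, of T2] spec by blast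
  define G1 G2 where "G1 e \<alpha> = Gamma_op r e \<alpha> T1" and "G2 e \<alpha> = Gamma_op r e \<alpha> T2" for e \<alpha>
  have main: "(\<forall>u. 0 \<le> Re (cinner (blinfun_apply
        (kernel_op ((1 - e)\<^sup>2 * r) 1 1 (of_real (1 - e) * \<alpha>) (upper X T1 T2) (upper X B1 B2)) u) u)) \<longleftrightarrow>
      (\<exists>K. op_contraction K \<and> (1/2) *\<^sub>R (X o\<^sub>L (G1 e \<alpha> - G2 e \<alpha>)) = op_sqrt (op_Re (G1 e \<alpha>)) o\<^sub>L K o\<^sub>L op_sqrt (op_Re (G2 e \<alpha>)))"
    if e\<alpha>: "e \<in> {0<..<1}" "\<alpha> \<in> sphere 0 1" for e \<alpha>
  proof -
    have e: "0 < e" "e < 1" and \<alpha>: "cmod \<alpha> = 1" using e\<alpha> by auto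
    have s: "0 < 1 - e" "1 - e < 1" using e by auto
    have \<beta>: "cmod (of_real (1 - e) * \<alpha>) = 1 - e" using \<alpha> s by (simp add: norm_mult del: of_real_diff)
    have one: "cmod 1 = 1" by simp
    note Gk = Gamma_op_eq_kernel_op[OF r ann1 e \<alpha>, folded G1_def] Gamma_op_eq_kernel_op[OF r ann2 e \<alpha>, folded G2_def]
    have cl: "clinear_op (G1 e \<alpha>)" "clinear_op (G2 e \<alpha>)"
      unfolding Gk using power_bounded_annular.clinear_kernel_op[OF P1 s \<beta> one one]
        power_bounded_annular.clinear_kernel_op[OF P2 s \<beta> one one] by auto
    have pos1: "0 \<le> Re (cinner (blinfun_apply (G1 e \<alpha>) x) x)" for x
      using power_bounded_annular.annulus_contraction_iff_kernels_positive[OF P1 spec(1)] assms(3) e\<alpha>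
      unfolding Gk by blast
    have pos2: "0 \<le> Re (cinner (blinfun_apply (G2 e \<alpha>) x) x)" for x
      using power_bounded_annular.annulus_contraction_iff_kernels_positive[OF P2 spec(2)] assms(4) e\<alpha>
      unfolding Gk by blast
    have K: "kernel_op ((1 - e)\<^sup>2 * r) 1 1 (of_real (1 - e) * \<alpha>) (upper X T1 T2) (upper X B1 B2) = upper X (G1 e \<alpha>) (G2 e \<alpha>)"
      unfolding Gk by (rule kernel_op_upper[OF X P1 P2 s \<beta> one one])
    have "clinear_op (X o\<^sub>L (G1 e \<alpha> - G2 e \<alpha>))" by (intro clin X cl)
    from positive_block_iff_factorization[OF cl this pos1 pos2] show ?thesis
      unfolding K by (simp add: upper_apply cinner_prod_def blinfun.bilinear_simps)
  qed
  have "annulus_contraction r (upper X T1 T2) \<longleftrightarrow> (\<forall>e\<in>{0<..<1}. \<forall>\<alpha>\<in>sphere 0 1.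
      \<exists>K. op_contraction K \<and> (1/2) *\<^sub>R (X o\<^sub>L (G1 e \<alpha> - G2 e \<alpha>)) = op_sqrt (op_Re (G1 e \<alpha>)) o\<^sub>L K o\<^sub>L op_sqrt (op_Re (G2 e \<alpha>)))"
    unfolding P.annulus_contraction_iff_kernels_positive[OF spec'] by (intro ball_cong refl main)
  moreover have "(\<exists>K. op_contraction K \<and> (1/2) *\<^sub>R (X o\<^sub>L (G1 e \<alpha> - G2 e \<alpha>)) = op_sqrt (op_Re (G1 e \<alpha>)) o\<^sub>L K o\<^sub>L op_sqrt (op_Re (G2 e \<alpha>)))
     \<longleftrightarrow> (\<exists>U :: ('h \<times> 'h) \<Rightarrow>\<^sub>L ('h \<times> 'h). op_unitary U \<and> (1/2) *\<^sub>R (X o\<^sub>L (G1 e \<alpha> - G2 e \<alpha>))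
        = row_op (op_sqrt (op_Re (G1 e \<alpha>))) 0 o\<^sub>L U o\<^sub>L col_op (op_sqrt (op_Re (G2 e \<alpha>))) 0)" for e \<alpha>
    by (rule contraction_iff_unitary_corner)
  ultimately show ?thesis
    unfolding G1_def G2_def upper_def by simp
qed

end
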